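(* Let $\bar H_\Lambda(\sigma;\beta)$ be the complete Hamiltonian described in the context, let $\bar p(\beta)=\lim_{\Lambda\nearrow\mathbb Z^d}\frac1{|\Lambda|}\mathbb E\big[\log\sum_\sigma \exp(-\bar H_\Lambda(\sigma;\beta))\big]$ be its limiting pressure, and let $\beta=(\beta_p)_{p\ge1}$ satisfy one of the following: (A) $\bar p$ is differentiable at $\beta$ in each direction $\beta_p$, $p\ge1$ (as a function of $\beta_p$ with the other parameters fixed); or (B) $\beta$ is outside an exceptional null set of parameters; precisely, the conclusion below holds for $\mu$-almost every $\beta$ whenever $\mu=\bigotimes_{p\ge1}\mu_p$ is a product of probability measures $\mu_p$ on $(0,\infty)$ that are absolutely continuous with respect to Lebesgue measure and $\sum_p\beta_p^2<\infty$ for $\mu$-a.e. $\beta$. Then any subsequential limit in distribution, as $\Lambda\nearrow\mathbb Z^d$, $(c_{l,l'})_{l,l'\ge1}$ of the overlap arrays $(c_\Lambda(\sigma^{(l)},\sigma^{(l')}))_{l,l'\ge1}$ (under the quenched replica measure $\mathbb E\,\mathcal G_{\Lambda,\beta}^{\otimes\infty}$) satisfies, with $\mathbb E\,\Omega$ denoting expectation under the limit law: (1) the Ghirlanda-Guerra identities in the distributional sense: for every $n\ge2$, every bounded measurable function $f$ of $(c_{l,l'})_{l,l'\le n}$ and every bounded measurable function $\psi$ of one overlap, $$\mathbb E\,\Omega\big(f\,\psi(c_{1,n+1})\big)=\frac1n\,\mathbb E\,\Omega(f)\;\mathbb E\,\Omega\big(\psi(c_{1,2})\big)+\frac1n\sum_{l=2}^n\mathbb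 E\,\Omega\big(f\,\psi(c_{1,l})\big);$$ (2) ultrametricity: $$\mathbb E\,\Omega\Big(\mathbf 1\big\{c_{1,2}\ge\min(c_{1,3},c_{2,3})\big\}\Big)=1 .$$
   Context: Fix $d\ge1$. For each finite $\Lambda\subset\mathbb Z^d$, spin configurations are $\sigma\in\{-1,1\}^\Lambda$, and $\sigma_X=\prod_{x\in X}\sigma_x$ for $X\subseteq\Lambda$. Let $H_\Lambda(\sigma)=-\sum_{X\subseteq\Lambda}J_{\Lambda,X}\sigma_X$, where the $J_{\Lambda,X}$ are independent centered Gaussian random variables with variances $\Delta^2_{\Lambda,X}$ ($\Delta_{\Lambda,X}\ge0$). Its normalized covariance is $c_\Lambda(\sigma,\tau)=\frac1{|\Lambda|}\mathbb E[H_\Lambda(\sigma)H_\Lambda(\tau)]=\frac1{|\Lambda|}\sum_{X\subseteq\Lambda}\Delta_{\Lambda,X}^2\sigma_X\tau_X$. Thermodynamic stability is assumed: there is a constant $0<c<\infty$ with $\sup_\Lambda \frac1{|\Lambda|}\sum_{X\subseteq\Lambda}\Delta^2_{\Lambda,X}\le c$. Complete Hamiltonian: $\bar H_\Lambda(\sigma;\beta)=\sum_{p\ge1}(\sqrt c)^{-p}\beta_pH^{(p)}_\Lambda(\sigma)$, where $H^{(1)}_\Lambda=H_\Lambda$, the families $(H^{(p)}_\Lambda(\sigma))_\sigma$, $p\ge1$, are independent centered Gaussian families with $\frac1{|\Lambda|}\mathbb E[H^{(p)}_\Lambda(\sigma)H^{(p)}_\Lambda(\tau)]=[c_\Lambda(\sigma,\tau)]^p$,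 and $\beta=(\beta_p)_{p\ge1}$ satisfies $\beta_p>0$ for all $p$ and $\sum_p\beta_p^2<\infty$. Random Gibbs measure: $\mathcal G_{\Lambda,\beta}(\sigma)=\exp(-\bar H_\Lambda(\sigma;\beta))/\sum_{\tau}\exp(-\bar H_\Lambda(\tau;\beta))$. Under the quenched replica measure, given the disorder, $\sigma^{(1)},\sigma^{(2)},\dots$ are i.i.d. from $\mathcal G_{\Lambda,\beta}$, and one then averages over the disorder. Convergence in distribution of arrays is convergence of all finite-dimensional distributions. $\Lambda\nearrow\mathbb Z^d$ denotes the thermodynamic limit along a fixed increasing sequence of finite sets exhausting $\mathbb Z^d$. It is a standing assumption that the limit defining $\bar p(\beta)$ exists for all admissible $\beta$. *)

theory Defs
  imports "HOL-Probability.Probability"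
begin

section \<open>Gaussian variables and families\<close>

text \<open>The degenerate case of variance zero, for which \<^const>\<open>normal_density\<close> is not a
  density, is included.\<close>

definition centered_gaussian :: "'w measure \<Rightarrow> ('w \<Rightarrow> real) \<Rightarrow> real \<Rightarrow> bool" where
  "centered_gaussian M X v \<longleftrightarrow>
     0 \<le> v \<and> X \<in> borel_measurable M \<and>
     (if v = 0 then AE \<omega> in M. X \<omega> = 0
      else distributed M lborel X (\<lambda>x. ennreal (normal_density 0 (sqrt v) x)))"

definition centered_gaussian_family :: "'w measure \<Rightarrow> 'i set \<Rightarrow> ('i \<Rightarrow> 'w \<Rightarrow> real) \<Rightarrow> bool" where
  "centered_gaussian_family M I X \<longleftrightarrow>
     (\<forall>F a. finite F \<and> F \<subseteq> I \<longrightarrow> (\<exists>v. centered_gaussian M (\<lambda>\<omega>. \<Sum>i\<in>F. a i * X i \<omega>) v))"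


section \<open>Spin configurations, Hamiltonian and overlap\<close>

definition configs :: "'a set \<Rightarrow> ('a \<Rightarrow> real) set" where
  "configs \<Lambda> = (\<Lambda> \<rightarrow>\<^sub>E {-1, 1})"

definition spin_prod :: "('a \<Rightarrow> real) \<Rightarrow> 'a set \<Rightarrow> real" where
  "spin_prod \<sigma> X = (\<Prod>x\<in>X. \<sigma> x)"

definition hamiltonian ::
  "('a set \<Rightarrow> 'a set \<Rightarrow> 'w \<Rightarrow> real) \<Rightarrow> 'a set \<Rightarrow> ('a \<Rightarrow> real) \<Rightarrow> 'w \<Rightarrow> real" where
  "hamiltonian J \<Lambda> \<sigma> \<omega> = - (\<Sum>X\<in>Pow \<Lambda>. J \<Lambda> X \<omega> * spin_prod \<sigma> X)"

definition overlap ::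
  "'w measure \<Rightarrow> ('a set \<Rightarrow> 'a set \<Rightarrow> 'w \<Rightarrow> real) \<Rightarrow> 'a set \<Rightarrow> ('a \<Rightarrow> real) \<Rightarrow> ('a \<Rightarrow> real) \<Rightarrow> real"
  where
  "overlap M J \<Lambda> \<sigma> \<tau> =
     (1 / real (card \<Lambda>)) * (\<integral>\<omega>. hamiltonian J \<Lambda> \<sigma> \<omega> * hamiltonian J \<Lambda> \<tau> \<omega> \<partial>M)"

lemma centered_gaussian_moments:
  assumes "prob_space M" "centered_gaussian M X v"
  shows "integrable M (\<lambda>w. X w)" "integrable M (\<lambda>w. X w * X w)" "(\<integral>w. X w \<partial>M) = 0" "(\<integral>w. X w * X w \<partial>M) = v"
proof -
  interpret prob_space M by fact
  have m: "X \<in> borel_measurable M" and v: "0 \<le> v" using assms by (auto simp: centered_gaussian_def)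
  have "integrable M X \<and> integrable M (\<lambda>w. X w * X w) \<and> (\<integral>w. X w \<partial>M) = 0 \<and> (\<integral>w. X w * X w \<partial>M) = v"
  proof (cases "v = 0")
    case True
    then have ae: "AE w in M. X w = 0" using assms by (simp add: centered_gaussian_def)
    have "integrable M X = integrable M (\<lambda>w. 0::real)" "(\<integral>w. X w \<partial>M) = (\<integral>w. 0 \<partial>M)"
      using ae m by (intro integrable_cong_AE integral_cong_AE; simp)+
    moreover have "integrable M (\<lambda>w. X w * X w) = integrable M (\<lambda>w. 0::real)" 
      "(\<integral>w. X w * X w \<partial>M) = (\<integral>w. 0 \<partial>M)"
      using ae m by (intro integrable_cong_AE integral_cong_AE; auto)+
    ultimately show ?thesis using True by simp
  next
    case False
    then have d: "distributed M lborel X (normal_density 0 (sqrt v))" and s: "0 < sqrt v"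
      using assms v by (auto simp: centered_gaussian_def)
    note nm = integrable_normal_moment[OF s, of 0 ]
    have i1: "integrable lborel (\<lambda>x. normal_density 0 (sqrt v) x * x)"
      using nm[of 1] by simp
    have i2: "integrable lborel (\<lambda>x. normal_density 0 (sqrt v) x * (x*x))"
      using nm[of 2] by (simp add: power2_eq_square)
    have e: "expectation X = 0" using normal_distributed_expectation[OF s d] by simp
    have vv: "variance X = v" using normal_distributed_variance[OF s d] v by simp
    have "integrable M X" using distributed_integrable[OF d, of "\<lambda>x. x"] i1 by simp
    moreover have "integrable M (\<lambda>w. X w * X w)" using distributed_integrable[OF d, of "\<lambda>x. x*x"] i2 by simp
    moreover have "(\<integral>w. X w * X w \<partial>M) = v" using vv e by (simp add: power2_eq_square)
    ultimately show ?thesis using e by blast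
  qed
  then show "integrable M (\<lambda>w. X w)" "integrable M (\<lambda>w. X w * X w)" "(\<integral>w. X w \<partial>M) = 0" "(\<integral>w. X w * X w \<partial>M) = v"
    by auto
qed

lemma overlap_eq_sum:
  assumes ps: "prob_space M" and fin: "finite L"
    and ind: "prob_space.indep_vars M (\<lambda>_. borel) (J L) (Pow L)"
    and g: "\<And>X. X \<subseteq> L \<Longrightarrow> centered_gaussian M (J L X) ((D L X)\<^sup>2)"
  shows "overlap M J L s t = (1 / real (card L)) * (\<Sum>X\<in>Pow L. (D L X)\<^sup>2 * spin_prod s X * spin_prod t X)"
proof -
  interpret prob_space M by fact
  note cm = centered_gaussian_moments[OF ps g]
  have mix: "integrable M (\<lambda>w. J L X w * J L Y w) \<and> (\<integral>w. J L X w * J L Y w \<partial>M) = (if X = Y then (D L X)\<^sup>2 else 0)"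
    if "X \<in> Pow L" "Y \<in> Pow L" for X Y
  proof (cases "X = Y")
    case True then show ?thesis using cm that by auto
  next
    case False
    have i: "indep_vars (\<lambda>_. borel) (J L) {X,Y}"
      using indep_vars_subset[OF ind, of "{X,Y}"] that by auto
    show ?thesis using cm that False indep_vars_lebesgue_integral[OF _ i] indep_vars_integrable[OF _ i] by auto
  qed
  have "(\<integral>w. hamiltonian J L s w * hamiltonian J L t w \<partial>M)
     = (\<integral>w. (\<Sum>X\<in>Pow L. \<Sum>Y\<in>Pow L. (J L X w * J L Y w) * (spin_prod s X * spin_prod t Y)) \<partial>M)"
    by (simp add: hamiltonian_def sum_product mult_ac)
  also have "\<dots> = (\<Sum>X\<in>Pow L. \<Sum>Y\<in>Pow L. (\<integral>w. J L X w * J L Y w \<partial>M) * (spin_prod s X * spin_prod t Y))"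
    using mix by (subst Bochner_Integration.integral_sum Bochner_Integration.integrable_sum | auto intro!: Bochner_Integration.integrable_sum)+
  also have "\<dots> = (\<Sum>X\<in>Pow L. (D L X)\<^sup>2 * (spin_prod s X * spin_prod t X))"
  proof (rule sum.cong[OF refl])
    fix X assume X: "X \<in> Pow L"
    have "(\<Sum>Y\<in>Pow L. (\<integral>w. J L X w * J L Y w \<partial>M) * (spin_prod s X * spin_prod t Y))
      = (\<Sum>Y\<in>Pow L. if X = Y then (D L X)\<^sup>2 * (spin_prod s X * spin_prod t X) else 0)"
      using mix X by (intro sum.cong) auto
    then show "(\<Sum>Y\<in>Pow L. (\<integral>w. J L X w * J L Y w \<partial>M) * (spin_prod s X * spin_prod t Y)) = (D L X)\<^sup>2 * (spin_prod s X * spin_prod t X)"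
      using X fin by simp
  qed
  finally show ?thesis by (simp add: overlap_def mult.assoc)
qed


section \<open>Complete Hamiltonian, Gibbs measure and pressure\<close>

text \<open>Levels run over \<open>p \<ge> 1\<close>; the values of \<open>\<beta>\<close> and \<open>H\<close> at \<open>p = 0\<close> are never used.
  The series converges almost surely, but in general only conditionally, so it is
  the ordered sum \<^const>\<open>suminf\<close> and not an unconditional one.\<close>

definition complete_hamiltonian ::
  "real \<Rightarrow> (nat \<Rightarrow> 'a set \<Rightarrow> ('a \<Rightarrow> real) \<Rightarrow> 'w \<Rightarrow> real) \<Rightarrow> 'a set \<Rightarrow> (nat \<Rightarrow> real)
     \<Rightarrow> ('a \<Rightarrow> real) \<Rightarrow> 'w \<Rightarrow> real" where
  "complete_hamiltonian c H \<Lambda> \<beta> \<sigma> \<omega> =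
     (\<Sum>p. inverse (sqrt c ^ Suc p) * \<beta> (Suc p) * H (Suc p) \<Lambda> \<sigma> \<omega>)"

definition admissible :: "(nat \<Rightarrow> real) \<Rightarrow> bool" where
  "admissible \<beta> \<longleftrightarrow> (\<forall>p\<ge>1. 0 < \<beta> p) \<and> summable (\<lambda>p. (\<beta> (Suc p))\<^sup>2)"

definition partition_function ::
  "real \<Rightarrow> (nat \<Rightarrow> 'a set \<Rightarrow> ('a \<Rightarrow> real) \<Rightarrow> 'w \<Rightarrow> real) \<Rightarrow> 'a set \<Rightarrow> (nat \<Rightarrow> real) \<Rightarrow> 'w \<Rightarrow> real"
  where
  "partition_function c H \<Lambda> \<beta> \<omega> = (\<Sum>\<sigma>\<in>configs \<Lambda>. exp (- complete_hamiltonian c H \<Lambda> \<beta> \<sigma> \<omega>))"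

definition pressure ::
  "'w measure \<Rightarrow> real \<Rightarrow> (nat \<Rightarrow> 'a set \<Rightarrow> ('a \<Rightarrow> real) \<Rightarrow> 'w \<Rightarrow> real) \<Rightarrow> 'a set \<Rightarrow> (nat \<Rightarrow> real) \<Rightarrow> real"
  where
  "pressure M c H \<Lambda> \<beta> = (1 / real (card \<Lambda>)) * (\<integral>\<omega>. ln (partition_function c H \<Lambda> \<beta> \<omega>) \<partial>M)"

definition limiting_pressure ::
  "'w measure \<Rightarrow> real \<Rightarrow> (nat \<Rightarrow> 'a set \<Rightarrow> ('a \<Rightarrow> real) \<Rightarrow> 'w \<Rightarrow> real) \<Rightarrow> (nat \<Rightarrow> 'a set)
     \<Rightarrow> (nat \<Rightarrow> real) \<Rightarrow> real" where
  "limiting_pressure M c H V \<beta> = lim (\<lambda>k. pressure M c H (V k) \<beta>)"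

definition gibbs ::
  "real \<Rightarrow> (nat \<Rightarrow> 'a set \<Rightarrow> ('a \<Rightarrow> real) \<Rightarrow> 'w \<Rightarrow> real) \<Rightarrow> 'a set \<Rightarrow> (nat \<Rightarrow> real) \<Rightarrow> 'w
     \<Rightarrow> ('a \<Rightarrow> real) measure" where
  "gibbs c H \<Lambda> \<beta> \<omega> = point_measure (configs \<Lambda>)
     (\<lambda>\<sigma>. ennreal (exp (- complete_hamiltonian c H \<Lambda> \<beta> \<sigma> \<omega>) / partition_function c H \<Lambda> \<beta> \<omega>))"


section \<open>Quenched replica expectation and overlap arrays\<close>

definition quenched_expectation ::
  "'w measure \<Rightarrow> real \<Rightarrow> (nat \<Rightarrow> 'a set \<Rightarrow> ('a \<Rightarrow> real) \<Rightarrow> 'w \<Rightarrow> real) \<Rightarrow> 'a set \<Rightarrow> (nat \<Rightarrow> real)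
     \<Rightarrow> ((nat \<Rightarrow> 'a \<Rightarrow> real) \<Rightarrow> real) \<Rightarrow> real" where
  "quenched_expectation M c H \<Lambda> \<beta> F =
     (\<integral>\<omega>. (\<integral>s. F s \<partial>(PiM {1..} (\<lambda>l. gibbs c H \<Lambda> \<beta> \<omega>))) \<partial>M)"

definition overlap_array ::
  "'w measure \<Rightarrow> ('a set \<Rightarrow> 'a set \<Rightarrow> 'w \<Rightarrow> real) \<Rightarrow> 'a set \<Rightarrow> (nat \<Rightarrow> 'a \<Rightarrow> real)
     \<Rightarrow> (nat \<times> nat \<Rightarrow> real)" where
  "overlap_array M J \<Lambda> s = (\<lambda>(l, l'). overlap M J \<Lambda> (s l) (s l'))"

definition array_space :: "(nat \<times> nat \<Rightarrow> real) measure" where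
  "array_space = PiM ({1..} \<times> {1..}) (\<lambda>_. borel)"

text \<open>\<open>N\<close> is the limit in distribution of the overlap arrays along the volumes \<open>W k\<close>. The test
  functions of the marginal on a finite index set \<open>I\<close> are the maps \<open>R \<mapsto> g (restrict R I)\<close>,
  with \<open>g\<close> bounded and continuous for the product topology on the full function type;
  every bounded continuous function on the space of real functions on \<open>I\<close> arises in this way.\<close>

definition overlap_limit_law ::
  "'w measure \<Rightarrow> ('a set \<Rightarrow> 'a set \<Rightarrow> 'w \<Rightarrow> real) \<Rightarrow> real
     \<Rightarrow> (nat \<Rightarrow> 'a set \<Rightarrow> ('a \<Rightarrow> real) \<Rightarrow> 'w \<Rightarrow> real) \<Rightarrow> (nat \<Rightarrow> real) \<Rightarrow> (nat \<Rightarrow> 'a set)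
     \<Rightarrow> (nat \<times> nat \<Rightarrow> real) measure \<Rightarrow> bool" where
  "overlap_limit_law M J c H \<beta> W N \<longleftrightarrow>
     prob_space N \<and> sets N = sets array_space \<and>
     (\<forall>I g. finite I \<and> I \<subseteq> {1..} \<times> {1..} \<and> continuous_on UNIV g \<and> bounded (range g) \<longrightarrow>
        (\<lambda>k. quenched_expectation M c H (W k) \<beta> (\<lambda>s. g (restrict (overlap_array M J (W k) s) I)))
          \<longlonglongrightarrow> (\<integral>R. g (restrict R I) \<partial>N))"


section \<open>Ghirlanda-Guerra identities and ultrametricity\<close>

definition ghirlanda_guerra :: "(nat \<times> nat \<Rightarrow> real) measure \<Rightarrow> bool" where
  "ghirlanda_guerra N \<longleftrightarrow>
     (\<forall>n\<ge>2. \<forall>f \<psi>.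
        f \<in> borel_measurable (PiM ({1..n} \<times> {1..n}) (\<lambda>_. borel)) \<and>
        bounded (f ` space (PiM ({1..n} \<times> {1..n}) (\<lambda>_. borel))) \<and>
        \<psi> \<in> borel_measurable borel \<and> bounded (range \<psi>) \<longrightarrow>
        (\<integral>R. f (restrict R ({1..n} \<times> {1..n})) * \<psi> (R (1, n + 1)) \<partial>N) =
          (1 / real n) * (\<integral>R. f (restrict R ({1..n} \<times> {1..n})) \<partial>N) * (\<integral>R. \<psi> (R (1, 2)) \<partial>N)
          + (1 / real n) * (\<Sum>l=2..n. \<integral>R. f (restrict R ({1..n} \<times> {1..n})) * \<psi> (R (1, l)) \<partial>N))"

definition ultrametric_law :: "(nat \<times> nat \<Rightarrow> real) measure \<Rightarrow> bool" where
  "ultrametric_law N \<longleftrightarrow>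
     (\<integral>R. indicator {R. R (1, 2) \<ge> min (R (1, 3)) (R (2, 3))} R \<partial>N) = (1::real)"

end

(* For a fixed level p, convexity of the pressure in beta_p and differentiability of its limit
   force the level-p energy per site to concentrate, under the averaged Gibbs measure, at the
   derivative: Chernoff's bound expresses its exponential moments by free energy differences, and
   the free energy has variance of the order of the volume. Gaussian integration by parts of a
   bounded function of n replicas against this energy yields the Ghirlanda-Guerra identities for
   the p-th power of the overlap up to a vanishing error, hence exactly in any limit; since all
   beta_p are positive, the Weierstrass theorem extends them to continuous functions and the
   Cramer-Wold device to bounded measurable ones.

   Ultrametricity follows as in Panchenko's argument. If replicas 1, 2, 3 violated it with positive
   probability, the identities would allow them to be duplicated into three groups of m replicas
   with prescribed overlaps across groups and, inside a group, overlaps not much larger than the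
   largest one across. Positivity of the overlap array then makes the barycenters of the two groups
   with the largest mutual overlap almost equal, so both have almost the same overlap with the
   third group, which contradicts the violation.

   For part (B), a convex function of beta_p has only countably many kinks, which are null for an
   absolutely continuous law, and Fubini's theorem moves this to the product measure. *)
theory Submission
  imports Defs "HOL-Real_Asymp.Real_Asymp"
begin

section \<open>Characteristic functions, Gaussian calculus and random series\<close>

subsection \<open>Joint laws and characteristic functions\<close>

text \<open>Gaussian families are given only through one-dimensional laws of linear combinations,
  and limit laws only through continuous test functions, so every statement about a joint law goes
  through characteristic functions and \<open>Cramer_Wold\<close>: rotation invariance of two
  independent Hamiltonians, independence of regression residuals, exchangeability of the limit
  array, the step from continuous to measurable functions. Conditioning is avoided: an independent
  copy lives on the product of the measure with itself, and Fubini freezes one factor.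

  The complete Hamiltonian is a series that converges almost surely, in general only conditionally,
  so the free energy is not differentiated in beta_p. Finite differences at beta_p - d and beta_p +
  d take the place of the derivative, with d fixed before the volume grows.

  A self-overlap does not depend on the configuration. The diagonal term of the integration by parts
  is therefore deterministic and cancels against the same term in the mean energy, which leaves
  exactly the Ghirlanda-Guerra combination.\<close>

lemma (in prob_space) char_weighted:
  fixes X w :: "'a \<Rightarrow> real"
  assumes X: "X \<in> borel_measurable M" and w: "w \<in> borel_measurable M"
    and bd: "\<And>x. 0 \<le> w x" "\<And>x. w x \<le> C" and m: "m = (\<integral>x. w x \<partial>M)" "0 < m"
  shows "real_distribution (distr (density M (\<lambda>x. ennreal (w x / m))) borel X)"
    and "char (distr (density M (\<lambda>x. ennreal (w x / m))) borel X) t =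
      Complex ((\<integral>x. w x * cos (t * X x) \<partial>M) / m) ((\<integral>x. w x * sin (t * X x) \<partial>M) / m)"
    and "B \<in> sets borel \<Longrightarrow> measure (distr (density M (\<lambda>x. ennreal (w x / m))) borel X) B =
      (\<integral>x. w x * indicator B (X x) \<partial>M) / m"
proof -
  note [measurable] = X w
  let ?D = "density M (\<lambda>x. ennreal (w x / m))"
  have iw: "integrable M w"
    using bd by (intro integrable_const_bound[where B=C]) (auto simp: abs_of_nonneg)
  have D: "emeasure ?D (space ?D) = 1"
  proof -
    have "emeasure ?D (space ?D) = (\<integral>\<^sup>+x. ennreal (w x / m) \<partial>M)"
      by (subst emeasure_density) (auto intro!: nn_integral_cong)
    also have "\<dots> = ennreal (\<integral>x. w x / m \<partial>M)"
      using iw bd m by (intro nn_integral_eq_integral) auto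
    also have "\<dots> = 1" using m by simp
    finally show ?thesis .
  qed
  interpret D: prob_space ?D by (rule prob_spaceI) (rule D)
  show "real_distribution (distr ?D borel X)" by (rule D.real_distribution_distr) simp
  have int: "(\<integral>x. f x \<partial>?D) = (\<integral>x. w x * f x \<partial>M) / m" if [measurable]: "f \<in> borel_measurable M" for f :: "'a \<Rightarrow> real"
    using bd m by (subst integral_density) auto
  have "integrable (distr ?D borel X) (\<lambda>x. iexp (t * x))"
  proof (rule finite_measure.integrable_const_bound[where B=1])
    show "finite_measure (distr ?D borel X)"
      by (intro D.finite_measure_distr) simp
  qed (auto)
  then have i: "integrable ?D (\<lambda>x. iexp (t * X x))"
    by (subst (asm) integrable_distr_eq) auto
  have c: "char (distr ?D borel X) t = (CLINT x|?D. iexp (t * X x))"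
    unfolding char_def by (subst integral_distr) auto
  have "Re (CLINT x|?D. iexp (t * X x)) = (\<integral>x. cos (t * X x) \<partial>?D)"
       "Im (CLINT x|?D. iexp (t * X x)) = (\<integral>x. sin (t * X x) \<partial>?D)"
    using i by (simp_all add: Re_exp Im_exp flip: integral_Re integral_Im)
  then show "char (distr ?D borel X) t = Complex ((\<integral>x. w x * cos (t * X x) \<partial>M) / m) ((\<integral>x. w x * sin (t * X x) \<partial>M) / m)"
    unfolding c by (simp add: complex_eq_iff int)
  assume B: "B \<in> sets borel"
  have "measure (distr ?D borel X) B = (\<integral>x. indicator B x \<partial>distr ?D borel X)"
    using B by simp
  also have "\<dots> = (\<integral>x. indicator B (X x) \<partial>?D)"
    using B by (subst integral_distr) auto
  also have "\<dots> = (\<integral>x. w x * indicator B (X x) \<partial>M) / m"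
    by (rule int) (use B in measurable)
  finally show "measure (distr ?D borel X) B = (\<integral>x. w x * indicator B (X x) \<partial>M) / m" .
qed

text \<open>After division by their total mass the weights are probability densities, and the images
  under \<open>X\<close> and \<open>Y\<close> have the same characteristic function. Zero mass
  cannot be normalized and is treated apart; \<open>c\<close> at t = 0 shows that both masses are
  equal.\<close>

lemma weighted_Levy_uniqueness:
  fixes X w :: "'a \<Rightarrow> real" and Y v :: "'b \<Rightarrow> real"
  assumes M: "prob_space M" and N: "prob_space N"
    and X: "X \<in> borel_measurable M" and w: "w \<in> borel_measurable M"
    and Y: "Y \<in> borel_measurable N" and v: "v \<in> borel_measurable N"
    and bd: "\<And>x. 0 \<le> w x" "\<And>x. w x \<le> C" "\<And>x. 0 \<le> v x" "\<And>x. v x \<le> C"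
    and c: "\<And>t. (\<integral>x. w x * cos (t * X x) \<partial>M) = (\<integral>x. v x * cos (t * Y x) \<partial>N)"
    and s: "\<And>t. (\<integral>x. w x * sin (t * X x) \<partial>M) = (\<integral>x. v x * sin (t * Y x) \<partial>N)"
    and B: "B \<in> sets borel"
  shows "(\<integral>x. w x * indicator B (X x) \<partial>M) = (\<integral>x. v x * indicator B (Y x) \<partial>N)"
proof -
  interpret M: prob_space M by fact
  interpret N: prob_space N by fact
  note [measurable] = X w Y v B
  define m where "m = (\<integral>x. w x \<partial>M)"
  have m': "m = (\<integral>x. v x \<partial>N)" using c[of 0] by (simp add: m_def)
  have iw: "integrable M w" "integrable N v"
    using bd by (auto intro!: M.integrable_const_bound[where B=C] N.integrable_const_bound[where B=C] simp: abs_of_nonneg)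
  have "0 \<le> m" unfolding m_def using bd by (simp add: integral_nonneg_AE)
  show ?thesis
  proof (cases "m = 0")
    case True
    then have "AE x in M. w x = 0" "AE x in N. v x = 0"
      using integral_nonneg_eq_0_iff_AE[OF iw(1)] integral_nonneg_eq_0_iff_AE[OF iw(2)] bd m_def m' by simp_all
    then have "AE x in M. w x * indicator B (X x) = 0" "AE x in N. v x * indicator B (Y x) = 0" by auto
    then show ?thesis by (simp add: integral_eq_zero_AE)
  next
    case False
    with \<open>0 \<le> m\<close> have "0 < m" by simp
    note cM = M.char_weighted[OF X w bd(1,2) m_def this] and cN = N.char_weighted[OF Y v bd(3,4) m' this]
    have "distr (density M (\<lambda>x. ennreal (w x / m))) borel X = distr (density N (\<lambda>x. ennreal (v x / m))) borel Y"
      by (intro Levy_uniqueness cM(1) cN(1) ext) (simp add: cM(2) cN(2) c s)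
    then show ?thesis using cM(3)[OF B] cN(3)[OF B] \<open>0 < m\<close> by simp
  qed
qed

text \<open>The coordinates are replaced by indicators one at a time: the one-dimensional uniqueness
  theorem applies to the image of a measure with the nonnegative density
  \<open>\<phi> (1 + cos \<theta>)\<close> (or \<open>\<phi> (1 + sin \<theta>)\<close>), where \<open>\<phi>\<close> collects the indicators
  already present and \<open>\<theta>\<close> the linear form in the coordinates still to be treated.\<close>

lemma Cramer_Wold:
  fixes X :: "'i \<Rightarrow> 'a \<Rightarrow> real" and Y :: "'i \<Rightarrow> 'b \<Rightarrow> real"
  assumes M: "prob_space M" and N: "prob_space N" and I: "finite I"
    and X: "\<And>i. i \<in> I \<Longrightarrow> X i \<in> borel_measurable M" and Y: "\<And>i. i \<in> I \<Longrightarrow> Y i \<in> borel_measurable N"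
    and c: "\<And>a. (\<integral>x. cos (\<Sum>i\<in>I. a i * X i x) \<partial>M) = (\<integral>x. cos (\<Sum>i\<in>I. a i * Y i x) \<partial>N)"
    and s: "\<And>a. (\<integral>x. sin (\<Sum>i\<in>I. a i * X i x) \<partial>M) = (\<integral>x. sin (\<Sum>i\<in>I. a i * Y i x) \<partial>N)"
  shows "distr M (PiM I (\<lambda>_. borel)) (\<lambda>x. \<lambda>i\<in>I. X i x) = distr N (PiM I (\<lambda>_. borel)) (\<lambda>x. \<lambda>i\<in>I. Y i x)"
proof -
  interpret M: prob_space M by fact
  interpret N: prob_space N by fact
  have main: "(\<integral>x. (\<Prod>i\<in>S. indicator (A i) (X i x)) * cos (\<Sum>i\<in>I-S. a i * X i x) \<partial>M) =
      (\<integral>x. (\<Prod>i\<in>S. indicator (A i) (Y i x)) * cos (\<Sum>i\<in>I-S. a i * Y i x) \<partial>N) \<and>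
     (\<integral>x. (\<Prod>i\<in>S. indicator (A i) (X i x)) * sin (\<Sum>i\<in>I-S. a i * X i x) \<partial>M) =
      (\<integral>x. (\<Prod>i\<in>S. indicator (A i) (Y i x)) * sin (\<Sum>i\<in>I-S. a i * Y i x) \<partial>N)"
    if "finite S" "S \<subseteq> I" "\<And>i. i \<in> S \<Longrightarrow> A i \<in> sets borel" for S A and a :: "'i \<Rightarrow> real"
    using that
  proof (induction S arbitrary: a rule: finite_induct)
    case empty
    then show ?case using c s by simp
  next
    case (insert k S)
    have mX[measurable]: "X k \<in> borel_measurable M" "Y k \<in> borel_measurable N"
      using X Y insert.prems by auto
    define f where "f x = (\<Prod>i\<in>S. indicator (A i) (X i x) :: real)" for x
    define g where "g x = (\<Prod>i\<in>S. indicator (A i) (Y i x) :: real)" for x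
    define p where "p x = (\<Sum>i\<in>I - insert k S. a i * X i x)" for x
    define q where "q x = (\<Sum>i\<in>I - insert k S. a i * Y i x)" for x
    have [measurable]: "f \<in> borel_measurable M" "g \<in> borel_measurable N"
      unfolding f_def[abs_def] g_def[abs_def] using insert.prems X Y
      by (auto intro!: borel_measurable_prod measurable_compose[OF _ borel_measurable_indicator])
    have [measurable]: "p \<in> borel_measurable M" "q \<in> borel_measurable N"
      unfolding p_def[abs_def] q_def[abs_def] using insert.prems X Y by (auto intro!: borel_measurable_sum)
    have f01: "0 \<le> f x" "f x \<le> 1" and g01: "0 \<le> g y" "g y \<le> 1" for x y
      unfolding f_def g_def by (auto intro!: prod_nonneg prod_le_1)
    have Ak[measurable]: "A k \<in> sets borel" using insert.prems by auto
    have sp: "I - S = insert k (I - insert k S)" using insert by auto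
    have bf: "\<bar>f x * h\<bar> \<le> 1" if "\<bar>h\<bar> \<le> 1" for x h
      using f01[of x] that by (metis abs_mult abs_of_nonneg mult_le_one abs_ge_zero)
    have bg: "\<bar>g x * h\<bar> \<le> 1" if "\<bar>h\<bar> \<le> 1" for x h
      using g01[of x] that by (metis abs_mult abs_of_nonneg mult_le_one abs_ge_zero)
    have intf: "integrable M (\<lambda>x. f x * h x)" if [measurable]: "h \<in> borel_measurable M" and "\<And>x. \<bar>h x\<bar> \<le> 1" for h
      by (rule M.integrable_const_bound[where B=1]) (use bf that in auto)
    have intg: "integrable N (\<lambda>x. g x * h x)" if [measurable]: "h \<in> borel_measurable N" and "\<And>x. \<bar>h x\<bar> \<le> 1" for h
      by (rule N.integrable_const_bound[where B=1]) (use bg that in auto)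
    \<comment> \<open>The induction hypothesis is taken with coefficient t at k and r * a elsewhere.
      Only r = 0, 1, -1 occur below: these are the phases that the product formulas
      \<open>tc\<close> produce from the density 1 + h.\<close>
    have IH: "(\<integral>x. f x * cos (t * X k x + r * p x) \<partial>M) = (\<integral>x. g x * cos (t * Y k x + r * q x) \<partial>N)"
             "(\<integral>x. f x * sin (t * X k x + r * p x) \<partial>M) = (\<integral>x. g x * sin (t * Y k x + r * q x) \<partial>N)" for t r
    proof -
      have "(\<Sum>i\<in>I-S. ((\<lambda>i. r * a i)(k := t)) i * Z i) = t * Z k + r * (\<Sum>i\<in>I - insert k S. a i * Z i)" for Z :: "'i \<Rightarrow> real"
      proof -
        have "(\<Sum>i\<in>I-S. ((\<lambda>i. r * a i)(k := t)) i * Z i) = t * Z k + (\<Sum>i\<in>I - insert k S. ((\<lambda>i. r * a i)(k := t)) i * Z i)"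
          unfolding sp using I by (subst sum.insert) auto
        also have "(\<Sum>i\<in>I - insert k S. ((\<lambda>i. r * a i)(k := t)) i * Z i) = r * (\<Sum>i\<in>I - insert k S. a i * Z i)"
          by (subst sum_distrib_left) (auto intro!: sum.cong)
        finally show ?thesis .
      qed
      note eq = this
      show "(\<integral>x. f x * cos (t * X k x + r * p x) \<partial>M) = (\<integral>x. g x * cos (t * Y k x + r * q x) \<partial>N)"
           "(\<integral>x. f x * sin (t * X k x + r * p x) \<partial>M) = (\<integral>x. g x * sin (t * Y k x + r * q x) \<partial>N)"
        using insert.IH[of "(\<lambda>i. r * a i)(k := t)"] insert.prems unfolding eq
        by (auto simp: f_def g_def p_def q_def)
    qed
    have e0: "(\<integral>x. f x * indicator (A k) (X k x) \<partial>M) = (\<integral>x. g x * indicator (A k) (Y k x) \<partial>N)"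
      by (rule weighted_Levy_uniqueness[where C=1]) (use M N IH[of _ 0] f01 g01 in auto)
    have e: "(\<integral>x. (f x * (1 + h (p x))) * indicator (A k) (X k x) \<partial>M) = (\<integral>x. (g x * (1 + h (q x))) * indicator (A k) (Y k x) \<partial>N)"
      if h: "h = cos \<or> h = sin" for h :: "real \<Rightarrow> real"
    proof (rule weighted_Levy_uniqueness[where C=2])
      have hm[measurable]: "h \<in> borel_measurable borel" using h by auto
      have h1: "\<bar>h z\<bar> \<le> 1" for z using h by auto
      then have h2: "-1 \<le> h z" "h z \<le> 1" for z by (auto simp: abs_le_iff minus_le_iff)
      show "prob_space M" "prob_space N" by fact+
      show "X k \<in> borel_measurable M" "Y k \<in> borel_measurable N" "A k \<in> sets borel" by measurable
      show "(\<lambda>x. f x * (1 + h (p x))) \<in> borel_measurable M" "(\<lambda>x. g x * (1 + h (q x))) \<in> borel_measurable N" by measurable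
      show "0 \<le> f x * (1 + h (p x))" for x using f01 h2[of "p x"] by auto
      show "0 \<le> g x * (1 + h (q x))" for x using g01 h2[of "q x"] by auto
      show "f x * (1 + h (p x)) \<le> 2" for x using f01[of x] h2[of "p x"] mult_mono[of "f x" 1 "1 + h (p x)" 2] by auto
      show "g x * (1 + h (q x)) \<le> 2" for x using g01[of x] h2[of "q x"] mult_mono[of "g x" 1 "1 + h (q x)" 2] by auto
      note [simp] = intf intg
      have tc: "f x * (1 + cos P) * cos Q = f x * cos Q + (f x * cos (Q + P) + f x * cos (Q - P)) / 2"
       "f x * (1 + cos P) * sin Q = f x * sin Q + (f x * sin (Q + P) + f x * sin (Q - P)) / 2"
       "f x * (1 + sin P) * cos Q = f x * cos Q + (f x * sin (Q + P) - f x * sin (Q - P)) / 2"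
       "f x * (1 + sin P) * sin Q = f x * sin Q + (f x * cos (Q - P) - f x * cos (Q + P)) / 2" for f :: "'z \<Rightarrow> real" and x P Q
        by (simp_all add: cos_add cos_diff sin_add sin_diff algebra_simps)
      show "(\<integral>x. f x * (1 + h (p x)) * cos (t * X k x) \<partial>M) = (\<integral>x. g x * (1 + h (q x)) * cos (t * Y k x) \<partial>N)"
           "(\<integral>x. f x * (1 + h (p x)) * sin (t * X k x) \<partial>M) = (\<integral>x. g x * (1 + h (q x)) * sin (t * Y k x) \<partial>N)" for t
        using h IH[of t 0] IH[of t 1] IH[of t "-1"] by (auto simp: tc)
    qed
    \<comment> \<open>Subtracting \<open>e0\<close> removes the 1 that made the density
      nonnegative.\<close>
    have e': "(\<integral>x. f x * indicator (A k) (X k x) * h (p x) \<partial>M) = (\<integral>x. g x * indicator (A k) (Y k x) * h (q x) \<partial>N)"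
      if h: "h = cos \<or> h = sin" for h :: "real \<Rightarrow> real"
    proof -
      have hm[measurable]: "h \<in> borel_measurable borel" using h by auto
      have h1: "\<bar>h z\<bar> \<le> 1" for z using h by auto
      have 1: "integrable M (\<lambda>x. f x * (indicator (A k) (X k x) * h (p x)))" "integrable M (\<lambda>x. f x * indicator (A k) (X k x))"
        using h1 by (auto intro!: intf simp: abs_mult indicator_def)
      have 2: "integrable N (\<lambda>x. g x * (indicator (A k) (Y k x) * h (q x)))" "integrable N (\<lambda>x. g x * indicator (A k) (Y k x))"
        using h1 by (auto intro!: intg simp: abs_mult indicator_def)
      have "(\<integral>x. f x * indicator (A k) (X k x) + f x * (indicator (A k) (X k x) * h (p x)) \<partial>M)
         = (\<integral>x. g x * indicator (A k) (Y k x) + g x * (indicator (A k) (Y k x) * h (q x)) \<partial>N)"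
        using e[OF h] by (simp add: algebra_simps)
      then show ?thesis using 1 2 e0 by (simp add: mult.assoc)
    qed
    have pr: "(\<Prod>i\<in>insert k S. indicator (A i) (X i x)) = f x * indicator (A k) (X k x)"
      "(\<Prod>i\<in>insert k S. indicator (A i) (Y i y)) = g y * indicator (A k) (Y k y)" for x y
      using insert by (auto simp: f_def g_def)
    show ?case unfolding pr using e'[of cos] e'[of sin] by (auto simp: p_def q_def)
  qed
  let ?P = "PiM I (\<lambda>_. borel) :: ('i \<Rightarrow> real) measure"
  have mX: "(\<lambda>x. \<lambda>i\<in>I. X i x) \<in> measurable M ?P" "(\<lambda>x. \<lambda>i\<in>I. Y i x) \<in> measurable N ?P"
    using X Y by (auto intro!: measurable_restrict)
  have em: "emeasure (distr K ?P (\<lambda>x. \<lambda>i\<in>I. Z i x)) (Pi\<^sub>E I A) = ennreal (\<integral>x. (\<Prod>i\<in>I. indicator (A i) (Z i x)) \<partial>K)"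
    if K: "prob_space K" and Z: "\<And>i. i \<in> I \<Longrightarrow> Z i \<in> borel_measurable K" and A: "\<And>i. i \<in> I \<Longrightarrow> A i \<in> sets borel"
    for K :: "'z measure" and Z A
  proof -
    interpret prob_space K by fact
    have m: "(\<lambda>x. \<lambda>i\<in>I. Z i x) \<in> measurable K ?P" using Z by (auto intro!: measurable_restrict)
    have P: "Pi\<^sub>E I A \<in> sets ?P" using A I by (auto intro!: sets_PiM_I_finite)
    have "indicator (Pi\<^sub>E I A) (\<lambda>i\<in>I. Z i x) = (\<Prod>i\<in>I. indicator (A i) (Z i x) :: real)" for x
      using I by (induction I rule: infinite_finite_induct) (auto simp: indicator_def PiE_iff)
    then have "(\<integral>x. (\<Prod>i\<in>I. indicator (A i) (Z i x) :: real) \<partial>K) = (\<integral>y. indicator (Pi\<^sub>E I A) y \<partial>distr K ?P (\<lambda>x. \<lambda>i\<in>I. Z i x))"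
      using m P by (subst integral_distr[OF m]) auto
    also have "\<dots> = measure (distr K ?P (\<lambda>x. \<lambda>i\<in>I. Z i x)) (Pi\<^sub>E I A)"
      using P by (simp add: sets.sets_into_space inf.absorb1)
    finally show ?thesis using prob_space.finite_measure[OF prob_space_distr[OF m]]
      by (simp add: finite_measure.emeasure_eq_measure)
  qed
  show ?thesis
  proof (rule measure_eqI_PiM_finite[where A="\<lambda>_. space ?P"])
    show "emeasure (distr M ?P (\<lambda>x. \<lambda>i\<in>I. X i x)) (Pi\<^sub>E I A) = emeasure (distr N ?P (\<lambda>x. \<lambda>i\<in>I. Y i x)) (Pi\<^sub>E I A)"
      if "\<And>i. i \<in> I \<Longrightarrow> A i \<in> sets borel" for A
      using main[of I A] that I by (simp add: em[OF M X] em[OF N Y])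
    show "range (\<lambda>_::nat. space ?P) \<subseteq> prod_algebra I (\<lambda>_. borel)"
      using space_in_prod_algebra[of I "\<lambda>_. borel"] by (auto simp: space_PiM)
    show "emeasure (distr M ?P (\<lambda>x. \<lambda>i\<in>I. X i x)) (space ?P) \<noteq> \<infinity>"
      using prob_space.emeasure_space_1[OF M.prob_space_distr[OF mX(1)]] by simp
  qed (use I in auto)
qed

subsection \<open>One-dimensional Gaussian variables\<close>

context prob_space begin

lemma std_normal_char_integrals:
  assumes d: "distributed M lborel X std_normal_density"
  shows "expectation (\<lambda>x. cos (t * X x)) = exp (- t\<^sup>2 / 2)" "expectation (\<lambda>x. sin (t * X x)) = 0"
proof -
  have m[measurable]: "X \<in> borel_measurable M" using distributed_measurable[OF d] by simp
  have D: "distr M borel X = std_normal_distribution"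
    using distributed_distr_eq_density[OF d] distr_cong[of M M borel lborel X X] by simp
  have i: "integrable M (\<lambda>x. iexp (t * X x))"
    by (rule integrable_const_bound[where B=1]) auto
  have "complex_of_real (exp (- t\<^sup>2 / 2)) = char (distr M borel X) t"
    unfolding D by (simp add: char_std_normal_distribution)
  also have "\<dots> = (CLINT x|M. iexp (t * X x))"
    unfolding char_def by (subst integral_distr) auto
  finally have eq: "(CLINT x|M. iexp (t * X x)) = complex_of_real (exp (- t\<^sup>2 / 2))" ..
  have "exp (- t\<^sup>2 / 2) = Re (CLINT x|M. iexp (t * X x))" "0 = Im (CLINT x|M. iexp (t * X x))"
    unfolding eq by (simp_all only: Re_complex_of_real Im_complex_of_real)
  then show "expectation (\<lambda>x. cos (t * X x)) = exp (- t\<^sup>2 / 2)" "expectation (\<lambda>x. sin (t * X x)) = 0"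
    using i by (simp_all add: Re_exp Im_exp flip: integral_Re integral_Im)
qed

lemma centered_gaussian_char:
  assumes g: "centered_gaussian M X v"
  shows "expectation (\<lambda>x. cos (t * X x)) = exp (- (t\<^sup>2 * v) / 2)" "expectation (\<lambda>x. sin (t * X x)) = 0"
proof -
  have [measurable]: "X \<in> borel_measurable M" and v: "0 \<le> v" using g by (auto simp: centered_gaussian_def)
  show "expectation (\<lambda>x. cos (t * X x)) = exp (- (t\<^sup>2 * v) / 2)" "expectation (\<lambda>x. sin (t * X x)) = 0"
  proof (atomize (full), cases "v = 0")
    case True
    then have ae: "AE x in M. X x = 0" using g by (simp add: centered_gaussian_def)
    then have "expectation (\<lambda>x. cos (t * X x)) = expectation (\<lambda>x. 1)" "expectation (\<lambda>x. sin (t * X x)) = expectation (\<lambda>x. 0)"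
      by (intro integral_cong_AE; auto)+
    then show "expectation (\<lambda>x. cos (t * X x)) = exp (- (t\<^sup>2 * v) / 2) \<and> expectation (\<lambda>x. sin (t * X x)) = 0"
      using True by (simp add: prob_space)
  next
    case False
    with v have s: "0 < sqrt v" by simp
    have "distributed M lborel (\<lambda>x. (X x - 0) / sqrt v) std_normal_density"
      using g False normal_standard_normal_convert[OF s, of X 0] by (simp add: centered_gaussian_def)
    from std_normal_char_integrals[OF this, of "t * sqrt v"] s v
    show "expectation (\<lambda>x. cos (t * X x)) = exp (- (t\<^sup>2 * v) / 2) \<and> expectation (\<lambda>x. sin (t * X x)) = 0"
      by (simp add: power_mult_distrib)
  qed
qed

text \<open>Together with \<open>centered_gaussian_char\<close> this reduces the claim that a
  variable is Gaussian to two real integrals, which behave well under independent sums and almost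
  sure limits.\<close>

lemma centered_gaussianI_char:
  assumes m[measurable]: "X \<in> borel_measurable M" and v: "0 \<le> v"
    and c: "\<And>t. expectation (\<lambda>x. cos (t * X x)) = exp (- (t\<^sup>2 * v) / 2)"
    and s: "\<And>t. expectation (\<lambda>x. sin (t * X x)) = 0"
  shows "centered_gaussian M X v"
proof -
  have ch: "char (distr M borel Y) t = Complex (expectation (\<lambda>x. cos (t * Y x))) (expectation (\<lambda>x. sin (t * Y x)))"
    if [measurable]: "Y \<in> borel_measurable M" for Y t
  proof -
    have i: "integrable M (\<lambda>x. iexp (t * Y x))"
      by (rule integrable_const_bound[where B=1]) auto
    have "char (distr M borel Y) t = (CLINT x|M. iexp (t * Y x))"
      unfolding char_def by (subst integral_distr) auto
    then show ?thesis using i by (simp add: complex_eq_iff Re_exp Im_exp flip: integral_Re integral_Im)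
  qed
  show ?thesis
  proof (cases "v = 0")
    case True
    \<comment> \<open>Without a density at variance zero, the law is identified with the point mass
      at 0.\<close>
    have "distr M borel X = distr M borel (\<lambda>_. 0)"
      by (intro Levy_uniqueness real_distribution_distr ext)
        (auto simp: ch c s True prob_space simp del: distr_const)
    then have "measure (distr M borel X) (-{0}) = measure (distr M borel (\<lambda>_. 0)) (-{0::real})"
      by (rule arg_cong[where f="\<lambda>K. measure K (-{0})"])
    then have "prob (X -` (-{0}) \<inter> space M) = 0" by (simp add: measure_distr del: distr_const)
    then have "AE x in M. x \<notin> X -` (-{0}) \<inter> space M"
      by (intro AE_not_in) (auto simp: null_sets_def emeasure_eq_measure)
    then have "AE x in M. X x = 0" using AE_space by eventually_elim auto
    then show ?thesis using True by (simp add: centered_gaussian_def)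
  next
    case False
    with v have s0: "0 < sqrt v" by simp
    have "distr M borel (\<lambda>x. X x / sqrt v) = std_normal_distribution"
    proof (intro Levy_uniqueness real_distribution_distr ext)
      show "real_distribution std_normal_distribution" by (rule real_dist_normal_dist)
      fix t
      show "char (distr M borel (\<lambda>x. X x / sqrt v)) t = char std_normal_distribution t"
        using c[of "t / sqrt v"] s[of "t / sqrt v"] s0 v False
        by (simp add: ch char_std_normal_distribution power_divide complex_eq_iff)
    qed simp
    then have "distributed M lborel (\<lambda>x. (X x - 0) / sqrt v) std_normal_density"
      using distr_cong[of M M borel lborel "\<lambda>x. X x / sqrt v" "\<lambda>x. X x / sqrt v"]
      by (simp add: distributed_def)
    then show ?thesis using normal_standard_normal_convert[OF s0, of X 0] False v
      by (simp add: centered_gaussian_def)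
  qed
qed

text \<open>The normal density of variance v times exp (x^2 / (4 v)) is sqrt 2 times the normal
  density of variance 2 v. The common bound V lets one exponent serve a family of different
  variances.\<close>

lemma centered_gaussian_exp_square:
  assumes g: "centered_gaussian M X v" and V: "v \<le> V" "0 < V"
  shows "integrable M (\<lambda>x. exp ((X x)\<^sup>2 / (4 * V)))" "expectation (\<lambda>x. exp ((X x)\<^sup>2 / (4 * V))) \<le> sqrt 2"
proof -
  have [measurable]: "X \<in> borel_measurable M" and v: "0 \<le> v" using g by (auto simp: centered_gaussian_def)
  have "integrable M (\<lambda>x. exp ((X x)\<^sup>2 / (4 * V))) \<and> expectation (\<lambda>x. exp ((X x)\<^sup>2 / (4 * V))) \<le> sqrt 2"
  proof (cases "v = 0")
    case True
    then have ae: "AE x in M. X x = 0" using g by (simp add: centered_gaussian_def)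
    have "integrable M (\<lambda>x. exp ((X x)\<^sup>2 / (4 * V))) = integrable M (\<lambda>x. 1::real)"
      "expectation (\<lambda>x. exp ((X x)\<^sup>2 / (4 * V))) = expectation (\<lambda>x. 1)"
      using ae by (intro integrable_cong_AE integral_cong_AE; auto)+
    then show ?thesis by (simp add: prob_space)
  next
    case False
    with v have v0: "0 < v" by simp
    have d: "distributed M lborel X (normal_density 0 (sqrt v))"
      using g False by (simp add: centered_gaussian_def)
    have key: "normal_density 0 (sqrt v) x * exp (x\<^sup>2 / (4 * v)) = sqrt 2 * normal_density 0 (sqrt (2 * v)) x" for x
    proof -
      have "exp (- (x\<^sup>2 / (2 * v))) * exp (x\<^sup>2 / (4 * v)) = exp (- (x\<^sup>2 / (4 * v)))"
        using v0 by (simp flip: exp_add add: field_simps)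
      then show ?thesis using v0 unfolding normal_density_def
        by (simp add: real_sqrt_mult field_simps)
    qed
    have i: "integrable lborel (\<lambda>x. sqrt 2 * normal_density 0 (sqrt (2 * v)) x)"
      using v0 by (intro integrable_mult_right integrable_normal_density) simp
    have i1: "integrable M (\<lambda>x. exp ((X x)\<^sup>2 / (4 * v)))"
      using distributed_integrable[OF d, of "\<lambda>x. exp (x\<^sup>2 / (4 * v))"] i by (simp add: key)
    have "expectation (\<lambda>x. exp ((X x)\<^sup>2 / (4 * v))) = (\<integral>x. normal_density 0 (sqrt v) x * exp (x\<^sup>2 / (4 * v)) \<partial>lborel)"
      by (rule distributed_integral[OF d, symmetric]) auto
    also have "\<dots> = sqrt 2" using v0 by (simp add: key integral_normal_density)
    finally have e1: "expectation (\<lambda>x. exp ((X x)\<^sup>2 / (4 * v))) = sqrt 2" .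
    have le: "exp ((X x)\<^sup>2 / (4 * V)) \<le> exp ((X x)\<^sup>2 / (4 * v))" for x
      using V v0 by (simp add: frac_le)
    have i2: "integrable M (\<lambda>x. exp ((X x)\<^sup>2 / (4 * V)))"
      by (rule Bochner_Integration.integrable_bound[OF i1]) (use le in auto)
    then show ?thesis using integral_mono[OF i2 i1 le] e1 by simp
  qed
  then show "integrable M (\<lambda>x. exp ((X x)\<^sup>2 / (4 * V)))" "expectation (\<lambda>x. exp ((X x)\<^sup>2 / (4 * V))) \<le> sqrt 2" by auto
qed

text \<open>The density satisfies phi' = - x phi / v. The integral of (phi h)' over the line
  vanishes because phi tends to 0 at infinity and h is bounded; this integral is E h'(X) - E (X
  h(X)) / v.\<close>

lemma centered_gaussian_integral_by_parts:
  fixes h h' :: "real \<Rightarrow> real"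
  assumes g: "centered_gaussian M X v"
    and h: "\<And>x. (h has_real_derivative h' x) (at x)" "continuous_on UNIV h'"
    and bd: "\<And>x. \<bar>h x\<bar> \<le> C" "\<And>x. \<bar>h' x\<bar> \<le> C"
  shows "expectation (\<lambda>x. X x * h (X x)) = v * expectation (\<lambda>x. h' (X x))"
proof -
  have [measurable]: "X \<in> borel_measurable M" and v: "0 \<le> v" using g by (auto simp: centered_gaussian_def)
  have ch: "continuous_on UNIV h" using h(1) by (meson DERIV_isCont continuous_at_imp_continuous_on)
  have [measurable]: "h \<in> borel_measurable borel" "h' \<in> borel_measurable borel"
    using ch h(2) by (auto intro: borel_measurable_continuous_onI)
  show ?thesis
  proof (cases "v = 0")
    case True
    then have ae: "AE x in M. X x = 0" using g by (simp add: centered_gaussian_def)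
    then have "AE x in M. X x * h (X x) = 0" by auto
    then show ?thesis using True by (simp add: integral_eq_zero_AE)
  next
    case False
    with v have v0: "0 < v" by simp
    define \<phi> where "\<phi> = normal_density 0 (sqrt v)"
    have \<phi>e: "\<phi> x = 1 / sqrt (2 * pi * v) * exp (- (x\<^sup>2 / (2 * v)))" for x
      using v0 by (simp add: \<phi>_def normal_density_def)
    have d: "distributed M lborel X \<phi>"
      using g False by (simp add: centered_gaussian_def \<phi>_def)
    have \<phi>0: "0 \<le> \<phi> x" for x by (simp add: \<phi>_def)
    have [measurable]: "\<phi> \<in> borel_measurable borel" by (simp add: \<phi>_def)
    have d\<phi>: "(\<phi> has_real_derivative - (x / v) * \<phi> x) (at x)" for x
      unfolding \<phi>e[abs_def] using v0 by (auto intro!: derivative_eq_intros simp: field_simps)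
    have c\<phi>: "isCont \<phi> x" for x using d\<phi> DERIV_isCont by blast
    have i\<phi>: "integrable lborel \<phi>" unfolding \<phi>_def using v0 by (intro integrable_normal_density) simp
    have ix\<phi>: "integrable lborel (\<lambda>x. \<phi> x * x)"
      using integrable_normal_moment[of "sqrt v" 0 1] v0 by (simp add: \<phi>_def)
    have i1: "integrable lborel (\<lambda>x. \<phi> x * h' x)"
      by (rule Bochner_Integration.integrable_bound[OF integrable_mult_left[OF i\<phi>, of C]])
         (use bd \<phi>0 in \<open>auto simp: abs_mult intro!: mult_left_mono order_trans[OF bd(2)]\<close>)
    have i2: "integrable lborel (\<lambda>x. \<phi> x * (x * h x))"
      by (rule Bochner_Integration.integrable_bound[OF integrable_mult_left[OF ix\<phi>, of C]])
         (use bd \<phi>0 in \<open>auto simp: abs_mult mult.assoc intro!: mult_left_mono order_trans[OF bd(1)]\<close>)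
    let ?f = "\<lambda>x. \<phi> x * h' x - \<phi> x * (x * h x) / v"
    have "(LBINT x=-\<infinity>..\<infinity>. ?f x) = 0 - 0"
    proof (rule interval_integral_FTC_integrable[where F="\<lambda>x. \<phi> x * h x"])
      show "((\<lambda>x. \<phi> x * h x) has_vector_derivative ?f x) (at x)" for x
        using DERIV_mult[OF d\<phi>[of x] h(1)[of x]] 
        by (simp add: has_real_derivative_iff_has_vector_derivative algebra_simps)
      show "isCont ?f x" for x
        using c\<phi> ch h(2) v0 by (auto intro!: continuous_intros simp: continuous_on_eq_continuous_at)
      have "integrable lborel ?f" using i1 i2 by auto
      then show "set_integrable lborel (einterval (-\<infinity>) \<infinity>) ?f"
        by (simp add: set_integrable_def)
      have lim: "((\<lambda>x. \<phi> x * h x) \<longlongrightarrow> 0) F" if "(\<phi> \<longlongrightarrow> 0) F" for F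
      proof (rule tendsto_0_le[where K=C and f=\<phi>])
        show "\<forall>\<^sub>F x in F. norm (\<phi> x * h x) \<le> norm (\<phi> x) * C"
          using bd(1) by (intro always_eventually) (auto simp: abs_mult intro!: mult_left_mono)
      qed fact
      have "(\<phi> \<longlongrightarrow> 0) at_bot" "(\<phi> \<longlongrightarrow> 0) at_top"
        unfolding \<phi>e[abs_def] using v0 by real_asymp+
      then show "((((\<lambda>x. \<phi> x * h x) \<circ> real_of_ereal)) \<longlongrightarrow> 0) (at_right (-\<infinity>))" "((((\<lambda>x. \<phi> x * h x) \<circ> real_of_ereal)) \<longlongrightarrow> 0) (at_left \<infinity>)"
        using lim by (auto simp: ereal_tendsto_simps1)
    qed auto
    then have "(LBINT x. ?f x) = 0" by (simp add: interval_lebesgue_integral_def set_lebesgue_integral_def)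
    then have e: "(LBINT x. \<phi> x * h' x) = (LBINT x. \<phi> x * (x * h x)) / v"
      using i1 i2 by simp
    have "expectation (\<lambda>x. X x * h (X x)) = (LBINT x. \<phi> x * (x * h x))"
      by (rule distributed_integral[OF d, symmetric]) (auto simp: \<phi>0)
    moreover have "expectation (\<lambda>x. h' (X x)) = (LBINT x. \<phi> x * h' x)"
      by (rule distributed_integral[OF d, symmetric]) (auto simp: \<phi>0)
    ultimately show ?thesis using e v0 by simp
  qed
qed

end

subsection \<open>Almost sure convergence of independent series\<close>

context prob_space begin

lemma integrable_mult_of_squares:
  fixes f g :: "'a \<Rightarrow> real"
  assumes [measurable]: "f \<in> borel_measurable M" "g \<in> borel_measurable M"
    and i: "integrable M (\<lambda>x. (f x)\<^sup>2)" "integrable M (\<lambda>x. (g x)\<^sup>2)"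
  shows "integrable M (\<lambda>x. f x * g x)"
proof (rule Bochner_Integration.integrable_bound[OF Bochner_Integration.integrable_add[OF i]])
  have "\<bar>a * b\<bar> \<le> a\<^sup>2 + b\<^sup>2" for a b :: real
  proof -
    have "0 \<le> (\<bar>a\<bar> - \<bar>b\<bar>)\<^sup>2" by simp
    then have "2 * (\<bar>a\<bar> * \<bar>b\<bar>) \<le> a\<^sup>2 + b\<^sup>2" by (simp add: power2_diff)
    moreover have "0 \<le> \<bar>a\<bar> * \<bar>b\<bar>" by simp
    ultimately show ?thesis unfolding abs_mult by linarith
  qed
  then show "AE x in M. norm (f x * g x) \<le> norm ((f x)\<^sup>2 + (g x)\<^sup>2)" by auto
qed simp

lemma integrable_square_add:
  fixes f g :: "'a \<Rightarrow> real"
  assumes "f \<in> borel_measurable M" "g \<in> borel_measurable M"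
    and "integrable M (\<lambda>x. (f x)\<^sup>2)" "integrable M (\<lambda>x. (g x)\<^sup>2)"
  shows "integrable M (\<lambda>x. (f x + g x)\<^sup>2)"
  using integrable_mult_of_squares[OF assms] assms by (simp add: power2_sum mult.assoc)

lemma integrable_square_sum:
  fixes f :: "'i \<Rightarrow> 'a \<Rightarrow> real"
  assumes "\<And>i. i \<in> I \<Longrightarrow> f i \<in> borel_measurable M" "\<And>i. i \<in> I \<Longrightarrow> integrable M (\<lambda>x. (f i x)\<^sup>2)"
  shows "integrable M (\<lambda>x. (\<Sum>i\<in>I. f i x)\<^sup>2)"
  using assms
proof (induction I rule: infinite_finite_induct)
  case (insert i I)
  then show ?case using integrable_square_add[of "f i" "\<lambda>x. \<Sum>i\<in>I. f i x"] by auto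
qed auto

lemma integrable_of_square:
  fixes f :: "'a \<Rightarrow> real"
  assumes "f \<in> borel_measurable M" "integrable M (\<lambda>x. (f x)\<^sup>2)"
  shows "integrable M f"
  using integrable_mult_of_squares[of f "\<lambda>_. 1"] assms by simp

context
  fixes Z :: "nat \<Rightarrow> 'a \<Rightarrow> real"
  assumes ind: "indep_vars (\<lambda>_. borel) Z UNIV"
    and sq: "\<And>i. integrable M (\<lambda>x. (Z i x)\<^sup>2)" and mean: "\<And>i. expectation (Z i) = 0"
begin

lemma independent_measurable: "Z i \<in> borel_measurable M"
  using ind by (auto simp: indep_vars_def)

text \<open>The orthogonality behind the maximal inequality: a function of the coordinates before k
  is independent of the later increments, which are centered.\<close>

lemma expectation_past_mult_future:
  assumes f: "f \<in> borel_measurable (PiM {m..<k} (\<lambda>_. borel))"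
    and i: "integrable M (\<lambda>x. f (\<lambda>i\<in>{m..<k}. Z i x))"
  shows "expectation (\<lambda>x. f (\<lambda>i\<in>{m..<k}. Z i x) * (\<Sum>i\<in>{k..<n}. Z i x)) = 0"
proof -
  have "indep_var (PiM {m..<k} (\<lambda>_. borel)) (\<lambda>x. \<lambda>i\<in>{m..<k}. Z i x) (PiM {k..<n} (\<lambda>_. borel)) (\<lambda>x. \<lambda>i\<in>{k..<n}. Z i x)"
    by (rule indep_var_restrict[OF ind]) auto
  from indep_var_compose[OF this f, of "\<lambda>y. \<Sum>i\<in>{k..<n}. y i" borel]
  have iv: "indep_var borel (\<lambda>x. f (\<lambda>i\<in>{m..<k}. Z i x)) borel (\<lambda>x. \<Sum>i\<in>{k..<n}. Z i x)"
    by (auto simp: comp_def intro!: borel_measurable_sum measurable_component_singleton)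
  have iZ: "integrable M (Z i)" for i by (rule integrable_of_square[OF independent_measurable sq])
  show ?thesis using indep_var_lebesgue_integral[OF iv i] iZ mean by simp
qed

lemma expectation_square_sum:
  "expectation (\<lambda>x. (\<Sum>i\<in>{m..<n}. Z i x)\<^sup>2) = (\<Sum>i\<in>{m..<n}. expectation (\<lambda>x. (Z i x)\<^sup>2))"
proof (cases "m \<le> n")
  case True
  then show ?thesis
  proof (induction n rule: dec_induct)
    case (step n)
    note [measurable] = independent_measurable
    have iS: "integrable M (\<lambda>x. (\<Sum>i\<in>{m..<n}. Z i x)\<^sup>2)"
      by (rule integrable_square_sum) (rule independent_measurable, rule sq)
    have mm: "(\<lambda>y::nat \<Rightarrow> real. \<Sum>i\<in>{m..<n}. y i) \<in> borel_measurable (PiM {m..<n} (\<lambda>_. borel))"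
      by (rule borel_measurable_sum) (rule measurable_component_singleton)
    have iS1: "integrable M (\<lambda>x. \<Sum>i\<in>{m..<n}. Z i x)"
      by (rule integrable_of_square[OF _ iS]) measurable
    have re: "(\<Sum>i\<in>{m..<n}. (\<lambda>i\<in>{m..<n}. Z i x) i) = (\<Sum>i\<in>{m..<n}. Z i x)" for x
      by (rule sum.cong) auto
    have 0: "expectation (\<lambda>x. (\<Sum>i\<in>{m..<n}. Z i x) * Z n x) = 0"
      using expectation_past_mult_future[OF mm, of "Suc n"] iS1 by (simp only: re) simp
    have ix: "integrable M (\<lambda>x. (\<Sum>i\<in>{m..<n}. Z i x) * Z n x)"
      by (rule integrable_mult_of_squares[OF _ _ iS sq]) measurable
    have "expectation (\<lambda>x. (\<Sum>i\<in>{m..<Suc n}. Z i x)\<^sup>2) =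
        expectation (\<lambda>x. (\<Sum>i\<in>{m..<n}. Z i x)\<^sup>2 + (Z n x)\<^sup>2 + 2 * ((\<Sum>i\<in>{m..<n}. Z i x) * Z n x))"
      using step by (simp add: power2_sum mult.assoc)
    also have "\<dots> = expectation (\<lambda>x. (\<Sum>i\<in>{m..<n}. Z i x)\<^sup>2) + expectation (\<lambda>x. (Z n x)\<^sup>2)"
      using iS ix sq 0 by simp
    finally show ?case using step by simp
  qed simp
qed simp

text \<open>\<open>A k\<close> is the event that the partial sums first reach e at time k. On it the
  final sum is S k + R with R orthogonal to S k restricted to \<open>A k\<close>, so its square has
  expectation at least e^2 times the probability of \<open>A k\<close>. Summing over the disjoint
  first passage events gives the bound.\<close>

lemma Kolmogorov_maximal:
  assumes e: "0 < e"
  shows "prob {x\<in>space M. \<exists>k\<in>{m..n}. e \<le> \<bar>\<Sum>i\<in>{m..<k}. Z i x\<bar>} \<le> (\<Sum>i\<in>{m..<n}. expectation (\<lambda>x. (Z i x)\<^sup>2)) / e\<^sup>2"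
proof -
  note [measurable] = independent_measurable
  define S where "S k x = (\<Sum>i\<in>{m..<k}. Z i x)" for k x
  define A where "A k = {x\<in>space M. e \<le> \<bar>S k x\<bar> \<and> (\<forall>j\<in>{m..<k}. \<bar>S j x\<bar> < e)}" for k
  have [measurable]: "S k \<in> borel_measurable M" for k unfolding S_def by measurable
  have [measurable]: "A k \<in> sets M" for k unfolding A_def by measurable
  have iS: "integrable M (\<lambda>x. (S k x)\<^sup>2)" for k
    unfolding S_def by (rule integrable_square_sum) (rule independent_measurable, rule sq)
  have iSA: "integrable M (\<lambda>x. (S k x)\<^sup>2 * indicator (A j) x)" for k j
    using integrable_real_mult_indicator[OF _ iS] by simp
  have un: "{x\<in>space M. \<exists>k\<in>{m..n}. e \<le> \<bar>S k x\<bar>} = (\<Union>k\<in>{m..n}. A k)"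
  proof safe
    fix x k assume x: "x \<in> space M" "k \<in> {m..n}" "e \<le> \<bar>S k x\<bar>"
    define l where "l = (LEAST k. m \<le> k \<and> e \<le> \<bar>S k x\<bar>)"
    have "m \<le> k \<and> e \<le> \<bar>S k x\<bar>" using x by simp
    from LeastI[of "\<lambda>k. m \<le> k \<and> e \<le> \<bar>S k x\<bar>", OF this] Least_le[of "\<lambda>k. m \<le> k \<and> e \<le> \<bar>S k x\<bar>", OF this]
    have l: "m \<le> l" "e \<le> \<bar>S l x\<bar>" "l \<le> k" unfolding l_def by blast+
    moreover have "\<bar>S j x\<bar> < e" if "j \<in> {m..<l}" for j
      using not_less_Least[of j "\<lambda>k. m \<le> k \<and> e \<le> \<bar>S k x\<bar>"] that by (simp flip: l_def)
    ultimately show "x \<in> (\<Union>k\<in>{m..n}. A k)" using x by (auto simp: A_def intro!: bexI[of _ l])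
  qed (auto simp: A_def)
  have disj: "disjoint_family_on A {m..n}"
  proof -
    have "A i \<inter> A j = {}" if "i \<in> {m..n}" "j \<in> {m..n}" "i < j" for i j
      using that unfolding A_def by (auto dest!: bspec[of _ _ i])
    note lt = this
    show ?thesis unfolding disjoint_family_on_def
    proof (intro ballI impI)
      fix i j assume "i \<in> {m..n}" "j \<in> {m..n}" "i \<noteq> j"
      then show "A i \<inter> A j = {}" using lt[of i j] lt[of j i] by (cases "i < j") auto
    qed
  qed
  have key: "e\<^sup>2 * prob (A k) \<le> expectation (\<lambda>x. (S n x)\<^sup>2 * indicator (A k) x)" if k: "k \<in> {m..n}" for k
  proof -
    define R where "R x = (\<Sum>i\<in>{k..<n}. Z i x)" for x
    have [measurable]: "R \<in> borel_measurable M" unfolding R_def by measurable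
    have iR: "integrable M (\<lambda>x. (R x)\<^sup>2)"
      unfolding R_def by (rule integrable_square_sum) (rule independent_measurable, rule sq)
    have SR: "S n x = S k x + R x" for x
      unfolding S_def R_def using k by (simp add: sum.atLeastLessThan_concat)
    have iSAk: "integrable M (\<lambda>x. S k x * indicator (A k) x)"
      using integrable_of_square[OF _ iS] by (intro integrable_real_mult_indicator) auto
    \<comment> \<open>S k restricted to the first passage event, written as a function of the
      coordinates m..<k so that the orthogonality lemma applies.\<close>
    define f where "f y = (\<Sum>i\<in>{m..<k}. y i) * (indicator {e..} \<bar>\<Sum>i\<in>{m..<k}. y i\<bar> *
        (\<Prod>j\<in>{m..<k}. indicator {..<e} \<bar>\<Sum>i\<in>{m..<j}. y i\<bar>))" for y :: "nat \<Rightarrow> real"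
    have c: "(\<lambda>y::nat\<Rightarrow>real. y i) \<in> borel_measurable (PiM {m..<k} (\<lambda>_. borel))" if "i \<in> {m..<k}" for i
      using measurable_component_singleton[OF that, of "\<lambda>_. borel"] by simp
    have mf: "f \<in> borel_measurable (PiM {m..<k} (\<lambda>_. borel))"
      unfolding f_def[abs_def]
      by (intro borel_measurable_times borel_measurable_prod measurable_compose[OF _ borel_measurable_indicator, where M=borel] borel_measurable_abs borel_measurable_sum c) auto
    have pi: "(\<Prod>j\<in>{m..<k}. indicator {..<e} (g j) :: real) = (if \<forall>j\<in>{m..<k}. g j < e then 1 else 0)" for g
    proof (cases "\<forall>j\<in>{m..<k}. g j < e")
      case False
      then have "\<exists>j\<in>{m..<k}. indicator {..<e} (g j) = (0::real)" by (auto simp: indicator_def)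
      then show ?thesis using False by (subst prod_zero) auto
    qed (auto intro!: prod.neutral)
    have fe: "f (\<lambda>i\<in>{m..<k}. Z i x) = S k x * indicator (A k) x" if "x \<in> space M" for x
    proof -
      have Sj: "(\<Sum>i\<in>{m..<j}. (\<lambda>i\<in>{m..<k}. Z i x) i) = S j x" if "j \<in> {m..<k} \<or> j = k" for j
        using that unfolding S_def by (intro sum.cong) auto
      have "(\<Prod>j\<in>{m..<k}. indicator {..<e} \<bar>\<Sum>i\<in>{m..<j}. (\<lambda>i\<in>{m..<k}. Z i x) i\<bar> :: real) = (\<Prod>j\<in>{m..<k}. indicator {..<e} \<bar>S j x\<bar>)"
      proof (rule prod.cong[OF refl])
        fix j assume "j \<in> {m..<k}"
        then show "indicator {..<e} \<bar>\<Sum>i\<in>{m..<j}. (\<lambda>i\<in>{m..<k}. Z i x) i\<bar> = (indicator {..<e} \<bar>S j x\<bar> :: real)"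
          by (simp only: Sj simp_thms)
      qed
      then have "f (\<lambda>i\<in>{m..<k}. Z i x) = S k x * (indicator {e..} \<bar>S k x\<bar> * (\<Prod>j\<in>{m..<k}. indicator {..<e} \<bar>S j x\<bar>))"
        unfolding f_def by (simp only: Sj simp_thms)
      then show ?thesis using that by (simp add: pi A_def indicator_def)
    qed
    have "expectation (\<lambda>x. f (\<lambda>i\<in>{m..<k}. Z i x) * R x) = 0"
      unfolding R_def
    proof (rule expectation_past_mult_future[OF mf])
      have "integrable M (\<lambda>x. f (\<lambda>i\<in>{m..<k}. Z i x)) = integrable M (\<lambda>x. S k x * indicator (A k) x)"
        by (rule Bochner_Integration.integrable_cong[OF refl fe])
      then show "integrable M (\<lambda>x. f (\<lambda>i\<in>{m..<k}. Z i x))" using iSAk by simp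
    qed
    moreover have "expectation (\<lambda>x. f (\<lambda>i\<in>{m..<k}. Z i x) * R x) = expectation (\<lambda>x. S k x * indicator (A k) x * R x)"
      by (intro Bochner_Integration.integral_cong[OF refl]) (simp only: fe)
    ultimately have 0: "expectation (\<lambda>x. S k x * indicator (A k) x * R x) = 0" by simp
    have iSR: "integrable M (\<lambda>x. S k x * indicator (A k) x * R x)"
    proof (rule integrable_mult_of_squares[OF _ _ _ iR])
      have "(S k x * indicator (A k) x)\<^sup>2 = (S k x)\<^sup>2 * indicator (A k) x" for x
        by (simp add: indicator_def power_mult_distrib)
      then show "integrable M (\<lambda>x. (S k x * indicator (A k) x)\<^sup>2)" using iSA[of k k] by simp
    qed measurable
    have "e\<^sup>2 * prob (A k) = expectation (\<lambda>x. e\<^sup>2 * indicator (A k) x)" by simp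
    also have "\<dots> \<le> expectation (\<lambda>x. (S k x)\<^sup>2 * indicator (A k) x + 2 * (S k x * indicator (A k) x * R x))"
    proof -
      have "expectation (\<lambda>x. e\<^sup>2 * indicator (A k) x) \<le> expectation (\<lambda>x. (S k x)\<^sup>2 * indicator (A k) x)"
      proof (rule integral_mono[OF _ iSA])
        show "integrable M (\<lambda>x. e\<^sup>2 * indicator (A k) x)" by (simp add: emeasure_eq_measure)
        show "e\<^sup>2 * indicator (A k) x \<le> (S k x)\<^sup>2 * indicator (A k) x" for x
          using e abs_le_square_iff[of e "S k x"] by (auto simp: indicator_def A_def)
      qed
      then show ?thesis using iSA iSR 0 by simp
    qed
    also have "\<dots> \<le> expectation (\<lambda>x. (S n x)\<^sup>2 * indicator (A k) x)"
    proof (rule integral_mono[OF _ iSA])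
      show "integrable M (\<lambda>x. (S k x)\<^sup>2 * indicator (A k) x + 2 * (S k x * indicator (A k) x * R x))"
        using iSA iSR by simp
    qed (auto simp: SR indicator_def power2_sum)
    finally show ?thesis .
  qed
  have "e\<^sup>2 * prob (\<Union>k\<in>{m..n}. A k) = (\<Sum>k\<in>{m..n}. e\<^sup>2 * prob (A k))"
    using disj by (subst finite_measure_finite_Union) (auto simp: sum_distrib_left)
  also have "\<dots> \<le> (\<Sum>k\<in>{m..n}. expectation (\<lambda>x. (S n x)\<^sup>2 * indicator (A k) x))"
    by (intro sum_mono key)
  also have "\<dots> = expectation (\<lambda>x. \<Sum>k\<in>{m..n}. (S n x)\<^sup>2 * indicator (A k) x)"
    by (rule Bochner_Integration.integral_sum[symmetric]) (rule iSA)
  also have "\<dots> \<le> expectation (\<lambda>x. (S n x)\<^sup>2)"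
  proof (intro integral_mono iS Bochner_Integration.integrable_sum iSA)
    fix x
    have "(\<Sum>k\<in>{m..n}. indicator (A k) x :: real) = indicator (\<Union>k\<in>{m..n}. A k) x"
      using disj by (simp add: indicator_UN_disjoint)
    then show "(\<Sum>k\<in>{m..n}. (S n x)\<^sup>2 * indicator (A k) x) \<le> (S n x)\<^sup>2"
      by (simp add: sum_distrib_left[symmetric] indicator_def mult_left_le)
  qed
  also have "\<dots> = (\<Sum>i\<in>{m..<n}. expectation (\<lambda>x. (Z i x)\<^sup>2))"
    unfolding S_def by (rule expectation_square_sum)
  finally have "prob (\<Union>k\<in>{m..n}. A k) * e\<^sup>2 \<le> (\<Sum>i\<in>{m..<n}. expectation (\<lambda>x. (Z i x)\<^sup>2))"
    by (simp add: mult.commute)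
  then show ?thesis using e unfolding un[unfolded S_def] by (simp add: pos_le_divide_eq)
qed

text \<open>The maximal inequality bounds the probability of an oscillation of size e beyond m by a
  tail of the variance series divided by e^2. Letting m grow and then e run through 1 / (j + 1)
  makes the partial sums Cauchy almost surely.\<close>

lemma AE_summable_independent:
  assumes sm: "summable (\<lambda>i. expectation (\<lambda>x. (Z i x)\<^sup>2))"
  shows "AE x in M. summable (\<lambda>i. Z i x)"
proof -
  note [measurable] = independent_measurable
  have bad: "AE x in M. \<exists>m. \<forall>k\<ge>m. \<bar>\<Sum>i\<in>{m..<k}. Z i x\<bar> < e" if e: "0 < e" for e
  proof -
    define B where "B m n = {x\<in>space M. \<exists>k\<in>{m..n}. e \<le> \<bar>\<Sum>i\<in>{m..<k}. Z i x\<bar>}" for m n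
    define C where "C m = {x\<in>space M. \<exists>k\<ge>m. e \<le> \<bar>\<Sum>i\<in>{m..<k}. Z i x\<bar>}" for m
    have [measurable]: "B m n \<in> sets M" "C m \<in> sets M" for m n unfolding B_def C_def by measurable
    have Cle: "prob (C m) \<le> (\<Sum>i. expectation (\<lambda>x. (Z (i + m) x)\<^sup>2)) / e\<^sup>2" for m
    proof -
      have lim: "(\<lambda>n. prob (B m n)) \<longlonglongrightarrow> prob (\<Union>n. B m n)"
        by (intro finite_Lim_measure_incseq) (auto simp: incseq_def B_def)
      have un: "(\<Union>n. B m n) = C m"
      proof safe
        fix x assume "x \<in> C m"
        then obtain k where "k \<ge> m" "e \<le> \<bar>\<Sum>i\<in>{m..<k}. Z i x\<bar>" "x \<in> space M" by (auto simp: C_def)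
        then show "x \<in> (\<Union>n. B m n)" by (auto simp: B_def intro!: exI[of _ k] bexI[of _ k])
      qed (auto simp: B_def C_def)
      have bd: "prob (B m n) \<le> (\<Sum>i. expectation (\<lambda>x. (Z (i + m) x)\<^sup>2)) / e\<^sup>2" for n
      proof -
        have "(\<Sum>i\<in>{m..<n}. expectation (\<lambda>x. (Z i x)\<^sup>2)) \<le> (\<Sum>i. expectation (\<lambda>x. (Z (i + m) x)\<^sup>2))"
        proof (cases "m \<le> n")
          case True
          then have "(\<Sum>i\<in>{m..<n}. expectation (\<lambda>x. (Z i x)\<^sup>2)) = (\<Sum>i<n-m. expectation (\<lambda>x. (Z (i + m) x)\<^sup>2))"
            using sum.shift_bounds_nat_ivl[of "\<lambda>i. expectation (\<lambda>x. (Z i x)\<^sup>2)" 0 m "n - m"] by (simp add: lessThan_atLeast0)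
          then show ?thesis using summable_ignore_initial_segment[OF sm, of m] by (auto intro!: sum_le_suminf)
        qed (use summable_ignore_initial_segment[OF sm, of m] in \<open>auto intro!: suminf_nonneg\<close>)
        then show ?thesis unfolding B_def
          by (rule order_trans[OF Kolmogorov_maximal[OF e] divide_right_mono]) simp
      qed
      show ?thesis using LIMSEQ_le_const2[OF lim] bd unfolding un by blast
    qed
    have "(\<lambda>m. (\<Sum>i. expectation (\<lambda>x. (Z (i + m) x)\<^sup>2)) / e\<^sup>2) \<longlonglongrightarrow> 0 / e\<^sup>2"
      using e by (intro tendsto_divide suminf_exist_split2[OF sm]) auto
    then have lim: "(\<lambda>m. (\<Sum>i. expectation (\<lambda>x. (Z (i + m) x)\<^sup>2)) / e\<^sup>2) \<longlonglongrightarrow> 0" by simp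
    have "prob (\<Inter>m. C m) \<le> (\<Sum>i. expectation (\<lambda>x. (Z (i + m) x)\<^sup>2)) / e\<^sup>2" for m
      by (rule order_trans[OF finite_measure_mono Cle]) auto
    then have "prob (\<Inter>m. C m) \<le> 0" using LIMSEQ_le_const[OF lim] by blast
    then have "prob (\<Inter>m. C m) = 0" using measure_nonneg[of M "\<Inter>m. C m"] by linarith
    then have "AE x in M. x \<notin> (\<Inter>m. C m)"
      by (intro AE_not_in) (auto simp: null_sets_def emeasure_eq_measure)
    then show ?thesis using AE_space
    proof eventually_elim
      case (elim x)
      then obtain m where "x \<notin> C m" by blast
      then show ?case using elim by (intro exI[of _ m]) (auto simp: C_def not_le[symmetric])
    qed
  qed
  have "AE x in M. \<forall>j. \<exists>m. \<forall>k\<ge>m. \<bar>\<Sum>i\<in>{m..<k}. Z i x\<bar> < 1 / real (Suc j)"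
    unfolding AE_all_countable by (auto intro!: bad)
  then show ?thesis
  proof eventually_elim
    case (elim x)
    show ?case unfolding summable_Cauchy
    proof safe
      fix e :: real assume "0 < e"
      then obtain j where j: "1 / real (Suc j) < e / 2"
        using reals_Archimedean[of "e/2"] by (auto simp: inverse_eq_divide)
      obtain m where m: "\<And>k. m \<le> k \<Longrightarrow> \<bar>\<Sum>i\<in>{m..<k}. Z i x\<bar> < 1 / real (Suc j)" using elim by blast
      have "norm (\<Sum>i\<in>{p..<q}. Z i x) < e" if "m \<le> p" for p q
      proof (cases "p \<le> q")
        case True
        have "(\<Sum>i\<in>{m..<p}. Z i x) + (\<Sum>i\<in>{p..<q}. Z i x) = (\<Sum>i\<in>{m..<q}. Z i x)"
          using True that by (simp add: sum.atLeastLessThan_concat)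
        then show ?thesis using m[of p] m[of q] True that j by auto
      qed (use \<open>0 < e\<close> in simp)
      then show "\<exists>N. \<forall>p\<ge>N. \<forall>q. norm (\<Sum>i\<in>{p..<q}. Z i x) < e" by blast
    qed
  qed
qed

end

end

subsection \<open>Sums of independent Gaussian variables\<close>

context prob_space begin

lemma centered_gaussian_AE_cong:
  assumes X: "centered_gaussian M X v" and Y[measurable]: "Y \<in> borel_measurable M" and ae: "AE x in M. X x = Y x"
  shows "centered_gaussian M Y v"
proof (rule centered_gaussianI_char[OF Y])
  have [measurable]: "X \<in> borel_measurable M" and "0 \<le> v" using X by (auto simp: centered_gaussian_def)
  then show "0 \<le> v" by simp
  fix t
  have "expectation (\<lambda>x. cos (t * Y x)) = expectation (\<lambda>x. cos (t * X x))" "expectation (\<lambda>x. sin (t * Y x)) = expectation (\<lambda>x. sin (t * X x))"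
    using ae by (intro integral_cong_AE; auto)+
  then show "expectation (\<lambda>x. cos (t * Y x)) = exp (- (t\<^sup>2 * v) / 2)" "expectation (\<lambda>x. sin (t * Y x)) = 0"
    using centered_gaussian_char[OF X] by simp_all
qed

lemma centered_gaussian_0: "centered_gaussian M (\<lambda>_. 0) 0"
  by (simp add: centered_gaussian_def)

lemma centered_gaussian_add:
  assumes i: "indep_var borel X borel Y" and X: "centered_gaussian M X v" and Y: "centered_gaussian M Y w"
  shows "centered_gaussian M (\<lambda>x. X x + Y x) (v + w)"
proof (rule centered_gaussianI_char)
  have [measurable]: "X \<in> borel_measurable M" "Y \<in> borel_measurable M" and "0 \<le> v" "0 \<le> w"
    using X Y by (auto simp: centered_gaussian_def)
  then show "(\<lambda>x. X x + Y x) \<in> borel_measurable M" "0 \<le> v + w" by auto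
  fix t
  have m: "expectation (\<lambda>x. f (X x) * g (Y x)) = expectation (\<lambda>x. f (X x)) * expectation (\<lambda>x. g (Y x)) \<and> integrable M (\<lambda>x. f (X x) * g (Y x))"
    if [measurable]: "f \<in> borel_measurable borel" "g \<in> borel_measurable borel" and "\<And>x. \<bar>f x\<bar> \<le> 1" "\<And>x. \<bar>g x\<bar> \<le> 1" for f g :: "real \<Rightarrow> real"
  proof -
    have "indep_var borel (f \<circ> X) borel (g \<circ> Y)" by (rule indep_var_compose[OF i]) measurable
    moreover have "integrable M (f \<circ> X)" "integrable M (g \<circ> Y)"
      unfolding comp_def using that by (auto intro!: integrable_const_bound[where B=1])
    ultimately show ?thesis using indep_var_lebesgue_integral[of "f \<circ> X" "g \<circ> Y"] indep_var_integrable[of "f \<circ> X" "g \<circ> Y"]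
      by (simp add: comp_def)
  qed
  have mm: "expectation (\<lambda>x. f (t * X x) * g (t * Y x)) = expectation (\<lambda>x. f (t * X x)) * expectation (\<lambda>x. g (t * Y x))"
    "integrable M (\<lambda>x. f (t * X x) * g (t * Y x))"
    if "f \<in> {sin, cos}" "g \<in> {sin, cos}" for f g
    using m[of "\<lambda>x. f (t * x)" "\<lambda>x. g (t * x)"] that by auto
  show "expectation (\<lambda>x. cos (t * (X x + Y x))) = exp (- (t\<^sup>2 * (v + w)) / 2)"
    using centered_gaussian_char[OF X] centered_gaussian_char[OF Y]
    by (simp add: distrib_left cos_add mm flip: exp_add)
  show "expectation (\<lambda>x. sin (t * (X x + Y x))) = 0"
    using centered_gaussian_char[OF X] centered_gaussian_char[OF Y]
    by (simp add: distrib_left sin_add mm)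
qed

text \<open>Partial sums are Gaussian by independence; dominated convergence carries their
  characteristic functions to the almost sure limit.\<close>

lemma centered_gaussian_series:
  assumes ind: "indep_vars (\<lambda>_. borel) Z UNIV" and Z: "\<And>i::nat. centered_gaussian M (Z i) (v i)" and v: "summable v"
  shows "AE x in M. summable (\<lambda>i. Z i x)" "centered_gaussian M (\<lambda>x. \<Sum>i. Z i x) (\<Sum>i. v i)"
proof -
  note mom = centered_gaussian_moments[OF prob_space_axioms Z]
  have [measurable]: "Z i \<in> borel_measurable M" for i using Z by (auto simp: centered_gaussian_def)
  have v0: "0 \<le> v i" for i using Z by (auto simp: centered_gaussian_def)
  show ae: "AE x in M. summable (\<lambda>i. Z i x)"
    by (rule AE_summable_independent[OF ind]) (use mom v in \<open>auto simp: power2_eq_square\<close>)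
  have fin: "centered_gaussian M (\<lambda>x. \<Sum>i<n. Z i x) (\<Sum>i<n. v i)" for n
  proof (induction n)
    case (Suc n)
    have "indep_var borel (Z n) borel (\<lambda>x. \<Sum>i<n. Z i x)"
      by (rule indep_vars_sum) (auto intro: indep_vars_subset[OF ind])
    from centered_gaussian_add[OF this Z Suc] show ?case by (simp add: add.commute)
  qed (simp add: centered_gaussian_0)
  have lim: "(\<lambda>n. expectation (\<lambda>x. f (t * (\<Sum>i<n. Z i x)))) \<longlonglongrightarrow> expectation (\<lambda>x. f (t * (\<Sum>i. Z i x)))"
    if f: "f \<in> {sin, cos}" for f :: "real \<Rightarrow> real" and t
  proof (rule integral_dominated_convergence[where w="\<lambda>_. 1"])
    have [measurable]: "f \<in> borel_measurable borel" using f by auto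
    show "(\<lambda>x. f (t * (\<Sum>i. Z i x))) \<in> borel_measurable M" "(\<lambda>x. f (t * (\<Sum>i<n. Z i x))) \<in> borel_measurable M" for n
      by measurable
    show "AE x in M. (\<lambda>n. f (t * (\<Sum>i<n. Z i x))) \<longlonglongrightarrow> f (t * (\<Sum>i. Z i x))"
      using ae
    proof eventually_elim
      case (elim x)
      have "isCont f y" for y using f by auto
      from isCont_tendsto_compose[OF this tendsto_mult[OF tendsto_const summable_LIMSEQ[OF elim]]] show ?case .
    qed
  qed (use f in auto)
  show "centered_gaussian M (\<lambda>x. \<Sum>i. Z i x) (\<Sum>i. v i)"
  proof (rule centered_gaussianI_char)
    show "(\<lambda>x. \<Sum>i. Z i x) \<in> borel_measurable M" by measurable
    show "0 \<le> (\<Sum>i. v i)" using v v0 by (rule suminf_nonneg)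
    fix t
    have "(\<lambda>n. exp (- (t\<^sup>2 * (\<Sum>i<n. v i)) / 2)) \<longlonglongrightarrow> exp (- (t\<^sup>2 * (\<Sum>i. v i)) / 2)"
      by (intro tendsto_intros summable_LIMSEQ v) auto
    then show "expectation (\<lambda>x. cos (t * (\<Sum>i. Z i x))) = exp (- (t\<^sup>2 * (\<Sum>i. v i)) / 2)"
      using lim[of cos t] centered_gaussian_char(1)[OF fin] by (auto intro: LIMSEQ_unique)
    show "expectation (\<lambda>x. sin (t * (\<Sum>i. Z i x))) = 0"
      using lim[of sin t] centered_gaussian_char(2)[OF fin] by (auto intro: LIMSEQ_unique)
  qed
qed

end

section \<open>Free energy, energy and approximate identities in one finite volume\<close>

subsection \<open>Independent Gaussian levels on a finite configuration space\<close>

text \<open>The complete Hamiltonian in one volume: \<open>G p\<close> is level \<open>p + 1\<close> divided by \<open>(sqrt c) ^ (p + 1)\<close>,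
  \<open>u\<close> is the overlap divided by \<open>c\<close>, and \<open>N\<close> is the number of sites.\<close>

locale gaussian_levels = prob_space M for M :: "'w measure" +
  fixes S :: "'s set" and N :: real and u :: "'s \<Rightarrow> 's \<Rightarrow> real" and G :: "nat \<Rightarrow> 's \<Rightarrow> 'w \<Rightarrow> real"
  assumes finite_S: "finite S" and S_ne: "S \<noteq> {}" and N1: "1 \<le> N" and card_S: "real (card S) \<le> exp N"
    and u_le: "\<And>s t. s \<in> S \<Longrightarrow> t \<in> S \<Longrightarrow> \<bar>u s t\<bar> \<le> 1"
    and family: "\<And>p. centered_gaussian_family M S (G p)"
    and cov: "\<And>p s t. s \<in> S \<Longrightarrow> t \<in> S \<Longrightarrow> expectation (\<lambda>x. G p s x * G p t x) = N * u s t ^ Suc p"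
    and indep: "indep_vars (\<lambda>_. PiM S (\<lambda>_. borel)) (\<lambda>p x. \<lambda>s\<in>S. G p s x) UNIV"
begin

lemma N_pos: "0 < N" using N1 by simp

text \<open>Read off from the covariance of level 0, where the exponent of \<open>u\<close> is
  1.\<close>

lemma u_commute: assumes "s \<in> S" "t \<in> S" shows "u s t = u t s"
proof -
  have c: "(\<lambda>x. G 0 s x * G 0 t x) = (\<lambda>x. G 0 t x * G 0 s x)" by (rule ext) (rule mult.commute)
  have "N * u s t ^ Suc 0 = expectation (\<lambda>x. G 0 s x * G 0 t x)" by (rule cov[OF assms, symmetric])
  also have "\<dots> = N * u t s ^ Suc 0" unfolding c by (rule cov[OF assms(2,1)])
  finally show ?thesis using N_pos by auto
qed

lemma G_gaussian: assumes "s \<in> S" shows "centered_gaussian M (G p s) (N * u s s ^ Suc p)"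
proof -
  have "finite {s} \<and> {s} \<subseteq> S" using assms by simp
  then obtain v where "centered_gaussian M (\<lambda>x. \<Sum>i\<in>{s}. 1 * G p i x) v"
    using family[of p, unfolded centered_gaussian_family_def, rule_format, of "{s}" "\<lambda>_. 1"] by metis
  then have v: "centered_gaussian M (G p s) v" by simp
  have "v = N * u s s ^ Suc p"
    using centered_gaussian_moments(4)[OF prob_space_axioms v] cov[OF assms assms, of p] by (simp only:)
  with v show ?thesis by simp
qed

lemma G_measurable: "s \<in> S \<Longrightarrow> G p s \<in> borel_measurable M"
  using G_gaussian by (auto simp: centered_gaussian_def)

lemma level_combination:
  "centered_gaussian M (\<lambda>x. \<Sum>s\<in>S. a s * G p s x) (N * (\<Sum>s\<in>S. \<Sum>t\<in>S. a s * a t * u s t ^ Suc p))"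
proof -
  obtain v where v: "centered_gaussian M (\<lambda>x. \<Sum>s\<in>S. a s * G p s x) v"
    using family[of p, unfolded centered_gaussian_family_def, rule_format, of S a] finite_S by auto
  have i: "integrable M (\<lambda>x. (a s * a t) * (G p s x * G p t x))" if "s \<in> S" "t \<in> S" for s t
    using integrable_mult_of_squares[OF G_measurable[OF that(1), of p] G_measurable[OF that(2), of p]] centered_gaussian_moments(2)[OF prob_space_axioms G_gaussian[OF that(1), of p]] centered_gaussian_moments(2)[OF prob_space_axioms G_gaussian[OF that(2), of p]]
    by (simp add: power2_eq_square)
  have "v = expectation (\<lambda>x. (\<Sum>s\<in>S. a s * G p s x) * (\<Sum>s\<in>S. a s * G p s x))"
    using centered_gaussian_moments(4)[OF prob_space_axioms v] by simp
  also have "\<dots> = expectation (\<lambda>x. \<Sum>s\<in>S. \<Sum>t\<in>S. (a s * a t) * (G p s x * G p t x))"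
    by (simp add: sum_product mult_ac)
  also have "\<dots> = (\<Sum>s\<in>S. \<Sum>t\<in>S. (a s * a t) * (N * u s t ^ Suc p))"
    using i cov by (simp add: Bochner_Integration.integral_sum Bochner_Integration.integrable_sum del: power_Suc)
  also have "\<dots> = N * (\<Sum>s\<in>S. \<Sum>t\<in>S. a s * a t * u s t ^ Suc p)"
    by (simp add: sum_distrib_left mult_ac)
  finally show ?thesis using v by simp
qed

lemma indep_combination: "indep_vars (\<lambda>_. borel) (\<lambda>p x. \<Sum>s\<in>S. a p s * G p s x) UNIV"
proof -
  have "indep_vars (\<lambda>_. borel) (\<lambda>p x. \<Sum>s\<in>S. a p s * (\<lambda>s\<in>S. G p s x) s) UNIV"
    by (rule indep_vars_compose2[OF indep, where Y="\<lambda>p y. \<Sum>s\<in>S. a p s * y s"])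
       (intro borel_measurable_sum borel_measurable_times borel_measurable_const measurable_component_singleton)
  then show ?thesis by simp
qed

definition T :: "(nat \<Rightarrow> real) \<Rightarrow> 's \<Rightarrow> 'w \<Rightarrow> real" where
  "T b s x = (\<Sum>p. b p * G p s x)"

text \<open>The covariance of \<open>T b s\<close> and \<open>T b t\<close>, by independence of the
  levels.\<close>

definition K :: "(nat \<Rightarrow> real) \<Rightarrow> 's \<Rightarrow> 's \<Rightarrow> real" where
  "K b s t = N * (\<Sum>p. (b p)\<^sup>2 * u s t ^ Suc p)"

lemma T_measurable: "s \<in> S \<Longrightarrow> T b s \<in> borel_measurable M"
  unfolding T_def[abs_def] by (intro borel_measurable_suminf borel_measurable_times borel_measurable_const G_measurable)

context
  fixes b :: "nat \<Rightarrow> real"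
  assumes b: "summable (\<lambda>p. (b p)\<^sup>2)"
begin

lemma summable_K: "s \<in> S \<Longrightarrow> t \<in> S \<Longrightarrow> summable (\<lambda>p. (b p)\<^sup>2 * u s t ^ Suc p)"
proof (rule summable_comparison_test'[OF b])
  fix p :: nat assume "s \<in> S" "t \<in> S"
  then have "\<bar>u s t\<bar> ^ Suc p \<le> 1" using u_le by (intro power_le_one) auto
  then show "norm ((b p)\<^sup>2 * u s t ^ Suc p) \<le> (b p)\<^sup>2"
    by (simp add: abs_mult power_abs mult_left_le del: power_Suc)
qed

lemma K_le: "s \<in> S \<Longrightarrow> t \<in> S \<Longrightarrow> K b s t \<le> N * (\<Sum>p. (b p)\<^sup>2)"
  unfolding K_def
proof (intro mult_left_mono suminf_le b summable_K)
  fix p :: nat assume "s \<in> S" "t \<in> S"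
  then have "\<bar>u s t\<bar> ^ Suc p \<le> 1" using u_le by (intro power_le_one) auto
  then have "u s t ^ Suc p \<le> 1" by (metis abs_le_D1 power_abs)
  then show "(b p)\<^sup>2 * u s t ^ Suc p \<le> (b p)\<^sup>2" by (rule mult_left_le) simp
qed (use N_pos in auto)

lemma AE_summable_T: "AE x in M. \<forall>s\<in>S. summable (\<lambda>p. b p * G p s x)"
proof -
  have "AE x in M. summable (\<lambda>p. b p * G p s x)" if s: "s \<in> S" for s
  proof -
    have eq: "(\<Sum>r\<in>S. (if r = s then c else 0) * y r) = c * y s" for c and y :: "'s \<Rightarrow> real"
      using s finite_S by (simp add: if_distrib[of "\<lambda>z. z * _"] cong: if_cong)
    have eq2: "(\<Sum>r\<in>S. \<Sum>t\<in>S. (if r = s then c else 0) * (if t = s then c else 0) * y r t) = c\<^sup>2 * y s s" for c and y :: "'s \<Rightarrow> 's \<Rightarrow> real"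
    proof -
      have "(\<Sum>t\<in>S. (if r = s then c else 0) * (if t = s then c else 0) * y r t) = (if r = s then c else 0) * (c * y r s)" for r
        using s finite_S by (simp add: if_distrib[of "\<lambda>z. z * _"] if_distrib[of "\<lambda>z. _ * z"] cong: if_cong)
      then show ?thesis using eq[of c "\<lambda>r. c * y r s"] by (simp add: power2_eq_square)
    qed
    have "AE x in M. summable (\<lambda>p. \<Sum>r\<in>S. (if r = s then b p else 0) * G p r x)"
    proof (rule centered_gaussian_series(1)[OF indep_combination level_combination])
      show "summable (\<lambda>p. N * (\<Sum>r\<in>S. \<Sum>t\<in>S. (if r = s then b p else 0) * (if t = s then b p else 0) * u r t ^ Suc p))"
        unfolding eq2 by (intro summable_mult summable_K s)
    qed
    then show ?thesis unfolding eq .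
  qed
  then show ?thesis by (simp add: AE_finite_all[OF finite_S])
qed

text \<open>Joint normality of the Hamiltonian and a single energy of level p, as needed for the
  regression in \<open>Gibbs_integration_by_parts\<close>. Adding r * G p s0 changes only the
  coefficients of level p, so the combination is again a series of independent Gaussian
  levels.\<close>

lemma joint_gaussian:
  assumes s0: "s0 \<in> S"
  shows "centered_gaussian M (\<lambda>x. (\<Sum>s\<in>S. a s * T b s x) + r * G p s0 x)
    ((\<Sum>s\<in>S. \<Sum>t\<in>S. a s * a t * K b s t) + N * (2 * r * b p * (\<Sum>s\<in>S. a s * u s s0 ^ Suc p) + r\<^sup>2 * u s0 s0 ^ Suc p))"
proof -
  define d where "d s = (if s = s0 then r else 0)" for s
  define c where "c q s = a s * b q + (if q = p then d s else 0)" for q s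
  have ds: "(\<Sum>s\<in>S. d s * y s) = r * y s0" for y
    using s0 finite_S by (simp add: d_def if_distrib[of "\<lambda>z. z * _"] cong: if_cong)
  define w where "w q = N * (\<Sum>s\<in>S. \<Sum>t\<in>S. a s * a t * ((b q)\<^sup>2 * u s t ^ Suc q))" for q
  define z where "z = N * (2 * r * b p * (\<Sum>s\<in>S. a s * u s s0 ^ Suc p) + r\<^sup>2 * u s0 s0 ^ Suc p)"
  have v: "N * (\<Sum>s\<in>S. \<Sum>t\<in>S. c q s * c q t * u s t ^ Suc q) = w q + (if q = p then z else 0)" for q
  proof (cases "q = p")
    case True
    have cm: "(\<Sum>t\<in>S. a t * u s0 t ^ Suc p) = (\<Sum>t\<in>S. a t * u t s0 ^ Suc p)"
      by (rule sum.cong) (auto simp only: u_commute[OF s0])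
    have "(\<Sum>s\<in>S. \<Sum>t\<in>S. c q s * c q t * u s t ^ Suc q) =
      (\<Sum>s\<in>S. \<Sum>t\<in>S. a s * a t * ((b p)\<^sup>2 * u s t ^ Suc p)) + b p * (\<Sum>s\<in>S. a s * (\<Sum>t\<in>S. d t * u s t ^ Suc p))
       + b p * (\<Sum>s\<in>S. d s * (\<Sum>t\<in>S. a t * u s t ^ Suc p)) + (\<Sum>s\<in>S. d s * (\<Sum>t\<in>S. d t * u s t ^ Suc p))"
      unfolding c_def True by (simp add: sum_distrib_left sum.distrib[symmetric] algebra_simps power2_eq_square)
    also have "\<dots> = (\<Sum>s\<in>S. \<Sum>t\<in>S. a s * a t * ((b p)\<^sup>2 * u s t ^ Suc p)) + b p * (\<Sum>s\<in>S. a s * (r * u s s0 ^ Suc p))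
       + b p * (r * (\<Sum>t\<in>S. a t * u t s0 ^ Suc p)) + r * (r * u s0 s0 ^ Suc p)"
      unfolding ds cm ..
    finally show ?thesis using True
      by (simp add: w_def z_def algebra_simps sum_distrib_left power2_eq_square del: power_Suc)
  next
    case False
    then show ?thesis by (simp add: c_def w_def mult_ac power2_eq_square del: power_Suc)
  qed
  have sw: "w sums (\<Sum>s\<in>S. \<Sum>t\<in>S. a s * a t * K b s t)"
  proof -
    have "(\<lambda>q. \<Sum>s\<in>S. \<Sum>t\<in>S. (N * (a s * a t)) * ((b q)\<^sup>2 * u s t ^ Suc q)) sums
       (\<Sum>s\<in>S. \<Sum>t\<in>S. (N * (a s * a t)) * (\<Sum>q. (b q)\<^sup>2 * u s t ^ Suc q))"
      by (intro sums_sum sums_mult summable_sums summable_K)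
    then show ?thesis by (simp add: w_def[abs_def] K_def sum_distrib_left mult_ac)
  qed
  have sz: "(\<lambda>q. if q = p then z else 0) sums z" by (rule sums_single[of p "\<lambda>_. z"])
  have sv: "(\<lambda>q. N * (\<Sum>s\<in>S. \<Sum>t\<in>S. c q s * c q t * u s t ^ Suc q)) sums ((\<Sum>s\<in>S. \<Sum>t\<in>S. a s * a t * K b s t) + z)"
    unfolding v by (rule sums_add[OF sw sz])
  have g: "centered_gaussian M (\<lambda>x. \<Sum>q. \<Sum>s\<in>S. c q s * G q s x) ((\<Sum>s\<in>S. \<Sum>t\<in>S. a s * a t * K b s t) + z)"
    using centered_gaussian_series(2)[OF indep_combination level_combination sums_summable[OF sv]] sums_unique[OF sv] by simp
  show ?thesis unfolding z_def[symmetric]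
  proof (rule centered_gaussian_AE_cong[OF g])
    show "(\<lambda>x. (\<Sum>s\<in>S. a s * T b s x) + r * G p s0 x) \<in> borel_measurable M"
      using T_measurable G_measurable s0 by (intro borel_measurable_add borel_measurable_sum borel_measurable_times) auto
    show "AE x in M. (\<Sum>q. \<Sum>s\<in>S. c q s * G q s x) = (\<Sum>s\<in>S. a s * T b s x) + r * G p s0 x"
      using AE_summable_T
    proof eventually_elim
      case (elim x)
      have "(\<lambda>q. (\<Sum>s\<in>S. a s * (b q * G q s x)) + (if q = p then r * G q s0 x else 0)) sums ((\<Sum>s\<in>S. a s * T b s x) + r * G p s0 x)"
        unfolding T_def using elim by (intro sums_add sums_sum sums_mult summable_sums sums_single[of p "\<lambda>q. r * G q s0 x"]) auto
      also have "(\<lambda>q. (\<Sum>s\<in>S. a s * (b q * G q s x)) + (if q = p then r * G q s0 x else 0)) = (\<lambda>q. \<Sum>s\<in>S. c q s * G q s x)"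
      proof (rule ext)
        fix q
        have "r * G q s0 x = (\<Sum>s\<in>S. d s * G q s x)" by (rule ds[symmetric])
        then show "(\<Sum>s\<in>S. a s * (b q * G q s x)) + (if q = p then r * G q s0 x else 0) = (\<Sum>s\<in>S. c q s * G q s x)"
          unfolding c_def by (cases "q = p") (simp_all add: distrib_right sum.distrib mult.assoc)
      qed
      finally show ?case by (rule sums_unique[symmetric])
    qed
  qed
qed

end

end

subsection \<open>Log-sum-exp\<close>

definition sum_exp :: "'s set \<Rightarrow> ('s \<Rightarrow> real) \<Rightarrow> real" where
  "sum_exp S x = (\<Sum>s\<in>S. exp (- x s))"

definition weight :: "'s set \<Rightarrow> ('s \<Rightarrow> real) \<Rightarrow> 's \<Rightarrow> real" where
  "weight S x s = exp (- x s) / sum_exp S x"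

lemma sum_exp_cong: "(\<And>s. s \<in> S \<Longrightarrow> x s = y s) \<Longrightarrow> sum_exp S x = sum_exp S y"
  unfolding sum_exp_def by simp

lemma weight_cong: "(\<And>s. s \<in> S \<Longrightarrow> x s = y s) \<Longrightarrow> s \<in> S \<Longrightarrow> weight S x s = weight S y s"
  unfolding weight_def using sum_exp_cong[of S x y] by simp

text \<open>Jensen's inequality for exp, from the tangent line at the mean.\<close>

lemma exp_sum_le:
  fixes w z :: "'s \<Rightarrow> real"
  assumes w: "\<And>s. s \<in> S \<Longrightarrow> 0 \<le> w s" "(\<Sum>s\<in>S. w s) = 1"
  shows "exp (\<Sum>s\<in>S. w s * z s) \<le> (\<Sum>s\<in>S. w s * exp (z s))"
proof -
  define m where "m = (\<Sum>s\<in>S. w s * z s)"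
  have "exp m = (\<Sum>s\<in>S. w s * (exp m * (1 + (z s - m))))"
  proof -
    have "(\<Sum>s\<in>S. w s * (exp m * (1 + (z s - m)))) = exp m * ((\<Sum>s\<in>S. w s) * (1 - m) + (\<Sum>s\<in>S. w s * z s))"
      by (simp add: sum_distrib_left sum_distrib_right algebra_simps sum.distrib sum_subtractf)
    then show ?thesis using w(2) by (simp add: m_def)
  qed
  also have "\<dots> \<le> (\<Sum>s\<in>S. w s * exp (z s))"
  proof (intro sum_mono mult_left_mono w)
    fix s
    have "exp m * (1 + (z s - m)) \<le> exp m * exp (z s - m)" by (intro mult_left_mono exp_ge_add_one_self) simp
    then show "exp m * (1 + (z s - m)) \<le> exp (z s)" by (simp flip: exp_add)
  qed
  finally show ?thesis by (simp add: m_def)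
qed

text \<open>The variance of z under the weights w is nonnegative.\<close>

lemma square_sum_le:
  fixes w z :: "'s \<Rightarrow> real"
  assumes w: "\<And>s. s \<in> S \<Longrightarrow> 0 \<le> w s" "(\<Sum>s\<in>S. w s) = 1"
  shows "(\<Sum>s\<in>S. w s * z s)\<^sup>2 \<le> (\<Sum>s\<in>S. w s * (z s)\<^sup>2)"
proof -
  define m where "m = (\<Sum>s\<in>S. w s * z s)"
  have "0 \<le> (\<Sum>s\<in>S. w s * (z s - m)\<^sup>2)" by (intro sum_nonneg mult_nonneg_nonneg w) auto
  also have "\<dots> = (\<Sum>s\<in>S. w s * (z s)\<^sup>2) + (\<Sum>s\<in>S. w s) * m\<^sup>2 - 2 * m * (\<Sum>s\<in>S. w s * z s)"
    by (simp add: power2_diff sum_distrib_left sum_distrib_right algebra_simps sum.distrib sum_subtractf)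
  also have "\<dots> = (\<Sum>s\<in>S. w s * (z s)\<^sup>2) - m\<^sup>2" using w(2) by (simp add: m_def[symmetric] power2_eq_square)
  finally show ?thesis by (simp add: m_def)
qed

context
  fixes S :: "'s set"
  assumes fin: "finite S" "S \<noteq> {}"
begin

lemma sum_exp_pos: "0 < sum_exp S x"
  unfolding sum_exp_def using fin by (intro sum_pos) auto

lemma weight_nonneg: "0 \<le> weight S x s"
  unfolding weight_def using sum_exp_pos[of x] by simp

lemma sum_weight: "(\<Sum>s\<in>S. weight S x s) = 1"
  unfolding weight_def using sum_exp_pos[of x] by (simp add: sum_exp_def flip: sum_divide_distrib)

lemma weight_le_1: "s \<in> S \<Longrightarrow> weight S x s \<le> 1"
  using member_le_sum[of s S "weight S x"] weight_nonneg fin sum_weight[of x] by auto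

lemma sum_exp_ratio: "sum_exp S y / sum_exp S x = (\<Sum>s\<in>S. weight S x s * exp (x s - y s))"
proof -
  have "(\<Sum>s\<in>S. weight S x s * exp (x s - y s)) = (\<Sum>s\<in>S. exp (- y s) / sum_exp S x)"
    by (intro sum.cong refl) (simp add: weight_def exp_diff exp_minus field_simps)
  then show ?thesis by (simp add: sum_exp_def sum_divide_distrib)
qed

text \<open>The Gibbs variational inequality: a ratio of partition functions is a Gibbs average of
  an exponential, to which Jensen applies. This bound by a linear term stands in for the derivative
  of log-sum-exp, in the variance estimate as well as in the convexity of the pressure.\<close>

lemma ln_sum_exp_diff_ge: "(\<Sum>s\<in>S. weight S x s * (x s - y s)) \<le> ln (sum_exp S y) - ln (sum_exp S x)"
proof -
  have "exp (\<Sum>s\<in>S. weight S x s * (x s - y s)) \<le> sum_exp S y / sum_exp S x"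
    unfolding sum_exp_ratio by (rule exp_sum_le) (auto simp: weight_nonneg sum_weight)
  then have "(\<Sum>s\<in>S. weight S x s * (x s - y s)) \<le> ln (sum_exp S y / sum_exp S x)"
    using sum_exp_pos by (subst ln_ge_iff) auto
  then show ?thesis using sum_exp_pos by (simp add: ln_divide_pos)
qed

text \<open>Used in both directions, the linear bound encloses the difference between two Gibbs
  averages of the increment, one for each endpoint.\<close>

lemma ln_sum_exp_diff_square:
  "(ln (sum_exp S y) - ln (sum_exp S x))\<^sup>2 \<le>
    (\<Sum>s\<in>S. weight S x s * (x s - y s))\<^sup>2 + (\<Sum>s\<in>S. weight S y s * (y s - x s))\<^sup>2"
proof -
  have sq: "d\<^sup>2 \<le> a\<^sup>2 + c\<^sup>2" if "a \<le> d" "c \<le> - d" for a c d :: real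
  proof (cases "0 \<le> d")
    case True
    then have "d\<^sup>2 \<le> c\<^sup>2" using that power_mono[of d "-c" 2] by simp
    then show ?thesis by (simp add: add_increasing)
  next
    case False
    then have "d\<^sup>2 \<le> a\<^sup>2" using that power_mono[of "-d" "-a" 2] by simp
    then show ?thesis by (simp add: add_increasing2)
  qed
  show ?thesis
    by (rule sq) (use ln_sum_exp_diff_ge[of x y] ln_sum_exp_diff_ge[of y x] in linarith)+
qed

text \<open>Comparison, in both directions, with the zero Hamiltonian.\<close>

lemma abs_ln_sum_exp_le: "\<bar>ln (sum_exp S x)\<bar> \<le> ln (card S) + (\<Sum>s\<in>S. \<bar>x s\<bar>)"
proof -
  have c: "0 < card S" using fin by (simp add: card_gt_0_iff)
  have ab: "\<bar>\<Sum>s\<in>S. weight S y s * x s\<bar> \<le> (\<Sum>s\<in>S. \<bar>x s\<bar>)" for y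
  proof (rule order_trans[OF sum_abs sum_mono])
    fix s assume "s \<in> S"
    then show "\<bar>weight S y s * x s\<bar> \<le> \<bar>x s\<bar>"
      using weight_le_1[of s y] weight_nonneg[of y s] by (simp add: abs_mult mult_left_le_one_le)
  qed
  have z: "sum_exp S (\<lambda>_. 0) = card S" by (simp add: sum_exp_def)
  have "0 \<le> ln (real (card S))" using c by simp
  moreover have "(\<Sum>s\<in>S. weight S (\<lambda>_. 0) s * (0 - x s)) = - (\<Sum>s\<in>S. weight S (\<lambda>_. 0) s * x s)" by (simp add: sum_negf)
  ultimately show ?thesis
    using ln_sum_exp_diff_ge[of x "\<lambda>_. 0"] ln_sum_exp_diff_ge[of "\<lambda>_. 0" x] ab[of x] ab[of "\<lambda>_. 0"]
    unfolding z by (auto simp: abs_le_iff)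
qed

end

lemma measurable_sum_exp:
  assumes "\<And>s. s \<in> S \<Longrightarrow> (\<lambda>z. x z s) \<in> borel_measurable M"
  shows "(\<lambda>z. sum_exp S (x z)) \<in> borel_measurable M"
  unfolding sum_exp_def using assms by (intro borel_measurable_sum measurable_compose[OF _ borel_measurable_exp] borel_measurable_uminus)

lemma measurable_weight:
  assumes "\<And>s. s \<in> S \<Longrightarrow> (\<lambda>z. x z s) \<in> borel_measurable M" "s \<in> S"
  shows "(\<lambda>z. weight S (x z) s) \<in> borel_measurable M"
  unfolding weight_def using assms
  by (intro borel_measurable_divide measurable_sum_exp measurable_compose[OF _ borel_measurable_exp] borel_measurable_uminus) auto

subsection \<open>Independent copies\<close>

context prob_space begin

lemma pair_prob_space: "prob_space (M \<Otimes>\<^sub>M M)"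
proof -
  interpret pair_prob_space M M ..
  show ?thesis by unfold_locales
qed

lemma distr_fst: "distr (M \<Otimes>\<^sub>M M) M fst = M"
  by (rule distr_pair_fst)

lemma distr_snd: "distr (M \<Otimes>\<^sub>M M) M snd = M"
proof -
  interpret pair_sigma_finite M M ..
  have "distr (M \<Otimes>\<^sub>M M) M snd = distr (distr (M \<Otimes>\<^sub>M M) (M \<Otimes>\<^sub>M M) (\<lambda>(x, y). (y, x))) M snd"
    using distr_pair_swap by simp
  also have "\<dots> = distr (M \<Otimes>\<^sub>M M) M fst"
    by (subst distr_distr) (auto intro!: distr_cong)
  finally show ?thesis using distr_fst by simp
qed

lemma indep_var_fst_snd: "prob_space.indep_var (M \<Otimes>\<^sub>M M) M fst M snd"
proof -
  interpret P: prob_space "M \<Otimes>\<^sub>M M" by (rule pair_prob_space)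
  show ?thesis
    unfolding P.indep_var_distribution_eq distr_fst distr_snd
    by (simp add: distr_id2 cong: distr_cong)
qed

lemma integral_fst_eq: "f \<in> borel_measurable M \<Longrightarrow> (\<integral>z. f (fst z) \<partial>(M \<Otimes>\<^sub>M M)) = (expectation f :: real)"
  using integral_distr[of fst "M \<Otimes>\<^sub>M M" M f] by (simp add: distr_fst)

lemma integral_snd_eq: "f \<in> borel_measurable M \<Longrightarrow> (\<integral>z. f (snd z) \<partial>(M \<Otimes>\<^sub>M M)) = (expectation f :: real)"
  using integral_distr[of snd "M \<Otimes>\<^sub>M M" M f] by (simp add: distr_snd)

lemma integrable_fst_eq: "f \<in> borel_measurable M \<Longrightarrow> integrable (M \<Otimes>\<^sub>M M) (\<lambda>z. f (fst z) :: real) = integrable M f"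
  using integrable_distr_eq[of fst "M \<Otimes>\<^sub>M M" M f] by (simp add: distr_fst)

lemma integrable_snd_eq: "f \<in> borel_measurable M \<Longrightarrow> integrable (M \<Otimes>\<^sub>M M) (\<lambda>z. f (snd z) :: real) = integrable M f"
  using integrable_distr_eq[of snd "M \<Otimes>\<^sub>M M" M f] by (simp add: distr_snd)

lemma indep_var_comp_fst_snd:
  assumes "f \<in> borel_measurable M" "g \<in> borel_measurable M"
  shows "prob_space.indep_var (M \<Otimes>\<^sub>M M) borel (\<lambda>z. f (fst z)) borel (\<lambda>z. g (snd z))"
  using prob_space.indep_var_compose[OF pair_prob_space indep_var_fst_snd assms] by (simp add: comp_def)

lemma integral_fst_mult_snd:
  fixes f g :: "'a \<Rightarrow> real"
  assumes "integrable M f" "integrable M g"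
  shows "(\<integral>z. f (fst z) * g (snd z) \<partial>(M \<Otimes>\<^sub>M M)) = expectation f * expectation g"
    and "integrable (M \<Otimes>\<^sub>M M) (\<lambda>z. f (fst z) * g (snd z))"
proof -
  have m: "f \<in> borel_measurable M" "g \<in> borel_measurable M" using assms by auto
  have i: "integrable (M \<Otimes>\<^sub>M M) (\<lambda>z. f (fst z))" "integrable (M \<Otimes>\<^sub>M M) (\<lambda>z. g (snd z))"
    using assms m by (simp_all add: integrable_fst_eq integrable_snd_eq)
  show "(\<integral>z. f (fst z) * g (snd z) \<partial>(M \<Otimes>\<^sub>M M)) = expectation f * expectation g"
    using prob_space.indep_var_lebesgue_integral[OF pair_prob_space indep_var_comp_fst_snd[OF m] i] m
    by (simp add: integral_fst_eq integral_snd_eq)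
  show "integrable (M \<Otimes>\<^sub>M M) (\<lambda>z. f (fst z) * g (snd z))"
    by (rule prob_space.indep_var_integrable[OF pair_prob_space indep_var_comp_fst_snd[OF m] i])
qed

lemma centered_gaussian_pair:
  assumes X: "centered_gaussian M X v" and Y: "centered_gaussian M Y w"
  shows "centered_gaussian (M \<Otimes>\<^sub>M M) (\<lambda>z. X (fst z) + Y (snd z)) (v + w)"
proof -
  interpret P: prob_space "M \<Otimes>\<^sub>M M" by (rule pair_prob_space)
  have m[measurable]: "X \<in> borel_measurable M" "Y \<in> borel_measurable M" and nn: "0 \<le> v" "0 \<le> w"
    using X Y by (auto simp: centered_gaussian_def)
  have "centered_gaussian (M \<Otimes>\<^sub>M M) (\<lambda>z. X (fst z)) v"
    by (rule P.centered_gaussianI_char)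
      (use nn integral_fst_eq[of "\<lambda>x. cos (_ * X x)"] integral_fst_eq[of "\<lambda>x. sin (_ * X x)"] centered_gaussian_char[OF X] in auto)
  moreover have "centered_gaussian (M \<Otimes>\<^sub>M M) (\<lambda>z. Y (snd z)) w"
    by (rule P.centered_gaussianI_char)
      (use nn integral_snd_eq[of "\<lambda>x. cos (_ * Y x)"] integral_snd_eq[of "\<lambda>x. sin (_ * Y x)"] centered_gaussian_char[OF Y] in auto)
  ultimately show ?thesis by (intro P.centered_gaussian_add indep_var_comp_fst_snd m)
qed

lemma integral_square_diff_copies:
  fixes f :: "'a \<Rightarrow> real"
  assumes m[measurable]: "f \<in> borel_measurable M" and i: "integrable M (\<lambda>x. (f x)\<^sup>2)"
  shows "(\<integral>z. (f (snd z) - f (fst z))\<^sup>2 \<partial>(M \<Otimes>\<^sub>M M)) = 2 * variance f"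
proof -
  have i1: "integrable M f" by (rule integrable_of_square[OF m i])
  have "(\<integral>z. (f (snd z) - f (fst z))\<^sup>2 \<partial>(M \<Otimes>\<^sub>M M)) =
      (\<integral>z. (f (snd z))\<^sup>2 + (f (fst z))\<^sup>2 - 2 * (f (fst z) * f (snd z)) \<partial>(M \<Otimes>\<^sub>M M))"
    by (simp add: power2_diff mult_ac)
  also have "\<dots> = expectation (\<lambda>x. (f x)\<^sup>2) + expectation (\<lambda>x. (f x)\<^sup>2) - 2 * (expectation f * expectation f)"
  proof -
    have "integrable (M \<Otimes>\<^sub>M M) (\<lambda>z. (f (snd z))\<^sup>2)" "integrable (M \<Otimes>\<^sub>M M) (\<lambda>z. (f (fst z))\<^sup>2)"
      using i by (simp_all add: integrable_fst_eq[of "\<lambda>x. (f x)\<^sup>2"] integrable_snd_eq[of "\<lambda>x. (f x)\<^sup>2"])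
    then show ?thesis using integral_fst_mult_snd[OF i1 i1]
      by (simp add: integral_fst_eq[of "\<lambda>x. (f x)\<^sup>2"] integral_snd_eq[of "\<lambda>x. (f x)\<^sup>2"])
  qed
  finally show ?thesis using variance_eq[OF i1 i] by (simp add: power2_eq_square)
qed

end

subsection \<open>Concentration of the free energy\<close>

context gaussian_levels begin

lemma card_pos: "0 < card S" using finite_S S_ne by (simp add: card_gt_0_iff)

lemma ln_card_le: "ln (real (card S)) \<le> N"
  using card_S card_pos by (metis exp_gt_zero ln_exp ln_le_cancel_iff of_nat_0_less_iff)

text \<open>The weights may be correlated with the Gaussians, as Gibbs weights are, so the variances
  alone do not bound the average. By Jensen the exponential of the weighted squares over 4 V is at
  most the unweighted sum E, whose mean is at most a = sqrt 2 * card S. The inequality ln E \<le> ln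
  a + E / a - 1 then leaves 4 V ln a, and ln a is at most 2 N. The correlation costs a factor of
  order N.\<close>

lemma weighted_square_bound:
  assumes X: "\<And>s. s \<in> S \<Longrightarrow> centered_gaussian M (X s) (v s)" "\<And>s. s \<in> S \<Longrightarrow> v s \<le> V" and V: "0 < V"
    and w[measurable]: "\<And>s. s \<in> S \<Longrightarrow> w s \<in> borel_measurable M"
    and w0: "\<And>s x. s \<in> S \<Longrightarrow> 0 \<le> w s x" and w1: "\<And>x. (\<Sum>s\<in>S. w s x) = 1"
  shows "integrable M (\<lambda>x. \<Sum>s\<in>S. w s x * (X s x)\<^sup>2)"
    and "expectation (\<lambda>x. \<Sum>s\<in>S. w s x * (X s x)\<^sup>2) \<le> 8 * V * N"
proof -
  have mX[measurable]: "X s \<in> borel_measurable M" if "s \<in> S" for s using X(1)[OF that] by (auto simp: centered_gaussian_def)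
  define E where "E x = (\<Sum>s\<in>S. exp ((X s x)\<^sup>2 / (4 * V)))" for x
  note es = centered_gaussian_exp_square[OF X(1) X(2) V]
  have iE: "integrable M E" unfolding E_def using es by (intro Bochner_Integration.integrable_sum) auto
  define a where "a = sqrt 2 * real (card S)"
  have a0: "0 < a" using card_pos by (simp add: a_def)
  have eE: "expectation E \<le> a"
  proof -
    have "expectation E = (\<Sum>s\<in>S. expectation (\<lambda>x. exp ((X s x)\<^sup>2 / (4 * V))))"
      unfolding E_def using es by (intro Bochner_Integration.integral_sum) auto
    also have "\<dots> \<le> (\<Sum>s\<in>S. sqrt 2)" using es by (intro sum_mono) auto
    finally show ?thesis by (simp add: a_def mult.commute)
  qed
  have wl1: "w s x \<le> 1" if "s \<in> S" for s x
    using member_le_sum[of s S "\<lambda>s. w s x"] w0 that finite_S w1[of x] by auto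
  have le: "(\<Sum>s\<in>S. w s x * (X s x)\<^sup>2) \<le> 4 * V * (ln a + E x / a - 1)" for x
  proof -
    have E0: "0 < E x" unfolding E_def using finite_S S_ne by (intro sum_pos) auto
    have "exp (\<Sum>s\<in>S. w s x * ((X s x)\<^sup>2 / (4 * V))) \<le> (\<Sum>s\<in>S. w s x * exp ((X s x)\<^sup>2 / (4 * V)))"
      by (rule exp_sum_le) (use w0 w1 in auto)
    also have "\<dots> \<le> E x" unfolding E_def
      by (intro sum_mono mult_left_le_one_le) (auto simp: wl1 w0)
    finally have "(\<Sum>s\<in>S. w s x * ((X s x)\<^sup>2 / (4 * V))) \<le> ln (E x)" using E0 by (subst ln_ge_iff) auto
    also have "ln (E x) = ln a + ln (E x / a)" using E0 a0 by (simp add: ln_divide_pos)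
    also have "\<dots> \<le> ln a + (E x / a - 1)" using E0 a0 by (intro add_left_mono ln_le_minus_one) simp
    finally have "(\<Sum>s\<in>S. w s x * (X s x)\<^sup>2) / (4 * V) \<le> ln a + E x / a - 1"
      by (simp add: sum_divide_distrib)
    then show ?thesis using V by (simp add: pos_divide_le_eq mult.commute)
  qed
  have nn: "0 \<le> (\<Sum>s\<in>S. w s x * (X s x)\<^sup>2)" for x by (intro sum_nonneg mult_nonneg_nonneg w0) auto
  have ib: "integrable M (\<lambda>x. 4 * V * (ln a + E x / a - 1))" using iE by simp
  show i: "integrable M (\<lambda>x. \<Sum>s\<in>S. w s x * (X s x)\<^sup>2)"
  proof (rule Bochner_Integration.integrable_bound[OF ib])
    show "(\<lambda>x. \<Sum>s\<in>S. w s x * (X s x)\<^sup>2) \<in> borel_measurable M"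
      by (intro borel_measurable_sum borel_measurable_times borel_measurable_power w mX)
    show "AE x in M. norm (\<Sum>s\<in>S. w s x * (X s x)\<^sup>2) \<le> norm (4 * V * (ln a + E x / a - 1))"
      using le nn by (intro AE_I2) (simp, meson abs_ge_self order_trans)
  qed
  have "expectation (\<lambda>x. \<Sum>s\<in>S. w s x * (X s x)\<^sup>2) \<le> expectation (\<lambda>x. 4 * V * (ln a + E x / a - 1))"
    by (rule integral_mono[OF i ib le])
  also have "\<dots> = 4 * V * (ln a + expectation E / a - 1)" using iE by (simp add: prob_space)
  also have "\<dots> \<le> 4 * V * ln a"
    using eE a0 V by (intro mult_left_mono) (auto simp: field_simps)
  also have "\<dots> \<le> 4 * V * (2 * N)"
  proof (intro mult_left_mono)
    have "ln a = ln 2 / 2 + ln (card S)" using card_pos by (simp add: a_def ln_mult_pos ln_sqrt)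
    moreover have "ln 2 \<le> (1::real)" using ln_le_minus_one[of 2] by simp
    ultimately show "ln a \<le> 2 * N" using ln_card_le N1 by simp
  qed (use V in simp)
  finally show "expectation (\<lambda>x. \<Sum>s\<in>S. w s x * (X s x)\<^sup>2) \<le> 8 * V * N" by simp
qed

definition F :: "(nat \<Rightarrow> real) \<Rightarrow> 'w \<Rightarrow> real" where
  "F b x = ln (sum_exp S (\<lambda>s. T b s x))"

definition wt :: "(nat \<Rightarrow> real) \<Rightarrow> 's \<Rightarrow> 'w \<Rightarrow> real" where
  "wt b s x = weight S (\<lambda>s. T b s x) s"

lemma F_measurable[measurable]: "F b \<in> borel_measurable M"
  unfolding F_def[abs_def] by (intro measurable_compose[OF _ borel_measurable_ln] measurable_sum_exp T_measurable borel_measurable_ln)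

lemma wt_measurable: "s \<in> S \<Longrightarrow> wt b s \<in> borel_measurable M"
  unfolding wt_def[abs_def] by (intro measurable_weight T_measurable)

lemma wt_nonneg: "0 \<le> wt b s x"
  unfolding wt_def by (rule weight_nonneg[OF finite_S S_ne])

lemma sum_wt: "(\<Sum>s\<in>S. wt b s x) = 1"
  unfolding wt_def by (rule sum_weight[OF finite_S S_ne])

lemma wt_le_1: "s \<in> S \<Longrightarrow> wt b s x \<le> 1"
  unfolding wt_def by (rule weight_le_1[OF finite_S S_ne])

context
  fixes b :: "nat \<Rightarrow> real"
  assumes b: "summable (\<lambda>p. (b p)\<^sup>2)"
begin

lemma T_combination_gaussian:
  "centered_gaussian M (\<lambda>x. \<Sum>s\<in>S. a s * T b s x) (\<Sum>s\<in>S. \<Sum>t\<in>S. a s * a t * K b s t)"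
proof -
  obtain s0 where "s0 \<in> S" using S_ne by blast
  from joint_gaussian[OF b this, of a 0 0] show ?thesis by simp
qed

lemma T_gaussian: assumes s: "s \<in> S" shows "centered_gaussian M (T b s) (K b s s)"
proof -
  have eq: "(\<Sum>r\<in>S. (if r = s then 1 else 0) * y r) = y s" for y :: "'s \<Rightarrow> real"
    using s finite_S by (simp add: if_distrib[of "\<lambda>z. z * _"] cong: if_cong)
  have "(\<Sum>r\<in>S. \<Sum>t\<in>S. (if r = s then 1 else 0) * (if t = s then 1 else 0) * K b r t) = K b s s"
    using eq[of "\<lambda>r. \<Sum>t\<in>S. (if t = s then 1 else 0) * K b r t"] eq[of "K b s"]
    by (simp add: sum_distrib_left mult.assoc)
  then show ?thesis using T_combination_gaussian[of "\<lambda>r. if r = s then 1 else 0"] unfolding eq by simp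
qed

lemma T_square_integrable: "s \<in> S \<Longrightarrow> integrable M (\<lambda>x. (T b s x)\<^sup>2)" "s \<in> S \<Longrightarrow> expectation (\<lambda>x. (T b s x)\<^sup>2) = K b s s"
  using centered_gaussian_moments[OF prob_space_axioms T_gaussian] by (simp_all add: power2_eq_square)

lemma F_square_integrable: "integrable M (\<lambda>x. (F b x)\<^sup>2)"
proof -
  have "integrable M (\<lambda>x. (ln (card S) + (\<Sum>s\<in>S. \<bar>T b s x\<bar>))\<^sup>2)"
    using T_square_integrable(1) T_measurable
    by (intro integrable_square_add integrable_square_sum borel_measurable_sum borel_measurable_abs) auto
  then show ?thesis
  proof (rule Bochner_Integration.integrable_bound)
    show "AE x in M. norm ((F b x)\<^sup>2) \<le> norm ((ln (card S) + (\<Sum>s\<in>S. \<bar>T b s x\<bar>))\<^sup>2)"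
    proof (rule AE_I2)
      fix x
      have "\<bar>F b x\<bar> \<le> ln (card S) + (\<Sum>s\<in>S. \<bar>T b s x\<bar>)"
        unfolding F_def by (rule abs_ln_sum_exp_le[OF finite_S S_ne])
      then have "\<bar>F b x\<bar>\<^sup>2 \<le> (ln (card S) + (\<Sum>s\<in>S. \<bar>T b s x\<bar>))\<^sup>2" by (intro power_mono) auto
      then show "norm ((F b x)\<^sup>2) \<le> norm ((ln (card S) + (\<Sum>s\<in>S. \<bar>T b s x\<bar>))\<^sup>2)" by simp
    qed
  qed simp
qed

definition U :: "real \<Rightarrow> 's \<Rightarrow> 'w \<times> 'w \<Rightarrow> real" where
  "U \<alpha> s z = cos \<alpha> * T b s (fst z) + sin \<alpha> * T b s (snd z)"

text \<open>The pair formed by the Hamiltonian and its independent copy, rotated by the angle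
  \<alpha>.\<close>

definition W :: "real \<Rightarrow> 's + 's \<Rightarrow> 'w \<times> 'w \<Rightarrow> real" where
  "W \<alpha> i = (case i of Inl s \<Rightarrow> U \<alpha> s | Inr s \<Rightarrow> U (\<alpha> + pi / 2) s)"

lemma W_measurable: "i \<in> S <+> S \<Longrightarrow> W \<alpha> i \<in> borel_measurable (M \<Otimes>\<^sub>M M)"
  unfolding W_def U_def
  by (auto intro!: borel_measurable_add borel_measurable_times measurable_compose[OF measurable_fst T_measurable] measurable_compose[OF measurable_snd T_measurable])

lemma sum_Plus_eq: "(\<Sum>i\<in>S <+> S. f i) = (\<Sum>s\<in>S. f (Inl s)) + (\<Sum>s\<in>S. f (Inr s))"
  using finite_S by (simp add: sum.Plus)

text \<open>The pair (c s, d s) is a rotation of (a (Inl s), a (Inr s)), so \<alpha> disappears from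
  the variance. This is the source of \<open>rotation_invariance\<close>.\<close>

lemma W_combination_gaussian:
  "centered_gaussian (M \<Otimes>\<^sub>M M) (\<lambda>z. \<Sum>i\<in>S <+> S. a i * W \<alpha> i z)
    (\<Sum>s\<in>S. \<Sum>t\<in>S. (a (Inl s) * a (Inl t) + a (Inr s) * a (Inr t)) * K b s t)"
proof -
  define c where "c s = cos \<alpha> * a (Inl s) - sin \<alpha> * a (Inr s)" for s
  define d where "d s = sin \<alpha> * a (Inl s) + cos \<alpha> * a (Inr s)" for s
  have "(\<Sum>i\<in>S <+> S. a i * W \<alpha> i z) = (\<Sum>s\<in>S. c s * T b s (fst z)) + (\<Sum>s\<in>S. d s * T b s (snd z))" for z
    unfolding sum_Plus_eq sum.distrib[symmetric]
    by (intro sum.cong refl) (simp add: W_def U_def c_def d_def cos_add sin_add algebra_simps)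
  moreover have "(\<Sum>s\<in>S. \<Sum>t\<in>S. c s * c t * K b s t) + (\<Sum>s\<in>S. \<Sum>t\<in>S. d s * d t * K b s t) =
     (\<Sum>s\<in>S. \<Sum>t\<in>S. (a (Inl s) * a (Inl t) + a (Inr s) * a (Inr t)) * K b s t)"
    unfolding sum.distrib[symmetric]
  proof (intro sum.cong refl)
    fix s t
    have "c s * c t + d s * d t = ((cos \<alpha>)\<^sup>2 + (sin \<alpha>)\<^sup>2) * (a (Inl s) * a (Inl t) + a (Inr s) * a (Inr t))"
      unfolding c_def d_def power2_eq_square by (simp only: algebra_simps)
    then have "c s * c t + d s * d t = a (Inl s) * a (Inl t) + a (Inr s) * a (Inr t)" by simp
    then show "c s * c t * K b s t + d s * d t * K b s t = (a (Inl s) * a (Inl t) + a (Inr s) * a (Inr t)) * K b s t"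
      by (simp only: distrib_right[symmetric])
  qed
  ultimately show ?thesis
    using centered_gaussian_pair[OF T_combination_gaussian[of c] T_combination_gaussian[of d]] by simp
qed

lemma rotation_invariance:
  "distr (M \<Otimes>\<^sub>M M) (PiM (S <+> S) (\<lambda>_. borel)) (\<lambda>z. \<lambda>i\<in>S <+> S. W \<alpha> i z) =
   distr (M \<Otimes>\<^sub>M M) (PiM (S <+> S) (\<lambda>_. borel)) (\<lambda>z. \<lambda>i\<in>S <+> S. W 0 i z)"
proof -
  interpret P: prob_space "M \<Otimes>\<^sub>M M" by (rule pair_prob_space)
  show ?thesis
    by (rule Cramer_Wold)
      (use P.prob_space_axioms finite_S W_measurable P.centered_gaussian_char[OF W_combination_gaussian, where t=1] in auto)
qed

lemma integral_rotation:
  assumes m: "h \<in> borel_measurable (PiM (S <+> S) (\<lambda>_. borel))"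
  shows "(\<integral>z. h (\<lambda>i\<in>S <+> S. W \<alpha> i z) \<partial>(M \<Otimes>\<^sub>M M)) = (\<integral>z. h (\<lambda>i\<in>S <+> S. W 0 i z) \<partial>(M \<Otimes>\<^sub>M M) :: real)"
    "integrable (M \<Otimes>\<^sub>M M) (\<lambda>z. h (\<lambda>i\<in>S <+> S. W \<alpha> i z)) = integrable (M \<Otimes>\<^sub>M M) (\<lambda>z. h (\<lambda>i\<in>S <+> S. W 0 i z))"
proof -
  have mW: "(\<lambda>z. \<lambda>i\<in>S <+> S. W \<alpha> i z) \<in> measurable (M \<Otimes>\<^sub>M M) (PiM (S <+> S) (\<lambda>_. borel))" for \<alpha>
    by (intro measurable_restrict W_measurable)
  show "(\<integral>z. h (\<lambda>i\<in>S <+> S. W \<alpha> i z) \<partial>(M \<Otimes>\<^sub>M M)) = (\<integral>z. h (\<lambda>i\<in>S <+> S. W 0 i z) \<partial>(M \<Otimes>\<^sub>M M) :: real)"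
    using rotation_invariance[of \<alpha>] m by (simp flip: integral_distr[OF mW])
  show "integrable (M \<Otimes>\<^sub>M M) (\<lambda>z. h (\<lambda>i\<in>S <+> S. W \<alpha> i z)) = integrable (M \<Otimes>\<^sub>M M) (\<lambda>z. h (\<lambda>i\<in>S <+> S. W 0 i z))"
    using rotation_invariance[of \<alpha>] m by (simp flip: integrable_distr_eq[OF mW])
qed

text \<open>One of the two squared Gibbs averages in \<open>ln_sum_exp_diff_square\<close>, for a
  rotation from \<alpha> to \<alpha> + \<theta>; the other one is a step with angle -
  \<theta>.\<close>

definition step :: "real \<Rightarrow> real \<Rightarrow> 'w \<times> 'w \<Rightarrow> real" where
  "step \<theta> \<alpha> z = (\<Sum>s\<in>S. weight S (\<lambda>s. U \<alpha> s z) s * (U \<alpha> s z - U (\<alpha> + \<theta>) s z))\<^sup>2"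

text \<open>A step depends on the rotated pair alone, since \<open>U (\<alpha> + \<theta>)\<close>
  is cos \<theta> times \<open>U \<alpha>\<close> plus sin \<theta> times
  \<open>U (\<alpha> + pi / 2)\<close>.\<close>

lemma step_rotation:
  "(\<integral>z. step \<theta> \<alpha> z \<partial>(M \<Otimes>\<^sub>M M)) = (\<integral>z. step \<theta> 0 z \<partial>(M \<Otimes>\<^sub>M M))"
  "integrable (M \<Otimes>\<^sub>M M) (step \<theta> \<alpha>) = integrable (M \<Otimes>\<^sub>M M) (step \<theta> 0)"
proof -
  define h where "h v = (\<Sum>s\<in>S. weight S (\<lambda>s. v (Inl s)) s * (v (Inl s) - (cos \<theta> * v (Inl s) + sin \<theta> * v (Inr s))))\<^sup>2"
    for v :: "'s + 's \<Rightarrow> real"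
  have c: "(\<lambda>v::'s + 's \<Rightarrow> real. v i) \<in> borel_measurable (PiM (S <+> S) (\<lambda>_. borel))" if "i \<in> S <+> S" for i
    using measurable_component_singleton[OF that, of "\<lambda>_. borel"] by simp
  have m: "h \<in> borel_measurable (PiM (S <+> S) (\<lambda>_. borel))"
    unfolding h_def[abs_def]
    by (intro borel_measurable_power borel_measurable_sum borel_measurable_times measurable_weight borel_measurable_diff borel_measurable_add borel_measurable_const c) auto
  have eq: "step \<theta> \<alpha> z = h (\<lambda>i\<in>S <+> S. W \<alpha> i z)" for \<alpha> z
  proof -
    have "weight S (\<lambda>s. (\<lambda>i\<in>S <+> S. W \<alpha> i z) (Inl s)) s = weight S (\<lambda>s. U \<alpha> s z) s" if "s \<in> S" for s
      using that by (intro weight_cong) (simp_all add: W_def InlI)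
    moreover have "cos \<theta> * U \<alpha> s z + sin \<theta> * U (\<alpha> + pi / 2) s z = U (\<alpha> + \<theta>) s z" for s
      by (simp add: U_def cos_add sin_add algebra_simps)
    ultimately show ?thesis unfolding step_def h_def
      by (intro arg_cong[where f="\<lambda>x. x\<^sup>2"] sum.cong refl) (simp add: W_def InlI InrI)
  qed
  show "(\<integral>z. step \<theta> \<alpha> z \<partial>(M \<Otimes>\<^sub>M M)) = (\<integral>z. step \<theta> 0 z \<partial>(M \<Otimes>\<^sub>M M))"
    "integrable (M \<Otimes>\<^sub>M M) (step \<theta> \<alpha>) = integrable (M \<Otimes>\<^sub>M M) (step \<theta> 0)"
    using integral_rotation[OF m, of \<alpha>] integral_rotation[OF m, of 0] unfolding eq[abs_def, symmetric] eq[symmetric] by auto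
qed

lemma U_measurable: "s \<in> S \<Longrightarrow> U \<alpha> s \<in> borel_measurable (M \<Otimes>\<^sub>M M)"
  using W_measurable[of "Inl s" \<alpha>] by (auto simp: W_def)

lemma step_measurable: "step \<theta> \<alpha> \<in> borel_measurable (M \<Otimes>\<^sub>M M)"
  unfolding step_def[abs_def]
  by (intro borel_measurable_power borel_measurable_sum borel_measurable_times measurable_weight borel_measurable_diff U_measurable)

text \<open>At \<alpha> = 0 the increment is (1 - cos \<theta>) T - sin \<theta> T' with T' the
  independent copy. The square of T is correlated with the Gibbs weights and costs N^2 B, but its
  factor (1 - cos \<theta>)^2 is of order \<theta>^4. The square of T' is independent of the weights
  and costs only N B.\<close>

lemma step_bound:
  assumes B: "(\<Sum>p. (b p)\<^sup>2) \<le> B" "0 < B"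
  shows "integrable (M \<Otimes>\<^sub>M M) (step \<theta> \<alpha>)"
    and "(\<integral>z. step \<theta> \<alpha> z \<partial>(M \<Otimes>\<^sub>M M)) \<le> 16 * (1 - cos \<theta>)\<^sup>2 * N\<^sup>2 * B + 2 * (sin \<theta>)\<^sup>2 * N * B"
proof -
  interpret P: prob_space "M \<Otimes>\<^sub>M M" by (rule pair_prob_space)
  have KB: "K b s s \<le> N * B" if "s \<in> S" for s
    using K_le[OF b that that] B(1) N_pos by (meson mult_left_mono order_trans less_imp_le)
  have NB: "0 < N * B" using N_pos B by simp
  define f where "f x = (\<Sum>s\<in>S. wt b s x * (T b s x)\<^sup>2)" for x
  have f: "integrable M f" "expectation f \<le> 8 * (N * B) * N"
    unfolding f_def[abs_def]
    by (rule weighted_square_bound[OF T_gaussian KB NB]; simp add: wt_measurable wt_nonneg sum_wt)+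
  define g where "g z = (\<Sum>s\<in>S. wt b s (fst z) * (T b s (snd z))\<^sup>2)" for z
  have wti: "integrable M (wt b s)" if "s \<in> S" for s
    by (rule integrable_const_bound[where B=1]) (use wt_measurable wt_nonneg wt_le_1 that in auto)
  have gi: "integrable (M \<Otimes>\<^sub>M M) (\<lambda>z. wt b s (fst z) * (T b s (snd z))\<^sup>2)"
    "(\<integral>z. wt b s (fst z) * (T b s (snd z))\<^sup>2 \<partial>(M \<Otimes>\<^sub>M M)) = expectation (wt b s) * K b s s" if "s \<in> S" for s
    using integral_fst_mult_snd[OF wti T_square_integrable(1)] T_square_integrable(2) that by auto
  have g: "integrable (M \<Otimes>\<^sub>M M) g" unfolding g_def[abs_def] using gi by auto
  have "(\<integral>z. g z \<partial>(M \<Otimes>\<^sub>M M)) = (\<Sum>s\<in>S. expectation (wt b s) * K b s s)"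
    unfolding g_def using gi by simp
  also have "\<dots> \<le> (\<Sum>s\<in>S. expectation (wt b s) * (N * B))"
    by (intro sum_mono mult_left_mono KB integral_nonneg_AE) (auto simp: wt_nonneg)
  also have "\<dots> = expectation (\<lambda>x. \<Sum>s\<in>S. wt b s x) * (N * B)"
    using wti by (simp add: sum_distrib_right)
  finally have gB: "(\<integral>z. g z \<partial>(M \<Otimes>\<^sub>M M)) \<le> N * B" by (simp add: sum_wt prob_space)
  have le: "step \<theta> 0 z \<le> 2 * (1 - cos \<theta>)\<^sup>2 * f (fst z) + 2 * (sin \<theta>)\<^sup>2 * g z" for z
  proof -
    have U0: "U 0 s z = T b s (fst z)" for s by (simp add: U_def)
    have "step \<theta> 0 z = (\<Sum>s\<in>S. wt b s (fst z) * ((1 - cos \<theta>) * T b s (fst z) - sin \<theta> * T b s (snd z)))\<^sup>2"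
      unfolding step_def U0 wt_def by (simp add: U_def algebra_simps)
    also have "\<dots> \<le> (\<Sum>s\<in>S. wt b s (fst z) * ((1 - cos \<theta>) * T b s (fst z) - sin \<theta> * T b s (snd z))\<^sup>2)"
      by (rule square_sum_le) (auto simp: wt_nonneg sum_wt)
    also have "\<dots> \<le> (\<Sum>s\<in>S. wt b s (fst z) * (2 * (1 - cos \<theta>)\<^sup>2 * (T b s (fst z))\<^sup>2 + 2 * (sin \<theta>)\<^sup>2 * (T b s (snd z))\<^sup>2))"
    proof (intro sum_mono mult_left_mono wt_nonneg)
      fix s
      have "(x - y)\<^sup>2 \<le> 2 * x\<^sup>2 + 2 * y\<^sup>2" for x y :: real
        using zero_le_power2[of "x + y"] unfolding power2_diff power2_sum by linarith
      from this[of "(1 - cos \<theta>) * T b s (fst z)" "sin \<theta> * T b s (snd z)"]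
      show "((1 - cos \<theta>) * T b s (fst z) - sin \<theta> * T b s (snd z))\<^sup>2 \<le> 2 * (1 - cos \<theta>)\<^sup>2 * (T b s (fst z))\<^sup>2 + 2 * (sin \<theta>)\<^sup>2 * (T b s (snd z))\<^sup>2"
        by (simp only: power_mult_distrib mult.assoc)
    qed
    also have "\<dots> = 2 * (1 - cos \<theta>)\<^sup>2 * f (fst z) + 2 * (sin \<theta>)\<^sup>2 * g z"
      unfolding f_def g_def by (simp only: distrib_left sum.distrib sum_distrib_left mult_ac)
    finally show ?thesis .
  qed
  have fm: "f \<in> borel_measurable M" using f(1) by auto
  have fi: "integrable (M \<Otimes>\<^sub>M M) (\<lambda>z. f (fst z))" using f(1) fm by (simp add: integrable_fst_eq)
  have ib: "integrable (M \<Otimes>\<^sub>M M) (\<lambda>z. 2 * (1 - cos \<theta>)\<^sup>2 * f (fst z) + 2 * (sin \<theta>)\<^sup>2 * g z)" using fi g by simp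
  have i0: "integrable (M \<Otimes>\<^sub>M M) (step \<theta> 0)"
  proof (rule Bochner_Integration.integrable_bound[OF ib step_measurable])
    have "0 \<le> step \<theta> 0 z" for z by (simp add: step_def)
    then show "AE z in M \<Otimes>\<^sub>M M. norm (step \<theta> 0 z) \<le> norm (2 * (1 - cos \<theta>)\<^sup>2 * f (fst z) + 2 * (sin \<theta>)\<^sup>2 * g z)"
      using le by (intro AE_I2) (simp, meson abs_ge_self order_trans)
  qed
  then show "integrable (M \<Otimes>\<^sub>M M) (step \<theta> \<alpha>)" using step_rotation(2)[of \<theta> \<alpha>] by simp
  have "(\<integral>z. step \<theta> 0 z \<partial>(M \<Otimes>\<^sub>M M)) \<le> (\<integral>z. 2 * (1 - cos \<theta>)\<^sup>2 * f (fst z) + 2 * (sin \<theta>)\<^sup>2 * g z \<partial>(M \<Otimes>\<^sub>M M))"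
    by (rule integral_mono[OF i0 ib le])
  also have "\<dots> = 2 * (1 - cos \<theta>)\<^sup>2 * expectation f + 2 * (sin \<theta>)\<^sup>2 * (\<integral>z. g z \<partial>(M \<Otimes>\<^sub>M M))"
    using fi g fm by (simp add: integral_fst_eq)
  also have "\<dots> \<le> 2 * (1 - cos \<theta>)\<^sup>2 * (8 * (N * B) * N) + 2 * (sin \<theta>)\<^sup>2 * (N * B)"
    by (intro add_mono mult_left_mono f gB) auto
  also have "\<dots> = 16 * (1 - cos \<theta>)\<^sup>2 * N\<^sup>2 * B + 2 * (sin \<theta>)\<^sup>2 * N * B"
    by (simp add: power2_eq_square[of N])
  finally show "(\<integral>z. step \<theta> \<alpha> z \<partial>(M \<Otimes>\<^sub>M M)) \<le> 16 * (1 - cos \<theta>)\<^sup>2 * N\<^sup>2 * B + 2 * (sin \<theta>)\<^sup>2 * N * B"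
    unfolding step_rotation(1)[of \<theta> \<alpha>] .
qed

text \<open>Gaussian rotations connect the Hamiltonian with an independent copy by a path of
  identically distributed short steps, each of which changes the free energy by
  Gibbs averages of the increment.\<close>

lemma variance_F:
  assumes B: "(\<Sum>p. (b p)\<^sup>2) \<le> B" "0 < B"
  shows "variance (F b) \<le> 72 * N * B"
proof -
  interpret P: prob_space "M \<Otimes>\<^sub>M M" by (rule pair_prob_space)
  \<comment> \<open>Cauchy-Schwarz over k steps gives k^2 D, where k \<theta> = pi / 2. With k at
    least N the product N \<theta> stays bounded, so the N^2 term of D is also at most of order
    \<theta>^2 N B. The constant is 72 = 4 * (16 + 2), from (pi / 2)^2 \<le> 4.\<close>
  define k where "k = nat \<lceil>N\<rceil>"
  have kN: "N \<le> real k" unfolding k_def by linarith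
  have k0: "0 < real k" using kN N_pos by linarith
  define \<theta> where "\<theta> = pi / 2 / real k"
  define L where "L j z = ln (sum_exp S (\<lambda>s. U (real j * \<theta>) s z))" for j z
  define D where "D = 16 * (1 - cos \<theta>)\<^sup>2 * N\<^sup>2 * B + 2 * (sin \<theta>)\<^sup>2 * N * B"
  have sD: "integrable (M \<Otimes>\<^sub>M M) (step \<theta> \<alpha>)" "(\<integral>z. step \<theta> \<alpha> z \<partial>(M \<Otimes>\<^sub>M M)) \<le> D"
    "integrable (M \<Otimes>\<^sub>M M) (step (-\<theta>) \<alpha>)" "(\<integral>z. step (-\<theta>) \<alpha> z \<partial>(M \<Otimes>\<^sub>M M)) \<le> D" for \<alpha>
    using step_bound[OF B, of \<theta> \<alpha>] step_bound[OF B, of "-\<theta>" \<alpha>] by (simp_all add: D_def)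
  have Ls: "(L (Suc j) z - L j z)\<^sup>2 \<le> step \<theta> (real j * \<theta>) z + step (-\<theta>) (real (Suc j) * \<theta>) z" for j z
  proof -
    have e: "real j * \<theta> + \<theta> = real (Suc j) * \<theta>" "real (Suc j) * \<theta> + - \<theta> = real j * \<theta>" by (simp_all add: algebra_simps)
    show ?thesis
      using ln_sum_exp_diff_square[OF finite_S S_ne, of "\<lambda>s. U (real (Suc j) * \<theta>) s z" "\<lambda>s. U (real j * \<theta>) s z"]
      unfolding L_def step_def e .
  qed
  have sq: "(L k z - L 0 z)\<^sup>2 \<le> real k * (\<Sum>j<k. step \<theta> (real j * \<theta>) z + step (-\<theta>) (real (Suc j) * \<theta>) z)" for z
  proof -
    have "L k z - L 0 z = (\<Sum>j<k. L (Suc j) z - L j z)" by (rule sum_lessThan_telescope[of "\<lambda>j. L j z", symmetric])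
    then have "(L k z - L 0 z)\<^sup>2 = (\<Sum>j<k. L (Suc j) z - L j z)\<^sup>2" by simp
    also have "\<dots> \<le> (\<Sum>j<k. 1\<^sup>2) * (\<Sum>j<k. (L (Suc j) z - L j z)\<^sup>2)"
      using Cauchy_Schwarz_ineq_sum[of "\<lambda>_. 1" "\<lambda>j. L (Suc j) z - L j z" "{..<k}"] by simp
    also have "\<dots> \<le> real k * (\<Sum>j<k. step \<theta> (real j * \<theta>) z + step (-\<theta>) (real (Suc j) * \<theta>) z)"
    proof (rule mult_mono)
      show "(\<Sum>j<k. (L (Suc j) z - L j z)\<^sup>2) \<le> (\<Sum>j<k. step \<theta> (real j * \<theta>) z + step (-\<theta>) (real (Suc j) * \<theta>) z)"
        by (rule sum_mono) (rule Ls)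
    qed (auto intro!: sum_nonneg)
    finally show ?thesis .
  qed
  have L0: "L 0 z = F b (fst z)" for z by (simp add: L_def F_def U_def)
  have Lk: "L k z = F b (snd z)" for z
    using k0 by (simp add: L_def F_def U_def \<theta>_def)
  have ib: "integrable (M \<Otimes>\<^sub>M M) (\<lambda>z. real k * (\<Sum>j<k. step \<theta> (real j * \<theta>) z + step (-\<theta>) (real (Suc j) * \<theta>) z))"
    using sD by auto
  have "2 * variance (F b) = (\<integral>z. (F b (snd z) - F b (fst z))\<^sup>2 \<partial>(M \<Otimes>\<^sub>M M))"
    by (rule integral_square_diff_copies[symmetric]) (auto simp: F_square_integrable)
  also have "\<dots> \<le> (\<integral>z. real k * (\<Sum>j<k. step \<theta> (real j * \<theta>) z + step (-\<theta>) (real (Suc j) * \<theta>) z) \<partial>(M \<Otimes>\<^sub>M M))"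
    by (rule integral_mono'[OF ib]) (rule sq[unfolded L0 Lk], rule order_trans[OF zero_le_power2 sq])
  also have "\<dots> = real k * (\<Sum>j<k. (\<integral>z. step \<theta> (real j * \<theta>) z \<partial>(M \<Otimes>\<^sub>M M)) + (\<integral>z. step (-\<theta>) (real (Suc j) * \<theta>) z \<partial>(M \<Otimes>\<^sub>M M)))"
    using sD by (simp add: Bochner_Integration.integral_sum Bochner_Integration.integrable_sum)
  also have "\<dots> \<le> real k * (\<Sum>j<k. D + D)"
    using sD by (intro mult_left_mono sum_mono add_mono) auto
  also have "\<dots> = 2 * (real k)\<^sup>2 * D" by (simp add: power2_eq_square)
  finally have v: "variance (F b) \<le> (real k)\<^sup>2 * D" by simp
  have \<theta>0: "0 < \<theta>" using k0 by (simp add: \<theta>_def)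
  have c: "1 - cos \<theta> \<le> \<theta>\<^sup>2 / 2"
  proof -
    have "1 - cos \<theta> = 2 * (sin (\<theta> / 2))\<^sup>2" using cos_double_sin[of "\<theta> / 2"] by simp
    also have "\<dots> \<le> 2 * (\<theta> / 2)\<^sup>2"
      using abs_sin_le_one abs_sin_x_le_abs_x[of "\<theta> / 2"] by (intro mult_left_mono) (simp_all add: abs_le_square_iff[symmetric])
    finally show ?thesis by (simp add: power2_eq_square)
  qed
  have s: "(sin \<theta>)\<^sup>2 \<le> \<theta>\<^sup>2" using abs_sin_x_le_abs_x[of \<theta>] by (simp add: abs_le_square_iff[symmetric])
  have c2: "(1 - cos \<theta>)\<^sup>2 \<le> (\<theta>\<^sup>2 / 2)\<^sup>2" using c by (intro power_mono) auto
  have k\<theta>: "real k * \<theta> = pi / 2" using k0 by (simp add: \<theta>_def)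
  have pi2: "(pi / 2)\<^sup>2 \<le> 4" using pi_less_4 power_mono[of "pi/2" 2 2] by simp
  have N\<theta>: "N * \<theta> \<le> pi / 2" using kN \<theta>0 k\<theta> by (metis mult_right_mono less_imp_le)
  have N\<theta>2: "(N * \<theta>)\<^sup>2 \<le> 4" using N_pos \<theta>0 by (intro order_trans[OF power_mono[OF N\<theta>] pi2]) simp
  have "D \<le> 16 * (\<theta>\<^sup>2 / 2)\<^sup>2 * N\<^sup>2 * B + 2 * \<theta>\<^sup>2 * N * B"
    unfolding D_def using c2 s B N_pos by (intro add_mono mult_right_mono mult_left_mono) auto
  also have "\<dots> = \<theta>\<^sup>2 * (4 * (N * \<theta>)\<^sup>2 * B + 2 * N * B)" by (simp add: power2_eq_square algebra_simps)
  also have "\<dots> \<le> \<theta>\<^sup>2 * (4 * 4 * (N * B) + 2 * (N * B))"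
  proof -
    have "4 * (N * \<theta>)\<^sup>2 * B \<le> 4 * 4 * B" using N\<theta>2 B by (intro mult_right_mono mult_left_mono) auto
    also have "\<dots> \<le> 4 * 4 * (N * B)" using N1 B by simp
    finally show ?thesis by (intro mult_left_mono) auto
  qed
  also have "\<dots> = \<theta>\<^sup>2 * (18 * (N * B))" by (simp only: distrib_right[symmetric]) simp
  finally have "(real k)\<^sup>2 * D \<le> (real k)\<^sup>2 * (\<theta>\<^sup>2 * (18 * (N * B)))" by (rule mult_left_mono) simp
  also have "\<dots> = (real k * \<theta>)\<^sup>2 * (18 * (N * B))" by (simp add: power_mult_distrib)
  also have "\<dots> \<le> 4 * (18 * (N * B))"
    unfolding k\<theta> using pi2 N_pos B by (intro mult_right_mono) auto
  finally show ?thesis using v by simp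
qed

end

end

subsection \<open>Gaussian integration by parts for Gibbs averages\<close>

lemma has_real_derivative_prod_log:
  fixes w d :: "'l \<Rightarrow> real \<Rightarrow> real"
  assumes "\<And>l. l \<in> L \<Longrightarrow> (w l has_real_derivative w l x * d l x) (at x)"
  shows "((\<lambda>x. \<Prod>l\<in>L. w l x) has_real_derivative (\<Prod>l\<in>L. w l x) * (\<Sum>l\<in>L. d l x)) (at x)"
  using assms
proof (induction L rule: infinite_finite_induct)
  case (insert i L)
  have "((\<lambda>x. w i x * (\<Prod>l\<in>L. w l x)) has_real_derivative w i x * d i x * (\<Prod>l\<in>L. w l x) + (\<Prod>l\<in>L. w l x) * (\<Sum>l\<in>L. d l x) * w i x) (at x)"
    using insert by (intro DERIV_mult) auto
  then show ?case using insert by (simp add: algebra_simps)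
qed auto

lemma weight_line_derivative:
  assumes "finite S" "S \<noteq> {}"
  shows "((\<lambda>x. weight S (\<lambda>t. y t + k t * x) s) has_real_derivative
    weight S (\<lambda>t. y t + k t * x) s * ((\<Sum>t\<in>S. weight S (\<lambda>t. y t + k t * x) t * k t) - k s)) (at x)"
proof -
  define z where "z t x = exp (- (y t + k t * x))" for t x
  have dz: "(z t has_real_derivative - k t * z t x) (at x)" for t x
    unfolding z_def by (auto intro!: derivative_eq_intros)
  define Z where "Z x = (\<Sum>t\<in>S. z t x)" for x
  have dZ: "(Z has_real_derivative (\<Sum>t\<in>S. - k t * z t x)) (at x)" for x
    unfolding Z_def by (intro DERIV_sum dz)
  have Z0: "0 < Z x" for x unfolding Z_def z_def using assms by (intro sum_pos) auto
  have w: "weight S (\<lambda>t. y t + k t * x) t = z t x / Z x" for t x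
    by (simp add: weight_def sum_exp_def Z_def z_def)
  have "((\<lambda>x. z s x / Z x) has_real_derivative (- k s * z s x * Z x - z s x * (\<Sum>t\<in>S. - k t * z t x)) / (Z x * Z x)) (at x)"
    using Z0[of x] by (intro DERIV_divide dz dZ) simp
  also have "(- k s * z s x * Z x - z s x * (\<Sum>t\<in>S. - k t * z t x)) / (Z x * Z x) = z s x / Z x * ((\<Sum>t\<in>S. z t x / Z x * k t) - k s)"
  proof -
    have "(\<Sum>t\<in>S. z t x / Z x * k t) = (\<Sum>t\<in>S. k t * z t x) / Z x" by (simp add: sum_divide_distrib mult_ac)
    then show ?thesis using Z0[of x] by (simp add: sum_negf field_simps)
  qed
  finally show ?thesis unfolding w .
qed

context gaussian_levels begin

text \<open>Regression on X = G p s0: write \<open>T b t\<close> as \<open>Y t + k t * X\<close>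
  with \<open>Y\<close> uncorrelated with \<open>X\<close>. Being jointly Gaussian, (Y, X) has the
  law of the residuals on the first and X on the second factor of the product space. Fubini freezes
  the residuals, and one-dimensional integration by parts applies to the weights along the line y +
  k x.\<close>

lemma Gibbs_integration_by_parts:
  fixes L :: "'l set" and r :: "'l \<Rightarrow> 's"
  assumes b: "summable (\<lambda>p. (b p)\<^sup>2)" and L: "finite L" "\<And>l. l \<in> L \<Longrightarrow> r l \<in> S" and s0: "s0 \<in> S"
  shows "expectation (\<lambda>x. G p s0 x * (\<Prod>l\<in>L. wt b (r l) x)) =
    b p * N * expectation (\<lambda>x. (\<Prod>l\<in>L. wt b (r l) x) *
      (\<Sum>l\<in>L. (\<Sum>t\<in>S. wt b t x * u s0 t ^ Suc p) - u s0 (r l) ^ Suc p))"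
proof -
  interpret P: pair_prob_space M M ..
  define X where "X = G p s0"
  define v where "v = N * u s0 s0 ^ Suc p"
  have gX: "centered_gaussian M X v" unfolding X_def v_def by (rule G_gaussian[OF s0])
  have v0: "0 \<le> v" and mX: "X \<in> borel_measurable M" using gX by (auto simp: centered_gaussian_def)
  show ?thesis
  \<comment> \<open>At variance zero there is no regression on X. Then X vanishes almost surely,
    hence so do its covariances, and both sides are 0.\<close>
  proof (cases "v = 0")
    case True
    then have ae: "AE x in M. X x = 0" using gX by (simp add: centered_gaussian_def)
    have "u s0 t ^ Suc p = 0" if "t \<in> S" for t
    proof -
      have "expectation (\<lambda>x. G p s0 x * G p t x) = 0"
        using ae unfolding X_def by (intro integral_eq_zero_AE) auto
      then show ?thesis using cov[OF s0 that, of p] N_pos by simp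
    qed
    then have "expectation (\<lambda>x. (\<Prod>l\<in>L. wt b (r l) x) * (\<Sum>l\<in>L. (\<Sum>t\<in>S. wt b t x * u s0 t ^ Suc p) - u s0 (r l) ^ Suc p)) = 0"
      using L by (simp del: power_Suc)
    moreover have "expectation (\<lambda>x. G p s0 x * (\<Prod>l\<in>L. wt b (r l) x)) = 0"
      using ae unfolding X_def by (intro integral_eq_zero_AE) auto
    ultimately show ?thesis by simp
  next
    case False
    with v0 have vp: "0 < v" by simp
    \<comment> \<open>The regression coefficient: covariance of \<open>T b t\<close> and X divided
      by the variance of X.\<close>
    define k where "k t = b p * N * u s0 t ^ Suc p / v" for t
    have vk: "v * k t = b p * N * u s0 t ^ Suc p" for t using vp by (simp add: k_def)
    define Y where "Y t x = T b t x - k t * X x" for t x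
    have mY: "t \<in> S \<Longrightarrow> Y t \<in> borel_measurable M" for t
      unfolding Y_def[abs_def] using mX by (intro borel_measurable_diff borel_measurable_times T_measurable) auto
    \<comment> \<open>\<open>None\<close> stands for X and \<open>Some t\<close> for the residual at
      t. \<open>V\<close> is the vector on the original space, \<open>W\<close> its counterpart with
      X moved to the independent copy.\<close>
    define I where "I = insert None (Some ` S)"
    have I: "finite I" unfolding I_def using finite_S by simp
    define V where "V i = (case i of None \<Rightarrow> X | Some t \<Rightarrow> Y t)" for i
    define W where "W i = (case i of None \<Rightarrow> (\<lambda>z. X (snd z)) | Some t \<Rightarrow> (\<lambda>z. Y t (fst z)))" for i
    have sI: "(\<Sum>i\<in>I. f i) = f None + (\<Sum>t\<in>S. f (Some t))" for f :: "'s option \<Rightarrow> real"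
      unfolding I_def using finite_S by (subst sum.insert) (auto simp: sum.reindex)
    have mV: "i \<in> I \<Longrightarrow> V i \<in> borel_measurable M" for i using mX mY by (auto simp: I_def V_def)
    have mW: "i \<in> I \<Longrightarrow> W i \<in> borel_measurable (M \<Otimes>\<^sub>M M)" for i
      using mX mY by (auto simp: I_def W_def intro: measurable_compose[OF measurable_fst] measurable_compose[OF measurable_snd])
    \<comment> \<open>The variance of a combination of residuals. In \<open>gV\<close> the variance
      splits without a cross term between residuals and X, which is what matches it with the law of
      \<open>W\<close>.\<close>
    define q where "q a = (\<Sum>s\<in>S. \<Sum>t\<in>S. a (Some s) * a (Some t) * K b s t) - v * (\<Sum>t\<in>S. a (Some t) * k t)\<^sup>2" for a :: "'s option \<Rightarrow> real"
    have gV: "centered_gaussian M (\<lambda>x. \<Sum>i\<in>I. a i * V i x) (q a + v * (a None)\<^sup>2)" for a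
    proof -
      define A where "A = (\<Sum>t\<in>S. a (Some t) * k t)"
      have e1: "(\<Sum>i\<in>I. a i * V i x) = (\<Sum>s\<in>S. a (Some s) * T b s x) + (a None - A) * G p s0 x" for x
        by (simp add: sI V_def Y_def A_def X_def algebra_simps sum.distrib sum_subtractf sum_distrib_left)
      have e2: "b p * N * (\<Sum>s\<in>S. a (Some s) * u s s0 ^ Suc p) = v * A"
      proof -
        have "b p * N * (\<Sum>s\<in>S. a (Some s) * u s s0 ^ Suc p) = (\<Sum>s\<in>S. a (Some s) * (v * k s))"
          unfolding vk sum_distrib_left by (intro sum.cong refl) (simp add: u_commute[OF s0] del: power_Suc)
        then show ?thesis by (simp add: A_def sum_distrib_left mult_ac)
      qed
      have "N * (2 * (a None - A) * b p * (\<Sum>s\<in>S. a (Some s) * u s s0 ^ Suc p) + (a None - A)\<^sup>2 * u s0 s0 ^ Suc p)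
        = 2 * (a None - A) * (b p * N * (\<Sum>s\<in>S. a (Some s) * u s s0 ^ Suc p)) + (a None - A)\<^sup>2 * v"
        by (simp add: v_def algebra_simps del: power_Suc)
      also have "\<dots> = v * (a None)\<^sup>2 - v * A\<^sup>2" unfolding e2 by (simp add: power2_eq_square algebra_simps)
      finally have e3: "N * (2 * (a None - A) * b p * (\<Sum>s\<in>S. a (Some s) * u s s0 ^ Suc p) + (a None - A)\<^sup>2 * u s0 s0 ^ Suc p)
        = v * (a None)\<^sup>2 - v * A\<^sup>2" .
      have "c + (e - f) = c - f + e" for c e f :: real by simp
      then show ?thesis
        using joint_gaussian[OF b s0, of "\<lambda>s. a (Some s)" "a None - A" p] unfolding e1 e3 q_def A_def[symmetric]
        by (simp only:)
    qed
    have gY: "centered_gaussian M (\<lambda>x. \<Sum>t\<in>S. a (Some t) * Y t x) (q a)" for a :: "'s option \<Rightarrow> real"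
      using gV[of "a(None := 0)"] by (simp add: sI V_def q_def)
    have gaX: "centered_gaussian M (\<lambda>x. a * X x) (v * a\<^sup>2)" for a
      using gV[of "\<lambda>i. if i = None then a else 0"] by (simp add: sI V_def q_def)
    have gW: "centered_gaussian (M \<Otimes>\<^sub>M M) (\<lambda>z. \<Sum>i\<in>I. a i * W i z) (q a + v * (a None)\<^sup>2)" for a
      using centered_gaussian_pair[OF gY[of a] gaX[of "a None"]] by (simp add: sI W_def add.commute)
    have law: "distr M (PiM I (\<lambda>_. borel)) (\<lambda>x. \<lambda>i\<in>I. V i x) = distr (M \<Otimes>\<^sub>M M) (PiM I (\<lambda>_. borel)) (\<lambda>z. \<lambda>i\<in>I. W i z)"
      by (rule Cramer_Wold)
        (use prob_space_axioms pair_prob_space I mV mW centered_gaussian_char[OF gV, where t=1] prob_space.centered_gaussian_char[OF pair_prob_space gW, where t=1] in auto)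
    have mVr: "(\<lambda>x. \<lambda>i\<in>I. V i x) \<in> measurable M (PiM I (\<lambda>_. borel))"
      and mWr: "(\<lambda>z. \<lambda>i\<in>I. W i z) \<in> measurable (M \<Otimes>\<^sub>M M) (PiM I (\<lambda>_. borel))"
      by (intro measurable_restrict mV mW; assumption)+
    define w where "w l y x = weight S (\<lambda>t. y t + k t * x) (r l)" for l y x
    define h where "h y x = (\<Prod>l\<in>L. w l y x)" for y x
    define d where "d l y x = (\<Sum>t\<in>S. weight S (\<lambda>t. y t + k t * x) t * k t) - k (r l)" for l y x
    define h' where "h' y x = h y x * (\<Sum>l\<in>L. d l y x)" for y x
    have dw: "((\<lambda>x. weight S (\<lambda>t. y t + k t * x) s) has_real_derivative
        weight S (\<lambda>t. y t + k t * x) s * ((\<Sum>t\<in>S. weight S (\<lambda>t. y t + k t * x) t * k t) - k s)) (at x)" for y s x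
      by (rule weight_line_derivative[OF finite_S S_ne])
    have dh: "(h y has_real_derivative h' y x) (at x)" for y x
      unfolding h_def h'_def by (rule has_real_derivative_prod_log) (unfold w_def d_def, rule dw)
    have cw: "continuous_on UNIV (\<lambda>x. weight S (\<lambda>t. y t + k t * x) s)" for y s
      using dw DERIV_isCont continuous_at_imp_continuous_on by blast
    have ch': "continuous_on UNIV (h' y)" for y
      unfolding h'_def h_def w_def d_def by (intro continuous_intros cw)
    define C where "C = 1 + real (card L) * (2 * (\<Sum>t\<in>S. \<bar>k t\<bar>))"
    have C1: "1 \<le> C" unfolding C_def by (simp add: sum_nonneg)
    have h01: "0 \<le> h y x" "h y x \<le> 1" for y x
      unfolding h_def w_def using L weight_nonneg[OF finite_S S_ne] weight_le_1[OF finite_S S_ne]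
      by (auto intro!: prod_nonneg prod_le_1)
    have hC: "\<bar>h y x\<bar> \<le> C" for y x using h01[of y x] C1 by linarith
    have h'C: "\<bar>h' y x\<bar> \<le> C" for y x
    proof -
      have kb: "\<bar>k t\<bar> \<le> (\<Sum>t\<in>S. \<bar>k t\<bar>)" if "t \<in> S" for t using that finite_S by (intro member_le_sum) auto
      have "\<bar>d l y x\<bar> \<le> 2 * (\<Sum>t\<in>S. \<bar>k t\<bar>)" if "l \<in> L" for l
      proof -
        have "\<bar>\<Sum>t\<in>S. weight S (\<lambda>t. y t + k t * x) t * k t\<bar> \<le> (\<Sum>t\<in>S. \<bar>k t\<bar>)"
          using weight_nonneg[OF finite_S S_ne] weight_le_1[OF finite_S S_ne]
          by (intro order_trans[OF sum_abs sum_mono]) (auto simp: abs_mult mult_left_le_one_le)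
        then show ?thesis using kb[OF L(2)[OF that]] unfolding d_def by linarith
      qed
      then have "\<bar>\<Sum>l\<in>L. d l y x\<bar> \<le> real (card L) * (2 * (\<Sum>t\<in>S. \<bar>k t\<bar>))"
        using order_trans[OF sum_abs sum_bounded_above[of L "\<lambda>l. \<bar>d l y x\<bar>"]] by auto
      moreover have "\<bar>h' y x\<bar> \<le> \<bar>\<Sum>l\<in>L. d l y x\<bar>"
        unfolding h'_def abs_mult using h01[of y x] by (intro mult_left_le_one_le) auto
      ultimately show ?thesis unfolding C_def by linarith
    qed
    have ibp: "expectation (\<lambda>x. X x * h y (X x)) = v * expectation (\<lambda>x. h' y (X x))" for y
      by (rule centered_gaussian_integral_by_parts[OF gX dh ch' hC h'C])
    have c: "(\<lambda>f::'s option \<Rightarrow> real. f i) \<in> borel_measurable (PiM I (\<lambda>_. borel))" if "i \<in> I" for i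
      using measurable_component_singleton[OF that, of "\<lambda>_. borel"] by simp
    have mw: "(\<lambda>f. weight S (\<lambda>t. f (Some t) + k t * f None) s) \<in> borel_measurable (PiM I (\<lambda>_. borel))" if "s \<in> S" for s
      using that by (intro measurable_weight borel_measurable_add borel_measurable_times borel_measurable_const c) (auto simp: I_def)
    define H where "H f = h (\<lambda>t. f (Some t)) (f None)" for f :: "'s option \<Rightarrow> real"
    define H' where "H' f = h' (\<lambda>t. f (Some t)) (f None)" for f :: "'s option \<Rightarrow> real"
    have mH: "H \<in> borel_measurable (PiM I (\<lambda>_. borel))" "H' \<in> borel_measurable (PiM I (\<lambda>_. borel))"
      unfolding H_def[abs_def] H'_def[abs_def] h'_def h_def w_def d_def using L
      by (intro borel_measurable_times borel_measurable_prod borel_measurable_sum borel_measurable_diff borel_measurable_const mw; simp)+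
    have w_cong: "weight S (\<lambda>t. (\<lambda>i\<in>I. z i) (Some t) + k t * (\<lambda>i\<in>I. z i) None) s = weight S (\<lambda>t. z (Some t) + k t * z None) s" if "s \<in> S" for z s
      using that by (intro weight_cong) (auto simp: I_def)
    have H_restrict: "H (\<lambda>i\<in>I. z i) = H z" "H' (\<lambda>i\<in>I. z i) = H' z" for z
      unfolding H_def H'_def h'_def h_def w_def d_def by (simp_all only: w_cong L(2) cong: sum.cong prod.cong)
    have HV: "H (\<lambda>i. V i x) = (\<Prod>l\<in>L. wt b (r l) x)"
      "H' (\<lambda>i. V i x) = (\<Prod>l\<in>L. wt b (r l) x) * (\<Sum>l\<in>L. (\<Sum>t\<in>S. wt b t x * k t) - k (r l))" for x
      unfolding H_def H'_def h'_def h_def w_def d_def V_def Y_def wt_def by simp_all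
    have HW: "H (\<lambda>i. W i z) = h (\<lambda>t. Y t (fst z)) (X (snd z))" "H' (\<lambda>i. W i z) = h' (\<lambda>t. Y t (fst z)) (X (snd z))" for z
      unfolding H_def H'_def W_def by simp_all
    have NI: "None \<in> I" by (simp add: I_def)
    have iX: "integrable M X" using centered_gaussian_moments(1)[OF prob_space_axioms gX] by simp
    have mHW: "(\<lambda>z. h (\<lambda>t. Y t (fst z)) (X (snd z))) \<in> borel_measurable (M \<Otimes>\<^sub>M M)"
      "(\<lambda>z. h' (\<lambda>t. Y t (fst z)) (X (snd z))) \<in> borel_measurable (M \<Otimes>\<^sub>M M)"
      using measurable_compose[OF mWr mH(1)] measurable_compose[OF mWr mH(2)] by (simp_all add: H_restrict HW)
    have "expectation (\<lambda>x. X x * H (\<lambda>i. V i x)) = (\<integral>f. f None * H f \<partial>distr M (PiM I (\<lambda>_. borel)) (\<lambda>x. \<lambda>i\<in>I. V i x))"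
      using NI by (subst integral_distr[OF mVr]) (auto intro!: borel_measurable_times c mH simp: H_restrict, simp add: V_def)
    also have "\<dots> = (\<integral>z. X (snd z) * h (\<lambda>t. Y t (fst z)) (X (snd z)) \<partial>(M \<Otimes>\<^sub>M M))"
      unfolding law using NI by (subst integral_distr[OF mWr]) (auto intro!: borel_measurable_times c mH simp: H_restrict HW, simp add: W_def)
    also have "\<dots> = (\<integral>x. (\<integral>y. X y * h (\<lambda>t. Y t x) (X y) \<partial>M) \<partial>M)"
    proof -
      have "integrable (M \<Otimes>\<^sub>M M) (\<lambda>z. X (snd z) * h (\<lambda>t. Y t (fst z)) (X (snd z)))"
      proof (rule Bochner_Integration.integrable_bound)
        show "integrable (M \<Otimes>\<^sub>M M) (\<lambda>z. X (snd z))" using iX mX by (simp add: integrable_snd_eq)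
        show "(\<lambda>z. X (snd z) * h (\<lambda>t. Y t (fst z)) (X (snd z))) \<in> borel_measurable (M \<Otimes>\<^sub>M M)"
          using mX by (intro borel_measurable_times mHW measurable_compose[OF measurable_snd])
        show "AE z in M \<Otimes>\<^sub>M M. norm (X (snd z) * h (\<lambda>t. Y t (fst z)) (X (snd z))) \<le> norm (X (snd z))"
          using h01 by (auto simp: abs_mult intro!: mult_right_le_one_le)
      qed
      from P.integral_fst'[OF this] show ?thesis by simp
    qed
    also have "\<dots> = v * (\<integral>x. (\<integral>y. h' (\<lambda>t. Y t x) (X y) \<partial>M) \<partial>M)" unfolding ibp by simp
    also have "(\<integral>x. (\<integral>y. h' (\<lambda>t. Y t x) (X y) \<partial>M) \<partial>M) = (\<integral>z. h' (\<lambda>t. Y t (fst z)) (X (snd z)) \<partial>(M \<Otimes>\<^sub>M M))"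
    proof -
      have "integrable (M \<Otimes>\<^sub>M M) (\<lambda>z. h' (\<lambda>t. Y t (fst z)) (X (snd z)))"
        by (rule P.integrable_const_bound[where B=C]) (use h'C mHW in auto)
      from P.integral_fst'[OF this] show ?thesis by simp
    qed
    also have "\<dots> = (\<integral>f. H' f \<partial>distr M (PiM I (\<lambda>_. borel)) (\<lambda>x. \<lambda>i\<in>I. V i x))"
      unfolding law by (subst integral_distr[OF mWr mH(2)]) (simp add: H_restrict HW)
    also have "\<dots> = expectation (\<lambda>x. H' (\<lambda>i. V i x))"
      by (subst integral_distr[OF mVr mH(2)]) (simp add: H_restrict)
    finally have "expectation (\<lambda>x. X x * H (\<lambda>i. V i x)) = expectation (\<lambda>x. v * H' (\<lambda>i. V i x))" by simp
    also have "\<dots> = expectation (\<lambda>x. b p * N * ((\<Prod>l\<in>L. wt b (r l) x) * (\<Sum>l\<in>L. (\<Sum>t\<in>S. wt b t x * u s0 t ^ Suc p) - u s0 (r l) ^ Suc p)))"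
    proof (intro Bochner_Integration.integral_cong refl)
      fix x
      have "v * (\<Sum>l\<in>L. (\<Sum>t\<in>S. wt b t x * k t) - k (r l)) = (\<Sum>l\<in>L. (\<Sum>t\<in>S. wt b t x * (v * k t)) - v * k (r l))"
        by (simp only: sum_distrib_left right_diff_distrib mult_ac)
      also have "\<dots> = b p * N * (\<Sum>l\<in>L. (\<Sum>t\<in>S. wt b t x * u s0 t ^ Suc p) - u s0 (r l) ^ Suc p)"
        unfolding vk by (simp only: sum_distrib_left right_diff_distrib mult_ac)
      finally have e: "v * (\<Sum>l\<in>L. (\<Sum>t\<in>S. wt b t x * k t) - k (r l)) =
        b p * N * (\<Sum>l\<in>L. (\<Sum>t\<in>S. wt b t x * u s0 t ^ Suc p) - u s0 (r l) ^ Suc p)" .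
      have gen: "v * y = c * y' \<Longrightarrow> v * (q * y) = c * (q * y')" for q y c y' :: real
        by (metis mult.left_commute)
      show "v * H' (\<lambda>i. V i x) = b p * N * ((\<Prod>l\<in>L. wt b (r l) x) * (\<Sum>l\<in>L. (\<Sum>t\<in>S. wt b t x * u s0 t ^ Suc p) - u s0 (r l) ^ Suc p))"
        unfolding HV by (rule gen[OF e])
    qed
    finally show ?thesis unfolding HV X_def by simp
  qed
qed

end

subsection \<open>Energy concentration\<close>

context gaussian_levels begin

lemma summable_update:
  assumes b: "summable (\<lambda>p. (b p)\<^sup>2)"
  shows "summable (\<lambda>q. ((b(p := c)) q)\<^sup>2 :: real)"
proof -
  have "eventually (\<lambda>q. ((b(p := c)) q)\<^sup>2 = (b q)\<^sup>2) sequentially"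
    using eventually_gt_at_top[of p] by eventually_elim auto
  from summable_cong[OF this] b show ?thesis by simp
qed

lemma AE_T_update:
  assumes b: "summable (\<lambda>p. (b p)\<^sup>2)"
  shows "AE x in M. \<forall>s\<in>S. T (b(p := b p + d)) s x = T b s x + d * G p s x"
  using AE_summable_T[OF b]
proof eventually_elim
  case (elim x)
  show ?case
  proof
    fix s assume "s \<in> S"
    with elim have "(\<lambda>q. b q * G q s x) sums T b s x" unfolding T_def by (auto intro: summable_sums)
    moreover have "(\<lambda>q. if q = p then d * G q s x else 0) sums (d * G p s x)" by (rule sums_single)
    ultimately have "(\<lambda>q. b q * G q s x + (if q = p then d * G q s x else 0)) sums (T b s x + d * G p s x)" by (rule sums_add)
    also have "(\<lambda>q. b q * G q s x + (if q = p then d * G q s x else 0)) = (\<lambda>q. (b(p := b p + d)) q * G q s x)"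
      by (auto simp: fun_eq_iff distrib_right)
    finally show "T (b(p := b p + d)) s x = T b s x + d * G p s x" unfolding T_def by (rule sums_unique[symmetric])
  qed
qed

lemma Gibbs_tilt:
  assumes b: "summable (\<lambda>p. (b p)\<^sup>2)"
  shows "AE x in M. (\<Sum>s\<in>S. wt b s x * exp (- d * G p s x)) = exp (F (b(p := b p + d)) x - F b x)"
  using AE_T_update[OF b, of p d]
proof eventually_elim
  case (elim x)
  have "sum_exp S (\<lambda>s. T (b(p := b p + d)) s x) = sum_exp S (\<lambda>s. T b s x + d * G p s x)"
    by (rule sum_exp_cong) (use elim in auto)
  then have "exp (F (b(p := b p + d)) x - F b x) = sum_exp S (\<lambda>s. T b s x + d * G p s x) / sum_exp S (\<lambda>s. T b s x)"
    unfolding F_def using sum_exp_pos[OF finite_S S_ne] by (simp add: exp_diff)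
  also have "\<dots> = (\<Sum>s\<in>S. wt b s x * exp (- d * G p s x))"
    unfolding sum_exp_ratio[OF finite_S S_ne] wt_def by simp
  finally show ?case ..
qed

lemma Chebyshev_F:
  assumes b: "summable (\<lambda>p. (b p)\<^sup>2)" and B: "(\<Sum>p. (b p)\<^sup>2) \<le> B" "0 < B" and h: "0 < h"
  shows "prob {x\<in>space M. h * N \<le> \<bar>F b x - expectation (F b)\<bar>} \<le> 72 * B / (h\<^sup>2 * N)"
proof -
  have "prob {x\<in>space M. h * N \<le> \<bar>F b x - expectation (F b)\<bar>} \<le> variance (F b) / (h * N)\<^sup>2"
    using h N_pos F_square_integrable[OF b] by (intro Chebyshev_inequality) auto
  also have "\<dots> \<le> 72 * N * B / (h * N)\<^sup>2" by (intro divide_right_mono variance_F[OF b B]) simp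
  also have "\<dots> = 72 * B / (h\<^sup>2 * N)" using N_pos by (simp add: power2_eq_square)
  finally show ?thesis .
qed

text \<open>An a priori second moment. It turns the small probability of a deviation in
  \<open>energy_deviation_bound\<close> into a small mean deviation.\<close>

lemma energy_square_bound:
  "integrable M (\<lambda>x. \<Sum>s\<in>S. wt b s x * (G p s x)\<^sup>2)"
  "expectation (\<lambda>x. \<Sum>s\<in>S. wt b s x * (G p s x)\<^sup>2) \<le> 8 * N\<^sup>2"
proof -
  have le: "N * u s s ^ Suc p \<le> N" if "s \<in> S" for s
  proof -
    have "\<bar>u s s\<bar> ^ Suc p \<le> 1" using u_le[OF that that] by (intro power_le_one) auto
    then have "u s s ^ Suc p \<le> 1" by (metis abs_le_D1 power_abs)
    then show ?thesis using N_pos by (intro mult_left_le) auto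
  qed
  show "integrable M (\<lambda>x. \<Sum>s\<in>S. wt b s x * (G p s x)\<^sup>2)"
    by (rule weighted_square_bound(1)[OF G_gaussian le N_pos]; simp add: wt_measurable wt_nonneg sum_wt)
  have "expectation (\<lambda>x. \<Sum>s\<in>S. wt b s x * (G p s x)\<^sup>2) \<le> 8 * N * N"
    by (rule weighted_square_bound(2)[OF G_gaussian le N_pos]; simp add: wt_measurable wt_nonneg sum_wt)
  then show "expectation (\<lambda>x. \<Sum>s\<in>S. wt b s x * (G p s x)\<^sup>2) \<le> 8 * N\<^sup>2" by (simp add: power2_eq_square)
qed

text \<open>Chernoff's bound: the exponential moments of the energy per site under the Gibbs
  measure are ratios of partition functions, so they are controlled by free energy
  differences, which are close to their expectations.\<close>

lemma energy_deviation_bound: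
  assumes b: "summable (\<lambda>p. (b p)\<^sup>2)" and pos: "0 < d" "0 < e"
    and B: "0 < B" "(\<Sum>q. (b q)\<^sup>2) \<le> B" "(\<Sum>q. ((b(p := b p + d)) q)\<^sup>2) \<le> B" "(\<Sum>q. ((b(p := b p + - d)) q)\<^sup>2) \<le> B"
    and up: "expectation (F (b(p := b p + d))) / N - expectation (F b) / N \<le> d * m + d * e / 2"
    and dn: "expectation (F (b(p := b p + - d))) / N - expectation (F b) / N \<le> - d * m + d * e / 2"
  shows "expectation (\<lambda>x. \<Sum>s\<in>S. wt b s x * indicator {x. e < \<bar>- G p s x / N - m\<bar>} x)
    \<le> (8 / (d * e) + 13824 * B / (d * e)\<^sup>2) / N"
proof -
  \<comment> \<open>In units of d e N: the two free energies may fluctuate by 1/8 each, their means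
    contribute 1/2, and Chernoff's exponent contributes -1, which leaves -1/4.\<close>
  define h where "h = d * e / 8"
  have h: "0 < h" using pos by (simp add: h_def)
  define bad where "bad b = {x\<in>space M. h * N \<le> \<bar>F b x - expectation (F b)\<bar>}" for b
  have mb[measurable]: "bad b \<in> sets M" for b unfolding bad_def by measurable
  define b1 where "b1 = b(p := b p + d)"
  define b2 where "b2 = b(p := b p + - d)"
  define q where "q x = (\<Sum>s\<in>S. wt b s x * indicator {x. e < \<bar>- G p s x / N - m\<bar>} x)" for x
  define E where "E = bad b \<union> bad b1 \<union> bad b2"
  have mE[measurable]: "E \<in> sets M" unfolding E_def by auto
  have q1: "q x \<le> 1" for x
  proof -
    have "q x \<le> (\<Sum>s\<in>S. wt b s x)" unfolding q_def
      by (intro sum_mono) (auto simp: indicator_def wt_nonneg)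
    then show ?thesis by (simp add: sum_wt)
  qed
  have q0: "0 \<le> q x" for x unfolding q_def by (intro sum_nonneg) (auto simp: wt_nonneg)
  have mq: "q \<in> borel_measurable M" unfolding q_def[abs_def]
  proof (intro borel_measurable_sum borel_measurable_times wt_measurable)
    fix s assume s: "s \<in> S"
    have "(\<lambda>x. indicator {e<..} \<bar>- G p s x / N - m\<bar> :: real) \<in> borel_measurable M"
      using G_measurable[OF s] by measurable
    then show "(\<lambda>x. indicator {x. e < \<bar>- G p s x / N - m\<bar>} x :: real) \<in> borel_measurable M"
      by (simp add: indicator_def)
  qed
  \<comment> \<open>The signs \<sigma> = 1 and \<sigma> = -1 give the upper tail with
    \<open>b1\<close> and the lower tail with \<open>b2\<close>.\<close>
  have tail: "(\<Sum>s\<in>S. wt b s x * indicator {x. \<sigma> * m + e < - \<sigma> * G p s x / N} x) \<le> exp (- N * d * e / 4)"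
    if tilt: "(\<Sum>s\<in>S. wt b s x * exp (- (\<sigma> * d) * G p s x)) = exp (F c x - F b x)"
      and x: "x \<in> space M" "x \<notin> bad b" "x \<notin> bad c"
      and c: "expectation (F c) / N - expectation (F b) / N \<le> \<sigma> * d * m + d * e / 2" for \<sigma> c x
  proof -
    have "(\<Sum>s\<in>S. wt b s x * indicator {x. \<sigma> * m + e < - \<sigma> * G p s x / N} x)
      \<le> (\<Sum>s\<in>S. wt b s x * (exp (- (\<sigma> * d) * G p s x) * exp (- d * N * (\<sigma> * m + e))))"
    proof (intro sum_mono mult_left_mono wt_nonneg)
      fix s
      show "indicator {x. \<sigma> * m + e < - \<sigma> * G p s x / N} x \<le> exp (- (\<sigma> * d) * G p s x) * exp (- d * N * (\<sigma> * m + e))"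
      proof (cases "\<sigma> * m + e < - \<sigma> * G p s x / N")
        case True
        then have "(\<sigma> * m + e) * N < - \<sigma> * G p s x / N * N" by (rule mult_strict_right_mono[OF _ N_pos])
        then have "(\<sigma> * m + e) * N < - \<sigma> * G p s x" using N_pos by simp
        then have "d * ((\<sigma> * m + e) * N) < d * (- \<sigma> * G p s x)" by (rule mult_strict_left_mono[OF _ pos(1)])
        then have "0 \<le> - (\<sigma> * d) * G p s x + - d * N * (\<sigma> * m + e)" by (simp add: algebra_simps)
        then have "1 \<le> exp (- (\<sigma> * d) * G p s x + - d * N * (\<sigma> * m + e))" by simp
        then show ?thesis using True by (simp only: exp_add) simp
      qed simp
    qed
    also have "\<dots> = exp (F c x - F b x) * exp (- d * N * (\<sigma> * m + e))"
      unfolding tilt[symmetric] by (simp add: sum_distrib_right mult.assoc)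
    also have "\<dots> = exp (F c x - F b x + - d * N * (\<sigma> * m + e))" by (rule exp_add[symmetric])
    also have "\<dots> \<le> exp (- N * d * e / 4)"
    proof -
      have "F c x - expectation (F c) \<le> h * N" "expectation (F b) - F b x \<le> h * N"
        using x by (auto simp: bad_def)
      moreover have "expectation (F c) - expectation (F b) \<le> (\<sigma> * d * m + d * e / 2) * N"
        using c N_pos by (simp add: pos_divide_le_eq diff_divide_distrib[symmetric])
      ultimately have "F c x - F b x \<le> 2 * (h * N) + (\<sigma> * d * m + d * e / 2) * N" by linarith
      then show ?thesis by (simp add: h_def algebra_simps)
    qed
    finally show ?thesis .
  qed
  have "AE x in M. q x \<le> 2 * exp (- N * d * e / 4) + indicator E x"
    using Gibbs_tilt[OF b, of d p] Gibbs_tilt[OF b, of "-d" p] AE_space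
  proof eventually_elim
    case (elim x)
    show ?case
    proof (cases "x \<in> E")
      case True
      then show ?thesis using q1[of x] by (simp add: add_increasing)
    next
      case False
      have "(\<Sum>s\<in>S. wt b s x * indicator {x. 1 * m + e < - 1 * G p s x / N} x) \<le> exp (- N * d * e / 4)"
        by (rule tail[of x 1 b1]) (use elim False up in \<open>auto simp: E_def b1_def\<close>)
      moreover have "(\<Sum>s\<in>S. wt b s x * indicator {x. (-1) * m + e < - (-1) * G p s x / N} x) \<le> exp (- N * d * e / 4)"
        by (rule tail[of x "-1" b2]) (use elim False dn in \<open>auto simp: E_def b2_def\<close>)
      moreover have "q x \<le> (\<Sum>s\<in>S. wt b s x * indicator {x. 1 * m + e < - 1 * G p s x / N} x) + (\<Sum>s\<in>S. wt b s x * indicator {x. (-1) * m + e < - (-1) * G p s x / N} x)"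
        unfolding q_def sum.distrib[symmetric] distrib_left[symmetric]
        by (intro sum_mono mult_left_mono wt_nonneg) (auto simp: indicator_def abs_if split: if_splits)
      ultimately show ?thesis using False by simp
    qed
  qed
  then have "expectation q \<le> expectation (\<lambda>x. 2 * exp (- N * d * e / 4) + indicator E x)"
  proof (intro integral_mono_AE)
    show "integrable M q" by (rule integrable_const_bound[where B=1]) (use q0 q1 mq in auto)
    show "integrable M (\<lambda>x. 2 * exp (- N * d * e / 4) + indicator E x)" by (simp add: emeasure_eq_measure)
  qed
  also have "\<dots> = 2 * exp (- N * d * e / 4) + prob E"
    by (subst Bochner_Integration.integral_add) (auto simp: prob_space emeasure_eq_measure)
  \<comment> \<open>The exponential is bounded through exp (- z) \<le> 1 / z with z = N d e / 4.
    Below, 13824 = 3 * 72 * 64 collects three Chebyshev bounds with 1 / h^2 = 64 / (d e)^2.\<close>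
  also have "\<dots> \<le> 8 / (d * e) / N + 3 * (72 * B / (h\<^sup>2 * N))"
  proof (rule add_mono)
    have z: "0 < N * d * e / 4" using N_pos pos by simp
    have "exp (- (N * d * e / 4)) = inverse (exp (N * d * e / 4))" by (rule exp_minus)
    also have "\<dots> \<le> inverse (N * d * e / 4)"
    proof (rule le_imp_inverse_le[OF _ z])
      show "N * d * e / 4 \<le> exp (N * d * e / 4)" using exp_ge_add_one_self[of "N * d * e / 4"] by linarith
    qed
    finally show "2 * exp (- N * d * e / 4) \<le> 8 / (d * e) / N" by (simp add: field_simps)
    have "prob E \<le> prob (bad b) + prob (bad b1) + prob (bad b2)"
      unfolding E_def by (rule order_trans[OF measure_Un_le add_right_mono[OF measure_Un_le]]) auto
    also have "\<dots> \<le> 72 * B / (h\<^sup>2 * N) + 72 * B / (h\<^sup>2 * N) + 72 * B / (h\<^sup>2 * N)"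
      unfolding bad_def using B summable_update[OF b, of p] b
      by (intro add_mono Chebyshev_F h) (auto simp: b1_def b2_def)
    also have "\<dots> = 3 * (72 * B / (h\<^sup>2 * N))" by simp
    finally show "prob E \<le> 3 * (72 * B / (h\<^sup>2 * N))" .
  qed
  also have "\<dots> = (8 / (d * e) + 13824 * B / (d * e)\<^sup>2) / N"
    using pos N_pos by (simp add: h_def power_divide add_divide_distrib)
  finally show ?thesis unfolding q_def .
qed

text \<open>Deviations up to e are kept. A larger deviation y satisfies |y| \<le> c y^2 / 2 + 1 / (2
  c); the square has a bounded mean by \<open>energy_square_bound\<close>, and the second term
  carries the indicator of a deviation beyond e. The free parameter c is made small before N tends
  to infinity.\<close>

lemma energy_concentration_bound:
  assumes b: "summable (\<lambda>p. (b p)\<^sup>2)" and pos: "0 < d" "0 < e" "0 < c"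
    and B: "0 < B" "(\<Sum>q. (b q)\<^sup>2) \<le> B" "(\<Sum>q. ((b(p := b p + d)) q)\<^sup>2) \<le> B" "(\<Sum>q. ((b(p := b p + - d)) q)\<^sup>2) \<le> B"
    and up: "expectation (F (b(p := b p + d))) / N - expectation (F b) / N \<le> d * m + d * e / 2"
    and dn: "expectation (F (b(p := b p + - d))) / N - expectation (F b) / N \<le> - d * m + d * e / 2"
  shows "expectation (\<lambda>x. \<Sum>s\<in>S. wt b s x * \<bar>- G p s x / N - m\<bar>)
    \<le> e + c * (m\<^sup>2 + 8) + (8 / (d * e) + 13824 * B / (d * e)\<^sup>2) / N / (2 * c)"
proof -
  define q where "q x = (\<Sum>s\<in>S. wt b s x * indicator {x. e < \<bar>- G p s x / N - m\<bar>} x)" for x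
  define f where "f x = (\<Sum>s\<in>S. wt b s x * (G p s x)\<^sup>2)" for x
  have q1: "q x \<le> 1" for x
  proof -
    have "q x \<le> (\<Sum>s\<in>S. wt b s x)" unfolding q_def
      by (intro sum_mono) (auto simp: indicator_def wt_nonneg)
    then show ?thesis by (simp add: sum_wt)
  qed
  have q0: "0 \<le> q x" for x unfolding q_def by (intro sum_nonneg) (auto simp: wt_nonneg)
  have mq: "q \<in> borel_measurable M" unfolding q_def[abs_def]
  proof (intro borel_measurable_sum borel_measurable_times wt_measurable)
    fix s assume s: "s \<in> S"
    have "(\<lambda>x. indicator {e<..} \<bar>- G p s x / N - m\<bar> :: real) \<in> borel_measurable M"
      using G_measurable[OF s] by measurable
    then show "(\<lambda>x. indicator {x. e < \<bar>- G p s x / N - m\<bar>} x :: real) \<in> borel_measurable M"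
      by (simp add: indicator_def)
  qed
  have iq: "integrable M q" by (rule integrable_const_bound[where B=1]) (use q0 q1 mq in auto)
  have f: "integrable M f" "expectation f \<le> 8 * N\<^sup>2" unfolding f_def using energy_square_bound by auto
  have le: "(\<Sum>s\<in>S. wt b s x * \<bar>- G p s x / N - m\<bar>) \<le> e + c * (m\<^sup>2 + f x / N\<^sup>2) + q x / (2 * c)" for x
  proof -
    have "(\<Sum>s\<in>S. wt b s x * \<bar>- G p s x / N - m\<bar>) \<le> (\<Sum>s\<in>S. wt b s x * (e + c * (m\<^sup>2 + (G p s x)\<^sup>2 / N\<^sup>2) + indicator {x. e < \<bar>- G p s x / N - m\<bar>} x / (2 * c)))"
    proof (intro sum_mono mult_left_mono wt_nonneg)
      fix s
      define y where "y = - G p s x / N - m"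
      have y2: "y\<^sup>2 \<le> 2 * (m\<^sup>2 + (G p s x)\<^sup>2 / N\<^sup>2)"
      proof -
        have "0 \<le> (- G p s x / N + m)\<^sup>2" by simp
        then have "y\<^sup>2 \<le> 2 * (- G p s x / N)\<^sup>2 + 2 * m\<^sup>2" unfolding y_def power2_diff power2_sum by linarith
        then show ?thesis by (simp add: power_divide)
      qed
      have "\<bar>y\<bar> \<le> e + c * (m\<^sup>2 + (G p s x)\<^sup>2 / N\<^sup>2) + (if e < \<bar>y\<bar> then 1 else 0) / (2 * c)"
      proof (cases "e < \<bar>y\<bar>")
        case True
        have "0 \<le> (c * \<bar>y\<bar> - 1)\<^sup>2" by simp
        then have "2 * (c * \<bar>y\<bar>) \<le> c\<^sup>2 * y\<^sup>2 + 1" by (simp add: power2_diff power_mult_distrib)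
        then have "(2 * (c * \<bar>y\<bar>)) / (2 * c) \<le> (c\<^sup>2 * y\<^sup>2 + 1) / (2 * c)" using pos by (intro divide_right_mono) auto
        then have y1: "\<bar>y\<bar> \<le> c * y\<^sup>2 / 2 + 1 / (2 * c)" using pos by (simp add: field_simps power2_eq_square)
        have "c * y\<^sup>2 \<le> c * (2 * (m\<^sup>2 + (G p s x)\<^sup>2 / N\<^sup>2))" using y2 pos by (intro mult_left_mono) auto
        then have "c * y\<^sup>2 \<le> 2 * (c * (m\<^sup>2 + (G p s x)\<^sup>2 / N\<^sup>2))" by (simp only: mult.left_commute)
        then have "c * y\<^sup>2 / 2 \<le> c * (m\<^sup>2 + (G p s x)\<^sup>2 / N\<^sup>2)" by (simp only: pos_divide_le_eq zero_less_numeral mult.commute[of _ 2])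
        with y1 show ?thesis using True pos(2) by (simp only: if_True)
      next
        case False
        have "0 \<le> c * (m\<^sup>2 + (G p s x)\<^sup>2 / N\<^sup>2)" using pos by simp
        then show ?thesis using False by simp
      qed
      then show "\<bar>- G p s x / N - m\<bar> \<le> e + c * (m\<^sup>2 + (G p s x)\<^sup>2 / N\<^sup>2) + indicator {x. e < \<bar>- G p s x / N - m\<bar>} x / (2 * c)"
        unfolding y_def indicator_def of_bool_def mem_Collect_eq .
    qed
    also have "\<dots> = (e + c * m\<^sup>2) * (\<Sum>s\<in>S. wt b s x) + c * (f x / N\<^sup>2) + q x / (2 * c)"
      unfolding f_def q_def by (simp add: distrib_left sum.distrib sum_distrib_left sum_distrib_right sum_divide_distrib mult_ac)
    finally show ?thesis by (simp add: sum_wt distrib_left)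
  qed
  have nn: "0 \<le> (\<Sum>s\<in>S. wt b s x * \<bar>- G p s x / N - m\<bar>)" for x by (intro sum_nonneg mult_nonneg_nonneg wt_nonneg) auto
  have ib: "integrable M (\<lambda>x. e + c * (m\<^sup>2 + f x / N\<^sup>2) + q x / (2 * c))" using f iq by simp
  have "expectation (\<lambda>x. \<Sum>s\<in>S. wt b s x * \<bar>- G p s x / N - m\<bar>) \<le> expectation (\<lambda>x. e + c * (m\<^sup>2 + f x / N\<^sup>2) + q x / (2 * c))"
    by (rule integral_mono'[OF ib le order_trans[OF nn le]])
  also have "\<dots> = e + c * (m\<^sup>2 + expectation f / N\<^sup>2) + expectation q / (2 * c)"
    using f iq by (simp add: prob_space)
  also have "\<dots> \<le> e + c * (m\<^sup>2 + 8) + (8 / (d * e) + 13824 * B / (d * e)\<^sup>2) / N / (2 * c)"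
  proof (intro add_mono mult_left_mono divide_right_mono order_refl)
    show "expectation f / N\<^sup>2 \<le> 8" using f(2) N_pos by (simp add: pos_divide_le_eq)
    show "expectation q \<le> (8 / (d * e) + 13824 * B / (d * e)\<^sup>2) / N"
      unfolding q_def by (rule energy_deviation_bound[OF b pos(1,2) B up dn])
  qed (use pos in auto)
  finally show ?thesis .
qed

end

subsection \<open>Approximate Ghirlanda-Guerra identities in finite volume\<close>

definition replicas :: "'s set \<Rightarrow> nat \<Rightarrow> (nat \<Rightarrow> 's) set" where
  "replicas S n = ({1..n} \<rightarrow>\<^sub>E S)"

context gaussian_levels begin

definition replica_avg :: "(nat \<Rightarrow> real) \<Rightarrow> nat \<Rightarrow> ((nat \<Rightarrow> 's) \<Rightarrow> real) \<Rightarrow> 'w \<Rightarrow> real" where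
  "replica_avg b n f x = (\<Sum>s\<in>replicas S n. f s * (\<Prod>l\<in>{1..n}. wt b (s l) x))"

lemma replicas_mem: "s \<in> replicas S n \<Longrightarrow> l \<in> {1..n} \<Longrightarrow> s l \<in> S"
  unfolding replicas_def by (auto simp: PiE_iff)

lemma replica_avg_Suc:
  "replica_avg b (Suc n) g x =
    (\<Sum>s\<in>replicas S n. (\<Sum>t\<in>S. wt b t x * g (s(Suc n := t))) * (\<Prod>l\<in>{1..n}. wt b (s l) x))"
proof -
  have eq: "{1..Suc n} = insert (Suc n) {1..n}" by auto
  have R: "replicas S (Suc n) = (\<lambda>(t, s). s(Suc n := t)) ` (S \<times> replicas S n)"
    unfolding replicas_def eq by (simp add: PiE_insert_eq)
  have inj: "inj_on (\<lambda>(t, s). s(Suc n := t)) (S \<times> replicas S n)"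
    unfolding replicas_def by (rule inj_combinator) auto
  have "replica_avg b (Suc n) g x = (\<Sum>(t, s)\<in>S \<times> replicas S n. g (s(Suc n := t)) * (\<Prod>l\<in>{1..Suc n}. wt b ((s(Suc n := t)) l) x))"
    unfolding replica_avg_def R by (subst sum.reindex[OF inj]) (simp add: case_prod_beta')
  also have "\<dots> = (\<Sum>(t, s)\<in>S \<times> replicas S n. g (s(Suc n := t)) * (wt b t x * (\<Prod>l\<in>{1..n}. wt b (s l) x)))"
  proof (intro sum.cong refl, clarify)
    fix t s
    have "(\<Prod>l\<in>{1..n}. wt b ((s(Suc n := t)) l) x) = (\<Prod>l\<in>{1..n}. wt b (s l) x)" by (intro prod.cong) auto
    then show "g (s(Suc n := t)) * (\<Prod>l\<in>{1..Suc n}. wt b ((s(Suc n := t)) l) x) = g (s(Suc n := t)) * (wt b t x * (\<Prod>l\<in>{1..n}. wt b (s l) x))"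
      unfolding eq by (subst prod.insert) auto
  qed
  also have "\<dots> = (\<Sum>s\<in>replicas S n. \<Sum>t\<in>S. g (s(Suc n := t)) * (wt b t x * (\<Prod>l\<in>{1..n}. wt b (s l) x)))"
    unfolding sum.cartesian_product[symmetric] by (rule sum.swap)
  finally show ?thesis unfolding sum_distrib_right by (simp only: mult_ac)
qed

lemma replica_avg_Suc_const:
  assumes "\<And>s t. g (s(Suc n := t)) = g s"
  shows "replica_avg b (Suc n) g x = replica_avg b n g x"
proof -
  have "(\<Sum>t\<in>S. wt b t x * g (s(Suc n := t))) = g s" for s
    unfolding assms by (simp add: sum_wt flip: sum_distrib_right)
  then show ?thesis unfolding replica_avg_Suc by (simp add: replica_avg_def)
qed

lemma replica_avg_0: "replica_avg b 0 g x = g (\<lambda>_. undefined)"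
  unfolding replica_avg_def replicas_def by simp

lemma replica_avg_const: "replica_avg b n (\<lambda>_. c) x = c"
  by (induction n) (simp_all add: replica_avg_0 replica_avg_Suc_const)

lemma replica_avg_first:
  assumes "1 \<le> n"
  shows "replica_avg b n (\<lambda>s. f (s 1)) x = (\<Sum>t\<in>S. wt b t x * f t)"
  using assms
proof (induction n rule: dec_induct)
  case base
  show ?case using replica_avg_Suc[of b 0 "\<lambda>s. f (s 1)" x] by (simp add: replicas_def)
next
  case (step n)
  then show ?case by (subst replica_avg_Suc_const) auto
qed

lemma replica_avg_mono:
  assumes "\<And>s. s \<in> replicas S n \<Longrightarrow> f s \<le> g s"
  shows "replica_avg b n f x \<le> replica_avg b n g x"
  unfolding replica_avg_def by (intro sum_mono mult_right_mono assms prod_nonneg) (auto simp: wt_nonneg)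

lemma replica_avg_abs_le:
  assumes "\<And>s. s \<in> replicas S n \<Longrightarrow> \<bar>f s\<bar> \<le> g s"
  shows "\<bar>replica_avg b n f x\<bar> \<le> replica_avg b n g x"
proof -
  have "replica_avg b n f x \<le> replica_avg b n g x" by (rule replica_avg_mono) (use assms in fastforce)
  moreover have "replica_avg b n (\<lambda>s. - f s) x \<le> replica_avg b n g x" by (rule replica_avg_mono) (use assms in fastforce)
  ultimately show ?thesis unfolding replica_avg_def by (simp add: sum_negf abs_le_iff)
qed

lemma replica_weight_measurable:
  "s \<in> replicas S n \<Longrightarrow> (\<lambda>x. \<Prod>l\<in>{1..n}. wt b (s l) x) \<in> borel_measurable M"
  by (intro borel_measurable_prod wt_measurable) (auto intro: replicas_mem)

lemma replica_weight_integrable: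
  assumes s: "s \<in> replicas S n" shows "integrable M (\<lambda>x. \<Prod>l\<in>{1..n}. wt b (s l) x)"
proof (rule integrable_const_bound[where B=1])
  show "AE x in M. norm (\<Prod>l\<in>{1..n}. wt b (s l) x) \<le> 1"
    using s by (intro AE_I2) (auto simp: abs_prod wt_nonneg wt_le_1 replicas_mem intro!: prod_le_1)
qed (rule replica_weight_measurable[OF s])

lemma replica_avg_integrable: "integrable M (replica_avg b n f)"
  unfolding replica_avg_def[abs_def]
  by (intro Bochner_Integration.integrable_sum integrable_mult_right replica_weight_integrable)

definition quenched :: "(nat \<Rightarrow> real) \<Rightarrow> nat \<Rightarrow> ((nat \<Rightarrow> 's) \<Rightarrow> real) \<Rightarrow> real" where
  "quenched b n f = expectation (replica_avg b n f)"

lemma replica_energy_integrable: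
  assumes "t \<in> S" "s \<in> replicas S n"
  shows "integrable M (\<lambda>x. G p t x * (\<Prod>l\<in>{1..n}. wt b (s l) x))"
proof (rule Bochner_Integration.integrable_bound)
  show "integrable M (G p t)" using centered_gaussian_moments(1)[OF prob_space_axioms G_gaussian[OF assms(1)]] by simp
  show "(\<lambda>x. G p t x * (\<Prod>l\<in>{1..n}. wt b (s l) x)) \<in> borel_measurable M"
    using assms by (intro borel_measurable_times G_measurable replica_weight_measurable)
  have "\<bar>\<Prod>l\<in>{1..n}. wt b (s l) x\<bar> \<le> 1" for x
    using assms by (auto simp: abs_prod wt_nonneg wt_le_1 replicas_mem intro!: prod_le_1)
  then show "AE x in M. norm (G p t x * (\<Prod>l\<in>{1..n}. wt b (s l) x)) \<le> norm (G p t x)"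
    by (intro AE_I2) (simp add: abs_mult mult_right_le_one_le)
qed

text \<open>Each of the n weights contributes to the derivative its own overlap with replica 1 and a
  Gibbs average over t. That average is a fresh replica n + 1, and it occurs n times with the
  opposite sign.\<close>

lemma replica_energy_identity:
  assumes b: "summable (\<lambda>p. (b p)\<^sup>2)" and n: "1 \<le> n" and f: "\<And>s t. f (s(Suc n := t)) = f s"
  shows "expectation (\<lambda>x. replica_avg b n (\<lambda>s. f s * (- G p (s 1) x / N)) x) =
    b p * ((\<Sum>l\<in>{1..n}. quenched b n (\<lambda>s. f s * u (s 1) (s l) ^ Suc p))
      - real n * quenched b (Suc n) (\<lambda>s. f s * u (s 1) (s (Suc n)) ^ Suc p))"
proof -
  define P where "P s x = (\<Prod>l\<in>{1..n}. wt b (s l) x)" for s x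
  have s1: "s 1 \<in> S" if "s \<in> replicas S n" for s using that n by (auto intro: replicas_mem)
  have iP: "integrable M (P s)" if "s \<in> replicas S n" for s
    unfolding P_def using replica_weight_integrable[OF that] .
  have iw: "integrable M (\<lambda>x. P s x * (\<Sum>l\<in>{1..n}. (\<Sum>t\<in>S. wt b t x * c t) - d l))" if s: "s \<in> replicas S n" for s c d
  proof -
    have "integrable M (\<lambda>x. wt b t x * P s x)" if "t \<in> S" for t
    proof (rule integrable_const_bound[where B=1])
      have "\<bar>P s x\<bar> \<le> 1" for x unfolding P_def
        using s by (auto simp: abs_prod wt_nonneg wt_le_1 replicas_mem intro!: prod_le_1)
      then show "AE x in M. norm (wt b t x * P s x) \<le> 1"
        using that by (intro AE_I2) (simp add: abs_mult wt_nonneg wt_le_1 mult_le_one)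
      show "(\<lambda>x. wt b t x * P s x) \<in> borel_measurable M"
        unfolding P_def by (intro borel_measurable_times wt_measurable that replica_weight_measurable s)
    qed
    then have "integrable M (\<lambda>x. \<Sum>l\<in>{1..n}. (\<Sum>t\<in>S. c t * (wt b t x * P s x)) - d l * P s x)"
      using iP[OF s] by (intro Bochner_Integration.integrable_sum Bochner_Integration.integrable_diff integrable_mult_right) auto
    then show ?thesis by (simp add: sum_distrib_left sum_distrib_right right_diff_distrib mult_ac)
  qed
  have "expectation (\<lambda>x. replica_avg b n (\<lambda>s. f s * (- G p (s 1) x / N)) x)
    = expectation (\<lambda>x. \<Sum>s\<in>replicas S n. (- f s / N) * (G p (s 1) x * P s x))"
    unfolding replica_avg_def P_def by (simp add: mult_ac)
  also have "\<dots> = (\<Sum>s\<in>replicas S n. (- f s / N) * expectation (\<lambda>x. G p (s 1) x * P s x))"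
    using replica_energy_integrable[OF s1] unfolding P_def by (subst Bochner_Integration.integral_sum) auto
  also have "\<dots> = (\<Sum>s\<in>replicas S n. (- f s / N) * (b p * N * expectation (\<lambda>x. P s x * (\<Sum>l\<in>{1..n}. (\<Sum>t\<in>S. wt b t x * u (s 1) t ^ Suc p) - u (s 1) (s l) ^ Suc p))))"
  proof (intro sum.cong refl arg_cong2[where f=times])
    fix s assume s: "s \<in> replicas S n"
    show "expectation (\<lambda>x. G p (s 1) x * P s x) = b p * N * expectation (\<lambda>x. P s x * (\<Sum>l\<in>{1..n}. (\<Sum>t\<in>S. wt b t x * u (s 1) t ^ Suc p) - u (s 1) (s l) ^ Suc p))"
      unfolding P_def by (rule Gibbs_integration_by_parts[OF b]) (use s s1 in \<open>auto intro: replicas_mem\<close>)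
  qed
  also have "\<dots> = (\<Sum>s\<in>replicas S n. expectation (\<lambda>x. - f s * b p * (P s x * (\<Sum>l\<in>{1..n}. (\<Sum>t\<in>S. wt b t x * u (s 1) t ^ Suc p) - u (s 1) (s l) ^ Suc p))))"
    using N_pos by (simp add: mult.assoc del: power_Suc)
  also have "\<dots> = expectation (\<lambda>x. \<Sum>s\<in>replicas S n. - f s * b p * (P s x * (\<Sum>l\<in>{1..n}. (\<Sum>t\<in>S. wt b t x * u (s 1) t ^ Suc p) - u (s 1) (s l) ^ Suc p)))"
    by (rule Bochner_Integration.integral_sum[symmetric]) (intro integrable_mult_right iw)
  also have "\<dots> = expectation (\<lambda>x. b p * ((\<Sum>l\<in>{1..n}. replica_avg b n (\<lambda>s. f s * u (s 1) (s l) ^ Suc p) x)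
      - real n * replica_avg b (Suc n) (\<lambda>s. f s * u (s 1) (s (Suc n)) ^ Suc p) x))"
  proof (intro Bochner_Integration.integral_cong refl)
    fix x
    have n1: "Suc n \<noteq> 1" using n by simp
    have e1: "replica_avg b (Suc n) (\<lambda>s. f s * u (s 1) (s (Suc n)) ^ Suc p) x =
      (\<Sum>s\<in>replicas S n. f s * (\<Sum>t\<in>S. wt b t x * u (s 1) t ^ Suc p) * P s x)"
      unfolding replica_avg_Suc P_def f using n1 by (simp add: sum_distrib_left mult_ac)
    have e2: "(\<Sum>l\<in>{1..n}. replica_avg b n (\<lambda>s. f s * u (s 1) (s l) ^ Suc p) x) =
      (\<Sum>s\<in>replicas S n. f s * (\<Sum>l\<in>{1..n}. u (s 1) (s l) ^ Suc p) * P s x)"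
      unfolding replica_avg_def P_def[symmetric] by (subst sum.swap) (simp add: sum_distrib_left sum_distrib_right mult_ac)
    have "(\<Sum>s\<in>replicas S n. - f s * b p * (P s x * (\<Sum>l\<in>{1..n}. (\<Sum>t\<in>S. wt b t x * u (s 1) t ^ Suc p) - u (s 1) (s l) ^ Suc p)))
      = (\<Sum>s\<in>replicas S n. b p * (f s * (\<Sum>l\<in>{1..n}. u (s 1) (s l) ^ Suc p) * P s x) - b p * (real n * (f s * (\<Sum>t\<in>S. wt b t x * u (s 1) t ^ Suc p) * P s x)))"
      by (intro sum.cong refl) (simp add: sum_subtractf algebra_simps del: power_Suc)
    also have "\<dots> = b p * ((\<Sum>l\<in>{1..n}. replica_avg b n (\<lambda>s. f s * u (s 1) (s l) ^ Suc p) x)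
      - real n * replica_avg b (Suc n) (\<lambda>s. f s * u (s 1) (s (Suc n)) ^ Suc p) x)"
      unfolding e1 e2 by (simp only: sum_subtractf sum_distrib_left right_diff_distrib)
    finally show "(\<Sum>s\<in>replicas S n. - f s * b p * (P s x * (\<Sum>l\<in>{1..n}. (\<Sum>t\<in>S. wt b t x * u (s 1) t ^ Suc p) - u (s 1) (s l) ^ Suc p))) = \<dots>" .
  qed
  also have "\<dots> = b p * ((\<Sum>l\<in>{1..n}. quenched b n (\<lambda>s. f s * u (s 1) (s l) ^ Suc p))
      - real n * quenched b (Suc n) (\<lambda>s. f s * u (s 1) (s (Suc n)) ^ Suc p))"
    unfolding quenched_def using replica_avg_integrable
    by (simp add: Bochner_Integration.integral_sum Bochner_Integration.integral_diff Bochner_Integration.integrable_sum del: power_Suc)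
  finally show ?thesis .
qed

text \<open>The identity \<open>replica_energy_identity\<close> is used twice, for f and for the
  constant 1. Subtracting the product of the averages cancels D ^ Suc p times the mean of f, the
  contribution of the diagonal, and leaves the stated combination. The difference is small because
  the energy is close to the deterministic m: replacing it by m costs A times the mean deviation on
  each side.\<close>

lemma finite_volume_Ghirlanda_Guerra:
  assumes b: "summable (\<lambda>p. (b p)\<^sup>2)" and n: "1 \<le> n" and f: "\<And>s t. f (s(Suc n := t)) = f s"
    and A: "\<And>s. \<bar>f s\<bar> \<le> A" and diag: "\<And>s. s \<in> S \<Longrightarrow> u s s = D"
  shows "\<bar>b p * (quenched b n f * quenched b 2 (\<lambda>s. u (s 1) (s 2) ^ Suc p)
      + (\<Sum>l\<in>{2..n}. quenched b n (\<lambda>s. f s * u (s 1) (s l) ^ Suc p))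
      - real n * quenched b (Suc n) (\<lambda>s. f s * u (s 1) (s (Suc n)) ^ Suc p))\<bar>
    \<le> 2 * A * expectation (\<lambda>x. \<Sum>s\<in>S. wt b s x * \<bar>- G p s x / N - m\<bar>)"
proof -
  define h where "h s x = - G p s x / N" for s x
  define W where "W = expectation (\<lambda>x. \<Sum>s\<in>S. wt b s x * \<bar>h s x - m\<bar>)"
  define Ef where "Ef = expectation (\<lambda>x. replica_avg b n (\<lambda>s. f s * h (s 1) x) x)"
  define Eh where "Eh = expectation (\<lambda>x. replica_avg b 1 (\<lambda>s. 1 * h (s 1) x) x)"
  have A0: "0 \<le> A" using A[of "\<lambda>_. undefined"] by linarith
  have d1: "quenched b n (\<lambda>s. f s * u (s 1) (s 1) ^ Suc p) = D ^ Suc p * quenched b n f"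
  proof -
    have "replica_avg b n (\<lambda>s. f s * u (s 1) (s 1) ^ Suc p) x = D ^ Suc p * replica_avg b n f x" for x
      unfolding replica_avg_def sum_distrib_left
      by (intro sum.cong refl) (use n in \<open>simp add: diag replicas_mem mult_ac del: power_Suc\<close>)
    then have eq: "replica_avg b n (\<lambda>s. f s * u (s 1) (s 1) ^ Suc p) = (\<lambda>x. D ^ Suc p * replica_avg b n f x)" by (rule ext)
    show ?thesis unfolding quenched_def eq by (simp del: power_Suc)
  qed
  have d2: "quenched b 1 (\<lambda>s. 1 * u (s 1) (s 1) ^ Suc p) = D ^ Suc p"
  proof -
    have "replica_avg b 1 (\<lambda>s. 1 * u (s 1) (s 1) ^ Suc p) x = replica_avg b 1 (\<lambda>_. D ^ Suc p) x" for x
      unfolding replica_avg_def by (intro sum.cong refl) (simp add: diag replicas_mem del: power_Suc)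
    then have eq: "replica_avg b 1 (\<lambda>s. 1 * u (s 1) (s 1) ^ Suc p) = (\<lambda>x. D ^ Suc p)"
      by (intro ext) (simp only: replica_avg_const)
    show ?thesis unfolding quenched_def eq by (simp add: prob_space del: power_Suc)
  qed
  have sp: "{1..n} = insert 1 {2..n}" using n by auto
  have Ef: "Ef = b p * (D ^ Suc p * quenched b n f + (\<Sum>l\<in>{2..n}. quenched b n (\<lambda>s. f s * u (s 1) (s l) ^ Suc p))
      - real n * quenched b (Suc n) (\<lambda>s. f s * u (s 1) (s (Suc n)) ^ Suc p))"
    using replica_energy_identity[OF b n f, of p] d1 unfolding Ef_def h_def sp by (subst (asm) sum.insert) auto
  have s2: "Suc 1 = 2" by simp
  have Eh: "Eh = b p * (D ^ Suc p - quenched b 2 (\<lambda>s. u (s 1) (s 2) ^ Suc p))"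
    using replica_energy_identity[OF b order_refl, of "\<lambda>_. 1" p] d2 unfolding Eh_def h_def s2 by simp
  have Eh': "Eh = expectation (\<lambda>x. \<Sum>s\<in>S. wt b s x * h s x)"
    unfolding Eh_def using replica_avg_first[of 1 b "\<lambda>t. h t _"] by simp
  have iG: "integrable M (\<lambda>x. wt b s x * G p s x)" if "s \<in> S" for s
  proof (rule Bochner_Integration.integrable_bound)
    show "integrable M (G p s)" using centered_gaussian_moments(1)[OF prob_space_axioms G_gaussian[OF that]] by simp
    show "(\<lambda>x. wt b s x * G p s x) \<in> borel_measurable M"
      using that by (intro borel_measurable_times G_measurable wt_measurable)
    show "AE x in M. norm (wt b s x * G p s x) \<le> norm (G p s x)"
      using that by (intro AE_I2) (simp add: abs_mult wt_nonneg wt_le_1 mult_left_le_one_le)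
  qed
  have iwt: "integrable M (wt b s)" if "s \<in> S" for s
    by (rule integrable_const_bound[where B=1]) (use wt_measurable wt_nonneg wt_le_1 that in auto)
  have ih: "integrable M (\<lambda>x. wt b s x * (h s x - m))" if "s \<in> S" for s
  proof -
    have "wt b s x * (h s x - m) = (- 1 / N) * (wt b s x * G p s x) - m * wt b s x" for x
      by (simp add: h_def algebra_simps)
    then show ?thesis using iG[OF that] iwt[OF that] by simp
  qed
  have iW: "integrable M (\<lambda>x. \<Sum>s\<in>S. wt b s x * \<bar>h s x - m\<bar>)"
  proof (intro Bochner_Integration.integrable_sum)
    fix s assume "s \<in> S"
    from integrable_abs[OF ih[OF this]] show "integrable M (\<lambda>x. wt b s x * \<bar>h s x - m\<bar>)"
      by (simp add: abs_mult wt_nonneg)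
  qed
  have 1: "\<bar>Eh - m\<bar> \<le> W"
  proof -
    have "Eh - m = expectation (\<lambda>x. \<Sum>s\<in>S. wt b s x * (h s x - m))"
    proof -
      have "(\<Sum>s\<in>S. wt b s x * (h s x - m)) = (\<Sum>s\<in>S. wt b s x * h s x) - m" for x
        by (simp add: right_diff_distrib sum_subtractf sum_wt flip: sum_distrib_right)
      moreover have "integrable M (\<lambda>x. \<Sum>s\<in>S. wt b s x * h s x)"
        using iG by (auto simp: h_def intro!: Bochner_Integration.integrable_sum)
      ultimately show ?thesis unfolding Eh' by (simp add: prob_space)
    qed
    also have "\<bar>\<dots>\<bar> \<le> expectation (\<lambda>x. \<bar>\<Sum>s\<in>S. wt b s x * (h s x - m)\<bar>)" by (rule integral_abs_bound)
    also have "\<dots> \<le> W" unfolding W_def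
    proof (rule integral_mono[OF _ iW])
      show "integrable M (\<lambda>x. \<bar>\<Sum>s\<in>S. wt b s x * (h s x - m)\<bar>)" using ih by auto
      show "\<bar>\<Sum>s\<in>S. wt b s x * (h s x - m)\<bar> \<le> (\<Sum>s\<in>S. wt b s x * \<bar>h s x - m\<bar>)" for x
        by (rule order_trans[OF sum_abs]) (simp add: abs_mult wt_nonneg)
    qed
    finally show ?thesis .
  qed
  have 2: "\<bar>Ef - m * quenched b n f\<bar> \<le> A * W"
  proof -
    define R where "R x = replica_avg b n (\<lambda>s. f s * (h (s 1) x - m)) x" for x
    have R: "R x = replica_avg b n (\<lambda>s. f s * h (s 1) x) x - m * replica_avg b n f x" for x
      unfolding R_def replica_avg_def by (simp add: sum_distrib_left sum_subtractf algebra_simps)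
    have iEf: "integrable M (\<lambda>x. replica_avg b n (\<lambda>s. f s * h (s 1) x) x)"
    proof -
      have "integrable M (\<lambda>x. \<Sum>s\<in>replicas S n. (- f s / N) * (G p (s 1) x * (\<Prod>l\<in>{1..n}. wt b (s l) x)))"
        using n by (intro Bochner_Integration.integrable_sum integrable_mult_right replica_energy_integrable) (auto intro: replicas_mem)
      then show ?thesis unfolding replica_avg_def h_def by (simp add: mult_ac)
    qed
    have iR: "integrable M R" unfolding R[abs_def] using iEf replica_avg_integrable by auto
    have "Ef - m * quenched b n f = expectation R"
      unfolding R[abs_def] Ef_def quenched_def using iEf replica_avg_integrable by simp
    also have "\<bar>\<dots>\<bar> \<le> expectation (\<lambda>x. \<bar>R x\<bar>)" by (rule integral_abs_bound)
    also have "\<dots> \<le> expectation (\<lambda>x. A * (\<Sum>s\<in>S. wt b s x * \<bar>h s x - m\<bar>))"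
    proof (rule integral_mono)
      fix x
      have "\<bar>R x\<bar> \<le> replica_avg b n (\<lambda>s. A * \<bar>h (s 1) x - m\<bar>) x"
        unfolding R_def by (rule replica_avg_abs_le) (auto simp: abs_mult intro!: mult_right_mono A)
      also have "\<dots> = (\<Sum>s\<in>S. wt b s x * (A * \<bar>h s x - m\<bar>))" by (rule replica_avg_first[OF n])
      finally show "\<bar>R x\<bar> \<le> A * (\<Sum>s\<in>S. wt b s x * \<bar>h s x - m\<bar>)" by (simp add: sum_distrib_left mult_ac)
    qed (use iR iW in auto)
    finally show ?thesis using iW by (simp add: W_def)
  qed
  have Q: "\<bar>quenched b n f\<bar> \<le> A"
  proof -
    have "\<bar>replica_avg b n f x\<bar> \<le> A" for x
      using replica_avg_abs_le[of n f "\<lambda>_. A" b x] A by (simp add: replica_avg_const)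
    then have "expectation (\<lambda>x. \<bar>replica_avg b n f x\<bar>) \<le> A"
      using replica_avg_integrable by (intro integral_le_const) auto
    then show ?thesis unfolding quenched_def using integral_abs_bound[of M "replica_avg b n f"] by linarith
  qed
  have "\<bar>Ef - Eh * quenched b n f\<bar> \<le> \<bar>Ef - m * quenched b n f\<bar> + \<bar>(Eh - m) * quenched b n f\<bar>"
    by (simp add: left_diff_distrib)
  also have "\<dots> \<le> A * W + W * A"
    unfolding abs_mult using 1 2 Q A0 by (intro add_mono mult_mono) auto
  also have "\<dots> = 2 * A * W" by simp
  also have "Ef - Eh * quenched b n f = b p * (quenched b n f * quenched b 2 (\<lambda>s. u (s 1) (s 2) ^ Suc p)
      + (\<Sum>l\<in>{2..n}. quenched b n (\<lambda>s. f s * u (s 1) (s l) ^ Suc p))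
      - real n * quenched b (Suc n) (\<lambda>s. f s * u (s 1) (s (Suc n)) ^ Suc p))"
    unfolding Ef Eh by (simp add: algebra_simps)
  finally show ?thesis unfolding W_def h_def .
qed

end

section \<open>From the Ghirlanda-Guerra identities to ultrametricity, for abstract arrays\<close>

subsection \<open>Ultrametricity of arrays satisfying the Ghirlanda-Guerra identities\<close>

lemma space_array: "space array_space = ({1..} \<times> {1..}) \<rightarrow>\<^sub>E UNIV"
  unfolding array_space_def by (simp add: space_PiM)

definition permute_array :: "(nat \<Rightarrow> nat) \<Rightarrow> (nat \<times> nat \<Rightarrow> real) \<Rightarrow> nat \<times> nat \<Rightarrow> real" where
  "permute_array \<pi> R = (\<lambda>(i, j)\<in>{1..} \<times> {1..}. R (\<pi> i, \<pi> j))"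

text \<open>Exchangeability is stated for injections of the labels, not only for permutations, so
  that any finite set of replicas can be carried onto an initial segment without completing the map
  to a bijection.\<close>

locale gg_array = prob_space N for N :: "(nat \<times> nat \<Rightarrow> real) measure" +
  fixes c :: real
  assumes sets_N: "sets N = sets array_space"
    and exchangeable: "\<And>\<pi>. inj_on \<pi> {1..} \<Longrightarrow> \<pi> ` {1..} \<subseteq> {1..} \<Longrightarrow> distr N N (permute_array \<pi>) = N"
    and symmetric: "\<And>i j. 1 \<le> i \<Longrightarrow> 1 \<le> j \<Longrightarrow> AE R in N. R (i, j) = R (j, i)"
    and bounded_entries: "\<And>i j. 1 \<le> i \<Longrightarrow> 1 \<le> j \<Longrightarrow> AE R in N. \<bar>R (i, j)\<bar> \<le> c"
    and positive: "\<And>A v. finite A \<Longrightarrow> A \<subseteq> {1..} \<Longrightarrow> AE R in N. 0 \<le> (\<Sum>i\<in>A. \<Sum>j\<in>A. v i * v j * R (i, j))"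
    and gg: "ghirlanda_guerra N"
begin

lemma space_N: "space N = ({1..} \<times> {1..}) \<rightarrow>\<^sub>E UNIV"
  using sets_eq_imp_space_eq[OF sets_N] space_array by simp

lemma measurable_entry: "1 \<le> i \<Longrightarrow> 1 \<le> j \<Longrightarrow> (\<lambda>R. R (i, j)) \<in> borel_measurable N"
proof -
  assume "1 \<le> i" "1 \<le> j"
  then have "(\<lambda>R. R (i, j)) \<in> borel_measurable array_space"
    unfolding array_space_def using measurable_component_singleton[of "(i,j)" "{1..} \<times> {1..}" "\<lambda>_. borel"] by simp
  then show ?thesis using measurable_cong_sets[OF sets_N refl] by blast
qed

lemma measurable_permute:
  assumes "\<pi> ` {1..} \<subseteq> {1..}" shows "permute_array \<pi> \<in> measurable N N"
proof -
  have "permute_array \<pi> \<in> measurable N array_space"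
    unfolding permute_array_def[abs_def] array_space_def case_prod_beta'
    using assms by (intro measurable_restrict measurable_entry) auto
  then show ?thesis using measurable_cong_sets[OF refl sets_N] by blast
qed

lemma prob_permute:
  assumes p: "inj_on \<pi> {1..}" "\<pi> ` {1..} \<subseteq> {1..}" and E: "{R\<in>space N. P R} \<in> sets N"
  shows "prob {R\<in>space N. P (permute_array \<pi> R)} = prob {R\<in>space N. P R}"
proof -
  have "prob {R\<in>space N. P R} = measure (distr N N (permute_array \<pi>)) {R\<in>space N. P R}"
    by (simp add: exchangeable[OF p])
  also have "\<dots> = prob (permute_array \<pi> -` {R\<in>space N. P R} \<inter> space N)"
    by (rule measure_distr[OF measurable_permute[OF p(2)] E])
  also have "permute_array \<pi> -` {R\<in>space N. P R} \<inter> space N = {R\<in>space N. P (permute_array \<pi> R)}"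
    using measurable_space[OF measurable_permute[OF p(2)]] by auto
  finally show ?thesis ..
qed

lemma permute_array_apply: "1 \<le> i \<Longrightarrow> 1 \<le> j \<Longrightarrow> permute_array \<pi> R (i, j) = R (\<pi> i, \<pi> j)"
  by (simp add: permute_array_def)

text \<open>The identities for two indicators: of an event that depends on the first n replicas, and
  of the half-line above q.\<close>

lemma gg_event_initial:
  assumes n: "2 \<le> n" and E: "{R\<in>space N. P R} \<in> sets N"
    and det: "\<And>R R'. (\<And>i j. i \<in> {1..n} \<Longrightarrow> j \<in> {1..n} \<Longrightarrow> R (i, j) = R' (i, j)) \<Longrightarrow> P R = P R'"
  shows "prob {R\<in>space N. P R \<and> q \<le> R (1, n + 1)} = (1 / real n) *
    (prob {R\<in>space N. P R} * prob {R\<in>space N. q \<le> R (1, 2)} + (\<Sum>l=2..n. prob {R\<in>space N. P R \<and> q \<le> R (1, l)}))"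
proof -
  let ?D = "{1..n} \<times> {1..n}"
  let ?S = "PiM ?D (\<lambda>_. borel) :: (nat \<times> nat \<Rightarrow> real) measure"
  \<comment> \<open>The event speaks of full arrays. Padding a block by zeros makes it a function of
    the block, and by \<open>det\<close> the padding does not affect its truth.\<close>
  define ext where "ext r = (\<lambda>ij\<in>{1..} \<times> {1..}. if ij \<in> ?D then r ij else 0)" for r :: "nat \<times> nat \<Rightarrow> real"
  have mext: "ext \<in> measurable ?S N"
  proof -
    have "ext \<in> measurable ?S array_space"
      unfolding ext_def[abs_def] array_space_def
    proof (rule measurable_restrict)
      fix ij
      show "(\<lambda>r. if ij \<in> ?D then r ij else 0) \<in> borel_measurable ?S"
        using measurable_component_singleton[of ij ?D "\<lambda>_. borel"] by (cases "ij \<in> ?D") auto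
    qed
    then show ?thesis using measurable_cong_sets[OF refl sets_N] by blast
  qed
  have Pext: "P (ext (restrict R ?D)) = P R" for R
    by (rule det) (auto simp: ext_def)
  define f where "f r = indicat_real {R\<in>space N. P R} (ext r)" for r :: "nat \<times> nat \<Rightarrow> real"
  have mf: "f \<in> borel_measurable ?S"
    unfolding f_def[abs_def] using measurable_compose[OF mext borel_measurable_indicator[OF E]] by simp
  have bf: "bounded (f ` space ?S)" unfolding bounded_iff by (rule exI[of _ 1]) (auto simp: f_def indicator_def)
  have sp: "ext r \<in> space N" for r unfolding space_N ext_def by auto
  have f: "f (restrict R ?D) = (if P R then 1 else 0)" for R
    unfolding f_def using sp Pext by (simp add: indicator_def)
  define \<psi> where "\<psi> x = indicat_real {q..} x" for x
  have \<psi>: "\<psi> \<in> borel_measurable borel" "bounded (range \<psi>)"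
    unfolding \<psi>_def[abs_def] bounded_iff by (auto intro!: exI[of _ 1] simp: indicator_def)
  have main: "(\<integral>R. f (restrict R ?D) * \<psi> (R (1, n + 1)) \<partial>N) =
          (1 / real n) * (\<integral>R. f (restrict R ?D) \<partial>N) * (\<integral>R. \<psi> (R (1, 2)) \<partial>N)
          + (1 / real n) * (\<Sum>l=2..n. \<integral>R. f (restrict R ?D) * \<psi> (R (1, l)) \<partial>N)"
    using gg n mf bf \<psi> unfolding ghirlanda_guerra_def by blast
  have a1: "(\<integral>R. f (restrict R ?D) * \<psi> (R (1, l)) \<partial>N) = prob {R\<in>space N. P R \<and> q \<le> R (1, l)}" if "1 \<le> l" for l
  proof -
    have "{R\<in>space N. P R \<and> q \<le> R (1, l)} \<in> sets N"
      using E measurable_entry[OF order_refl that] by (intro sets.sets_Collect_conj borel_measurable_le) auto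
    then have "prob {R\<in>space N. P R \<and> q \<le> R (1, l)} = (\<integral>R. indicator {R\<in>space N. P R \<and> q \<le> R (1, l)} R \<partial>N)" by simp
    also have "\<dots> = (\<integral>R. f (restrict R ?D) * \<psi> (R (1, l)) \<partial>N)"
      unfolding f \<psi>_def by (intro Bochner_Integration.integral_cong refl) (auto simp: indicator_def)
    finally show ?thesis ..
  qed
  have a2: "(\<integral>R. f (restrict R ?D) \<partial>N) = prob {R\<in>space N. P R}"
  proof -
    have "prob {R\<in>space N. P R} = (\<integral>R. indicator {R\<in>space N. P R} R \<partial>N)" using E by simp
    also have "\<dots> = (\<integral>R. f (restrict R ?D) \<partial>N)"
      unfolding f by (intro Bochner_Integration.integral_cong refl) (auto simp: indicator_def)
    finally show ?thesis ..
  qed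
  have a3: "(\<integral>R. \<psi> (R (1, 2)) \<partial>N) = prob {R\<in>space N. q \<le> R (1, 2)}"
  proof -
    have "{R\<in>space N. q \<le> R (1, 2)} \<in> sets N"
      using measurable_entry[of 1 2] by (intro borel_measurable_le) auto
    then have "prob {R\<in>space N. q \<le> R (1, 2)} = (\<integral>R. indicator {R\<in>space N. q \<le> R (1, 2)} R \<partial>N)" by simp
    also have "\<dots> = (\<integral>R. \<psi> (R (1, 2)) \<partial>N)"
      by (intro Bochner_Integration.integral_cong refl) (auto simp: \<psi>_def indicator_def)
    finally show ?thesis ..
  qed
  have s: "(\<Sum>l=2..n. \<integral>R. f (restrict R ?D) * \<psi> (R (1, l)) \<partial>N) = (\<Sum>l=2..n. prob {R\<in>space N. P R \<and> q \<le> R (1, l)})"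
    by (rule sum.cong) (auto intro!: a1[simplified])
  have n1: "1 \<le> n + 1" by simp
  show ?thesis using main unfolding a1[OF n1] a2 a3 s by (simp add: distrib_left)
qed

text \<open>The identities single out replica 1, the block 1..n and the fresh replica n + 1. An
  injection of the labels that takes these to i, A and j transports them.\<close>

lemma gg_event:
  assumes A: "finite A" "A \<subseteq> {1..}" "2 \<le> card A" and i: "i \<in> A" and j: "1 \<le> j" "j \<notin> A"
    and E: "{R\<in>space N. P R} \<in> sets N"
    and det: "\<And>R R'. (\<And>i j. i \<in> A \<Longrightarrow> j \<in> A \<Longrightarrow> R (i, j) = R' (i, j)) \<Longrightarrow> P R = P R'"
  shows "prob {R\<in>space N. P R \<and> q \<le> R (i, j)} = (1 / real (card A)) *
    (prob {R\<in>space N. P R} * prob {R\<in>space N. q \<le> R (1, 2)} + (\<Sum>l\<in>A - {i}. prob {R\<in>space N. P R \<and> q \<le> R (i, l)}))"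
proof -
  define n where "n = card A"
  obtain h where h: "bij_betw h {1..n} A" using ex_bij_betw_nat_finite_1[OF A(1)] unfolding n_def by blast
  \<comment> \<open>The enumeration h with two values exchanged, so that g 1 = i.\<close>
  define g where "g k = (if h k = i then h 1 else if k = 1 then i else h k)" for k
  have n2: "2 \<le> n" using A by (simp add: n_def)
  have h1: "h 1 \<in> A" using h n2 by (auto simp: bij_betw_def)
  have hinj: "h k = h l \<Longrightarrow> k \<in> {1..n} \<Longrightarrow> l \<in> {1..n} \<Longrightarrow> k = l" for k l
    by (rule inj_onD[OF bij_betw_imp_inj_on[OF h]])
  have hA: "h ` {1..n} = A" by (rule bij_betw_imp_surj_on[OF h])
  have ginj: "inj_on g {1..n}"
  proof (rule inj_onI)
    fix k l assume kl: "k \<in> {1..n}" "l \<in> {1..n}" "g k = g l"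
    have o: "1 \<in> {1..n}" using n2 by simp
    show "k = l" using kl(3) hinj[of k l] hinj[of k 1] hinj[of l 1] kl(1,2) o
      unfolding g_def by (auto split: if_splits)
  qed
  have gA: "g ` {1..n} = A"
  proof -
    have "g ` {1..n} \<subseteq> A" using h1 i hA by (auto simp: g_def)
    moreover have "card (g ` {1..n}) = card A" using card_image[OF ginj] by (simp add: n_def)
    ultimately show ?thesis using A(1) card_subset_eq by metis
  qed
  have g1: "g 1 = i" by (simp add: g_def)
  define m where "m = Max (insert j A)"
  have mA: "a \<le> m" if "a \<in> insert j A" for a unfolding m_def using A(1) that by (intro Max_ge) auto
  \<comment> \<open>Beyond n + 1 a shift by m, which exceeds no label by less than is needed to pass
    all of A and j, keeps the map injective.\<close>
  define \<pi> where "\<pi> k = (if k \<le> n then g k else if k = n + 1 then j else k + m)" for k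
  have p\<pi>: "inj_on \<pi> {1..}"
  proof (rule inj_onI)
    fix k l assume kl: "k \<in> {1..}" "l \<in> {1..}" "\<pi> k = \<pi> l"
    have gk: "g k \<in> A" if "k \<le> n" "1 \<le> k" for k using gA that by auto
    have gm: "g k \<le> m" if "k \<le> n" "1 \<le> k" for k using gk[OF that] mA by auto
    have gj: "g k \<noteq> j" if "k \<le> n" "1 \<le> k" for k using gk[OF that] j by auto
    have jm: "j \<le> m" using mA by auto
    have gi: "k \<le> n \<Longrightarrow> l \<le> n \<Longrightarrow> g k = g l \<Longrightarrow> k = l" using inj_onD[OF ginj, of k l] kl(1,2) by auto
    show "k = l" using kl gi gm[of k] gm[of l] gj[of k] gj[of l] jm unfolding \<pi>_def
      by (auto split: if_splits)
  qed
  have s\<pi>: "\<pi> ` {1..} \<subseteq> {1..}"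
  proof (rule image_subsetI)
    fix k :: nat assume "k \<in> {1..}"
    then have k: "1 \<le> k" by simp
    then have "k \<le> n \<Longrightarrow> g k \<in> A" using gA by auto
    then show "\<pi> k \<in> {1..}" using A(2) j(1) k unfolding \<pi>_def by auto
  qed
  define r where "r R = (\<lambda>(a, b)\<in>{1..} \<times> {1..}. R (inv_into {1..n} g a, inv_into {1..n} g b))" for R :: "nat \<times> nat \<Rightarrow> real"
  \<comment> \<open>The event moved back to the initial block; \<open>PP\<close> shows that
    relabelling by \<open>\<pi>\<close> returns \<open>P\<close>.\<close>
  define P' where "P' R = P (\<lambda>(a, b)\<in>{1..} \<times> {1..}. if a \<in> A \<and> b \<in> A then R (inv_into {1..n} g a, inv_into {1..n} g b) else 0)" for R
  have inv: "inv_into {1..n} g a \<in> {1..n}" "g (inv_into {1..n} g a) = a" if "a \<in> A" for a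
    using that gA inv_into_into f_inv_into_f by metis+
  have PP: "P' (permute_array \<pi> R) = P R" for R
    unfolding P'_def
  proof (rule det)
    fix a b assume ab: "a \<in> A" "b \<in> A"
    then have "1 \<le> a" "1 \<le> b" using A(2) by auto
    then show "(\<lambda>(a, b)\<in>{1..} \<times> {1..}. if a \<in> A \<and> b \<in> A then permute_array \<pi> R (inv_into {1..n} g a, inv_into {1..n} g b) else 0) (a, b) = R (a, b)"
      using ab inv[OF ab(1)] inv[OF ab(2)] by (simp add: permute_array_apply \<pi>_def)
  qed
  have E': "{R\<in>space N. P' R} \<in> sets N"
  proof -
    define k where "k R = (\<lambda>(a, b)\<in>{1..} \<times> {1..}. if a \<in> A \<and> b \<in> A then R (inv_into {1..n} g a, inv_into {1..n} g b) else 0)" for R :: "nat \<times> nat \<Rightarrow> real"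
    have "k \<in> measurable N array_space"
      unfolding k_def[abs_def] array_space_def case_prod_beta'
    proof (rule measurable_restrict)
      fix ij :: "nat \<times> nat"
      show "(\<lambda>R. if fst ij \<in> A \<and> snd ij \<in> A then R (inv_into {1..n} g (fst ij), inv_into {1..n} g (snd ij)) else 0) \<in> borel_measurable N"
        using inv(1) by (cases "fst ij \<in> A \<and> snd ij \<in> A") (auto intro!: measurable_entry)
    qed
    then have "k \<in> measurable N N" using measurable_cong_sets[OF refl sets_N] by blast
    from measurable_sets[OF this E] have "k -` {R \<in> space N. P R} \<inter> space N \<in> sets N" .
    also have "k -` {R \<in> space N. P R} \<inter> space N = {R\<in>space N. P' R}"
      unfolding P'_def using measurable_space[OF \<open>k \<in> measurable N N\<close>] by (auto simp: k_def)
    finally show ?thesis .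
  qed
  have det': "P' R = P' R'" if "\<And>i j. i \<in> {1..n} \<Longrightarrow> j \<in> {1..n} \<Longrightarrow> R (i, j) = R' (i, j)" for R R'
    unfolding P'_def by (rule det) (use that inv(1) in auto)
  have main: "prob {R\<in>space N. P' R \<and> q \<le> R (1, n + 1)} = (1 / real n) *
    (prob {R\<in>space N. P' R} * prob {R\<in>space N. q \<le> R (1, 2)} + (\<Sum>l=2..n. prob {R\<in>space N. P' R \<and> q \<le> R (1, l)}))"
    by (rule gg_event_initial[OF n2 E']) (rule det')
  have mE: "{R\<in>space N. P' R \<and> q \<le> R (1, l)} \<in> sets N" if "1 \<le> l" for l
    using E' measurable_entry[OF order_refl that] by (intro sets.sets_Collect_conj borel_measurable_le) auto
  have tr: "prob {R\<in>space N. P' R \<and> q \<le> R (1, l)} = prob {R\<in>space N. P R \<and> q \<le> R (i, \<pi> l)}" if "1 \<le> l" for l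
  proof -
    have "\<pi> 1 = i" using n2 g1 by (simp add: \<pi>_def)
    then show ?thesis using prob_permute[OF p\<pi> s\<pi> mE[OF that]] that by (simp add: PP permute_array_apply)
  qed
  have tr0: "prob {R\<in>space N. P' R} = prob {R\<in>space N. P R}"
    using prob_permute[OF p\<pi> s\<pi> E'] by (simp add: PP)
  have bij: "bij_betw \<pi> {2..n} (A - {i})"
  proof -
    have "bij_betw g {2..n} (g ` {2..n})" using ginj by (auto intro!: inj_on_imp_bij_betw inj_on_subset[OF ginj])
    moreover have "g ` {2..n} = A - {i}"
    proof -
      have e: "{1..n} = insert 1 {2..n}" using n2 by auto
      have "i \<notin> g ` {2..n}"
      proof
        assume "i \<in> g ` {2..n}"
        then obtain k where "k \<in> {2..n}" "g k = g 1" using g1 by auto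
        then show False using inj_onD[OF ginj, of k 1] n2 by auto
      qed
      moreover have "A = insert i (g ` {2..n})" using gA g1 unfolding e by auto
      ultimately show ?thesis by auto
    qed
    ultimately have "bij_betw g {2..n} (A - {i})" by simp
    then show ?thesis by (subst bij_betw_cong[where g=g]) (auto simp: \<pi>_def)
  qed
  have "(\<Sum>l=2..n. prob {R\<in>space N. P' R \<and> q \<le> R (1, l)}) = (\<Sum>l=2..n. prob {R\<in>space N. P R \<and> q \<le> R (i, \<pi> l)})"
    by (intro sum.cong refl tr) auto
  also have "\<dots> = (\<Sum>l\<in>A - {i}. prob {R\<in>space N. P R \<and> q \<le> R (i, l)})"
    by (rule sum.reindex_bij_betw[OF bij])
  finally have s: "(\<Sum>l=2..n. prob {R\<in>space N. P' R \<and> q \<le> R (1, l)}) = (\<Sum>l\<in>A - {i}. prob {R\<in>space N. P R \<and> q \<le> R (i, l)})" .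
  have pn: "\<pi> (n + 1) = j" by (simp add: \<pi>_def)
  have n1: "1 \<le> n + 1" by simp
  show ?thesis using main unfolding s tr0 tr[OF n1] pn by (simp only: n_def)
qed

end

context gg_array begin

lemma measurable_lt: "1 \<le> i \<Longrightarrow> 1 \<le> j \<Longrightarrow> {R\<in>space N. R (i, j) < q} \<in> sets N"
  using measurable_entry by (intro borel_measurable_less) auto

text \<open>The identities show that a fresh replica avoids the set \<open>{R (i, -) \<ge> q}\<close> with conditional
  probability at least \<open>1 - 1 / m\<close> when \<open>m\<close> replicas are present, so the probabilities of
  avoiding it \<open>k\<close> times in a row have a divergent sum. If the conclusion failed,
  avoiding it would entail violating \<open>\<Omega>\<close>; but by exchangeability the probability that replica
  \<open>i\<close> satisfies \<open>\<Omega>\<close> and the next \<open>k\<close> replicas violate it is the probability that the first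
  success in an exchangeable sequence occurs at time \<open>k\<close>, and these sum to at most one.\<close>

lemma duplication:
  assumes A: "finite A" "A \<subseteq> {1..}" "A \<noteq> {}" and i: "1 \<le> i" "i \<notin> A" and j: "1 \<le> j" "j \<notin> A" "j \<noteq> i"
    and B: "{R\<in>space N. B R} \<in> sets N"
      "\<And>R R'. (\<And>a b. a \<in> A \<Longrightarrow> b \<in> A \<Longrightarrow> R (a, b) = R' (a, b)) \<Longrightarrow> B R = B R'"
    and W: "\<And>b. 1 \<le> b \<Longrightarrow> {R\<in>space N. W (\<lambda>a. R (a, b))} \<in> sets N"
      "\<And>v v'. (\<And>a. a \<in> A \<Longrightarrow> v a = v' a) \<Longrightarrow> W v = W v'"
      "\<And>v a. W v \<Longrightarrow> a \<in> A \<Longrightarrow> v a < q"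
    and pos: "0 < prob {R\<in>space N. B R \<and> W (\<lambda>a. R (a, i))}"
  shows "0 < prob {R\<in>space N. B R \<and> W (\<lambda>a. R (a, i)) \<and> W (\<lambda>a. R (a, j)) \<and> R (i, j) < q}"
proof (rule ccontr)
  assume "\<not> ?thesis"
  then have zero: "prob {R\<in>space N. B R \<and> W (\<lambda>a. R (a, i)) \<and> W (\<lambda>a. R (a, j)) \<and> R (i, j) < q} = 0"
    using measure_nonneg[of N] by (simp add: not_less) (meson antisym measure_nonneg)
  define m where "m = Max (insert i (insert j A))"
  have mA: "a \<le> m" if "a \<in> insert i (insert j A)" for a
    unfolding m_def using A(1) that by (intro Max_ge) auto
  \<comment> \<open>The exchangeable sequence of candidates: i itself, then j, then labels larger
    than everything in use.\<close>
  define e where "e k = (if k = 0 then i else if k = 1 then j else m + k)" for k :: nat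
  have e0: "e 0 = i" and e1: "e 1 = j" by (simp_all add: e_def)
  have eA: "e k \<notin> A" for k using i j mA[of "m + k"] by (auto simp: e_def)
  have epos: "1 \<le> e k" for k using i j by (auto simp: e_def)
  have einj: "e k = e l \<longleftrightarrow> k = l" for k l
    using mA[of i] mA[of j] j(3) by (auto simp: e_def)
  have tp: "inj_on (Transposition.transpose a b) {1..}" "Transposition.transpose a b ` {1..} \<subseteq> {1..}"
    if "1 \<le> a" "1 \<le> b" for a b :: nat
    using that by (auto simp: inj_on_def Transposition.transpose_def split: if_splits)
  have colperm: "B (permute_array (Transposition.transpose a b) R) = B R"
    "1 \<le> d \<Longrightarrow> W (\<lambda>x. permute_array (Transposition.transpose a b) R (x, d)) = W (\<lambda>x. R (x, Transposition.transpose a b d))"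
    if "a \<notin> A" "b \<notin> A" for a b d R
  proof -
    have t: "Transposition.transpose a b x = x" if "x \<in> A" for x
      using that \<open>a \<notin> A\<close> \<open>b \<notin> A\<close> by (auto simp: Transposition.transpose_def)
    have A1: "1 \<le> x" if "x \<in> A" for x using that A(2) by auto
    show "B (permute_array (Transposition.transpose a b) R) = B R"
      by (rule B(2)) (simp only: permute_array_apply A1 t)
    show "W (\<lambda>x. permute_array (Transposition.transpose a b) R (x, d)) = W (\<lambda>x. R (x, Transposition.transpose a b d))" if "1 \<le> d"
      by (rule W(2)) (simp only: permute_array_apply A1 t that)
  qed
  have null: "prob {R\<in>space N. B R \<and> W (\<lambda>a. R (a, i)) \<and> W (\<lambda>a. R (a, e k)) \<and> R (i, e k) < q} = 0" if "1 \<le> k" for k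
  proof -
    let ?t = "Transposition.transpose j (e k)"
    have ek: "e k \<noteq> i" using einj[of k 0] that e0 by auto
    have ti: "?t i = i" "?t j = e k" using j(3) ek by (auto simp: Transposition.transpose_def)
    have "prob {R\<in>space N. (\<lambda>R. B R \<and> W (\<lambda>a. R (a, i)) \<and> W (\<lambda>a. R (a, j)) \<and> R (i, j) < q) (permute_array ?t R)} = 
      prob {R\<in>space N. B R \<and> W (\<lambda>a. R (a, i)) \<and> W (\<lambda>a. R (a, j)) \<and> R (i, j) < q}"
      by (rule prob_permute[OF tp]) (use j epos B(1) W(1) i measurable_lt in \<open>auto intro!: sets.sets_Collect_conj\<close>)
    then show ?thesis unfolding colperm(1)[OF j(2) eA] colperm(2)[OF j(2) eA i(1)] colperm(2)[OF j(2) eA j(1)]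
        permute_array_apply[OF i(1) j(1)] ti zero .
  qed
  define Ev where "Ev k R \<longleftrightarrow> B R \<and> W (\<lambda>a. R (a, i)) \<and> (\<forall>l\<in>{1..k}. R (i, e l) < q)" for k R
  define p where "p k = prob {R\<in>space N. Ev k R}" for k
  have mEv: "{R\<in>space N. Ev k R} \<in> sets N" for k
    unfolding Ev_def using B(1) W(1) i epos measurable_lt
    by (intro sets.sets_Collect_conj sets.sets_Collect_finite_All) auto
  define n where "n = card A + 1"
  have n2: "2 \<le> n" using A by (simp add: n_def Suc_le_eq card_gt_0_iff)
  \<comment> \<open>With n + k replicas present, a fresh one fails to avoid with conditional
    probability at most 1 / (n + k). So (n + k - 1) p k is nondecreasing, and p k is at least a
    constant times 1 / (n + k - 1), the term of a harmonic series.\<close>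
  have step: "real (n + k - 1) * p k \<le> real (n + Suc k - 1) * p (Suc k)" for k
  proof -
    define Ak where "Ak = insert i (A \<union> e ` {1..k})"
    have inj: "inj_on e {1..k}" using einj by (auto simp: inj_on_def)
    have ie: "i \<notin> e ` {1..k}"
    proof
      assume "i \<in> e ` {1..k}"
      then obtain l where "l \<in> {1..k}" "e l = e 0" using e0 by auto
      then show False using einj[of l 0] by auto
    qed
    have dj: "A \<inter> e ` {1..k} = {}" using eA by auto
    have cA: "card Ak = n + k"
    proof -
      have "card (A \<union> e ` {1..k}) = card A + k"
        using A(1) dj card_image[OF inj] by (subst card_Un_disjoint) auto
      then show ?thesis unfolding Ak_def using A(1) i ie by (simp add: n_def)
    qed
    have Ak: "finite Ak" "Ak \<subseteq> {1..}" "2 \<le> card Ak" "i \<in> Ak" "e (Suc k) \<notin> Ak"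
    proof -
      show "finite Ak" using A by (simp add: Ak_def)
      show "Ak \<subseteq> {1..}" using A i epos by (auto simp: Ak_def)
      show "2 \<le> card Ak" using cA n2 by simp
      show "i \<in> Ak" by (simp add: Ak_def)
      have "e (Suc k) \<noteq> i" using einj[of "Suc k" 0] e0 by auto
      then show "e (Suc k) \<notin> Ak" using eA einj by (auto simp: Ak_def)
    qed
    have det: "Ev k R = Ev k R'" if h: "\<And>a b. a \<in> Ak \<Longrightarrow> b \<in> Ak \<Longrightarrow> R (a, b) = R' (a, b)" for R R'
    proof -
      have "B R = B R'" by (rule B(2)) (use h in \<open>auto simp: Ak_def\<close>)
      moreover have "W (\<lambda>a. R (a, i)) = W (\<lambda>a. R' (a, i))" by (rule W(2)) (use h in \<open>auto simp: Ak_def\<close>)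
      moreover have "R (i, e l) = R' (i, e l)" if "l \<in> {1..k}" for l using h that by (auto simp: Ak_def)
      ultimately show ?thesis unfolding Ev_def by auto
    qed
    have gg: "prob {R\<in>space N. Ev k R \<and> q \<le> R (i, e (Suc k))} = (1 / real (card Ak)) *
      (prob {R\<in>space N. Ev k R} * prob {R\<in>space N. q \<le> R (1, 2)} + (\<Sum>l\<in>Ak - {i}. prob {R\<in>space N. Ev k R \<and> q \<le> R (i, l)}))"
      by (rule gg_event[OF Ak(1,2,3,4) epos Ak(5) mEv]) (rule det)
    \<comment> \<open>The replicas already present contribute nothing: those in A have overlap below
      q with i by \<open>W(3)\<close>, the earlier candidates by \<open>Ev\<close>. Only the term
      with the independent copy of the overlap remains in \<open>gg\<close>.\<close>
    have z: "prob {R\<in>space N. Ev k R \<and> q \<le> R (i, l)} = 0" if l: "l \<in> Ak - {i}" for l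
    proof -
      have l1: "1 \<le> l" using l Ak(2) by auto
      have "AE R in N. \<not> (Ev k R \<and> q \<le> R (i, l))"
      proof (cases "l \<in> A")
        case True
        show ?thesis using symmetric[OF i(1) l1]
        proof eventually_elim
          case (elim R)
          show ?case
          proof
            assume h: "Ev k R \<and> q \<le> R (i, l)"
            then have "W (\<lambda>a. R (a, i))" by (simp add: Ev_def)
            from W(3)[OF this True] h elim show False by simp
          qed
        qed
      next
        case False
        then obtain k' where "k' \<in> {1..k}" "l = e k'" using l by (auto simp: Ak_def)
        then have "\<not> (Ev k R \<and> q \<le> R (i, l))" for R unfolding Ev_def by (meson not_le)
        then show ?thesis by (intro AE_I2)
      qed
      moreover have "{R\<in>space N. Ev k R \<and> q \<le> R (i, l)} \<in> sets N"
        using mEv measurable_entry[OF i(1) l1] by (intro sets.sets_Collect_conj borel_measurable_le) auto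
      ultimately show ?thesis
        by (subst prob_eq_0) auto
    qed
    have le: "prob {R\<in>space N. Ev k R \<and> q \<le> R (i, e (Suc k))} \<le> p k / real (n + k)"
    proof -
      have "prob {R\<in>space N. Ev k R \<and> q \<le> R (i, e (Suc k))} = p k * prob {R\<in>space N. q \<le> R (1, 2)} / real (n + k)"
        unfolding gg cA p_def using z by simp
      also have "\<dots> \<le> p k * 1 / real (n + k)"
        by (intro divide_right_mono mult_left_mono) (auto simp: p_def)
      finally show ?thesis by simp
    qed
    have "p k \<le> p (Suc k) + prob {R\<in>space N. Ev k R \<and> q \<le> R (i, e (Suc k))}"
    proof -
      have m2: "{R\<in>space N. Ev k R \<and> q \<le> R (i, e (Suc k))} \<in> sets N"
        using mEv measurable_entry[OF i(1) epos] by (intro sets.sets_Collect_conj borel_measurable_le) auto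
      have "{R\<in>space N. Ev k R} \<subseteq> {R\<in>space N. Ev (Suc k) R} \<union> {R\<in>space N. Ev k R \<and> q \<le> R (i, e (Suc k))}"
        by (auto simp: Ev_def le_Suc_eq)
      then have "p k \<le> prob ({R\<in>space N. Ev (Suc k) R} \<union> {R\<in>space N. Ev k R \<and> q \<le> R (i, e (Suc k))})"
        unfolding p_def using mEv m2 by (intro finite_measure_mono) auto
      also have "\<dots> \<le> p (Suc k) + prob {R\<in>space N. Ev k R \<and> q \<le> R (i, e (Suc k))}"
        unfolding p_def using mEv m2 by (intro measure_Un_le) auto
      finally show ?thesis .
    qed
    with le have "p k - p k / real (n + k) \<le> p (Suc k)" by linarith
    then have "real (n + k) * (p k - p k / real (n + k)) \<le> real (n + k) * p (Suc k)" by (intro mult_left_mono) auto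
    moreover have "real (n + k) * (p k - p k / real (n + k)) = real (n + k - 1) * p k"
      using n2 by (simp add: right_diff_distrib of_nat_diff left_diff_distrib)
    ultimately show ?thesis by simp
  qed
  have lower: "real (n - 1) * p 0 \<le> real (n + k - 1) * p k" for k
    by (induction k) (use step order_trans in \<open>auto\<close>)
  define Fs where "Fs k = {R\<in>space N. B R \<and> W (\<lambda>a. R (a, e k)) \<and> (\<forall>l<k. \<not> W (\<lambda>a. R (a, e l)))}" for k
  have mFs: "Fs k \<in> sets N" for k
    unfolding Fs_def using B(1) W(1) epos
    by (intro sets.sets_Collect_conj sets.sets_Collect_countable_All sets.sets_Collect_imp sets.sets_Collect_neg) auto
  have upper: "p k \<le> prob (Fs k)" for k
  proof -
    define Gk where "Gk R \<longleftrightarrow> B R \<and> W (\<lambda>a. R (a, e 0)) \<and> (\<forall>l\<in>{1..k}. \<not> W (\<lambda>a. R (a, e l)))" for R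
    have mG: "{R\<in>space N. Gk R} \<in> sets N"
      unfolding Gk_def using B(1) W(1) epos
      by (intro sets.sets_Collect_conj sets.sets_Collect_finite_All sets.sets_Collect_neg) auto
    have "AE R in N. \<forall>l\<in>{1..k}. \<not> (B R \<and> W (\<lambda>a. R (a, i)) \<and> W (\<lambda>a. R (a, e l)) \<and> R (i, e l) < q)"
    proof (intro AE_finite_allI)
      fix l assume "l \<in> {1..k}"
      then have "prob {R\<in>space N. B R \<and> W (\<lambda>a. R (a, i)) \<and> W (\<lambda>a. R (a, e l)) \<and> R (i, e l) < q} = 0" by (intro null) simp
      then show "AE R in N. \<not> (B R \<and> W (\<lambda>a. R (a, i)) \<and> W (\<lambda>a. R (a, e l)) \<and> R (i, e l) < q)"
        by (subst (asm) prob_eq_0) (use B(1) W(1) i epos measurable_lt in \<open>auto intro!: sets.sets_Collect_conj\<close>)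
    qed simp
    then have "p k \<le> prob {R\<in>space N. Gk R}"
      unfolding p_def
    proof (intro finite_measure_mono_AE mG)
      assume "AE R in N. \<forall>l\<in>{1..k}. \<not> (B R \<and> W (\<lambda>a. R (a, i)) \<and> W (\<lambda>a. R (a, e l)) \<and> R (i, e l) < q)"
      then show "AE R in N. R \<in> {R\<in>space N. Ev k R} \<longrightarrow> R \<in> {R\<in>space N. Gk R}"
        by eventually_elim (auto simp: Ev_def Gk_def e0)
    qed
    \<comment> \<open>Exchanging the candidates 0 and k turns a success at time 0 followed by k
      failures into a first success at time k.\<close>
    also have "\<dots> = prob {R\<in>space N. Gk (permute_array (Transposition.transpose (e 0) (e k)) R)}"
      by (rule prob_permute[OF tp[OF epos epos] mG, symmetric])
    also have "{R\<in>space N. Gk (permute_array (Transposition.transpose (e 0) (e k)) R)} = Fs k"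
    proof -
      have "Gk (permute_array (Transposition.transpose (e 0) (e k)) R) \<longleftrightarrow>
        B R \<and> W (\<lambda>a. R (a, e k)) \<and> (\<forall>l\<in>{1..k}. \<not> W (\<lambda>a. R (a, Transposition.transpose (e 0) (e k) (e l))))" for R
        unfolding Gk_def colperm(1)[OF eA eA] colperm(2)[OF eA eA epos] by simp
      moreover have "(\<forall>l\<in>{1..k}. \<not> W (\<lambda>a. R (a, Transposition.transpose (e 0) (e k) (e l)))) \<longleftrightarrow> (\<forall>l<k. \<not> W (\<lambda>a. R (a, e l)))" for R
      proof -
        have t: "Transposition.transpose (e 0) (e k) (e l) = e (if l = k then 0 else l)" if "l \<in> {1..k}" for l
          using that einj by (auto simp: Transposition.transpose_def)
        have "(\<forall>l\<in>{1..k}. \<not> W (\<lambda>a. R (a, Transposition.transpose (e 0) (e k) (e l)))) \<longleftrightarrow> (\<forall>l\<in>{1..k}. \<not> W (\<lambda>a. R (a, e (if l = k then 0 else l))))"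
          by (intro ball_cong refl) (simp only: t)
        also have "\<dots> \<longleftrightarrow> (\<forall>l<k. \<not> W (\<lambda>a. R (a, e l)))"
        proof safe
          fix l assume h: "\<forall>l\<in>{1..k}. \<not> W (\<lambda>a. R (a, e (if l = k then 0 else l)))" "l < k" "W (\<lambda>a. R (a, e l))"
          show False
          proof (cases "l = 0")
            case True
            then show False using h(1)[rule_format, of k] h(2,3) by auto
          next
            case False
            then show False using h(1)[rule_format, of l] h(2,3) by auto
          qed
        next
          fix l assume "\<forall>l<k. \<not> W (\<lambda>a. R (a, e l))" "l \<in> {1..k}" "W (\<lambda>a. R (a, e (if l = k then 0 else l)))"
          then show False by (auto split: if_splits)
        qed
        finally show ?thesis .
      qed
      ultimately show ?thesis unfolding Fs_def by auto
    qed
    finally show ?thesis .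
  qed
  have sum1: "(\<Sum>k<K. p k) \<le> 1" for K
  proof -
    have "disjoint_family_on Fs {..<K}"
      unfolding disjoint_family_on_def
    proof (intro ballI impI)
      fix k l :: nat assume "k \<noteq> l"
      then show "Fs k \<inter> Fs l = {}" by (cases "k < l") (auto simp: Fs_def)
    qed
    then have "(\<Sum>k<K. prob (Fs k)) = prob (\<Union>k<K. Fs k)"
      using mFs by (intro finite_measure_finite_Union[symmetric]) auto
    then show ?thesis using sum_mono[of "{..<K}" p "\<lambda>k. prob (Fs k)"] upper by (metis order_trans prob_le_1)
  qed
  have p0: "0 < p 0" using pos by (simp add: p_def Ev_def)
  define d where "d = real (n - 1) * p 0"
  have d0: "0 < d" using p0 n2 by (simp add: d_def)
  have pk: "d * inverse (real (k + (n - 1))) \<le> p k" for k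
  proof -
    have "d \<le> real (k + (n - 1)) * p k" using lower[of k] n2 by (simp add: d_def add.commute)
    moreover have "0 < real (k + (n - 1))" using n2 by simp
    ultimately show ?thesis by (simp add: field_simps)
  qed
  have "summable (\<lambda>k. d * inverse (real (k + (n - 1))))"
  proof (rule summableI_nonneg_bounded[where x=1])
    show "(\<Sum>k<K. d * inverse (real (k + (n - 1)))) \<le> 1" for K
      by (rule order_trans[OF sum_mono sum1]) (rule pk)
  qed (use d0 in auto)
  then have "summable (\<lambda>k. inverse (real (k + (n - 1))))"
    using d0 by (subst (asm) summable_cmult_iff) auto
  then have "summable (\<lambda>k. inverse (real k))"
    by (subst (asm) summable_iff_shift)
  then show False using not_summable_harmonic[where 'a=real] by simp
qed

end

text \<open>Divided by m^2, the form at v is the squared length of s P' + (Q' - T'), with P', Q', T'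
  the barycenters of the groups. Off-diagonal overlaps inside Q and T are at most z + e and those
  between Q and T at least z - e, so Q' - T' has squared length at most 4 e, up to the diagonal
  entries, which are only bounded by c and weigh 1 / m. Its product with P' is at most x - y + 2 e.
  If x < y, a suitable small s > 0 makes the right-hand side negative for small e and large
  m.\<close>

lemma barycenter_inequality:
  fixes R :: "nat \<times> nat \<Rightarrow> real"
  assumes fin: "finite P" "finite Q" "finite T" and disj: "P \<inter> Q = {}" "P \<inter> T = {}" "Q \<inter> T = {}"
    and card: "card P = m" "card Q = m" "card T = m" "1 \<le> m"
    and c: "\<And>i j. i \<in> P \<union> Q \<union> T \<Longrightarrow> j \<in> P \<union> Q \<union> T \<Longrightarrow> \<bar>R (i, j)\<bar> \<le> c"
    and PQ: "\<And>i j. i \<in> P \<Longrightarrow> j \<in> Q \<Longrightarrow> R (i, j) \<le> x + e \<and> R (j, i) \<le> x + e"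
    and PT: "\<And>i j. i \<in> P \<Longrightarrow> j \<in> T \<Longrightarrow> y - e \<le> R (i, j) \<and> y - e \<le> R (j, i)"
    and QT: "\<And>i j. i \<in> Q \<Longrightarrow> j \<in> T \<Longrightarrow> z - e \<le> R (i, j) \<and> z - e \<le> R (j, i)"
    and QQ: "\<And>i j. i \<in> Q \<Longrightarrow> j \<in> Q \<Longrightarrow> i \<noteq> j \<Longrightarrow> R (i, j) \<le> z + e"
    and TT: "\<And>i j. i \<in> T \<Longrightarrow> j \<in> T \<Longrightarrow> i \<noteq> j \<Longrightarrow> R (i, j) \<le> z + e"
    and v: "\<And>i. i \<in> P \<Longrightarrow> v i = s" "\<And>i. i \<in> Q \<Longrightarrow> v i = 1" "\<And>i. i \<in> T \<Longrightarrow> v i = -1"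
    and psd: "0 \<le> (\<Sum>i\<in>P \<union> Q \<union> T. \<Sum>j\<in>P \<union> Q \<union> T. v i * v j * R (i, j))"
    and s: "0 \<le> s" and e: "0 \<le> e"
  shows "0 \<le> s\<^sup>2 * c + 2 * s * (x - y + 2 * e) + 4 * e + 2 * (c + \<bar>z\<bar> + e) / real m"
proof -
  define S where "S A B = (\<Sum>i\<in>A. \<Sum>j\<in>B. R (i, j))" for A B
  have m0: "0 < real m" using card by simp
  have sp: "(\<Sum>i\<in>P \<union> Q \<union> T. f i) = (\<Sum>i\<in>P. f i) + (\<Sum>i\<in>Q. f i) + (\<Sum>i\<in>T. f i)" for f :: "nat \<Rightarrow> real"
    using fin disj by (subst sum.union_disjoint, simp, simp, blast)+ simp
  have qq: "(\<Sum>i\<in>A. \<Sum>j\<in>B. v i * v j * R (i, j)) = a * b * S A B"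
    if "\<forall>i\<in>A. v i = a" "\<forall>i\<in>B. v i = b" for A B a b
    unfolding S_def sum_distrib_left by (intro sum.cong refl) (simp add: that)
  have vv: "\<forall>i\<in>P. v i = s" "\<forall>i\<in>Q. v i = 1" "\<forall>i\<in>T. v i = -1" using v by auto
  note q = qq[OF vv(1) vv(1)] qq[OF vv(1) vv(2)] qq[OF vv(1) vv(3)] qq[OF vv(2) vv(1)] qq[OF vv(2) vv(2)]
    qq[OF vv(2) vv(3)] qq[OF vv(3) vv(1)] qq[OF vv(3) vv(2)] qq[OF vv(3) vv(3)]
  have "0 \<le> (\<Sum>i\<in>P \<union> Q \<union> T. \<Sum>j\<in>P \<union> Q \<union> T. v i * v j * R (i, j))" by (rule psd)
  also have "\<dots> = s * s * S P P + s * S P Q - s * S P T + s * S Q P + S Q Q - S Q T - s * S T P - S T Q + S T T"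
    unfolding sp sum.distrib q by (simp add: algebra_simps)
  finally have main: "0 \<le> s * s * S P P + s * (S P Q + S Q P) - s * (S P T + S T P) + S Q Q + S T T - (S Q T + S T Q)"
    by (simp add: algebra_simps)
  have ub: "S A B \<le> real m * (real m * k)" if "\<And>i j. i \<in> A \<Longrightarrow> j \<in> B \<Longrightarrow> R (i, j) \<le> k" "card A = m" "card B = m" for A B k
    unfolding S_def using that by (intro order_trans[OF sum_bounded_above[of A _ "real m * k"]] order_trans[OF sum_bounded_above[of B _ k]]) auto
  have lb: "real m * (real m * k) \<le> S A B" if "\<And>i j. i \<in> A \<Longrightarrow> j \<in> B \<Longrightarrow> k \<le> R (i, j)" "card A = m" "card B = m" for A B k
    unfolding S_def using that by (intro order_trans[OF _ sum_bounded_below[of A "real m * k"]] order_trans[OF _ sum_bounded_below[of B k]]) auto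
  have dg: "S A A \<le> real m * (real m * (z + e) + (c + \<bar>z\<bar> + e))"
    if A: "\<And>i j. i \<in> A \<Longrightarrow> j \<in> A \<Longrightarrow> i \<noteq> j \<Longrightarrow> R (i, j) \<le> z + e" "card A = m" "finite A" "A \<subseteq> P \<union> Q \<union> T" for A
  proof -
    have "(\<Sum>j\<in>A. R (i, j)) \<le> real m * (z + e) + (c + \<bar>z\<bar> + e)" if i: "i \<in> A" for i
    proof -
      have "R (i, i) \<le> c" using c[of i i] i A(4) by auto
      moreover have "(\<Sum>j\<in>A - {i}. R (i, j)) \<le> (\<Sum>j\<in>A - {i}. z + e)" using A i by (intro sum_mono) auto
      moreover have "(\<Sum>j\<in>A - {i}. z + e) = real m * (z + e) - (z + e)"
        using A i card by (simp add: of_nat_diff left_diff_distrib)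
      moreover have "(\<Sum>j\<in>A. R (i, j)) = R (i, i) + (\<Sum>j\<in>A - {i}. R (i, j))" using A i by (simp add: sum.remove)
      moreover have "- z \<le> \<bar>z\<bar>" by simp
      ultimately show ?thesis using e by linarith
    qed
    then show ?thesis unfolding S_def using A sum_bounded_above[of A "\<lambda>i. \<Sum>j\<in>A. R (i, j)" "real m * (z + e) + (c + \<bar>z\<bar> + e)"] by simp
  qed
  have PP: "S P P \<le> real m * (real m * c)" by (rule ub) (use c card in \<open>auto simp: abs_le_iff\<close>)
  have t1: "s * s * S P P \<le> s * s * (real m * (real m * c))" using PP by (rule mult_left_mono) simp
  have "S P Q + S Q P \<le> real m * (real m * (x + e)) + real m * (real m * (x + e))"
    by (intro add_mono ub) (use PQ card in auto)
  then have t2: "s * (S P Q + S Q P) \<le> s * (real m * (real m * (x + e)) + real m * (real m * (x + e)))" using s by (rule mult_left_mono)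
  have "real m * (real m * (y - e)) + real m * (real m * (y - e)) \<le> S P T + S T P"
    by (intro add_mono lb) (use PT card in auto)
  then have t3: "s * (real m * (real m * (y - e)) + real m * (real m * (y - e))) \<le> s * (S P T + S T P)" using s by (rule mult_left_mono)
  have t4: "real m * (real m * (z - e)) + real m * (real m * (z - e)) \<le> S Q T + S T Q"
    by (intro add_mono lb) (use QT card in auto)
  have t5: "S Q Q \<le> real m * (real m * (z + e) + (c + \<bar>z\<bar> + e))" by (rule dg) (use QQ card fin in auto)
  have t6: "S T T \<le> real m * (real m * (z + e) + (c + \<bar>z\<bar> + e))" by (rule dg) (use TT card fin in auto)
  have "0 \<le> s * s * (real m * (real m * c)) + s * (real m * (real m * (x + e)) + real m * (real m * (x + e)))
    - s * (real m * (real m * (y - e)) + real m * (real m * (y - e))) + 2 * (real m * (real m * (z + e) + (c + \<bar>z\<bar> + e)))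
    - (real m * (real m * (z - e)) + real m * (real m * (z - e)))"
    using main t1 t2 t3 t4 t5 t6 by linarith
  also have "\<dots> = real m * real m * (s\<^sup>2 * c + 2 * s * (x - y + 2 * e) + 4 * e + 2 * (c + \<bar>z\<bar> + e) / real m)"
    using m0 by (simp add: field_simps power2_eq_square)
  finally have "0 \<le> real m * real m * (s\<^sup>2 * c + 2 * s * (x - y + 2 * e) + 4 * e + 2 * (c + \<bar>z\<bar> + e) / real m)" .
  moreover have "0 < real m * real m" using m0 by simp
  ultimately show ?thesis using zero_le_mult_iff by (metis not_less)
qed

lemma card_residue_class:
  assumes "r < 3" shows "card {i\<in>{1..3 * m}. i mod 3 = r} = (m :: nat)"
proof (induction m)
  case (Suc m)
  define k where "k = 3 * m + (if r = 0 then 3 else r)"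
  have r: "r = 0 \<or> r = 1 \<or> r = 2" using assms by auto
  have "i \<in> {i\<in>{1..3 * Suc m}. i mod 3 = r} \<longleftrightarrow> i \<in> insert k {i\<in>{1..3 * m}. i mod 3 = r}" for i
  proof -
    have m: "i \<in> {i\<in>{1..3 * Suc m}. i mod 3 = r} \<longleftrightarrow> 1 \<le> i \<and> i \<le> 3 * m + 3 \<and> i mod 3 = r"
      "i \<in> insert k {i\<in>{1..3 * m}. i mod 3 = r} \<longleftrightarrow> i = k \<or> 1 \<le> i \<and> i \<le> 3 * m \<and> i mod 3 = r" by auto
    from r show ?thesis
    proof (elim disjE)
      assume r: "r = 0" show ?thesis unfolding m unfolding k_def r by presburger
    next
      assume r: "r = 1" show ?thesis unfolding m unfolding k_def r by presburger
    next
      assume r: "r = 2" show ?thesis unfolding m unfolding k_def r by presburger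
    qed
  qed
  then have "{i\<in>{1..3 * Suc m}. i mod 3 = r} = insert k {i\<in>{1..3 * m}. i mod 3 = r}" by (rule set_eqI)
  moreover have "k \<notin> {i\<in>{1..3 * m}. i mod 3 = r}" using assms by (auto simp: k_def)
  ultimately show ?case using Suc by simp
qed simp

context gg_array begin

lemma exists_of_positive:
  assumes "0 < prob {R\<in>space N. P R}" "AE R in N. Q R"
  shows "\<exists>R. P R \<and> Q R"
proof (rule ccontr)
  assume no: "\<not> (\<exists>R. P R \<and> Q R)"
  have "AE R in N. \<not> P R" using assms(2)
  proof eventually_elim
    case (elim R)
    then show ?case using no by auto
  qed
  moreover have "{R\<in>space N. P R} \<in> sets N" using assms(1) measure_notin_sets[of _ N] by force
  ultimately have "prob {R\<in>space N. P R} = 0" by (subst prob_eq_0) auto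
  with assms(1) show False by simp
qed

context
  fixes a :: "nat \<Rightarrow> nat \<Rightarrow> real" and top :: "nat \<Rightarrow> real" and e :: real
begin

text \<open>The type of replica i is i mod 3. Overlaps between different types are prescribed up to
  e; inside a type only an upper bound is imposed, since duplication gives no control from
  below.\<close>

definition close :: "nat \<Rightarrow> nat \<Rightarrow> real \<Rightarrow> bool" where
  "close i j r \<longleftrightarrow> (if i mod 3 = j mod 3 then r < top (i mod 3) + e else \<bar>r - a (i mod 3) (j mod 3)\<bar> < e)"

definition pattern :: "nat set \<Rightarrow> (nat \<times> nat \<Rightarrow> real) \<Rightarrow> bool" where
  "pattern A R \<longleftrightarrow> (\<forall>i\<in>A. \<forall>j\<in>A. i \<noteq> j \<longrightarrow> close i j (R (i, j)))"

context
  assumes a_sym: "\<And>s t. a s t = a t s" and a_top: "\<And>s t. s < 3 \<Longrightarrow> t < 3 \<Longrightarrow> s \<noteq> t \<Longrightarrow> a s t \<le> top s"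
begin

lemma close_sym: "close i j r = close j i r"
  unfolding close_def using a_sym[of "i mod 3" "j mod 3"] by auto

lemma measurable_close: "1 \<le> k \<Longrightarrow> 1 \<le> l \<Longrightarrow> {R\<in>space N. close i j (R (k, l))} \<in> sets N"
  unfolding close_def using measurable_entry[of k l]
  by (cases "i mod 3 = j mod 3") (auto intro!: borel_measurable_less borel_measurable_abs borel_measurable_diff)

lemma measurable_pattern: "finite A \<Longrightarrow> A \<subseteq> {1..} \<Longrightarrow> {R\<in>space N. pattern A R} \<in> sets N"
  unfolding pattern_def
  by (intro sets.sets_Collect_finite_All sets.sets_Collect_imp measurable_close sets.sets_Collect_const) auto

text \<open>Replica n - 2 is duplicated, as it has the type of the new replica n + 1. The threshold
  is \<open>top\<close> of this type plus e, which by \<open>a_top\<close> lies above all overlaps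
  that the duplicated replica has with the others, as \<open>duplication\<close> requires.\<close>

lemma pattern_Suc:
  assumes n: "3 \<le> n" and pos: "0 < prob {R\<in>space N. pattern {1..n} R}"
  shows "0 < prob {R\<in>space N. pattern {1..Suc n} R}"
proof -
  define i where "i = n - 2"
  define j where "j = n + 1"
  define A where "A = {1..n} - {i}"
  define W where "W v \<longleftrightarrow> (\<forall>k\<in>A. close k i (v k))" for v
  have "j = i + 3" using n by (simp add: i_def j_def)
  then have ij: "j mod 3 = i mod 3" by simp
  have "n \<in> A" using n by (simp add: A_def i_def)
  then have A: "finite A" "A \<subseteq> {1..}" "A \<noteq> {}" by (auto simp: A_def)
  have i: "1 \<le> i" "i \<notin> A" and j: "1 \<le> j" "j \<notin> A" "j \<noteq> i" using n by (auto simp: A_def i_def j_def)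
  have n1: "{1..n} = insert i A" and n2: "{1..Suc n} = insert j (insert i A)" using n by (auto simp: A_def i_def j_def)
  have m1: "{R\<in>space N. pattern A R} \<in> sets N" by (rule measurable_pattern[OF A(1,2)])
  have m2: "{R\<in>space N. W (\<lambda>a. R (a, b))} \<in> sets N" if "1 \<le> b" for b
    unfolding W_def using A that by (intro sets.sets_Collect_finite_All measurable_close) auto
  have p0: "0 < prob {R\<in>space N. pattern A R \<and> W (\<lambda>a. R (a, i))}"
  proof -
    have "prob {R\<in>space N. pattern {1..n} R} \<le> prob {R\<in>space N. pattern A R \<and> W (\<lambda>a. R (a, i))}"
    proof (rule finite_measure_mono)
      have "pattern A R \<and> W (\<lambda>a. R (a, i))" if "pattern (insert i A) R" for R
        using that i(2) unfolding pattern_def W_def by (metis insertI1 insertI2)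
      then show "{R\<in>space N. pattern {1..n} R} \<subseteq> {R\<in>space N. pattern A R \<and> W (\<lambda>a. R (a, i))}"
        unfolding n1 by blast
      show "{R\<in>space N. pattern A R \<and> W (\<lambda>a. R (a, i))} \<in> sets N"
        by (intro sets.sets_Collect_conj m1 m2 i)
    qed
    with pos show ?thesis by simp
  qed
  have "0 < prob {R\<in>space N. pattern A R \<and> W (\<lambda>a. R (a, i)) \<and> W (\<lambda>a. R (a, j)) \<and> R (i, j) < top (i mod 3) + e}"
  proof (rule duplication[OF A i j])
    show "{R\<in>space N. pattern A R} \<in> sets N" by (rule m1)
    show "{R\<in>space N. W (\<lambda>a. R (a, b))} \<in> sets N" if "1 \<le> b" for b by (rule m2[OF that])
    show "0 < prob {R\<in>space N. pattern A R \<and> W (\<lambda>a. R (a, i))}" by (rule p0)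
    show "pattern A R = pattern A R'" if "\<And>a b. a \<in> A \<Longrightarrow> b \<in> A \<Longrightarrow> R (a, b) = R' (a, b)" for R R'
      unfolding pattern_def using that by auto
    show "W v = W v'" if "\<And>a. a \<in> A \<Longrightarrow> v a = v' a" for v v'
      unfolding W_def using that by auto
    show "v k < top (i mod 3) + e" if "W v" "k \<in> A" for v k
    proof -
      have "close k i (v k)" using that by (simp add: W_def)
      then show ?thesis using a_top[of "i mod 3" "k mod 3"] a_sym[of "i mod 3" "k mod 3"]
        unfolding close_def by (auto split: if_splits simp: abs_less_iff)
    qed
  qed
  also have "\<dots> \<le> prob {R\<in>space N. pattern {1..Suc n} R}"
  proof (rule finite_measure_mono_AE)
    have "AE R in N. \<forall>k\<in>{1..Suc n}. \<forall>l\<in>{1..Suc n}. R (k, l) = R (l, k)"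
      by (intro AE_finite_allI symmetric) auto
    then show "AE R in N. R \<in> {R\<in>space N. pattern A R \<and> W (\<lambda>a. R (a, i)) \<and> W (\<lambda>a. R (a, j)) \<and> R (i, j) < top (i mod 3) + e} \<longrightarrow> R \<in> {R\<in>space N. pattern {1..Suc n} R}"
    proof eventually_elim
      case (elim R)
      have sym: "R (k, l) = R (l, k)" if "k \<in> insert j (insert i A)" "l \<in> insert j (insert i A)" for k l
        using elim that unfolding n2 by blast
      show ?case
      proof (rule impI, safe)
        assume h: "pattern A R" "W (\<lambda>a. R (a, i))" "W (\<lambda>a. R (a, j))" "R (i, j) < top (i mod 3) + e"
        have ci: "close k i (R (k, i))" "close k j (R (k, j))" if "k \<in> A" for k
          using h(2,3) that ij unfolding W_def close_def by auto
        have cij: "close i j (R (i, j))" using h(4) ij unfolding close_def by auto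
        show "pattern {1..Suc n} R"
          unfolding pattern_def n2
        proof (intro ballI impI)
          fix k l assume kl: "k \<in> insert j (insert i A)" "l \<in> insert j (insert i A)" "k \<noteq> l"
          consider "k \<in> A" "l \<in> A" | "k \<in> A" "l = i" | "k \<in> A" "l = j" | "l \<in> A" "k = i" | "l \<in> A" "k = j" | "k = i" "l = j" | "k = j" "l = i"
            using kl by auto
          then show "close k l (R (k, l))"
          proof cases
            case 1 then show ?thesis using h(1) kl by (auto simp: pattern_def)
          next
            case 4 then show ?thesis using ci(1)[of l] sym[OF kl(1,2)] close_sym[of k l] by simp
          next
            case 5 then show ?thesis using ci(2)[of l] sym[OF kl(1,2)] close_sym[of k l] by simp
          next
            case 7 then show ?thesis using cij sym[OF kl(1,2)] close_sym[of k l] by simp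
          qed (use ci cij in auto)
        qed
      qed
    qed
    show "{R\<in>space N. pattern {1..Suc n} R} \<in> sets N" by (rule measurable_pattern) auto
  qed
  finally show ?thesis .
qed

lemma pattern_all:
  assumes "0 < prob {R\<in>space N. pattern {1..3} R}" and "3 \<le> n"
  shows "0 < prob {R\<in>space N. pattern {1..n} R}"
  using assms(2) by (induction n rule: dec_induct) (use assms(1) pattern_Suc in auto)

text \<open>Types q and t have a mutual overlap that their inner overlaps do not exceed by more than
  e. The conclusion fails for suitable s and e as soon as \<open>a p q\<close> is well below
  \<open>a p t\<close>.\<close>

lemma pattern_contradiction:
  assumes init: "0 < prob {R\<in>space N. pattern {1..3} R}"
    and types: "p < 3" "q < 3" "t < 3" "p \<noteq> q" "p \<noteq> t" "q \<noteq> t"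
    and tops: "top q \<le> a q t" "top t \<le> a q t"
    and s: "0 \<le> s" and e: "0 < e" and C: "c \<le> C" "\<bar>a q t\<bar> \<le> C"
  shows "0 \<le> s\<^sup>2 * C + 2 * s * (a p q - a p t + 2 * e) + 5 * e"
proof -
  \<comment> \<open>Groups of this size push the diagonal error of
    \<open>barycenter_inequality\<close> below e, whence 5 e in place of 4 e.\<close>
  obtain m0 :: nat where m0: "2 * (C + C + e) / e < real m0" using reals_Archimedean2 by blast
  define m where "m = max 1 m0"
  have m1: "1 \<le> m" and mm: "2 * (C + C + e) / e \<le> real m" using m0 by (auto simp: m_def)
  have pos: "0 < prob {R\<in>space N. pattern {1..3 * m} R}" using pattern_all[OF init] m1 by simp
  have "AE R in N. \<forall>i\<in>{1..3 * m}. \<forall>j\<in>{1..3 * m}. \<bar>R (i, j)\<bar> \<le> c"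
    by (intro AE_finite_allI bounded_entries) auto
  define G where "G r = {i\<in>{1..3 * m}. i mod 3 = r}" for r
  define U where "U = G p \<union> G q \<union> G t"
  define v where "v i = (if i \<in> G p then s else if i \<in> G q then 1 else -1)" for i
  have fU: "finite U" "U \<subseteq> {1..}" by (auto simp: U_def G_def)
  have "AE R in N. (\<forall>i\<in>{1..3 * m}. \<forall>j\<in>{1..3 * m}. \<bar>R (i, j)\<bar> \<le> c) \<and> 0 \<le> (\<Sum>i\<in>U. \<Sum>j\<in>U. v i * v j * R (i, j))"
    using positive[OF fU] by (intro AE_conjI AE_finite_allI bounded_entries) auto
  from exists_of_positive[OF pos this] obtain R where R: "pattern {1..3 * m} R"
    "\<And>i j. i \<in> {1..3 * m} \<Longrightarrow> j \<in> {1..3 * m} \<Longrightarrow> \<bar>R (i, j)\<bar> \<le> c"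
    "0 \<le> (\<Sum>i\<in>U. \<Sum>j\<in>U. v i * v j * R (i, j))" by blast
  have cl: "close i j (R (i, j))" if "i \<in> {1..3 * m}" "j \<in> {1..3 * m}" "i \<noteq> j" for i j
    using R(1) that unfolding pattern_def by blast
  have diff: "\<bar>R (i, j) - a k l\<bar> < e" if "i \<in> G k" "j \<in> G l" "k \<noteq> l" for i j k l
    using cl[of i j] that unfolding G_def close_def by auto
  have same: "R (i, j) < top k + e" if "i \<in> G k" "j \<in> G k" "i \<noteq> j" for i j k
    using cl[of i j] that unfolding G_def close_def by auto
  have "0 \<le> s\<^sup>2 * c + 2 * s * (a p q - a p t + 2 * e) + 4 * e + 2 * (c + \<bar>a q t\<bar> + e) / real m"
  proof (rule barycenter_inequality[where P="G p" and Q="G q" and T="G t" and v=v and R=R])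
    show "finite (G p)" "finite (G q)" "finite (G t)" by (auto simp: G_def)
    show "G p \<inter> G q = {}" "G p \<inter> G t = {}" "G q \<inter> G t = {}" using types by (auto simp: G_def)
    show "card (G p) = m" "card (G q) = m" "card (G t) = m"
      unfolding G_def by (rule card_residue_class[OF types(1)] card_residue_class[OF types(2)] card_residue_class[OF types(3)])+
    show "\<bar>R (i, j)\<bar> \<le> c" if "i \<in> G p \<union> G q \<union> G t" "j \<in> G p \<union> G q \<union> G t" for i j
      using that by (intro R(2)) (auto simp: G_def)
    show "R (i, j) \<le> a p q + e \<and> R (j, i) \<le> a p q + e" if "i \<in> G p" "j \<in> G q" for i j
      using diff[OF that types(4)] diff[OF that(2,1) types(4)[symmetric]] a_sym[of p q] by linarith
    show "a p t - e \<le> R (i, j) \<and> a p t - e \<le> R (j, i)" if "i \<in> G p" "j \<in> G t" for i j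
      using diff[OF that types(5)] diff[OF that(2,1) types(5)[symmetric]] a_sym[of p t] by linarith
    show "a q t - e \<le> R (i, j) \<and> a q t - e \<le> R (j, i)" if "i \<in> G q" "j \<in> G t" for i j
      using diff[OF that types(6)] diff[OF that(2,1) types(6)[symmetric]] a_sym[of q t] by linarith
    show "R (i, j) \<le> a q t + e" if "i \<in> G q" "j \<in> G q" "i \<noteq> j" for i j
      using same[OF that] tops by linarith
    show "R (i, j) \<le> a q t + e" if "i \<in> G t" "j \<in> G t" "i \<noteq> j" for i j
      using same[OF that] tops by linarith
    show "0 \<le> (\<Sum>i\<in>G p \<union> G q \<union> G t. \<Sum>j\<in>G p \<union> G q \<union> G t. v i * v j * R (i, j))" using R(3) by (simp only: U_def)
    show "v i = s" if "i \<in> G p" for i using that by (simp add: v_def)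
    show "v i = 1" if "i \<in> G q" for i using that types by (auto simp: v_def G_def)
    show "v i = - 1" if "i \<in> G t" for i using that types by (auto simp: v_def G_def)
  qed (use s e m1 in auto)
  also have "\<dots> \<le> s\<^sup>2 * C + 2 * s * (a p q - a p t + 2 * e) + 4 * e + e"
  proof (intro add_mono order_refl mult_left_mono C)
    have "2 * (c + \<bar>a q t\<bar> + e) / real m \<le> 2 * (C + C + e) / real m"
      using C by (intro divide_right_mono) auto
    also have "\<dots> \<le> e"
    proof -
      have "2 * (C + C + e) \<le> e * real m" using mm e by (simp add: pos_divide_le_eq mult.commute)
      then show ?thesis using m1 by (simp add: pos_divide_le_eq)
    qed
    finally show "2 * (c + \<bar>a q t\<bar> + e) / real m \<le> e" .
  qed simp
  finally show ?thesis by simp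
qed

end

end

text \<open>A violation by \<theta> with positive probability falls, with positive probability, into
  one cell of a grid of mesh e. The cell fixes the three overlaps up to e and starts the pattern on
  replicas 1, 2, 3.\<close>

lemma gap_null:
  assumes th: "0 < \<theta>"
  shows "prob {R\<in>space N. R (1, 2) + \<theta> < R (1, 3) \<and> R (1, 2) + \<theta> < R (2, 3)} = 0"
proof (rule ccontr)
  assume ne: "prob {R\<in>space N. R (1, 2) + \<theta> < R (1, 3) \<and> R (1, 2) + \<theta> < R (2, 3)} \<noteq> 0"
  define C where "C = \<bar>c\<bar> + 1 + \<theta>"
  have C0: "0 < C" using th by (simp add: C_def)
  \<comment> \<open>The first bound keeps x - w + 2 e below - \<theta> / 2 for w = y, z. The second
    makes 5 e at most \<theta>^2 / (8 C), half of the gain \<theta>^2 / (4 C) obtained in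
    \<open>fin\<close>.\<close>
  define e where "e = min (\<theta> / 8) (\<theta>\<^sup>2 / (40 * C))"
  have e0: "0 < e" using th C0 by (simp add: e_def)
  have e8: "e \<le> \<theta> / 8" "e \<le> \<theta>\<^sup>2 / (40 * C)" by (simp_all add: e_def)
  define Bx where "Bx k R \<longleftrightarrow> (R (1, 2) + \<theta> < R (1, 3) \<and> R (1, 2) + \<theta> < R (2, 3)) \<and>
      \<lfloor>R (1, 2) / e\<rfloor> = fst k \<and> \<lfloor>R (1, 3) / e\<rfloor> = fst (snd k) \<and> \<lfloor>R (2, 3) / e\<rfloor> = snd (snd k)" for k :: "int \<times> int \<times> int" and R :: "nat \<times> nat \<Rightarrow> real"
  have me[measurable]: "(\<lambda>R. R (1, 2)) \<in> borel_measurable N" "(\<lambda>R. R (1, 3)) \<in> borel_measurable N" "(\<lambda>R. R (2, 3)) \<in> borel_measurable N"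
    by (rule measurable_entry; simp)+
  have mg: "{R\<in>space N. R (1, 2) + \<theta> < R (1, 3) \<and> R (1, 2) + \<theta> < R (2, 3)} \<in> sets N" by measurable
  have mB: "{R\<in>space N. Bx k R} \<in> sets N" for k unfolding Bx_def by measurable
  have "\<exists>k. prob {R\<in>space N. Bx k R} \<noteq> 0"
  proof (rule ccontr)
    assume "\<not> ?thesis"
    then have "AE R in N. \<not> Bx k R" for k using prob_Collect_eq_0[OF mB[of k]] by blast
    then have "AE R in N. \<forall>k. \<not> Bx k R" by (simp add: AE_all_countable)
    then have "AE R in N. \<not> (R (1, 2) + \<theta> < R (1, 3) \<and> R (1, 2) + \<theta> < R (2, 3))"
      by eventually_elim (auto simp: Bx_def)
    then show False using ne prob_Collect_eq_0[OF mg] by blast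
  qed
  then obtain k where k: "0 < prob {R\<in>space N. Bx k R}" by (metis zero_less_measure_iff)
  define x where "x = e * of_int (fst k)"
  define y where "y = e * of_int (fst (snd k))"
  define z where "z = e * of_int (snd (snd k))"
  have fl: "e * of_int l \<le> r \<and> r < e * of_int l + e" if "\<lfloor>r / e\<rfloor> = l" for r l
  proof -
    have "of_int l \<le> r / e" "r / e < of_int l + 1" using that by linarith+
    then show ?thesis using e0 by (simp add: pos_le_divide_eq pos_divide_less_eq algebra_simps)
  qed
  have bx: "x \<le> R (1, 2) \<and> R (1, 2) < x + e \<and> y \<le> R (1, 3) \<and> R (1, 3) < y + e \<and> z \<le> R (2, 3) \<and> R (2, 3) < z + e" if "Bx k R" for R
  proof -
    have "\<lfloor>R (1, 2) / e\<rfloor> = fst k" "\<lfloor>R (1, 3) / e\<rfloor> = fst (snd k)" "\<lfloor>R (2, 3) / e\<rfloor> = snd (snd k)"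
      using that unfolding Bx_def by blast+
    from this[THEN fl] show ?thesis unfolding x_def y_def z_def by blast
  qed
  have "AE R in N. \<bar>R (1, 3)\<bar> \<le> c \<and> \<bar>R (2, 3)\<bar> \<le> c"
    by (intro AE_conjI bounded_entries) auto
  from exists_of_positive[OF k this] obtain R0 where R0: "Bx k R0" "\<bar>R0 (1, 3)\<bar> \<le> c" "\<bar>R0 (2, 3)\<bar> \<le> c" by blast
  have g: "x + \<theta> < R0 (1, 3)" "x + \<theta> < R0 (2, 3)" using R0(1) bx[OF R0(1)] unfolding Bx_def by linarith+
  have xy: "x < y - \<theta> + e" and xz: "x < z - \<theta> + e" using g bx[OF R0(1)] by linarith+
  have yC: "\<bar>y\<bar> \<le> C" "\<bar>z\<bar> \<le> C" "c \<le> C" using bx[OF R0(1)] R0(2,3) e8 th by (auto simp: C_def abs_le_iff)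
  \<comment> \<open>Replicas 1, 2, 3 have types 1, 2, 0, so the sum of two different types
    identifies the pair.\<close>
  define a where "a s t = (if s + t = 3 then x else if s + t = 1 then y else z)" for s t :: nat
  \<comment> \<open>For each type, the largest overlap with another type; x is below both y and
    z.\<close>
  define top where "top s = (if s = 0 then max y z else if s = 1 then y else z)" for s :: nat
  have a_sym: "a s t = a t s" for s t by (simp add: a_def add.commute)
  have xle: "x \<le> y" "x \<le> z" using xy xz e8 th by linarith+
  have a_top: "a s t \<le> top s" if "s < 3" "t < 3" "s \<noteq> t" for s t
  proof -
    have "s = 0 \<or> s = 1 \<or> s = 2" "t = 0 \<or> t = 1 \<or> t = 2" using that by auto
    then show ?thesis using that(3) xle by (auto simp: a_def top_def)
  qed
  have l3: "{1..3} = {1, 2, 3::nat}" by auto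
  have init: "0 < prob {R\<in>space N. pattern a top e {1..3} R}"
  proof -
    have "prob {R\<in>space N. Bx k R} \<le> prob {R\<in>space N. pattern a top e {1..3} R}"
    proof (rule finite_measure_mono_AE)
      have "AE R in N. R (2, 1) = R (1, 2) \<and> R (3, 1) = R (1, 3) \<and> R (3, 2) = R (2, 3)"
        by (intro AE_conjI symmetric) auto
      then show "AE R in N. R \<in> {R\<in>space N. Bx k R} \<longrightarrow> R \<in> {R\<in>space N. pattern a top e {1..3} R}"
      proof eventually_elim
        case (elim R)
        show ?case
        proof (rule impI, safe)
          assume "Bx k R"
          note b = bx[OF this]
          show "pattern a top e {1..3} R"
            unfolding pattern_def close_def l3
            using b elim by (auto simp: a_def abs_less_iff)
        qed
      qed
      show "{R\<in>space N. pattern a top e {1..3} R} \<in> sets N"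
        by (rule measurable_pattern[OF a_sym a_top]) auto
    qed
    with k show ?thesis by simp
  qed
  \<comment> \<open>The minimizer of s^2 C - s \<theta>, with minimum - \<theta>^2 / (4 C).\<close>
  define s where "s = \<theta> / (2 * C)"
  have s0: "0 < s" using th C0 by (simp add: s_def)
  have fin: "s\<^sup>2 * C + 2 * s * (x - w + 2 * e) + 5 * e < 0" if "x < w - \<theta> + e" for w
  proof -
    have "2 * s * (x - w + 2 * e) \<le> 2 * s * (- \<theta> / 2)" using s0 that e8 th by (intro mult_left_mono) auto
    moreover have "s\<^sup>2 * C + 2 * s * (- \<theta> / 2) = - (\<theta>\<^sup>2 / (4 * C))"
      using C0 by (simp add: s_def power2_eq_square field_simps)
    moreover have "5 * e \<le> \<theta>\<^sup>2 / (8 * C)" using e8(2) by simp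
    moreover have "\<theta>\<^sup>2 / (8 * C) < \<theta>\<^sup>2 / (4 * C)" using th C0 by (intro divide_strict_left_mono) auto
    ultimately show ?thesis by linarith
  qed
  show False
  \<comment> \<open>The two types with the largest mutual overlap become Q and T, and the third
    becomes P. Type 0 is always T: its overlap with P is the smaller of y and z, while P and Q have
    overlap x.\<close>
  proof (cases "y \<le> z")
    case True
    have "0 \<le> s\<^sup>2 * C + 2 * s * (a 1 2 - a 1 0 + 2 * e) + 5 * e"
      by (rule pattern_contradiction[OF a_sym a_top init]) (use True s0 e0 yC in \<open>auto simp: a_def top_def\<close>)
    then show False using fin[OF xy] by (simp add: a_def)
  next
    case False
    have "0 \<le> s\<^sup>2 * C + 2 * s * (a 2 1 - a 2 0 + 2 * e) + 5 * e"
      by (rule pattern_contradiction[OF a_sym a_top init]) (use False s0 e0 yC in \<open>auto simp: a_def top_def\<close>)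
    then show False using fin[OF xz] by (simp add: a_def)
  qed
qed

theorem ultrametric: "ultrametric_law N"
proof -
  have me[measurable]: "(\<lambda>R. R (1, 2)) \<in> borel_measurable N" "(\<lambda>R. R (1, 3)) \<in> borel_measurable N" "(\<lambda>R. R (2, 3)) \<in> borel_measurable N"
    by (rule measurable_entry; simp)+
  have "AE R in N. \<not> (R (1, 2) + 1 / real (Suc k) < R (1, 3) \<and> R (1, 2) + 1 / real (Suc k) < R (2, 3))" for k
  proof (subst prob_Collect_eq_0[symmetric])
    show "{R\<in>space N. R (1, 2) + 1 / real (Suc k) < R (1, 3) \<and> R (1, 2) + 1 / real (Suc k) < R (2, 3)} \<in> sets N" by measurable
    show "prob {R\<in>space N. R (1, 2) + 1 / real (Suc k) < R (1, 3) \<and> R (1, 2) + 1 / real (Suc k) < R (2, 3)} = 0"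
      by (rule gap_null) simp
  qed
  then have "AE R in N. \<forall>k. \<not> (R (1, 2) + 1 / real (Suc k) < R (1, 3) \<and> R (1, 2) + 1 / real (Suc k) < R (2, 3))"
    by (simp add: AE_all_countable)
  then have ae: "AE R in N. min (R (1, 3)) (R (2, 3)) \<le> R (1, 2)"
  proof eventually_elim
    case (elim R)
    show ?case
    proof (rule ccontr)
      assume "\<not> ?thesis"
      then have "0 < min (R (1, 3)) (R (2, 3)) - R (1, 2)" by linarith
      then obtain k where "inverse (real (Suc k)) < min (R (1, 3)) (R (2, 3)) - R (1, 2)" using reals_Archimedean by blast
      then show False using elim[rule_format, of k] by (auto simp: inverse_eq_divide)
    qed
  qed
  have "(\<integral>R. indicator {R. R (1, 2) \<ge> min (R (1, 3)) (R (2, 3))} R \<partial>N) = (\<integral>R. (1::real) \<partial>N)"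
  proof (rule integral_cong_AE)
    have "(\<lambda>R. if min (R (1, 3)) (R (2, 3)) \<le> R (1, 2) then 1 else 0 :: real) \<in> borel_measurable N" by measurable
    also have "(\<lambda>R. if min (R (1, 3)) (R (2, 3)) \<le> R (1, 2) then 1 else 0 :: real) = indicator {R. R (1, 2) \<ge> min (R (1, 3)) (R (2, 3))}"
      by (auto simp: fun_eq_iff indicator_def)
    finally show "indicat_real {R. R (1, 2) \<ge> min (R (1, 3)) (R (2, 3))} \<in> borel_measurable N" .
    show "AE R in N. indicator {R. R (1, 2) \<ge> min (R (1, 3)) (R (2, 3))} R = (1::real)"
      using ae by eventually_elim auto
  qed simp
  then show ?thesis unfolding ultrametric_law_def by (simp add: prob_space)
qed

end

section \<open>The spin glass model and the limits of its overlap arrays\<close>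

subsection \<open>Replicas of a finite Gibbs measure\<close>

text \<open>On the product space a function of the first n coordinates is a finite combination of
  indicators of cylinders, whose probabilities are products of weights.\<close>

lemma integral_PiM_point_measure:
  fixes F :: "(nat \<Rightarrow> 's) \<Rightarrow> real" and w :: "'s \<Rightarrow> real"
  assumes S: "finite S" and w: "\<And>s. s \<in> S \<Longrightarrow> 0 \<le> w s" "(\<Sum>s\<in>S. w s) = 1"
    and F: "\<And>s s'. (\<And>l. l \<in> {1..n} \<Longrightarrow> s l = s' l) \<Longrightarrow> F s = F s'"
  shows "(\<integral>s. F s \<partial>(PiM {1..} (\<lambda>_. point_measure S (\<lambda>s. ennreal (w s))))) =
    (\<Sum>s\<in>replicas S n. F s * (\<Prod>l\<in>{1..n}. w (s l)))"
proof -
  define K where "K = point_measure S (\<lambda>s. ennreal (w s))"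
  have eK: "emeasure K {s} = ennreal (w s)" if "s \<in> S" for s
    unfolding K_def using that S by (subst emeasure_point_measure_finite) auto
  have sK: "space K = S" by (simp add: K_def space_point_measure)
  have setsK: "sets K = Pow S" by (simp add: K_def sets_point_measure)
  have pK: "prob_space K"
  proof
    have "emeasure K (space K) = (\<Sum>s\<in>S. ennreal (w s))"
      unfolding sK unfolding K_def using S by (subst emeasure_point_measure_finite) auto
    also have "\<dots> = ennreal 1" using w by (subst sum_ennreal) auto
    finally show "emeasure K (space K) = 1" by simp
  qed
  interpret K: prob_space K by (rule pK)
  interpret P: product_prob_space "\<lambda>_::nat. K" "{1..}" ..
  let ?P = "PiM {1::nat..} (\<lambda>_. K)"
  have sP: "space ?P = {1..} \<rightarrow>\<^sub>E S" by (simp add: space_PiM sK)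
  define C where "C r = prod_emb {1..} (\<lambda>_. K) {1..n} (\<Pi>\<^sub>E l\<in>{1..n}. {r l})" for r :: "nat \<Rightarrow> 's"
  have Cmem: "s \<in> C r \<longleftrightarrow> (\<forall>l\<in>{1..n}. s l = r l)" if "s \<in> space ?P" for s r
    using that unfolding C_def prod_emb_def sP sK by (auto simp: PiE_iff restrict_def extensional_def)
  have Cm: "C r \<in> sets ?P" "measure ?P (C r) = (\<Prod>l\<in>{1..n}. w (r l))" if r: "r \<in> replicas S n" for r
  proof -
    have rS: "r l \<in> S" if "l \<in> {1..n}" for l using r that by (auto simp: replicas_def PiE_iff)
    have "emeasure ?P (C r) = (\<Prod>l\<in>{1..n}. emeasure K {r l})"
      unfolding C_def by (rule P.emeasure_PiM_emb) (use rS setsK in auto)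
    also have "\<dots> = (\<Prod>l\<in>{1..n}. ennreal (w (r l)))" by (intro prod.cong refl eK rS)
    also have "\<dots> = ennreal (\<Prod>l\<in>{1..n}. w (r l))" by (rule prod_ennreal) (use w rS in auto)
    finally have e: "emeasure ?P (C r) = ennreal (\<Prod>l\<in>{1..n}. w (r l))" .
    have "0 \<le> (\<Prod>l\<in>{1..n}. w (r l))" by (rule prod_nonneg) (use w rS in auto)
    then show "measure ?P (C r) = (\<Prod>l\<in>{1..n}. w (r l))"
      unfolding measure_def e by (rule enn2real_ennreal)
    show "C r \<in> sets ?P" unfolding C_def by (rule sets_PiM_I) (use rS setsK in auto)
  qed
  have fr: "finite (replicas S n)" unfolding replicas_def using S by (intro finite_PiE) auto
  have dec: "F s = (\<Sum>r\<in>replicas S n. F r * indicator (C r) s)" if s: "s \<in> space ?P" for s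
  proof -
    define r0 where "r0 = restrict s {1..n}"
    have r0: "r0 \<in> replicas S n" using s unfolding r0_def replicas_def sP by (auto simp: PiE_iff)
    have "indicator (C r) s = (if r = r0 then 1 else 0 :: real)" if "r \<in> replicas S n" for r
    proof -
      have "r = r0 \<longleftrightarrow> (\<forall>l\<in>{1..n}. s l = r l)"
        using that unfolding r0_def replicas_def by (auto simp: PiE_iff extensional_def fun_eq_iff restrict_def)
      then show ?thesis using Cmem[OF s] by (simp add: indicator_def)
    qed
    then have "(\<Sum>r\<in>replicas S n. F r * indicator (C r) s) = (\<Sum>r\<in>replicas S n. if r = r0 then F r else 0)"
      by (intro sum.cong refl) auto
    also have "\<dots> = F r0" using fr r0 by simp
    also have "\<dots> = F s" by (rule F) (simp add: r0_def)
    finally show ?thesis ..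
  qed
  have "(\<integral>s. F s \<partial>?P) = (\<integral>s. (\<Sum>r\<in>replicas S n. F r * indicator (C r) s) \<partial>?P)"
    by (rule Bochner_Integration.integral_cong[OF refl dec])
  also have "\<dots> = (\<Sum>r\<in>replicas S n. F r * (\<integral>s. indicator (C r) s \<partial>?P))"
  proof -
    have "integrable ?P (\<lambda>s. F r * indicator (C r) s)" if "r \<in> replicas S n" for r
      using Cm(1)[OF that] by (intro integrable_mult_right P.integrable_const_bound[where B=1]) (auto simp: indicator_def)
    then show ?thesis by (subst Bochner_Integration.integral_sum) auto
  qed
  also have "\<dots> = (\<Sum>r\<in>replicas S n. F r * (\<Prod>l\<in>{1..n}. w (r l)))"
    using Cm by (intro sum.cong refl) simp
  finally show ?thesis unfolding K_def .
qed

subsection \<open>The spin glass model\<close>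

locale spin_glass = prob_space M for M :: "'w measure" +
  fixes \<Delta> :: "'a set \<Rightarrow> 'a set \<Rightarrow> real" and J :: "'a set \<Rightarrow> 'a set \<Rightarrow> 'w \<Rightarrow> real"
    and H :: "nat \<Rightarrow> 'a set \<Rightarrow> ('a \<Rightarrow> real) \<Rightarrow> 'w \<Rightarrow> real" and c :: real
  assumes J_indep: "\<And>\<Lambda>. finite \<Lambda> \<Longrightarrow> \<Lambda> \<noteq> {} \<Longrightarrow> indep_vars (\<lambda>_. borel) (J \<Lambda>) (Pow \<Lambda>)"
    and J_gaussian: "\<And>\<Lambda> X. finite \<Lambda> \<Longrightarrow> \<Lambda> \<noteq> {} \<Longrightarrow> X \<subseteq> \<Lambda> \<Longrightarrow> centered_gaussian M (J \<Lambda> X) ((\<Delta> \<Lambda> X)\<^sup>2)"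
    and c_pos: "0 < c"
    and stability: "\<And>\<Lambda>. finite \<Lambda> \<Longrightarrow> \<Lambda> \<noteq> {} \<Longrightarrow> (1 / real (card \<Lambda>)) * (\<Sum>X\<in>Pow \<Lambda>. (\<Delta> \<Lambda> X)\<^sup>2) \<le> c"
    and H_gaussian: "\<And>p \<Lambda>. 1 \<le> p \<Longrightarrow> finite \<Lambda> \<Longrightarrow> \<Lambda> \<noteq> {} \<Longrightarrow> centered_gaussian_family M (configs \<Lambda>) (H p \<Lambda>)"
    and H_covariance: "\<And>p \<Lambda> \<sigma> \<tau>. 1 \<le> p \<Longrightarrow> finite \<Lambda> \<Longrightarrow> \<Lambda> \<noteq> {} \<Longrightarrow> \<sigma> \<in> configs \<Lambda> \<Longrightarrow> \<tau> \<in> configs \<Lambda> \<Longrightarrow>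
          (1 / real (card \<Lambda>)) * expectation (\<lambda>\<omega>. H p \<Lambda> \<sigma> \<omega> * H p \<Lambda> \<tau> \<omega>) = (overlap M J \<Lambda> \<sigma> \<tau>) ^ p"
    and H_indep: "\<And>\<Lambda>. finite \<Lambda> \<Longrightarrow> \<Lambda> \<noteq> {} \<Longrightarrow>
          indep_vars (\<lambda>_. PiM (configs \<Lambda>) (\<lambda>_. borel)) (\<lambda>p \<omega>. \<lambda>\<sigma>\<in>configs \<Lambda>. H p \<Lambda> \<sigma> \<omega>) {1..}"
begin

definition level :: "'a set \<Rightarrow> nat \<Rightarrow> ('a \<Rightarrow> real) \<Rightarrow> 'w \<Rightarrow> real" where
  "level \<Lambda> p \<sigma> \<omega> = inverse (sqrt c ^ Suc p) * H (Suc p) \<Lambda> \<sigma> \<omega>"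

context
  fixes \<Lambda> :: "'a set"
  assumes L: "finite \<Lambda>" "\<Lambda> \<noteq> {}"
begin

lemma overlap_sum:
  "overlap M J \<Lambda> s t = (1 / real (card \<Lambda>)) * (\<Sum>X\<in>Pow \<Lambda>. (\<Delta> \<Lambda> X)\<^sup>2 * spin_prod s X * spin_prod t X)"
  by (rule overlap_eq_sum[OF prob_space_axioms L(1)]) (use J_indep J_gaussian L in auto)

lemma spin_prod_cases: "\<sigma> \<in> configs \<Lambda> \<Longrightarrow> X \<subseteq> \<Lambda> \<Longrightarrow> spin_prod \<sigma> X \<in> {-1, 1}"
proof -
  assume s: "\<sigma> \<in> configs \<Lambda>" and X: "X \<subseteq> \<Lambda>"
  have "finite X" using X L(1) by (rule finite_subset)
  then show ?thesis using X
  proof (induction X)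
    case (insert x X)
    have "\<sigma> x \<in> {-1, 1}" using s insert.prems by (auto simp: configs_def PiE_iff)
    then show ?case using insert by (auto simp: spin_prod_def)
  qed (simp add: spin_prod_def)
qed

lemma overlap_abs_le: "s \<in> configs \<Lambda> \<Longrightarrow> t \<in> configs \<Lambda> \<Longrightarrow> \<bar>overlap M J \<Lambda> s t\<bar> \<le> c"
proof -
  assume st: "s \<in> configs \<Lambda>" "t \<in> configs \<Lambda>"
  have "\<bar>\<Sum>X\<in>Pow \<Lambda>. (\<Delta> \<Lambda> X)\<^sup>2 * spin_prod s X * spin_prod t X\<bar> \<le> (\<Sum>X\<in>Pow \<Lambda>. (\<Delta> \<Lambda> X)\<^sup>2)"
  proof (rule order_trans[OF sum_abs sum_mono])
    fix X assume "X \<in> Pow \<Lambda>"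
    then have "spin_prod s X \<in> {-1, 1}" "spin_prod t X \<in> {-1, 1}" using spin_prod_cases st by auto
    then show "\<bar>(\<Delta> \<Lambda> X)\<^sup>2 * spin_prod s X * spin_prod t X\<bar> \<le> (\<Delta> \<Lambda> X)\<^sup>2" by auto
  qed
  then have "\<bar>overlap M J \<Lambda> s t\<bar> \<le> (1 / real (card \<Lambda>)) * (\<Sum>X\<in>Pow \<Lambda>. (\<Delta> \<Lambda> X)\<^sup>2)"
    unfolding overlap_sum by (simp add: abs_mult divide_right_mono)
  then show ?thesis using stability[OF L] by linarith
qed

lemma overlap_commute: "overlap M J \<Lambda> s t = overlap M J \<Lambda> t s"
  unfolding overlap_sum by (simp add: mult_ac)

text \<open>Spin products square to 1. The resulting constancy of the self-overlap provides the D of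
  \<open>finite_volume_Ghirlanda_Guerra\<close>.\<close>

lemma overlap_diagonal: "s \<in> configs \<Lambda> \<Longrightarrow> overlap M J \<Lambda> s s = (1 / real (card \<Lambda>)) * (\<Sum>X\<in>Pow \<Lambda>. (\<Delta> \<Lambda> X)\<^sup>2)"
proof -
  assume s: "s \<in> configs \<Lambda>"
  have "(\<Delta> \<Lambda> X)\<^sup>2 * spin_prod s X * spin_prod s X = (\<Delta> \<Lambda> X)\<^sup>2" if "X \<in> Pow \<Lambda>" for X
    using spin_prod_cases[OF s, of X] that by auto
  then show ?thesis unfolding overlap_sum by (intro arg_cong2[where f=times] sum.cong refl)
qed

text \<open>Expanding the overlaps over the sets X gives a combination of squares with nonnegative
  coefficients.\<close>

lemma overlap_positive:
  "0 \<le> (\<Sum>i\<in>A. \<Sum>j\<in>A. v i * v j * overlap M J \<Lambda> (s i) (s j))"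
proof -
  have "(\<Sum>i\<in>A. \<Sum>j\<in>A. v i * v j * overlap M J \<Lambda> (s i) (s j)) =
    (1 / real (card \<Lambda>)) * (\<Sum>i\<in>A. \<Sum>j\<in>A. \<Sum>X\<in>Pow \<Lambda>. (\<Delta> \<Lambda> X)\<^sup>2 * ((v i * spin_prod (s i) X) * (v j * spin_prod (s j) X)))"
    unfolding overlap_sum by (simp add: sum_distrib_left mult_ac)
  also have "(\<Sum>i\<in>A. \<Sum>j\<in>A. \<Sum>X\<in>Pow \<Lambda>. (\<Delta> \<Lambda> X)\<^sup>2 * ((v i * spin_prod (s i) X) * (v j * spin_prod (s j) X)))
    = (\<Sum>X\<in>Pow \<Lambda>. (\<Delta> \<Lambda> X)\<^sup>2 * (\<Sum>i\<in>A. v i * spin_prod (s i) X)\<^sup>2)"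
  proof -
    have "(\<Sum>i\<in>A. \<Sum>j\<in>A. \<Sum>X\<in>Pow \<Lambda>. (\<Delta> \<Lambda> X)\<^sup>2 * ((v i * spin_prod (s i) X) * (v j * spin_prod (s j) X)))
      = (\<Sum>i\<in>A. \<Sum>X\<in>Pow \<Lambda>. \<Sum>j\<in>A. (\<Delta> \<Lambda> X)\<^sup>2 * ((v i * spin_prod (s i) X) * (v j * spin_prod (s j) X)))"
      by (intro sum.cong refl sum.swap)
    also have "\<dots> = (\<Sum>X\<in>Pow \<Lambda>. \<Sum>i\<in>A. \<Sum>j\<in>A. (\<Delta> \<Lambda> X)\<^sup>2 * ((v i * spin_prod (s i) X) * (v j * spin_prod (s j) X)))"
      by (rule sum.swap)
    finally show ?thesis unfolding power2_eq_square[of "sum _ _"] sum_product by (simp only: sum_distrib_left)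
  qed
  also have "0 \<le> (1 / real (card \<Lambda>)) * \<dots>" by (intro mult_nonneg_nonneg sum_nonneg) auto
  finally show ?thesis .
qed

lemma finite_configs: "finite (configs \<Lambda>)"
  unfolding configs_def using L(1) by (intro finite_PiE) auto

lemma gaussian_levels: "gaussian_levels M (configs \<Lambda>) (real (card \<Lambda>)) (\<lambda>s t. overlap M J \<Lambda> s t / c) (level \<Lambda>)"
proof (intro_locales, unfold_locales)
  have cd: "1 \<le> card \<Lambda>" using L by (simp add: Suc_le_eq card_gt_0_iff)
  show "finite (configs \<Lambda>)" by (rule finite_configs)
  show "configs \<Lambda> \<noteq> {}" unfolding configs_def by (simp add: PiE_eq_empty_iff)
  show "1 \<le> real (card \<Lambda>)" using cd by simp
  have "card (configs \<Lambda>) = 2 ^ card \<Lambda>" unfolding configs_def using L(1) by (simp add: card_PiE numeral_2_eq_2)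
  also have "real (2 ^ card \<Lambda>) \<le> exp 1 ^ card \<Lambda>"
    using exp_ge_add_one_self[of 1] by (simp add: power_mono)
  also have "\<dots> = exp (real (card \<Lambda>))" by (simp add: exp_of_nat_mult[symmetric])
  finally show "real (card (configs \<Lambda>)) \<le> exp (real (card \<Lambda>))" .
  show "\<bar>overlap M J \<Lambda> s t / c\<bar> \<le> 1" if "s \<in> configs \<Lambda>" "t \<in> configs \<Lambda>" for s t
    using overlap_abs_le[OF that] c_pos by simp
  show "centered_gaussian_family M (configs \<Lambda>) (level \<Lambda> p)" for p
    unfolding centered_gaussian_family_def
  proof (intro allI impI)
    fix F and a :: "('a \<Rightarrow> real) \<Rightarrow> real" assume F: "finite F \<and> F \<subseteq> configs \<Lambda>"
    have "\<exists>v. centered_gaussian M (\<lambda>\<omega>. \<Sum>i\<in>F. (a i * inverse (sqrt c ^ Suc p)) * H (Suc p) \<Lambda> i \<omega>) v"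
      using H_gaussian[OF _ L, of "Suc p"] F unfolding centered_gaussian_family_def by auto
    then show "\<exists>v. centered_gaussian M (\<lambda>\<omega>. \<Sum>i\<in>F. a i * level \<Lambda> p i \<omega>) v"
      unfolding level_def by (simp add: mult.assoc)
  qed
  show "expectation (\<lambda>x. level \<Lambda> p s x * level \<Lambda> p t x) = real (card \<Lambda>) * (overlap M J \<Lambda> s t / c) ^ Suc p"
    if st: "s \<in> configs \<Lambda>" "t \<in> configs \<Lambda>" for p s t
  proof -
    define k where "k = inverse (sqrt c ^ Suc p)"
    have kk: "k * k = inverse (c ^ Suc p)"
      unfolding k_def inverse_mult_distrib[symmetric] power_mult_distrib[symmetric] using c_pos by simp
    have "expectation (\<lambda>x. level \<Lambda> p s x * level \<Lambda> p t x) = expectation (\<lambda>x. (k * k) * (H (Suc p) \<Lambda> s x * H (Suc p) \<Lambda> t x))"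
      unfolding level_def k_def by (simp only: mult_ac)
    also have "\<dots> = inverse (c ^ Suc p) * expectation (\<lambda>x. H (Suc p) \<Lambda> s x * H (Suc p) \<Lambda> t x)"
      unfolding kk by simp
    also have "expectation (\<lambda>x. H (Suc p) \<Lambda> s x * H (Suc p) \<Lambda> t x) = real (card \<Lambda>) * overlap M J \<Lambda> s t ^ Suc p"
      using H_covariance[OF _ L st, of "Suc p"] cd by (simp add: field_simps del: power_Suc)
    finally show ?thesis by (simp only: power_divide) (simp add: field_simps del: power_Suc)
  qed
  let ?P = "PiM (configs \<Lambda>) (\<lambda>_. borel :: real measure)"
  define X where "X p \<omega> = (\<lambda>\<sigma>\<in>configs \<Lambda>. H p \<Lambda> \<sigma> \<omega>)" for p \<omega>
  \<comment> \<open>The levels are reindexed from {1..} to all of nat by grouping them into the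
    disjoint singletons {Suc j}.\<close>
  have "indep_vars (\<lambda>j. PiM {Suc j} (\<lambda>_. ?P)) (\<lambda>j \<omega>. \<lambda>i\<in>{Suc j}. X i \<omega>) UNIV"
    unfolding X_def by (rule indep_vars_restrict[OF H_indep[OF L]]) (auto simp: disjoint_family_on_def)
  note ind = this
  have "indep_vars (\<lambda>_. ?P) (\<lambda>p x. \<lambda>\<sigma>\<in>configs \<Lambda>. inverse (sqrt c ^ Suc p) * (\<lambda>i\<in>{Suc p}. X i x) (Suc p) \<sigma>) UNIV"
  proof (rule indep_vars_compose2[OF ind, where Y="\<lambda>p f. \<lambda>\<sigma>\<in>configs \<Lambda>. inverse (sqrt c ^ Suc p) * f (Suc p) \<sigma>" and N="\<lambda>_. ?P"])
    fix p
    show "(\<lambda>f. \<lambda>\<sigma>\<in>configs \<Lambda>. inverse (sqrt c ^ Suc p) * f (Suc p) \<sigma>) \<in> measurable (PiM {Suc p} (\<lambda>_. ?P)) ?P"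
    proof (intro measurable_restrict borel_measurable_times borel_measurable_const)
      fix \<sigma> assume "\<sigma> \<in> configs \<Lambda>"
      then show "(\<lambda>f. f (Suc p) \<sigma>) \<in> borel_measurable (PiM {Suc p} (\<lambda>_. ?P))"
        by (intro measurable_compose[OF measurable_component_singleton[of "Suc p" "{Suc p}" "\<lambda>_. ?P"] measurable_component_singleton]) auto
    qed
  qed
  then show "indep_vars (\<lambda>_. ?P) (\<lambda>p x. \<lambda>s\<in>configs \<Lambda>. level \<Lambda> p s x) UNIV"
    by (simp add: level_def X_def cong: restrict_cong)
qed

interpretation G: gaussian_levels M "configs \<Lambda>" "real (card \<Lambda>)" "\<lambda>s t. overlap M J \<Lambda> s t / c" "level \<Lambda>"
  by (rule gaussian_levels)

abbreviation shift :: "(nat \<Rightarrow> real) \<Rightarrow> nat \<Rightarrow> real" where "shift \<beta> \<equiv> \<lambda>p. \<beta> (Suc p)"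

lemma complete_hamiltonian_eq: "complete_hamiltonian c H \<Lambda> \<beta> \<sigma> \<omega> = G.T (shift \<beta>) \<sigma> \<omega>"
  unfolding complete_hamiltonian_def G.T_def level_def by (simp only: mult_ac)

lemma partition_function_eq: "partition_function c H \<Lambda> \<beta> \<omega> = sum_exp (configs \<Lambda>) (\<lambda>\<sigma>. G.T (shift \<beta>) \<sigma> \<omega>)"
  unfolding partition_function_def sum_exp_def complete_hamiltonian_eq ..

lemma pressure_eq: "pressure M c H \<Lambda> \<beta> = expectation (G.F (shift \<beta>)) / real (card \<Lambda>)"
  unfolding pressure_def partition_function_eq G.F_def[abs_def] by simp

lemma gibbs_eq: "gibbs c H \<Lambda> \<beta> \<omega> = point_measure (configs \<Lambda>) (\<lambda>\<sigma>. ennreal (G.wt (shift \<beta>) \<sigma> \<omega>))"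
  unfolding gibbs_def complete_hamiltonian_eq partition_function_eq G.wt_def weight_def ..

lemma quenched_expectation_eq:
  assumes F: "\<And>s s'. (\<And>l. l \<in> {1..n} \<Longrightarrow> s l = s' l) \<Longrightarrow> F s = F s'"
  shows "quenched_expectation M c H \<Lambda> \<beta> F = G.quenched (shift \<beta>) n F"
proof -
  have "(\<integral>s. F s \<partial>(PiM {1..} (\<lambda>l. gibbs c H \<Lambda> \<beta> \<omega>))) = G.replica_avg (shift \<beta>) n F \<omega>" for \<omega>
    unfolding gibbs_eq G.replica_avg_def
    by (rule integral_PiM_point_measure[OF finite_configs]) (auto simp: G.wt_nonneg G.sum_wt intro: F)
  then show ?thesis unfolding quenched_expectation_def G.quenched_def by simp
qed

end

end

subsection \<open>Thermodynamic limit of the energy\<close>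

context spin_glass begin

abbreviation Fr :: "'a set \<Rightarrow> (nat \<Rightarrow> real) \<Rightarrow> 'w \<Rightarrow> real" where
  "Fr \<Lambda> \<beta> \<equiv> gaussian_levels.F (configs \<Lambda>) (level \<Lambda>) (\<lambda>p. \<beta> (Suc p))"

abbreviation Wt :: "'a set \<Rightarrow> (nat \<Rightarrow> real) \<Rightarrow> ('a \<Rightarrow> real) \<Rightarrow> 'w \<Rightarrow> real" where
  "Wt \<Lambda> \<beta> \<equiv> gaussian_levels.wt (configs \<Lambda>) (level \<Lambda>) (\<lambda>p. \<beta> (Suc p))"

abbreviation Qn :: "'a set \<Rightarrow> (nat \<Rightarrow> real) \<Rightarrow> nat \<Rightarrow> ((nat \<Rightarrow> 'a \<Rightarrow> real) \<Rightarrow> real) \<Rightarrow> real" where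
  "Qn \<Lambda> \<beta> \<equiv> gaussian_levels.quenched M (configs \<Lambda>) (level \<Lambda>) (\<lambda>p. \<beta> (Suc p))"

definition energy_deviation :: "'a set \<Rightarrow> (nat \<Rightarrow> real) \<Rightarrow> nat \<Rightarrow> real \<Rightarrow> real" where
  "energy_deviation \<Lambda> \<beta> p m = expectation (\<lambda>x. \<Sum>s\<in>configs \<Lambda>. Wt \<Lambda> \<beta> s x * \<bar>- level \<Lambda> p s x / real (card \<Lambda>) - m\<bar>)"

lemma energy_deviation_nonneg: "finite \<Lambda> \<Longrightarrow> \<Lambda> \<noteq> {} \<Longrightarrow> 0 \<le> energy_deviation \<Lambda> \<beta> p m"
  unfolding energy_deviation_def
  by (intro integral_nonneg_AE AE_I2 sum_nonneg mult_nonneg_nonneg gaussian_levels.wt_nonneg[OF gaussian_levels]) auto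

context
  fixes W :: "nat \<Rightarrow> 'a set"
  assumes W: "\<And>k. finite (W k)" "\<And>k. W k \<noteq> {}" and card_W: "filterlim (\<lambda>k. real (card (W k))) at_top sequentially"
begin

text \<open>The order of the choices matters: e and the parameter a are fixed by r, then d so small
  that the difference quotients of q at distance d are within e / 4 of m, and only then k is taken
  large. Convergence of the pressure is used at three parameters, namely \<beta> and \<beta> with
  the coordinate Suc p moved by d and - d.\<close>

lemma energy_concentration_limit:
  assumes adm: "admissible \<beta>" and lim: "\<And>\<beta>'. admissible \<beta>' \<Longrightarrow> (\<lambda>k. pressure M c H (W k) \<beta>') \<longlonglongrightarrow> q \<beta>'"
    and der: "((\<lambda>t. q (\<beta>(Suc p := t))) has_real_derivative m) (at (\<beta> (Suc p)))"
  shows "(\<lambda>k. energy_deviation (W k) \<beta> p m) \<longlonglongrightarrow> 0"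
proof (rule LIMSEQ_I)
  fix r :: real assume r: "0 < r"
  define e where "e = r / 4"
  define a where "a = r / 4 / (m\<^sup>2 + 9)"
  have m9: "0 < m\<^sup>2 + 9" by (rule add_nonneg_pos) auto
  have e: "0 < e" and a: "0 < a" using r m9 by (auto simp: e_def a_def)
  have a8: "a * (m\<^sup>2 + 8) \<le> r / 4"
  proof -
    have "a * (m\<^sup>2 + 8) \<le> a * (m\<^sup>2 + 9)" using a by (intro mult_left_mono) auto
    also have "\<dots> = r / 4" unfolding a_def by (rule nonzero_eq_divide_eq[THEN iffD1, OF _ refl]) (use m9 in simp)
    finally show ?thesis .
  qed
  define t0 where "t0 = \<beta> (Suc p)"
  have t0: "0 < t0" using adm by (simp add: admissible_def t0_def)
  have b: "summable (\<lambda>p. (\<beta> (Suc p))\<^sup>2)" using adm by (simp add: admissible_def)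
  define \<phi> where "\<phi> t = q (\<beta>(Suc p := t))" for t
  have \<phi>0: "\<phi> t0 = q \<beta>" by (simp add: \<phi>_def t0_def)
  have "((\<lambda>y. (\<phi> y - \<phi> t0) / (y - t0)) \<longlongrightarrow> m) (at t0)"
    using der unfolding has_field_derivative_iff \<phi>_def t0_def by simp
  then have "eventually (\<lambda>y. dist ((\<phi> y - \<phi> t0) / (y - t0)) m < e / 4) (at t0)"
    using e by (intro tendstoD) auto
  then obtain d0 where d0: "0 < d0" "\<And>y. y \<noteq> t0 \<Longrightarrow> dist y t0 < d0 \<Longrightarrow> dist ((\<phi> y - \<phi> t0) / (y - t0)) m < e / 4"
    unfolding eventually_at by auto
  \<comment> \<open>Below d0 for the difference quotients, and below t0 so that the coordinate moved
    by - d stays positive.\<close>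
  define d where "d = min (d0 / 2) (t0 / 2)"
  have d: "0 < d" "d < d0" "d < t0" using d0 t0 by (auto simp: d_def)
  have inc: "\<phi> (t0 + x) - \<phi> t0 \<le> x * m + d * e / 4" if "x = d \<or> x = - d" for x
  proof -
    have x: "x \<noteq> 0" "\<bar>x\<bar> = d" using that d by auto
    have "\<bar>(\<phi> (t0 + x) - \<phi> t0) / x - m\<bar> < e / 4"
      using d0(2)[of "t0 + x"] x d by (auto simp: dist_real_def)
    then have "\<bar>x\<bar> * \<bar>(\<phi> (t0 + x) - \<phi> t0) / x - m\<bar> \<le> d * (e / 4)"
      unfolding x(2) using d by (intro mult_left_mono) auto
    also have "\<bar>x\<bar> * \<bar>(\<phi> (t0 + x) - \<phi> t0) / x - m\<bar> = \<bar>\<phi> (t0 + x) - \<phi> t0 - x * m\<bar>"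
      unfolding abs_mult[symmetric] right_diff_distrib[of x "_ / _"] using x(1) by simp
    finally have "\<phi> (t0 + x) - \<phi> t0 - x * m \<le> d * (e / 4)" by linarith
    then show ?thesis by simp
  qed
  define b' where "b' x = \<beta>(Suc p := t0 + x)" for x
  have sh: "(\<lambda>q. b' x (Suc q)) = (\<lambda>q. \<beta> (Suc q))(p := \<beta> (Suc p) + x)" for x
    by (auto simp: b'_def t0_def)
  have sb: "summable (\<lambda>q. (b' x (Suc q))\<^sup>2)" for x
  proof -
    have "eventually (\<lambda>q. (b' x (Suc q))\<^sup>2 = (\<beta> (Suc q))\<^sup>2) sequentially"
      using eventually_gt_at_top[of p] by eventually_elim (auto simp: b'_def)
    from summable_cong[OF this] b show ?thesis by simp
  qed
  have adm': "admissible (b' x)" if "x = d \<or> x = - d" for x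
    using that d adm sb[of x] unfolding admissible_def by (auto simp: b'_def)
  define N where "N k = real (card (W k))" for k
  have ev: "eventually (\<lambda>k. pressure M c H (W k) (b' x) - pressure M c H (W k) \<beta> \<le> x * m + d * e / 2) sequentially"
    if x: "x = d \<or> x = - d" for x
  proof -
    have "(\<lambda>k. pressure M c H (W k) (b' x) - pressure M c H (W k) \<beta>) \<longlonglongrightarrow> q (b' x) - q \<beta>"
      by (intro tendsto_diff lim adm' adm x)
    \<comment> \<open>The limits satisfy the bound with d e / 4; the other d e / 4 absorbs the error
      of finite volumes.\<close>
    moreover have "q (b' x) - q \<beta> < x * m + d * e / 2"
    proof -
      have "0 < d * e" using d e by simp
      then show ?thesis using inc[OF x] \<phi>0 by (simp add: \<phi>_def b'_def)
    qed
    ultimately have "eventually (\<lambda>k. pressure M c H (W k) (b' x) - pressure M c H (W k) \<beta> < x * m + d * e / 2) sequentially"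
      by (rule order_tendstoD(2))
    then show ?thesis by eventually_elim simp
  qed
  define B where "B = 1 + (\<Sum>q. (\<beta> (Suc q))\<^sup>2) + (\<Sum>q. (b' d (Suc q))\<^sup>2) + (\<Sum>q. (b' (- d) (Suc q))\<^sup>2)"
  have s0: "0 \<le> (\<Sum>q. (\<beta> (Suc q))\<^sup>2)" "0 \<le> (\<Sum>q. (b' x (Suc q))\<^sup>2)" for x
    using b sb by (auto intro!: suminf_nonneg)
  define Cst where "Cst = (8 / (d * e) + 13824 * B / (d * e)\<^sup>2) / (2 * a)"
  have bound: "energy_deviation (W k) \<beta> p m \<le> e + a * (m\<^sup>2 + 8) + Cst / N k"
    if k: "pressure M c H (W k) (b' d) - pressure M c H (W k) \<beta> \<le> d * m + d * e / 2"
      "pressure M c H (W k) (b' (- d)) - pressure M c H (W k) \<beta> \<le> - d * m + d * e / 2" for k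
  proof -
    interpret G: gaussian_levels M "configs (W k)" "real (card (W k))" "\<lambda>s t. overlap M J (W k) s t / c" "level (W k)"
      by (rule gaussian_levels[OF W])
    have "energy_deviation (W k) \<beta> p m \<le> e + a * (m\<^sup>2 + 8) + (8 / (d * e) + 13824 * B / (d * e)\<^sup>2) / real (card (W k)) / (2 * a)"
      unfolding energy_deviation_def
    proof (rule G.energy_concentration_bound[OF b d(1) e a])
      show "0 < B" using s0(1) s0(2)[of d] s0(2)[of "- d"] unfolding B_def by linarith
      show "(\<Sum>q. (\<beta> (Suc q))\<^sup>2) \<le> B" using s0(1) s0(2)[of d] s0(2)[of "- d"] unfolding B_def by linarith
      show "(\<Sum>q. (((\<lambda>q. \<beta> (Suc q))(p := \<beta> (Suc p) + d)) q)\<^sup>2) \<le> B"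
        unfolding sh[symmetric] using s0(1) s0(2)[of d] s0(2)[of "- d"] unfolding B_def by linarith
      show "(\<Sum>q. (((\<lambda>q. \<beta> (Suc q))(p := \<beta> (Suc p) + - d)) q)\<^sup>2) \<le> B"
        unfolding sh[symmetric] using s0(1) s0(2)[of d] s0(2)[of "- d"] unfolding B_def by linarith
      show "expectation (G.F ((\<lambda>q. \<beta> (Suc q))(p := \<beta> (Suc p) + d))) / real (card (W k)) - expectation (G.F (\<lambda>q. \<beta> (Suc q))) / real (card (W k)) \<le> d * m + d * e / 2"
        unfolding sh[symmetric] using k(1) unfolding pressure_eq[OF W] .
      show "expectation (G.F ((\<lambda>q. \<beta> (Suc q))(p := \<beta> (Suc p) + - d))) / real (card (W k)) - expectation (G.F (\<lambda>q. \<beta> (Suc q))) / real (card (W k)) \<le> - d * m + d * e / 2"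
        unfolding sh[symmetric] using k(2) unfolding pressure_eq[OF W] .
    qed
    then show ?thesis by (simp add: Cst_def N_def mult.commute)
  qed
  have "(\<lambda>k. Cst / N k) \<longlonglongrightarrow> 0"
    unfolding N_def by (rule tendsto_divide_0[OF tendsto_const filterlim_at_top_imp_at_infinity[OF card_W]])
  then have "eventually (\<lambda>k. Cst / N k < r / 4) sequentially" using r by (intro order_tendstoD(2)[of _ 0]) auto
  with ev[OF disjI1[OF refl]] ev[OF disjI2[OF refl]]
  have "eventually (\<lambda>k. energy_deviation (W k) \<beta> p m < r) sequentially"
  proof eventually_elim
    case (elim k)
    from bound[OF elim(1,2)] elim(3) a8 r show ?case unfolding e_def by linarith
  qed
  then show "\<exists>no. \<forall>k\<ge>no. norm (energy_deviation (W k) \<beta> p m - 0) < r"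
    unfolding eventually_sequentially using energy_deviation_nonneg[OF W] by auto
qed

end

end

subsection \<open>Subsequential limits of the overlap array\<close>

lemma continuous_entry: "continuous_on UNIV (\<lambda>R :: nat \<times> nat \<Rightarrow> real. R i)"
  by (rule continuous_on_product_coordinates)

lemma continuous_reindexed:
  fixes g :: "(nat \<times> nat \<Rightarrow> real) \<Rightarrow> real" and h :: "(nat \<times> nat \<Rightarrow> real) \<Rightarrow> nat \<times> nat \<Rightarrow> real"
  assumes g: "continuous_on UNIV g" and h: "\<And>i. continuous_on UNIV (\<lambda>R. h R i)"
  shows "continuous_on UNIV (\<lambda>R. g (h R))"
  by (rule continuous_on_compose2[OF g continuous_on_coordinatewise_then_product[OF h]]) auto

lemma test_measurable:
  fixes g :: "(nat \<times> nat \<Rightarrow> real) \<Rightarrow> real"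
  assumes N: "sets N = sets array_space" and g: "continuous_on UNIV g" and I: "I \<subseteq> {1..} \<times> {1..}"
  shows "(\<lambda>R. g (restrict R I)) \<in> borel_measurable N"
proof -
  have "(\<lambda>R. restrict R I) \<in> measurable array_space (PiM UNIV (\<lambda>_. borel))"
  proof (rule measurable_PiM_single')
    fix i :: "nat \<times> nat"
    show "(\<lambda>R. restrict R I i) \<in> borel_measurable array_space"
    proof (cases "i \<in> I")
      case True
      then have "i \<in> {1..} \<times> {1..}" using I by auto
      from measurable_component_singleton[OF this, of "\<lambda>_. borel"] True show ?thesis unfolding array_space_def by simp
    qed simp
  qed auto
  then have "(\<lambda>R. restrict R I) \<in> borel_measurable array_space"
    using measurable_cong_sets[OF refl sets_PiM_equal_borel] by blast
  from measurable_compose[OF this borel_measurable_continuous_onI[OF g]] show ?thesis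
    using measurable_cong_sets[OF N refl] by blast
qed

lemma measurable_PiM_point_measure:
  fixes F :: "(nat \<Rightarrow> 's) \<Rightarrow> real" and w :: "'s \<Rightarrow> real"
  assumes S: "finite S" and F: "\<And>s s'. (\<And>l. l \<in> {1..n} \<Longrightarrow> s l = s' l) \<Longrightarrow> F s = F s'"
  shows "F \<in> borel_measurable (PiM {1..} (\<lambda>_. point_measure S w))"
proof -
  let ?P = "PiM {1::nat..} (\<lambda>_. point_measure S w)"
  have sP: "space ?P = {1..} \<rightarrow>\<^sub>E S" by (simp add: space_PiM space_point_measure)
  have "(\<lambda>s. \<Sum>r\<in>replicas S n. F r * (\<Prod>l\<in>{1..n}. indicator {r l} (s l))) \<in> borel_measurable ?P"
  proof (intro borel_measurable_sum borel_measurable_times borel_measurable_const borel_measurable_prod)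
    fix r l assume "r \<in> replicas S n" "l \<in> {1..n}"
    then have "r l \<in> S" by (auto simp: replicas_def PiE_iff)
    then have "indicat_real {r l} \<in> borel_measurable (point_measure S w)"
      by (intro borel_measurable_indicator) (simp add: sets_point_measure)
    moreover have "(\<lambda>s. s l) \<in> measurable ?P (point_measure S w)"
      by (rule measurable_component_singleton) (use \<open>l \<in> {1..n}\<close> in auto)
    ultimately show "(\<lambda>s. indicator {r l} (s l) :: real) \<in> borel_measurable ?P" by (rule measurable_compose[rotated])
  qed
  moreover have "F s = (\<Sum>r\<in>replicas S n. F r * (\<Prod>l\<in>{1..n}. indicator {r l} (s l)))" if s: "s \<in> space ?P" for s
  proof -
    define r0 where "r0 = restrict s {1..n}"
    have r0: "r0 \<in> replicas S n" using s unfolding r0_def replicas_def sP by (auto simp: PiE_iff)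
    have fr: "finite (replicas S n)" unfolding replicas_def using S by (intro finite_PiE) auto
    have "(\<Prod>l\<in>{1..n}. indicator {r l} (s l)) = (if r = r0 then 1 else 0 :: real)" if "r \<in> replicas S n" for r
    proof (cases "r = r0")
      case False
      have "r = r0" if "\<forall>l\<in>{1..n}. s l = r l"
        using \<open>r \<in> replicas S n\<close> r0 that unfolding replicas_def by (intro PiE_ext[of r "{1..n}" "\<lambda>_. S" r0]) (auto simp: r0_def)
      with False obtain l where "l \<in> {1..n}" "s l \<noteq> r l" by blast
      then have "\<exists>l\<in>{1..n}. indicat_real {r l} (s l) = 0" by (intro bexI[of _ l]) auto
      then show ?thesis using False by (subst prod_zero) auto
    qed (auto simp: r0_def intro!: prod.neutral)
    then have "(\<Sum>r\<in>replicas S n. F r * (\<Prod>l\<in>{1..n}. indicator {r l} (s l))) = (\<Sum>r\<in>replicas S n. if r = r0 then F r else 0)"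
      by (intro sum.cong refl) auto
    also have "\<dots> = F r0" using fr r0 by simp
    also have "\<dots> = F s" by (rule F) (simp add: r0_def)
    finally show ?thesis ..
  qed
  ultimately show ?thesis by (subst measurable_cong) auto
qed

lemma (in gaussian_levels) quenched_cong:
  "(\<And>s. s \<in> replicas S n \<Longrightarrow> f s = g s) \<Longrightarrow> quenched b n f = quenched b n g"
  unfolding quenched_def replica_avg_def[abs_def] by (intro Bochner_Integration.integral_cong refl sum.cong arg_cong2[where f=times])

context spin_glass begin

lemma gibbs_prob_space:
  assumes L: "finite \<Lambda>" "\<Lambda> \<noteq> {}" shows "prob_space (gibbs c H \<Lambda> \<beta> \<omega>)"
proof
  interpret G: gaussian_levels M "configs \<Lambda>" "real (card \<Lambda>)" "\<lambda>s t. overlap M J \<Lambda> s t / c" "level \<Lambda>"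
    by (rule gaussian_levels[OF L])
  have "emeasure (gibbs c H \<Lambda> \<beta> \<omega>) (space (gibbs c H \<Lambda> \<beta> \<omega>)) = (\<Sum>s\<in>configs \<Lambda>. ennreal (Wt \<Lambda> \<beta> s \<omega>))"
    unfolding gibbs_eq[OF L] space_point_measure using finite_configs[OF L] by (subst emeasure_point_measure_finite) auto
  also have "\<dots> = ennreal 1" by (subst sum_ennreal) (auto simp: G.wt_nonneg G.sum_wt)
  finally show "emeasure (gibbs c H \<Lambda> \<beta> \<omega>) (space (gibbs c H \<Lambda> \<beta> \<omega>)) = 1" by simp
qed

lemma quenched_expectation_permute:
  assumes L: "finite \<Lambda>" "\<Lambda> \<noteq> {}" and p: "inj_on \<pi> {1..}" "\<pi> ` {1..} \<subseteq> {1..}"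
    and F: "\<And>s s'. (\<And>l. l \<in> {1..n} \<Longrightarrow> s l = s' l) \<Longrightarrow> F s = F s'"
  shows "quenched_expectation M c H \<Lambda> \<beta> (\<lambda>s. F (\<lambda>l. s (\<pi> l))) = quenched_expectation M c H \<Lambda> \<beta> F"
proof -
  have "(\<integral>s. F (\<lambda>l. s (\<pi> l)) \<partial>(PiM {1..} (\<lambda>l. gibbs c H \<Lambda> \<beta> \<omega>))) = (\<integral>s. F s \<partial>(PiM {1..} (\<lambda>l. gibbs c H \<Lambda> \<beta> \<omega>)))" for \<omega>
  proof -
    let ?P = "PiM {1::nat..} (\<lambda>l. gibbs c H \<Lambda> \<beta> \<omega>)"
    have d: "distr ?P ?P (\<lambda>s. \<lambda>l\<in>{1..}. s (\<pi> l)) = ?P"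
      by (rule distr_PiM_reindex[of "{1..}" "\<lambda>_. gibbs c H \<Lambda> \<beta> \<omega>" \<pi> "{1..}"]) (use p gibbs_prob_space[OF L] in auto)
    have mF: "F \<in> borel_measurable ?P"
      unfolding gibbs_eq[OF L] by (rule measurable_PiM_point_measure[OF finite_configs[OF L]]) (rule F)
    have m: "(\<lambda>s. \<lambda>l\<in>{1..}. s (\<pi> l)) \<in> measurable ?P ?P"
      using p(2) by (intro measurable_restrict measurable_component_singleton) auto
    have "(\<integral>s. F s \<partial>?P) = (\<integral>s. F s \<partial>distr ?P ?P (\<lambda>s. \<lambda>l\<in>{1..}. s (\<pi> l)))" by (simp only: d)
    also have "\<dots> = (\<integral>s. F (\<lambda>l\<in>{1..}. s (\<pi> l)) \<partial>?P)" by (rule integral_distr[OF m mF])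
    also have "\<dots> = (\<integral>s. F (\<lambda>l. s (\<pi> l)) \<partial>?P)"
      by (intro Bochner_Integration.integral_cong refl F) auto
    finally show ?thesis ..
  qed
  then show ?thesis unfolding quenched_expectation_def by simp
qed

lemma overlap_array_apply: "overlap_array M J \<Lambda> s (i, j) = overlap M J \<Lambda> (s i) (s j)"
  by (simp add: overlap_array_def)

context
  fixes W :: "nat \<Rightarrow> 'a set" and \<beta> :: "nat \<Rightarrow> real" and N :: "(nat \<times> nat \<Rightarrow> real) measure"
  assumes W: "\<And>k. finite (W k)" "\<And>k. W k \<noteq> {}" and law: "overlap_limit_law M J c H \<beta> W N"
begin

lemma limit_prob_space: "prob_space N" and limit_sets: "sets N = sets array_space"
  using law by (auto simp: overlap_limit_law_def)

lemma test_depends: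
  assumes I: "I \<subseteq> {1..n} \<times> {1..n}" and s: "\<And>l. l \<in> {1..n} \<Longrightarrow> s l = s' l"
  shows "g (restrict (overlap_array M J \<Lambda> s) I) = g (restrict (overlap_array M J \<Lambda> s') I)"
proof -
  have "restrict (overlap_array M J \<Lambda> s) I = restrict (overlap_array M J \<Lambda> s') I"
  proof (rule ext)
    fix ij :: "nat \<times> nat"
    obtain i j where ij: "ij = (i, j)" by (cases ij)
    show "restrict (overlap_array M J \<Lambda> s) I ij = restrict (overlap_array M J \<Lambda> s') I ij"
    proof (cases "(i, j) \<in> I")
      case True
      then have "i \<in> {1..n}" "j \<in> {1..n}" using I by auto
      from s[OF this(1)] s[OF this(2)] show ?thesis using True by (simp add: ij overlap_array_apply)
    qed (simp add: ij)
  qed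
  then show ?thesis by simp
qed

lemma test_limit_expectation:
  assumes I: "finite I" "I \<subseteq> {1..} \<times> {1..}" and g: "continuous_on UNIV g" "bounded (range g)"
  shows "(\<lambda>k. quenched_expectation M c H (W k) \<beta> (\<lambda>s. g (restrict (overlap_array M J (W k) s) I))) \<longlonglongrightarrow> (\<integral>R. g (restrict R I) \<partial>N)"
  using law I g unfolding overlap_limit_law_def by blast

lemma test_limit:
  assumes I: "I \<subseteq> {1..n} \<times> {1..n}" and g: "continuous_on UNIV g" "bounded (range g)"
  shows "(\<lambda>k. Qn (W k) \<beta> n (\<lambda>s. g (restrict (overlap_array M J (W k) s) I))) \<longlonglongrightarrow> (\<integral>R. g (restrict R I) \<partial>N)"
proof -
  have I': "finite I" "I \<subseteq> {1..} \<times> {1..}" using I finite_subset[OF I] by auto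
  have "quenched_expectation M c H (W k) \<beta> (\<lambda>s. g (restrict (overlap_array M J (W k) s) I)) =
    Qn (W k) \<beta> n (\<lambda>s. g (restrict (overlap_array M J (W k) s) I))" for k
    by (rule quenched_expectation_eq[OF W]) (rule test_depends[OF I])
  then show ?thesis using test_limit_expectation[OF I' g] by simp
qed

lemma test_integrable:
  fixes g :: "(nat \<times> nat \<Rightarrow> real) \<Rightarrow> real"
  assumes I: "I \<subseteq> {1..} \<times> {1..}" and g: "continuous_on UNIV g" "bounded (range g)"
  shows "integrable N (\<lambda>R. g (restrict R I))"
proof -
  interpret N: prob_space N by (rule limit_prob_space)
  obtain B where "\<And>x. norm (g x) \<le> B" using g(2) by (auto simp: bounded_iff)
  then show ?thesis by (intro N.integrable_const_bound[where B=B] test_measurable[OF limit_sets g(1) I]) auto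
qed

text \<open>Closed constraints that hold for every configuration pass to the limit law: such a
  constraint is encoded as the zero set of a bounded continuous nonnegative test function, whose
  expectation is 0 in every volume.\<close>

lemma AE_limit_zero:
  fixes g :: "(nat \<times> nat \<Rightarrow> real) \<Rightarrow> real"
  assumes I: "I \<subseteq> {1..n} \<times> {1..n}" and g: "continuous_on UNIV g" "bounded (range g)" "\<And>R. 0 \<le> g R"
    and z: "\<And>k s. s \<in> replicas (configs (W k)) n \<Longrightarrow> g (restrict (overlap_array M J (W k) s) I) = 0"
  shows "AE R in N. g (restrict R I) = 0"
proof -
  have "Qn (W k) \<beta> n (\<lambda>s. g (restrict (overlap_array M J (W k) s) I)) = 0" for k
  proof -
    interpret G: gaussian_levels M "configs (W k)" "real (card (W k))" "\<lambda>s t. overlap M J (W k) s t / c" "level (W k)"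
      by (rule gaussian_levels[OF W])
    have "Qn (W k) \<beta> n (\<lambda>s. g (restrict (overlap_array M J (W k) s) I)) = Qn (W k) \<beta> n (\<lambda>s. 0)"
      by (rule G.quenched_cong) (rule z)
    then show ?thesis by (simp add: G.quenched_def G.replica_avg_def[abs_def])
  qed
  then have "(\<integral>R. g (restrict R I) \<partial>N) = 0"
    using test_limit[OF I g(1,2)] by (simp add: LIMSEQ_const_iff)
  moreover have "integrable N (\<lambda>R. g (restrict R I))" by (rule test_integrable) (use I g in auto)
  ultimately show ?thesis using g(3) by (subst (asm) integral_nonneg_eq_0_iff_AE) auto
qed

lemma limit_bounded:
  assumes ij: "1 \<le> i" "1 \<le> j" shows "AE R in N. \<bar>R (i, j)\<bar> \<le> c"
proof -
  define n where "n = max i j"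
  define g where "g R = min 1 (max 0 (\<bar>R (i, j)\<bar> - c))" for R :: "nat \<times> nat \<Rightarrow> real"
  have "AE R in N. g (restrict R {(i, j)}) = 0"
  proof (rule AE_limit_zero[of "{(i, j)}" n])
    show "{(i, j)} \<subseteq> {1..n} \<times> {1..n}" using ij by (auto simp: n_def)
    show "continuous_on UNIV g" unfolding g_def by (intro continuous_intros continuous_entry)
    show "bounded (range g)" unfolding bounded_iff g_def by (intro exI[of _ 1]) auto
    show "0 \<le> g R" for R by (simp add: g_def)
    show "g (restrict (overlap_array M J (W k) s) {(i, j)}) = 0" if "s \<in> replicas (configs (W k)) n" for k s
    proof -
      have "s i \<in> configs (W k)" "s j \<in> configs (W k)" using that ij by (auto simp: replicas_def PiE_iff n_def)
      from overlap_abs_le[OF W this] show ?thesis by (simp add: g_def overlap_array_apply)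
    qed
  qed
  then show ?thesis by eventually_elim (auto simp: g_def min_def max_def split: if_splits)
qed

lemma limit_symmetric:
  assumes ij: "1 \<le> i" "1 \<le> j" shows "AE R in N. R (i, j) = R (j, i)"
proof -
  define n where "n = max i j"
  define g where "g R = min 1 \<bar>R (i, j) - R (j, i)\<bar>" for R :: "nat \<times> nat \<Rightarrow> real"
  have "AE R in N. g (restrict R {(i, j), (j, i)}) = 0"
  proof (rule AE_limit_zero[of "{(i, j), (j, i)}" n])
    show "{(i, j), (j, i)} \<subseteq> {1..n} \<times> {1..n}" using ij by (auto simp: n_def)
    show "continuous_on UNIV g" unfolding g_def by (intro continuous_intros continuous_entry)
    show "bounded (range g)" unfolding bounded_iff g_def by (intro exI[of _ 1]) auto
    show "0 \<le> g R" for R by (simp add: g_def)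
    show "g (restrict (overlap_array M J (W k) s) {(i, j), (j, i)}) = 0" for k s
      using overlap_commute[OF W, of k "s i" "s j"] by (simp add: g_def overlap_array_apply)
  qed
  then show ?thesis by eventually_elim (auto simp: g_def min_def split: if_splits)
qed

lemma limit_positive:
  assumes A: "finite A" "A \<subseteq> {1..}" shows "AE R in N. 0 \<le> (\<Sum>i\<in>A. \<Sum>j\<in>A. v i * v j * R (i, j))"
proof -
  define n where "n = Max (insert 1 A)"
  define g where "g R = min 1 (max 0 (- (\<Sum>i\<in>A. \<Sum>j\<in>A. v i * v j * R (i, j))))" for R :: "nat \<times> nat \<Rightarrow> real"
  have gr: "g (restrict R (A \<times> A)) = g R" for R unfolding g_def by (simp cong: sum.cong)
  have "AE R in N. g (restrict R (A \<times> A)) = 0"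
  proof (rule AE_limit_zero[of "A \<times> A" n])
    have "a \<le> n" if "a \<in> A" for a unfolding n_def using A that by (intro Max_ge) auto
    then show "A \<times> A \<subseteq> {1..n} \<times> {1..n}" using A by auto
    show "continuous_on UNIV g" unfolding g_def by (intro continuous_intros continuous_entry)
    show "bounded (range g)" unfolding bounded_iff g_def by (intro exI[of _ 1]) auto
    show "0 \<le> g R" for R by (simp add: g_def)
    show "g (restrict (overlap_array M J (W k) s) (A \<times> A)) = 0" for k s
      unfolding gr using overlap_positive[OF W, of v k s A] by (simp add: g_def overlap_array_apply)
  qed
  then show ?thesis unfolding gr by eventually_elim (auto simp: g_def min_def max_def split: if_splits)
qed

text \<open>The relabelling is absorbed into the test function, which then reads the entries in the
  image of the index set. In finite volume the replicas are independent and identically distributed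
  given the disorder, so both expectations agree before the limit.\<close>

lemma limit_exchangeable_test:
  fixes g :: "(nat \<times> nat \<Rightarrow> real) \<Rightarrow> real"
  assumes p: "inj_on \<pi> {1..}" "\<pi> ` {1..} \<subseteq> {1..}" and I: "finite I" "I \<subseteq> {1..} \<times> {1..}"
    and g: "continuous_on UNIV g" "bounded (range g)"
  shows "(\<integral>R. g (\<lambda>(i, j)\<in>I. R (\<pi> i, \<pi> j)) \<partial>N) = (\<integral>R. g (restrict R I) \<partial>N)"
proof -
  define I' where "I' = (\<lambda>(i, j). (\<pi> i, \<pi> j)) ` I"
  define g' where "g' r = g (\<lambda>(i, j)\<in>I. r (\<pi> i, \<pi> j))" for r :: "nat \<times> nat \<Rightarrow> real"
  have g'r: "g' (restrict R I') = g (\<lambda>(i, j)\<in>I. R (\<pi> i, \<pi> j))" for R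
  proof -
    have "(\<lambda>(i, j)\<in>I. restrict R I' (\<pi> i, \<pi> j)) = (\<lambda>(i, j)\<in>I. R (\<pi> i, \<pi> j))"
      by (auto simp: fun_eq_iff restrict_def I'_def)
    then show ?thesis unfolding g'_def by simp
  qed
  have I': "finite I'" "I' \<subseteq> {1..} \<times> {1..}" unfolding I'_def using I p(2) by auto
  have cg': "continuous_on UNIV g'"
    unfolding g'_def
  proof (rule continuous_reindexed[OF g(1)])
    fix i :: "nat \<times> nat"
    show "continuous_on UNIV (\<lambda>R. (\<lambda>(i, j)\<in>I. R (\<pi> i, \<pi> j)) i :: real)"
      by (cases "i \<in> I") (auto simp: case_prod_beta' intro: continuous_entry)
  qed
  have bg': "bounded (range g')" using g(2) unfolding g'_def by (rule bounded_subset) auto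
  obtain n where n: "I \<subseteq> {1..n} \<times> {1..n}"
  proof -
    define n where "n = Max (insert 1 (fst ` I \<union> snd ` I))"
    have "a \<le> n" if "a \<in> fst ` I \<union> snd ` I" for a unfolding n_def using I(1) that by (intro Max_ge) auto
    note le = this
    have "I \<subseteq> {1..n} \<times> {1..n}"
    proof
      fix ij assume ij: "ij \<in> I"
      then have "fst ij \<le> n" "snd ij \<le> n" "ij \<in> {1..} \<times> {1..}" using le I(2) by blast+
      then show "ij \<in> {1..n} \<times> {1..n}" by (cases ij) simp
    qed
    then show ?thesis by (rule that)
  qed
  have "quenched_expectation M c H (W k) \<beta> (\<lambda>s. g' (restrict (overlap_array M J (W k) s) I')) =
    quenched_expectation M c H (W k) \<beta> (\<lambda>s. g (restrict (overlap_array M J (W k) s) I))" for k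
  proof -
    have "g' (restrict (overlap_array M J (W k) s) I') = g (restrict (overlap_array M J (W k) (\<lambda>l. s (\<pi> l))) I)" for s
    proof -
      have "(\<lambda>(i, j)\<in>I. overlap_array M J (W k) s (\<pi> i, \<pi> j)) = restrict (overlap_array M J (W k) (\<lambda>l. s (\<pi> l))) I"
        by (auto simp: fun_eq_iff restrict_def overlap_array_apply)
      then show ?thesis unfolding g'r by simp
    qed
    note e = this
    show ?thesis unfolding e
      by (rule quenched_expectation_permute[OF W p, of n "\<lambda>s. g (restrict (overlap_array M J (W k) s) I)"]) (rule test_depends[OF n])
  qed
  then have "(\<lambda>k. quenched_expectation M c H (W k) \<beta> (\<lambda>s. g (restrict (overlap_array M J (W k) s) I))) \<longlonglongrightarrow> (\<integral>R. g' (restrict R I') \<partial>N)"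
    using test_limit_expectation[OF I' cg' bg'] by simp
  from LIMSEQ_unique[OF this test_limit_expectation[OF I g]] show ?thesis unfolding g'r .
qed

text \<open>Cosines and sines of linear forms are bounded continuous tests, so
  \<open>Cramer_Wold\<close> identifies the finite-dimensional laws, and these determine a measure
  on the product space.\<close>

lemma limit_exchangeable:
  assumes p: "inj_on \<pi> {1..}" "\<pi> ` {1..} \<subseteq> {1..}"
  shows "distr N N (permute_array \<pi>) = N"
proof -
  interpret N: prob_space N by (rule limit_prob_space)
  let ?X = "{1::nat..} \<times> {1::nat..}"
  have me: "(\<lambda>R. R i) \<in> borel_measurable N" if "i \<in> ?X" for i
    using measurable_component_singleton[OF that, of "\<lambda>_. borel"] measurable_cong_sets[OF limit_sets refl] unfolding array_space_def by blast
  have mp: "permute_array \<pi> \<in> measurable N N"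
  proof -
    have "permute_array \<pi> \<in> measurable N array_space"
      unfolding permute_array_def[abs_def] array_space_def case_prod_beta'
      using p(2) by (intro measurable_restrict me) auto
    then show ?thesis using measurable_cong_sets[OF refl limit_sets] by blast
  qed
  have sN: "sets N = sets (PiM ?X (\<lambda>_. borel))" using limit_sets by (simp add: array_space_def)
  have spN: "space N = ?X \<rightarrow>\<^sub>E UNIV" using sets_eq_imp_space_eq[OF sN] by (simp add: space_PiM)
  show ?thesis
  proof (rule measure_eqI_PiM_infinite[OF _ sN])
    show "sets (distr N N (permute_array \<pi>)) = sets (PiM ?X (\<lambda>_. borel))" using sN by simp
    show "finite_measure (distr N N (permute_array \<pi>))" by (rule N.finite_measure_distr[OF mp])
    fix A :: "nat \<times> nat \<Rightarrow> real set" and I assume I: "finite I" "I \<subseteq> ?X" and A: "\<And>i. i \<in> I \<Longrightarrow> A i \<in> sets borel"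
    have pI: "(\<pi> (fst i), \<pi> (snd i)) \<in> ?X" "i \<in> ?X" if "i \<in> I" for i
    proof -
      show "i \<in> ?X" using that I(2) by blast
      then have "fst i \<in> {1..}" "snd i \<in> {1..}" by (simp_all add: mem_Times_iff)
      then have "\<pi> (fst i) \<in> {1..}" "\<pi> (snd i) \<in> {1..}" using p(2) by blast+
      then show "(\<pi> (fst i), \<pi> (snd i)) \<in> ?X" by blast
    qed
    have eq: "distr N (PiM I (\<lambda>_. borel)) (\<lambda>R. \<lambda>i\<in>I. R (\<pi> (fst i), \<pi> (snd i))) = distr N (PiM I (\<lambda>_. borel)) (\<lambda>R. \<lambda>i\<in>I. R i)"
    proof (rule Cramer_Wold)
      show "(\<lambda>R. R (\<pi> (fst i), \<pi> (snd i))) \<in> borel_measurable N" "(\<lambda>R. R i) \<in> borel_measurable N" if "i \<in> I" for i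
        by (rule me[OF pI(1)[OF that]], rule me[OF pI(2)[OF that]])
      have t: "(\<integral>R. f (\<Sum>i\<in>I. a i * R (\<pi> (fst i), \<pi> (snd i))) \<partial>N) = (\<integral>R. f (\<Sum>i\<in>I. a i * R i) \<partial>N)"
        if f: "f = cos \<or> f = sin" for f :: "real \<Rightarrow> real" and a
      proof -
        have c: "continuous_on UNIV (\<lambda>r. f (\<Sum>i\<in>I. a i * r i))"
          using f by (auto intro!: continuous_intros continuous_entry)
        have bd: "bounded (range (\<lambda>r. f (\<Sum>i\<in>I. a i * r i)))" unfolding bounded_iff using f by (intro exI[of _ 1]) auto
        show ?thesis using limit_exchangeable_test[OF p I c bd] by (simp add: case_prod_beta' cong: sum.cong)
      qed
      show "(\<integral>R. cos (\<Sum>i\<in>I. a i * R (\<pi> (fst i), \<pi> (snd i))) \<partial>N) = (\<integral>R. cos (\<Sum>i\<in>I. a i * R i) \<partial>N)"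
        "(\<integral>R. sin (\<Sum>i\<in>I. a i * R (\<pi> (fst i), \<pi> (snd i))) \<partial>N) = (\<integral>R. sin (\<Sum>i\<in>I. a i * R i) \<partial>N)" for a
        by (rule t; simp)+
    qed (use I N.prob_space_axioms in auto)
    have box: "Pi\<^sub>E I A \<in> sets (PiM I (\<lambda>_. borel))" using I A by (intro sets_PiM_I_finite) auto
    have emb: "prod_emb ?X (\<lambda>_. borel) I (Pi\<^sub>E I A) \<in> sets N" unfolding sN using I A by (intro sets_PiM_I) auto
    have m1: "(\<lambda>R. \<lambda>i\<in>I. R (\<pi> (fst i), \<pi> (snd i))) \<in> measurable N (PiM I (\<lambda>_. borel))"
      by (intro measurable_restrict me pI)
    have m2: "(\<lambda>R. \<lambda>i\<in>I. R i) \<in> measurable N (PiM I (\<lambda>_. borel))"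
      by (intro measurable_restrict me pI)
    have "emeasure (distr N N (permute_array \<pi>)) (prod_emb ?X (\<lambda>_. borel) I (Pi\<^sub>E I A)) =
        emeasure N (permute_array \<pi> -` prod_emb ?X (\<lambda>_. borel) I (Pi\<^sub>E I A) \<inter> space N)"
      by (rule emeasure_distr[OF mp emb])
    also have "permute_array \<pi> -` prod_emb ?X (\<lambda>_. borel) I (Pi\<^sub>E I A) \<inter> space N =
        (\<lambda>R. \<lambda>i\<in>I. R (\<pi> (fst i), \<pi> (snd i))) -` Pi\<^sub>E I A \<inter> space N"
    proof -
      have "permute_array \<pi> R \<in> prod_emb ?X (\<lambda>_. borel) I (Pi\<^sub>E I A) \<longleftrightarrow> (\<lambda>i\<in>I. R (\<pi> (fst i), \<pi> (snd i))) \<in> Pi\<^sub>E I A" if "R \<in> space N" for R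
      proof -
        have "restrict (permute_array \<pi> R) I = (\<lambda>i\<in>I. R (\<pi> (fst i), \<pi> (snd i)))"
          using I(2) by (auto simp: permute_array_def fun_eq_iff restrict_def)
        moreover have "permute_array \<pi> R \<in> ?X \<rightarrow>\<^sub>E UNIV" by (auto simp: permute_array_def)
        ultimately show ?thesis by (simp add: prod_emb_iff PiE_iff)
      qed
      then show ?thesis by blast
    qed
    also have "emeasure N \<dots> = emeasure (distr N (PiM I (\<lambda>_. borel)) (\<lambda>R. \<lambda>i\<in>I. R (\<pi> (fst i), \<pi> (snd i)))) (Pi\<^sub>E I A)"
      by (rule emeasure_distr[OF m1 box, symmetric])
    also have "\<dots> = emeasure N ((\<lambda>R. \<lambda>i\<in>I. R i) -` Pi\<^sub>E I A \<inter> space N)"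
      unfolding eq by (rule emeasure_distr[OF m2 box])
    also have "(\<lambda>R. \<lambda>i\<in>I. R i) -` Pi\<^sub>E I A \<inter> space N = prod_emb ?X (\<lambda>_. borel) I (Pi\<^sub>E I A)"
      unfolding spN by (auto simp: prod_emb_def space_PiM)
    finally show "emeasure (distr N N (permute_array \<pi>)) (prod_emb ?X (\<lambda>_. borel) I (Pi\<^sub>E I A)) = emeasure N (prod_emb ?X (\<lambda>_. borel) I (Pi\<^sub>E I A))" .
  qed
qed

end

end

subsection \<open>The Ghirlanda-Guerra identities in the limit\<close>

text \<open>A mixture of n laws is realized on a product space with a uniform random label, so that
  \<open>Cramer_Wold\<close>, which compares random vectors, applies to mixtures.\<close>

lemma integral_uniform_mixture:
  fixes F :: "nat \<Rightarrow> 'z \<Rightarrow> real"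
  assumes K: "prob_space K" and n: "1 \<le> n" and F: "\<And>l. F l \<in> borel_measurable K" "\<And>l z. \<bar>F l z\<bar> \<le> B"
  shows "(\<integral>z. F (fst z) (snd z) \<partial>(measure_pmf (pmf_of_set {1..n}) \<Otimes>\<^sub>M K)) = (\<Sum>l\<in>{1..n}. \<integral>z. F l z \<partial>K) / real n"
proof -
  interpret K: prob_space K by fact
  interpret P: pair_prob_space "measure_pmf (pmf_of_set {1..n})" K ..
  have m: "(\<lambda>z. F (fst z) (snd z)) \<in> borel_measurable (measure_pmf (pmf_of_set {1..n}) \<Otimes>\<^sub>M K)"
  proof -
    have "(\<lambda>z. F (fst z) (snd z)) \<in> borel_measurable (count_space UNIV \<Otimes>\<^sub>M K)"
      by (rule measurable_pair_measure_countable1) (auto simp: F)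
    also have "borel_measurable (count_space UNIV \<Otimes>\<^sub>M K) = borel_measurable (measure_pmf (pmf_of_set {1..n}) \<Otimes>\<^sub>M K)"
      by (intro measurable_cong_sets sets_pair_measure_cong) auto
    finally show ?thesis .
  qed
  have "integrable (measure_pmf (pmf_of_set {1..n}) \<Otimes>\<^sub>M K) (\<lambda>z. F (fst z) (snd z))"
    by (rule P.integrable_const_bound[where B=B]) (use F m in auto)
  from P.integral_fst'[OF this] have "(\<integral>z. F (fst z) (snd z) \<partial>(measure_pmf (pmf_of_set {1..n}) \<Otimes>\<^sub>M K)) = (\<integral>l. (\<integral>z. F l z \<partial>K) \<partial>measure_pmf (pmf_of_set {1..n}))" by simp
  also have "\<dots> = (\<Sum>l\<in>{1..n}. \<integral>z. F l z \<partial>K) / real n" using n by (subst integral_pmf_of_set) auto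
  finally show ?thesis .
qed

context spin_glass begin

text \<open>Truncation to [- c, c]. It fixes every overlap of configurations and makes powers of an
  entry bounded test functions.\<close>

definition clip :: "real \<Rightarrow> real" where "clip x = max (- c) (min c x)"

lemma clip_id: "\<bar>x\<bar> \<le> c \<Longrightarrow> clip x = x" by (auto simp: clip_def)

lemma clip_le: "\<bar>clip x\<bar> \<le> c" using c_pos by (auto simp: clip_def)

lemma continuous_clip: "continuous_on UNIV clip" unfolding clip_def[abs_def] by (intro continuous_intros)

context
  fixes W :: "nat \<Rightarrow> 'a set" and \<beta> :: "nat \<Rightarrow> real" and N :: "(nat \<times> nat \<Rightarrow> real) measure"
  assumes W: "\<And>k. finite (W k)" "\<And>k. W k \<noteq> {}" and law: "overlap_limit_law M J c H \<beta> W N"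
    and adm: "admissible \<beta>" and conc: "\<And>p. \<exists>m. (\<lambda>k. energy_deviation (W k) \<beta> p m) \<longlonglongrightarrow> 0"
begin

text \<open>In each volume the error of the identity is at most a constant times the energy
  deviation. All its terms are test functions of the overlap array, because clipping changes nothing
  on configurations.\<close>

lemma limit_power_identity:
  fixes g :: "(nat \<times> nat \<Rightarrow> real) \<Rightarrow> real"
  assumes n: "1 \<le> n" and g: "continuous_on UNIV g" "bounded (range g)" "\<And>R. g (restrict R ({1..n} \<times> {1..n})) = g R"
  shows "real n * (\<integral>R. g R * (clip (R (1, n + 1)) / c) ^ Suc p \<partial>N) =
    (\<integral>R. g R \<partial>N) * (\<integral>R. (clip (R (1, 2)) / c) ^ Suc p \<partial>N) + (\<Sum>l\<in>{2..n}. \<integral>R. g R * (clip (R (1, l)) / c) ^ Suc p \<partial>N)"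
proof -
  let ?D = "\<lambda>m. {1..m} \<times> {1..m::nat}"
  obtain m where m: "(\<lambda>k. energy_deviation (W k) \<beta> p m) \<longlonglongrightarrow> 0" using conc by blast
  obtain A where A: "\<And>R. \<bar>g R\<bar> \<le> A" using g(2) by (auto simp: bounded_iff)
  have A0: "0 \<le> A" using A[of undefined] by linarith
  define \<psi> where "\<psi> x = (clip x / c) ^ Suc p" for x
  have c\<psi>: "continuous_on UNIV (\<lambda>R. \<psi> (R i))" for i :: "nat \<times> nat"
    unfolding \<psi>_def using c_pos
    by (intro continuous_intros continuous_on_compose2[OF continuous_clip continuous_entry]) auto
  have b\<psi>: "\<bar>\<psi> x\<bar> \<le> 1" for x
    unfolding \<psi>_def power_abs using clip_le[of x] c_pos by (intro power_le_one) auto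
  have test: "continuous_on UNIV (\<lambda>R. g R * \<psi> (R i))" "bounded (range (\<lambda>R. g R * \<psi> (R i)))" for i
  proof -
    show "continuous_on UNIV (\<lambda>R. g R * \<psi> (R i))" by (intro continuous_intros g c\<psi>)
    have "\<bar>g R * \<psi> (R i)\<bar> \<le> A * 1" for R unfolding abs_mult by (intro mult_mono A b\<psi>) (use A0 in auto)
    then show "bounded (range (\<lambda>R. g R * \<psi> (R i)))" unfolding bounded_iff by (intro exI[of _ A]) auto
  qed
  have gm: "g (restrict R (?D m)) = g R" if "n \<le> m" for R m
  proof -
    have "restrict (restrict R (?D m)) (?D n) = restrict R (?D n)" using that by (auto simp: fun_eq_iff restrict_def)
    then show ?thesis using g(3)[of "restrict R (?D m)"] g(3)[of R] by simp
  qed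
  define Q where "Q k = Qn (W k) \<beta>" for k
  define ov where "ov k s i = \<psi> (overlap_array M J (W k) s i)" for k s i
  have lim0: "(\<lambda>k. Q k n (\<lambda>s. g (overlap_array M J (W k) s))) \<longlonglongrightarrow> (\<integral>R. g R \<partial>N)"
    using test_limit[OF W law order_refl[of "?D n"] g(1,2)] unfolding Q_def g(3) .
  have lim: "(\<lambda>k. Q k j (\<lambda>s. g (overlap_array M J (W k) s) * ov k s (1, l))) \<longlonglongrightarrow> (\<integral>R. g R * \<psi> (R (1, l)) \<partial>N)"
    if "n \<le> j" "1 \<le> l" "l \<le> j" for j l
  proof -
    have "(1, l) \<in> ?D j" using that n by auto
    then have "g (restrict R (?D j)) * \<psi> (restrict R (?D j) (1, l)) = g R * \<psi> (R (1, l))" for R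
      using gm[OF that(1)] by simp
    with test_limit[OF W law order_refl[of "?D j"] test(1)[of "(1, l)"] test(2)[of "(1, l)"]] show ?thesis unfolding Q_def ov_def by simp
  qed
  have lim2: "(\<lambda>k. Q k 2 (\<lambda>s. ov k s (1, 2))) \<longlonglongrightarrow> (\<integral>R. \<psi> (R (1, 2)) \<partial>N)"
  proof -
    have bd: "bounded (range (\<lambda>R::nat \<times> nat \<Rightarrow> real. \<psi> (R (1, 2))))" unfolding bounded_iff using b\<psi> by (intro exI[of _ 1]) auto
    have "\<psi> (restrict R (?D 2) (1, 2)) = \<psi> (R (1, 2))" for R :: "nat \<times> nat \<Rightarrow> real" by simp
    with test_limit[OF W law order_refl[of "?D 2"] c\<psi>[of "(1, 2)"] bd] show ?thesis unfolding Q_def ov_def by simp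
  qed
  define X where "X k = \<beta> (Suc p) * (Q k n (\<lambda>s. g (overlap_array M J (W k) s)) * Q k 2 (\<lambda>s. ov k s (1, 2))
      + (\<Sum>l\<in>{2..n}. Q k n (\<lambda>s. g (overlap_array M J (W k) s) * ov k s (1, l)))
      - real n * Q k (Suc n) (\<lambda>s. g (overlap_array M J (W k) s) * ov k s (1, Suc n)))" for k
  have "X \<longlonglongrightarrow> \<beta> (Suc p) * ((\<integral>R. g R \<partial>N) * (\<integral>R. \<psi> (R (1, 2)) \<partial>N) + (\<Sum>l\<in>{2..n}. \<integral>R. g R * \<psi> (R (1, l)) \<partial>N) - real n * (\<integral>R. g R * \<psi> (R (1, Suc n)) \<partial>N))"
    unfolding X_def by (intro tendsto_intros lim0 lim2 lim) auto
  moreover have "X \<longlonglongrightarrow> 0"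
  proof (rule Lim_null_comparison)
    have "(\<lambda>k. 2 * A * energy_deviation (W k) \<beta> p m) \<longlonglongrightarrow> 2 * A * 0" by (intro tendsto_intros m)
    then show "(\<lambda>k. 2 * A * energy_deviation (W k) \<beta> p m) \<longlonglongrightarrow> 0" by simp
    show "eventually (\<lambda>k. norm (X k) \<le> 2 * A * energy_deviation (W k) \<beta> p m) sequentially"
    proof (intro always_eventually allI)
      fix k
      interpret G: gaussian_levels M "configs (W k)" "real (card (W k))" "\<lambda>s t. overlap M J (W k) s t / c" "level (W k)"
        by (rule gaussian_levels[OF W])
      have b: "summable (\<lambda>p. (\<beta> (Suc p))\<^sup>2)" using adm by (simp add: admissible_def)
      have ov: "ov k s (i, j) = (overlap M J (W k) (s i) (s j) / c) ^ Suc p" if "s \<in> replicas (configs (W k)) l" "i \<in> {1..l}" "j \<in> {1..l}" for s i j l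
      proof -
        have "\<bar>overlap M J (W k) (s i) (s j)\<bar> \<le> c"
          by (rule overlap_abs_le[OF W]) (use that in \<open>auto simp: replicas_def PiE_iff\<close>)
        then show ?thesis unfolding ov_def \<psi>_def overlap_array_apply by (simp only: clip_id)
      qed
      define f where "f s = g (overlap_array M J (W k) s)" for s
      have e1: "Q k 2 (\<lambda>s. ov k s (1, 2)) = G.quenched (\<lambda>p. \<beta> (Suc p)) 2 (\<lambda>s. (overlap M J (W k) (s 1) (s 2) / c) ^ Suc p)"
        unfolding Q_def
      proof (rule G.quenched_cong)
        fix s assume "s \<in> replicas (configs (W k)) 2"
        then show "ov k s (1, 2) = (overlap M J (W k) (s 1) (s 2) / c) ^ Suc p" by (rule ov) auto
      qed
      have e2: "Q k n (\<lambda>s. f s * ov k s (1, l)) = G.quenched (\<lambda>p. \<beta> (Suc p)) n (\<lambda>s. f s * (overlap M J (W k) (s 1) (s l) / c) ^ Suc p)" if "l \<in> {2..n}" for l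
        unfolding Q_def
      proof (rule G.quenched_cong)
        fix s assume s: "s \<in> replicas (configs (W k)) n"
        have "ov k s (1, l) = (overlap M J (W k) (s 1) (s l) / c) ^ Suc p" by (rule ov[OF s]) (use that n in auto)
        then show "f s * ov k s (1, l) = f s * (overlap M J (W k) (s 1) (s l) / c) ^ Suc p" by (simp only:)
      qed
      have e3: "Q k (Suc n) (\<lambda>s. f s * ov k s (1, Suc n)) = G.quenched (\<lambda>p. \<beta> (Suc p)) (Suc n) (\<lambda>s. f s * (overlap M J (W k) (s 1) (s (Suc n)) / c) ^ Suc p)"
        unfolding Q_def
      proof (rule G.quenched_cong)
        fix s assume s: "s \<in> replicas (configs (W k)) (Suc n)"
        have "ov k s (1, Suc n) = (overlap M J (W k) (s 1) (s (Suc n)) / c) ^ Suc p" by (rule ov[OF s]) auto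
        then show "f s * ov k s (1, Suc n) = f s * (overlap M J (W k) (s 1) (s (Suc n)) / c) ^ Suc p" by (simp only:)
      qed
      have fdep: "f (s(Suc n := t)) = f s" for s t
      proof -
        have "restrict (overlap_array M J (W k) (s(Suc n := t))) (?D n) = restrict (overlap_array M J (W k) s) (?D n)"
          by (auto simp: fun_eq_iff restrict_def overlap_array_apply)
        then show ?thesis using g(3)[of "overlap_array M J (W k) (s(Suc n := t))"] g(3)[of "overlap_array M J (W k) s"] unfolding f_def by simp
      qed
      have "\<bar>\<beta> (Suc p) * (G.quenched (\<lambda>p. \<beta> (Suc p)) n f * G.quenched (\<lambda>p. \<beta> (Suc p)) 2 (\<lambda>s. (overlap M J (W k) (s 1) (s 2) / c) ^ Suc p)
        + (\<Sum>l\<in>{2..n}. G.quenched (\<lambda>p. \<beta> (Suc p)) n (\<lambda>s. f s * (overlap M J (W k) (s 1) (s l) / c) ^ Suc p))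
        - real n * G.quenched (\<lambda>p. \<beta> (Suc p)) (Suc n) (\<lambda>s. f s * (overlap M J (W k) (s 1) (s (Suc n)) / c) ^ Suc p))\<bar>
        \<le> 2 * A * energy_deviation (W k) \<beta> p m"
        unfolding energy_deviation_def
        by (rule G.finite_volume_Ghirlanda_Guerra[OF b n fdep, where D="(1 / real (card (W k))) * (\<Sum>X\<in>Pow (W k). (\<Delta> (W k) X)\<^sup>2) / c"])
          (simp_all add: f_def A overlap_diagonal[OF W])
      also have "(\<Sum>l\<in>{2..n}. G.quenched (\<lambda>p. \<beta> (Suc p)) n (\<lambda>s. f s * (overlap M J (W k) (s 1) (s l) / c) ^ Suc p)) = (\<Sum>l\<in>{2..n}. Q k n (\<lambda>s. f s * ov k s (1, l)))"
        by (rule sum.cong[OF refl e2[symmetric]])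
      finally show "norm (X k) \<le> 2 * A * energy_deviation (W k) \<beta> p m"
        unfolding X_def f_def[symmetric] e1 e3 real_norm_def unfolding Q_def .
    qed
  qed
  ultimately have "\<beta> (Suc p) * ((\<integral>R. g R \<partial>N) * (\<integral>R. \<psi> (R (1, 2)) \<partial>N) + (\<Sum>l\<in>{2..n}. \<integral>R. g R * \<psi> (R (1, l)) \<partial>N) - real n * (\<integral>R. g R * \<psi> (R (1, Suc n)) \<partial>N)) = 0"
    by (rule LIMSEQ_unique)
  moreover have "0 < \<beta> (Suc p)" using adm by (simp add: admissible_def)
  ultimately show ?thesis by (simp add: \<psi>_def)
qed

text \<open>The defect \<Theta> is linear in the test function, vanishes on monomials and is at most
  2 n A times the supremum norm on [- c, c]; polynomials are dense in that norm. The factor 2 n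
  counts n + 1 + (n - 1) integrals.\<close>

lemma limit_continuous_identity:
  fixes g :: "(nat \<times> nat \<Rightarrow> real) \<Rightarrow> real" and \<psi> :: "real \<Rightarrow> real"
  assumes n: "1 \<le> n" and g: "continuous_on UNIV g" "bounded (range g)" "\<And>R. g (restrict R ({1..n} \<times> {1..n})) = g R"
    and \<psi>: "continuous_on UNIV \<psi>"
  shows "real n * (\<integral>R. g R * \<psi> (R (1, n + 1)) \<partial>N) =
    (\<integral>R. g R \<partial>N) * (\<integral>R. \<psi> (R (1, 2)) \<partial>N) + (\<Sum>l\<in>{2..n}. \<integral>R. g R * \<psi> (R (1, l)) \<partial>N)"
proof -
  interpret N: prob_space N by (rule limit_prob_space[OF W law])
  note sN = limit_sets[OF W law]
  obtain A where A: "\<And>R. \<bar>g R\<bar> \<le> A" using g(2) by (auto simp: bounded_iff)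
  have A0: "0 \<le> A" using A[of undefined] by linarith
  have mg: "g \<in> borel_measurable N"
  proof -
    have "(\<lambda>R. g (restrict R ({1..n} \<times> {1..n}))) \<in> borel_measurable N" by (rule test_measurable[OF sN g(1)]) auto
    then show ?thesis unfolding g(3) .
  qed
  have me: "(\<lambda>R. R (1, l)) \<in> borel_measurable N" if "1 \<le> l" for l
  proof -
    have "(1::nat, l) \<in> {1..} \<times> {1..}" using that by simp
    from measurable_component_singleton[OF this, of "\<lambda>_. borel"] have "(\<lambda>R. R (1, l)) \<in> borel_measurable array_space"
      unfolding array_space_def .
    then show ?thesis using measurable_cong_sets[OF sN refl] by blast
  qed
  have mcl: "clip \<in> borel_measurable borel" by (rule borel_measurable_continuous_onI[OF continuous_clip])
  define I where "I \<psi> l = (\<integral>R. g R * \<psi> (clip (R (1, l))) \<partial>N)" for \<psi> l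
  define I0 where "I0 \<psi> = (\<integral>R. \<psi> (clip (R (1, 2))) \<partial>N)" for \<psi> :: "real \<Rightarrow> real"
  define \<Theta> where "\<Theta> \<psi> = real n * I \<psi> (n + 1) - ((\<integral>R. g R \<partial>N) * I0 \<psi> + (\<Sum>l\<in>{2..n}. I \<psi> l))" for \<psi>
  have int: "integrable N (\<lambda>R. g R * \<psi> (clip (R (1, l))))" "integrable N (\<lambda>R. \<psi> (clip (R (1, l))))"
    if c: "continuous_on UNIV \<psi>" and l: "1 \<le> l" for \<psi> l
  proof -
    have "compact (\<psi> ` {- c..c})" by (intro compact_continuous_image continuous_on_subset[OF c]) auto
    then obtain B where B: "\<And>x. x \<in> {- c..c} \<Longrightarrow> \<bar>\<psi> x\<bar> \<le> B" using compact_imp_bounded by (force simp: bounded_iff)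
    have cB: "\<bar>\<psi> (clip x)\<bar> \<le> B" for x using B[of "clip x"] clip_le[of x] by (auto simp: abs_le_iff)
    have m: "(\<lambda>R. \<psi> (clip (R (1, l)))) \<in> borel_measurable N"
      by (rule measurable_compose[OF measurable_compose[OF me[OF l] mcl] borel_measurable_continuous_onI[OF c]])
    show "integrable N (\<lambda>R. \<psi> (clip (R (1, l))))" by (rule N.integrable_const_bound[where B=B]) (use cB m in auto)
    show "integrable N (\<lambda>R. g R * \<psi> (clip (R (1, l))))"
    proof (rule N.integrable_const_bound[where B="A * B"])
      have "\<bar>g R * \<psi> (clip (R (1, l)))\<bar> \<le> A * B" for R unfolding abs_mult by (intro mult_mono A cB) (use A0 in auto)
      then show "AE R in N. norm (g R * \<psi> (clip (R (1, l)))) \<le> A * B" by simp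
    qed (intro borel_measurable_times mg m)
  qed
  have \<Theta>_add: "\<Theta> (\<lambda>x. a * \<psi> x + \<phi> x) = a * \<Theta> \<psi> + \<Theta> \<phi>" if c: "continuous_on UNIV \<psi>" "continuous_on UNIV \<phi>" for \<psi> \<phi> a
  proof -
    have I: "I (\<lambda>x. a * \<psi> x + \<phi> x) l = a * I \<psi> l + I \<phi> l" if l: "1 \<le> l" for l
      unfolding I_def using int(1)[OF c(1) l] int(1)[OF c(2) l] by (simp add: distrib_left mult.left_commute[of _ a])
    have I0: "I0 (\<lambda>x. a * \<psi> x + \<phi> x) = a * I0 \<psi> + I0 \<phi>"
      unfolding I0_def using int(2)[OF c(1), of 2] int(2)[OF c(2), of 2] by simp
    have s: "(\<Sum>l\<in>{2..n}. I (\<lambda>x. a * \<psi> x + \<phi> x) l) = a * (\<Sum>l\<in>{2..n}. I \<psi> l) + (\<Sum>l\<in>{2..n}. I \<phi> l)"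
      unfolding sum_distrib_left sum.distrib[symmetric] by (intro sum.cong refl I) auto
    show ?thesis unfolding \<Theta>_def I0 s by (subst I) (simp_all add: algebra_simps)
  qed
  have \<Theta>_pow: "\<Theta> (\<lambda>x. x ^ i) = 0" for i
  proof (cases i)
    \<comment> \<open>Levels start at power 1, so the constant function is checked by hand: n copies
      of the mean of g on each side.\<close>
    case 0
    have "(\<Sum>l\<in>{2..n}. (\<integral>R. g R \<partial>N)) = (real n - 1) * (\<integral>R. g R \<partial>N)" using n by (simp add: of_nat_diff)
    then show ?thesis unfolding \<Theta>_def I_def I0_def 0 by (simp add: N.prob_space algebra_simps)
  next
    case (Suc p)
    have pw: "x ^ Suc p = c ^ Suc p * (x / c) ^ Suc p" for x using c_pos by (simp add: power_divide del: power_Suc)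
    define E where "E l = (\<integral>R. g R * (clip (R (1, l)) / c) ^ Suc p \<partial>N)" for l
    define E0 where "E0 = (\<integral>R. (clip (R (1, 2)) / c) ^ Suc p \<partial>N)"
    have I: "I (\<lambda>x. x ^ i) l = c ^ Suc p * E l" for l
      unfolding I_def Suc E_def by (subst pw) (simp only: mult.left_commute[of _ "c ^ Suc p"] Bochner_Integration.integral_mult_right_zero)
    have I0: "I0 (\<lambda>x. x ^ i) = c ^ Suc p * E0"
      unfolding I0_def Suc E0_def by (subst pw) (simp only: Bochner_Integration.integral_mult_right_zero)
    have "\<Theta> (\<lambda>x. x ^ i) = c ^ Suc p * (real n * E (n + 1) - ((\<integral>R. g R \<partial>N) * E0 + (\<Sum>l\<in>{2..n}. E l)))"
      unfolding \<Theta>_def I I0 sum_distrib_left[symmetric] by (simp only: algebra_simps)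
    also have "real n * E (n + 1) - ((\<integral>R. g R \<partial>N) * E0 + (\<Sum>l\<in>{2..n}. E l)) = 0"
      using limit_power_identity[OF n g, of p] unfolding E_def[symmetric] E0_def[symmetric] by linarith
    finally show ?thesis by simp
  qed
  have \<Theta>_poly: "\<Theta> (\<lambda>x. \<Sum>i\<le>m. a i * x ^ i) = 0" for a m
  proof (induction m)
    case 0
    have "\<Theta> (\<lambda>x. a 0 * x ^ 0 + 0 * x ^ 0) = 0"
      by (subst \<Theta>_add) (auto simp: \<Theta>_pow[of 0, simplified] intro!: continuous_intros, simp add: \<Theta>_def I_def I0_def)
    then show ?case by simp
  next
    case (Suc m)
    have "\<Theta> (\<lambda>x. a (Suc m) * x ^ Suc m + (\<Sum>i\<le>m. a i * x ^ i)) = 0"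
      by (subst \<Theta>_add) (auto simp: \<Theta>_pow Suc simp del: power_Suc intro!: continuous_intros)
    then show ?case by (simp add: add.commute)
  qed
  have \<Theta>_bound: "\<bar>\<Theta> \<phi>\<bar> \<le> 2 * real n * A * e" if c: "continuous_on UNIV \<phi>" and e: "\<And>x. x \<in> {- c..c} \<Longrightarrow> \<bar>\<phi> x\<bar> \<le> e" for \<phi> e
  proof -
    have cl: "\<bar>\<phi> (clip x)\<bar> \<le> e" for x using e[of "clip x"] clip_le[of x] by (auto simp: abs_le_iff)
    have e0: "0 \<le> e" using cl[of 0] by linarith
    have I: "\<bar>I \<phi> l\<bar> \<le> A * e" if l: "1 \<le> l" for l
    proof -
      have "\<bar>I \<phi> l\<bar> \<le> (\<integral>R. \<bar>g R * \<phi> (clip (R (1, l)))\<bar> \<partial>N)" unfolding I_def by (rule integral_abs_bound)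
      also have "\<dots> \<le> A * e"
      proof (rule N.integral_le_const)
        show "integrable N (\<lambda>R. \<bar>g R * \<phi> (clip (R (1, l)))\<bar>)" using int(1)[OF c l] by simp
        have "\<bar>g R * \<phi> (clip (R (1, l)))\<bar> \<le> A * e" for R unfolding abs_mult by (intro mult_mono A cl) (use A0 in auto)
        then show "AE R in N. \<bar>g R * \<phi> (clip (R (1, l)))\<bar> \<le> A * e" by simp
      qed
      finally show ?thesis .
    qed
    have I0: "\<bar>I0 \<phi>\<bar> \<le> e"
    proof -
      have "\<bar>I0 \<phi>\<bar> \<le> (\<integral>R. \<bar>\<phi> (clip (R (1, 2)))\<bar> \<partial>N)" unfolding I0_def by (rule integral_abs_bound)
      also have "\<dots> \<le> e" by (rule N.integral_le_const) (use int(2)[OF c, of 2] cl in auto)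
      finally show ?thesis .
    qed
    have Eg: "\<bar>\<integral>R. g R \<partial>N\<bar> \<le> A"
    proof -
      have ig: "integrable N g" by (rule N.integrable_const_bound[where B=A]) (use A mg in auto)
      have "\<bar>\<integral>R. g R \<partial>N\<bar> \<le> (\<integral>R. \<bar>g R\<bar> \<partial>N)" by (rule integral_abs_bound)
      also have "\<dots> \<le> A" by (rule N.integral_le_const) (use ig A in auto)
      finally show ?thesis .
    qed
    have s: "\<bar>\<Sum>l\<in>{2..n}. I \<phi> l\<bar> \<le> (real n - 1) * (A * e)"
    proof -
      have "\<bar>\<Sum>l\<in>{2..n}. I \<phi> l\<bar> \<le> (\<Sum>l\<in>{2..n}. A * e)" by (rule order_trans[OF sum_abs sum_mono]) (auto intro!: I)
      then show ?thesis using n by (simp add: of_nat_diff)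
    qed
    have p: "\<bar>(\<integral>R. g R \<partial>N) * I0 \<phi>\<bar> \<le> A * e" unfolding abs_mult by (intro mult_mono Eg I0) (use A0 in auto)
    have q: "\<bar>real n * I \<phi> (n + 1)\<bar> \<le> real n * (A * e)" unfolding abs_mult using I[of "n + 1"] by (simp add: mult_left_mono)
    have "\<bar>\<Theta> \<phi>\<bar> \<le> \<bar>real n * I \<phi> (n + 1)\<bar> + (\<bar>(\<integral>R. g R \<partial>N) * I0 \<phi>\<bar> + \<bar>\<Sum>l\<in>{2..n}. I \<phi> l\<bar>)"
      unfolding \<Theta>_def by linarith
    also have "\<dots> \<le> real n * (A * e) + (A * e + (real n - 1) * (A * e))" by (intro add_mono q p s)
    finally show ?thesis by (simp add: algebra_simps)
  qed
  have "\<Theta> \<psi> = 0"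
  proof -
    have "\<bar>\<Theta> \<psi>\<bar> \<le> 2 * real n * A * e" if e: "0 < e" for e
    proof -
      have "continuous_on {- c..c} \<psi>" using \<psi> by (rule continuous_on_subset) auto
      then obtain P where P: "real_polynomial_function P" "\<And>x. x \<in> {- c..c} \<Longrightarrow> \<bar>\<psi> x - P x\<bar> < e"
        using Stone_Weierstrass_real_polynomial_function[of "{- c..c}" \<psi> e] e by auto
      obtain a m where Pa: "P = (\<lambda>x. \<Sum>i\<le>m. a i * x ^ i)" using P(1) unfolding real_polynomial_function_iff_sum by auto
      have cP: "continuous_on UNIV P" unfolding Pa by (intro continuous_intros)
      have "\<Theta> (\<lambda>x. 1 * \<psi> x + (- 1) * P x) = 1 * \<Theta> \<psi> + (- 1) * \<Theta> P"
        using \<Theta>_add[OF \<psi>, of "\<lambda>x. - 1 * P x" 1] \<Theta>_add[OF cP, of "\<lambda>_. 0" "-1"] cP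
        by (simp add: continuous_intros) (simp add: \<Theta>_def I_def I0_def)
      then have "\<Theta> \<psi> = \<Theta> (\<lambda>x. \<psi> x - P x)" using \<Theta>_poly[of a m] by (simp add: Pa)
      also have "\<bar>\<dots>\<bar> \<le> 2 * real n * A * e"
        by (rule \<Theta>_bound) (use P(2) \<psi> cP in \<open>auto intro!: continuous_intros less_imp_le\<close>)
      finally show ?thesis .
    qed
    note bnd = this
    have "\<bar>\<Theta> \<psi>\<bar> \<le> 0"
    proof (rule field_le_epsilon)
      fix e :: real assume e: "0 < e"
      define e' where "e' = e / (2 * real n * A + 1)"
      have d: "0 < 2 * real n * A + 1" using A0 by (intro add_nonneg_pos) auto
      have "2 * real n * A * e' \<le> (2 * real n * A + 1) * e'" using e d by (intro mult_right_mono) (auto simp: e'_def)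
      also have "\<dots> = e" using d by (simp add: e'_def)
      finally show "\<bar>\<Theta> \<psi>\<bar> \<le> 0 + e" using bnd[of e'] e d by (simp add: e'_def)
    qed
    then show ?thesis by simp
  qed
  have ae: "AE R in N. clip (R (1, l)) = R (1, l)" if "1 \<le> l" for l
    using limit_bounded[OF W law order_refl that] by eventually_elim (rule clip_id)
  have m\<psi>: "\<psi> \<in> borel_measurable borel" by (rule borel_measurable_continuous_onI[OF \<psi>])
  have Ie: "I \<psi> l = (\<integral>R. g R * \<psi> (R (1, l)) \<partial>N)" if l: "1 \<le> l" for l
    unfolding I_def
  proof (rule integral_cong_AE)
    show "AE R in N. g R * \<psi> (clip (R (1, l))) = g R * \<psi> (R (1, l))" using ae[OF l] by eventually_elim simp
    show "(\<lambda>R. g R * \<psi> (clip (R (1, l)))) \<in> borel_measurable N" using int(1)[OF \<psi> l] by auto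
    show "(\<lambda>R. g R * \<psi> (R (1, l))) \<in> borel_measurable N"
      by (intro borel_measurable_times mg measurable_compose[OF me[OF l] m\<psi>])
  qed
  have I0e: "I0 \<psi> = (\<integral>R. \<psi> (R (1, 2)) \<partial>N)"
    unfolding I0_def
  proof (rule integral_cong_AE)
    show "AE R in N. \<psi> (clip (R (1, 2))) = \<psi> (R (1, 2))" using ae[OF one_le_numeral, of "num.Bit0 num.One"] by eventually_elim simp
    show "(\<lambda>R. \<psi> (clip (R (1, 2)))) \<in> borel_measurable N" using int(2)[OF \<psi>, of 2] by auto
    show "(\<lambda>R. \<psi> (R (1, 2))) \<in> borel_measurable N"
      by (rule measurable_compose[OF me m\<psi>]) simp
  qed
  have "(\<Sum>l\<in>{2..n}. I \<psi> l) = (\<Sum>l\<in>{2..n}. \<integral>R. g R * \<psi> (R (1, l)) \<partial>N)" by (intro sum.cong refl Ie) auto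
  with \<open>\<Theta> \<psi> = 0\<close> show ?thesis unfolding \<Theta>_def I0e using Ie[of "n + 1"] by simp
qed

text \<open>The identities say that the joint law of the first \<open>n\<close> replicas and \<open>c\<^sub>1\<^sub>,\<^sub>n\<^sub>+\<^sub>1\<close> is the uniform
  mixture of the laws obtained when \<open>c\<^sub>1\<^sub>,\<^sub>n\<^sub>+\<^sub>1\<close> is replaced by an independent copy of \<open>c\<^sub>1\<^sub>,\<^sub>2\<close> or by
  \<open>c\<^sub>1\<^sub>,\<^sub>l\<close>, \<open>2 \<le> l \<le> n\<close>; the two laws have the same characteristic function.\<close>

lemma limit_ghirlanda_guerra: "ghirlanda_guerra N"
  unfolding ghirlanda_guerra_def
proof (intro allI impI, elim conjE)
  fix n :: nat and f :: "(nat \<times> nat \<Rightarrow> real) \<Rightarrow> real" and \<psi> :: "real \<Rightarrow> real"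
  assume n2: "2 \<le> n" and f: "f \<in> borel_measurable (PiM ({1..n} \<times> {1..n}) (\<lambda>_. borel))"
      "bounded (f ` space (PiM ({1..n} \<times> {1..n}) (\<lambda>_. borel)))"
    and \<psi>: "\<psi> \<in> borel_measurable borel" "bounded (range \<psi>)"
  have n: "1 \<le> n" using n2 by simp
  interpret N: prob_space N by (rule limit_prob_space[OF W law])
  note sN = limit_sets[OF W law]
  define D where "D = {1..n} \<times> {1..n}"
  define e where "e = (1::nat, n + 1)"
  define I where "I = insert e D"
  have D: "finite D" "D \<subseteq> {1..} \<times> {1..}" and eD: "e \<notin> D" by (auto simp: D_def e_def)
  have me: "(\<lambda>R. R i) \<in> borel_measurable N" if "i \<in> {1..} \<times> {1..}" for i
    using measurable_component_singleton[OF that, of "\<lambda>_. borel"] measurable_cong_sets[OF sN refl]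
    unfolding array_space_def by blast
  have me1: "(\<lambda>R. R (1, l)) \<in> borel_measurable N" if "1 \<le> l" for l
    by (rule me) (use that in auto)
  have meI: "(\<lambda>R. R i) \<in> borel_measurable N" if "i \<in> I" for i
    by (rule me) (use that D in \<open>auto simp: I_def e_def\<close>)
  define K where "K = N \<Otimes>\<^sub>M N"
  define P where "P = measure_pmf (pmf_of_set {1..n}) \<Otimes>\<^sub>M K"
  have psK: "prob_space K" unfolding K_def by (rule N.pair_prob_space)
  interpret K: prob_space K by (rule psK)
  interpret P: pair_prob_space "measure_pmf (pmf_of_set {1..n})" K ..
  have psP: "prob_space P" unfolding P_def by (rule P.prob_space_axioms)
  interpret P: prob_space P by (rule psP)
  \<comment> \<open>Label 1 stands for the independent copy of the overlap, labels 2..n for an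
    overlap with replica 1. Labels outside 1..n have probability zero and receive an arbitrary
    value.\<close>
  define E where "E l z = (if l = 1 \<or> n < l then snd z (1, 2) else fst z (1, l) :: real)"
    for l :: nat and z :: "(nat \<times> nat \<Rightarrow> real) \<times> (nat \<times> nat \<Rightarrow> real)"
  define Y where "Y i w = (if i = e then E (fst w) (snd w) else fst (snd w) i)"
    for i and w :: "nat \<times> (nat \<times> nat \<Rightarrow> real) \<times> (nat \<times> nat \<Rightarrow> real)"
  have mfst: "(\<lambda>z. g (fst z)) \<in> borel_measurable K" if "g \<in> borel_measurable N" for g :: "_ \<Rightarrow> real"
    unfolding K_def by (rule measurable_compose[OF measurable_fst that])
  have msnd: "(\<lambda>z. g (snd z)) \<in> borel_measurable K" if "g \<in> borel_measurable N" for g :: "_ \<Rightarrow> real"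
    unfolding K_def by (rule measurable_compose[OF measurable_snd that])
  have mE: "E l \<in> borel_measurable K" for l
  proof (cases "l = 1 \<or> n < l")
    case True
    then have "E l = (\<lambda>z. snd z (1, 2))" by (auto simp: E_def fun_eq_iff)
    then show ?thesis using msnd[OF me1[OF one_le_numeral]] by simp
  next
    case False
    show ?thesis
    proof (cases "l = 0")
      case True
      \<comment> \<open>The position (1, 0) is outside the index set, so the entry is constant by
        extensionality.\<close>
      have "(\<lambda>R. R (1, 0)) \<in> borel_measurable N"
      proof -
        have "R (1, 0) = undefined" if "R \<in> space N" for R
          using that sets_eq_imp_space_eq[OF sN] by (auto simp: space_array PiE_iff extensional_def)
        then show ?thesis by (subst measurable_cong[where g="\<lambda>_. undefined"]) auto
      qed
      moreover have "E l = (\<lambda>z. fst z (1, 0))" using True by (auto simp: E_def fun_eq_iff)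
      ultimately show ?thesis using mfst by simp
    next
      case False
      then have "E l = (\<lambda>z. fst z (1, l))" using \<open>\<not> (l = 1 \<or> n < l)\<close> by (auto simp: E_def fun_eq_iff)
      moreover have "1 \<le> l" using False by simp
      ultimately show ?thesis using mfst[OF me1[of l]] by simp
    qed
  qed
  have mYe: "Y e \<in> borel_measurable P"
  proof -
    have "(\<lambda>z. E (fst z) (snd z)) \<in> borel_measurable (count_space UNIV \<Otimes>\<^sub>M K)"
      by (rule measurable_pair_measure_countable1) (auto simp: mE)
    also have "borel_measurable (count_space UNIV \<Otimes>\<^sub>M K) = borel_measurable P"
      unfolding P_def by (intro measurable_cong_sets sets_pair_measure_cong) auto
    finally show ?thesis unfolding Y_def by simp
  qed
  have mP: "(\<lambda>w. g (fst (snd w))) \<in> borel_measurable P" if "g \<in> borel_measurable N" for g :: "_ \<Rightarrow> real"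
    unfolding P_def by (rule measurable_compose[OF measurable_snd mfst[OF that]])
  have mY: "Y i \<in> borel_measurable P" if "i \<in> I" for i
  proof (cases "i = e")
    case False
    then have "Y i = (\<lambda>w. fst (snd w) i)" by (auto simp: Y_def fun_eq_iff)
    then show ?thesis using mP[OF meI[OF that]] by simp
  qed (simp add: mYe)
  \<comment> \<open>Integrating out the label writes the right-hand side of the identities as one
    integral, also for measurable functions. This serves once for continuous functions, to compare
    the laws, and once for the final f and \<psi>.\<close>
  have mix: "(\<integral>w. g (fst (snd w)) * \<phi> (Y e w) \<partial>P) = (1 / real n) * (\<integral>R. g R \<partial>N) * (\<integral>R. \<phi> (R (1, 2)) \<partial>N)
      + (1 / real n) * (\<Sum>l\<in>{2..n}. \<integral>R. g R * \<phi> (R (1, l)) \<partial>N)"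
    if g: "g \<in> borel_measurable N" "\<And>R. \<bar>g R\<bar> \<le> A" and \<phi>: "\<phi> \<in> borel_measurable borel" "\<And>x. \<bar>\<phi> x\<bar> \<le> B" for g A \<phi> B
  proof -
    have "(\<integral>w. g (fst (snd w)) * \<phi> (E (fst w) (snd w)) \<partial>P) = (\<Sum>l\<in>{1..n}. \<integral>z. g (fst z) * \<phi> (E l z) \<partial>K) / real n"
      unfolding P_def
    proof (rule integral_uniform_mixture[OF psK n, where F="\<lambda>l z. g (fst z) * \<phi> (E l z)" and B="A * B"])
      show "(\<lambda>z. g (fst z) * \<phi> (E l z)) \<in> borel_measurable K" for l
        by (intro borel_measurable_times mfst g measurable_compose[OF mE \<phi>(1)])
      show "\<bar>g (fst z) * \<phi> (E l z)\<bar> \<le> A * B" for l z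
        unfolding abs_mult by (intro mult_mono g \<phi>) (use order_trans[OF abs_ge_zero g(2)] in auto)
    qed
    also have "{1..n} = insert 1 {2..n}" using n by auto
    also have "(\<Sum>l\<in>insert 1 {2..n}. \<integral>z. g (fst z) * \<phi> (E l z) \<partial>K) =
        (\<integral>z. g (fst z) * \<phi> (E 1 z) \<partial>K) + (\<Sum>l\<in>{2..n}. \<integral>z. g (fst z) * \<phi> (E l z) \<partial>K)" by (rule sum.insert) auto
    also have "(\<integral>z. g (fst z) * \<phi> (E 1 z) \<partial>K) = (\<integral>R. g R \<partial>N) * (\<integral>R. \<phi> (R (1, 2)) \<partial>N)"
    proof -
      have m2: "(\<lambda>R. \<phi> (R (1, 2))) \<in> borel_measurable N" by (rule measurable_compose[OF me1[OF one_le_numeral] \<phi>(1)])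
      have "(\<integral>z. g (fst z) * \<phi> (snd z (1, 2)) \<partial>K) = (\<integral>R. g R \<partial>N) * (\<integral>R. \<phi> (R (1, 2)) \<partial>N)"
        unfolding K_def
      proof (rule N.integral_fst_mult_snd(1))
        show "integrable N g" by (rule N.integrable_const_bound[where B=A]) (use g in auto)
        show "integrable N (\<lambda>R. \<phi> (R (1, 2)))" by (rule N.integrable_const_bound[where B=B]) (use m2 \<phi> in auto)
      qed
      then show ?thesis by (simp add: E_def)
    qed
    also have "(\<Sum>l\<in>{2..n}. \<integral>z. g (fst z) * \<phi> (E l z) \<partial>K) = (\<Sum>l\<in>{2..n}. \<integral>R. g R * \<phi> (R (1, l)) \<partial>N)"
    proof (rule sum.cong[OF refl])
      fix l assume l: "l \<in> {2..n}"
      have "(\<integral>z. g (fst z) * \<phi> (E l z) \<partial>K) = (\<integral>z. (\<lambda>R. g R * \<phi> (R (1, l))) (fst z) \<partial>(N \<Otimes>\<^sub>M N))"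
        unfolding K_def using l by (simp add: E_def)
      also have "\<dots> = (\<integral>R. g R * \<phi> (R (1, l)) \<partial>N)"
        by (rule N.integral_fst_eq, intro borel_measurable_times g measurable_compose[OF me1 \<phi>(1)]) (use l in auto)
      finally show "(\<integral>z. g (fst z) * \<phi> (E l z) \<partial>K) = (\<integral>R. g R * \<phi> (R (1, l)) \<partial>N)" .
    qed
    finally show ?thesis by (simp add: Y_def add_divide_distrib)
  qed
  have id: "(\<integral>R. g R * \<phi> (R e) \<partial>N) = (\<integral>w. g (fst (snd w)) * \<phi> (Y e w) \<partial>P)"
    if g: "continuous_on UNIV g" "\<And>R. \<bar>g R\<bar> \<le> 1" "\<And>R. g (restrict R D) = g R"
      and \<phi>: "continuous_on UNIV \<phi>" "\<And>x. \<bar>\<phi> x\<bar> \<le> 1" for g :: "(nat \<times> nat \<Rightarrow> real) \<Rightarrow> real" and \<phi> :: "real \<Rightarrow> real"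
  proof -
    have mg: "g \<in> borel_measurable N" using test_measurable[OF sN g(1) D(2)] unfolding g(3) .
    have bg: "bounded (range g)" unfolding bounded_iff using g(2) by (intro exI[of _ 1]) auto
    have "real n * (\<integral>R. g R * \<phi> (R e) \<partial>N) =
      (\<integral>R. g R \<partial>N) * (\<integral>R. \<phi> (R (1, 2)) \<partial>N) + (\<Sum>l\<in>{2..n}. \<integral>R. g R * \<phi> (R (1, l)) \<partial>N)"
      unfolding e_def by (rule limit_continuous_identity[OF n g(1) bg g(3)[unfolded D_def] \<phi>(1)])
    also have "\<dots> = real n * (\<integral>w. g (fst (snd w)) * \<phi> (Y e w) \<partial>P)"
      unfolding mix[OF mg g(2) borel_measurable_continuous_onI[OF \<phi>(1)] \<phi>(2)] using n by (simp add: field_simps)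
    finally show ?thesis using n by simp
  qed
  have law_eq: "distr N (PiM I (\<lambda>_. borel)) (\<lambda>R. \<lambda>i\<in>I. R i) = distr P (PiM I (\<lambda>_. borel)) (\<lambda>w. \<lambda>i\<in>I. Y i w)"
  proof (rule Cramer_Wold)
    show "prob_space N" by (rule N.prob_space_axioms)
    show "prob_space P" by (rule psP)
    show "finite I" using D by (simp add: I_def)
    fix a :: "nat \<times> nat \<Rightarrow> real"
    define S where "S R = (\<Sum>i\<in>D. a i * R i)" for R
    have Sr: "S (restrict R D) = S R" for R unfolding S_def by (simp cong: sum.cong)
    have cS: "continuous_on UNIV S" unfolding S_def by (intro continuous_intros continuous_entry)
    have mS: "S \<in> borel_measurable N" using test_measurable[OF sN cS D(2)] unfolding Sr .
    have s1: "(\<Sum>i\<in>I. a i * R i) = S R + a e * R e" for R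
      unfolding I_def S_def using D eD by (simp add: add.commute)
    have s2: "(\<Sum>i\<in>I. a i * Y i w) = S (fst (snd w)) + a e * Y e w" for w
    proof -
      have "(\<Sum>i\<in>D. a i * Y i w) = S (fst (snd w))" unfolding S_def by (rule sum.cong) (use eD in \<open>auto simp: Y_def\<close>)
      then show ?thesis unfolding I_def using D eD by (simp add: add.commute)
    qed
    have mRe: "(\<lambda>R. R e) \<in> borel_measurable N" by (rule meI) (simp add: I_def)
    have m1 [measurable]: "(\<lambda>R. S R) \<in> borel_measurable N" "(\<lambda>R. R e) \<in> borel_measurable N" using mS mRe by auto
    have m2 [measurable]: "(\<lambda>w. S (fst (snd w))) \<in> borel_measurable P" "(\<lambda>w. Y e w) \<in> borel_measurable P"
      using mP[OF mS] mYe by auto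
    have p1: "\<bar>u * v\<bar> \<le> 1" if "\<bar>u\<bar> \<le> 1" "\<bar>v\<bar> \<le> 1" for u v :: real
      unfolding abs_mult using that by (intro mult_le_one) auto
    have iN: "integrable N (\<lambda>R. u (S R) * v (a e * R e))" and iP: "integrable P (\<lambda>w. u (S (fst (snd w))) * v (a e * Y e w))"
      if "u \<in> borel_measurable borel" "v \<in> borel_measurable borel" "\<And>x. \<bar>u x\<bar> \<le> 1" "\<And>x. \<bar>v x\<bar> \<le> 1" for u v :: "real \<Rightarrow> real"
    proof -
      note [measurable] = that(1,2)
      show "integrable N (\<lambda>R. u (S R) * v (a e * R e))"
        by (rule N.integrable_const_bound[where B=1]) (auto simp: p1 that)
      show "integrable P (\<lambda>w. u (S (fst (snd w))) * v (a e * Y e w))"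
        by (rule P.integrable_const_bound[where B=1]) (auto simp: p1 that)
    qed
    have idt: "(\<integral>R. u (S R) * v (a e * R e) \<partial>N) = (\<integral>w. u (S (fst (snd w))) * v (a e * Y e w) \<partial>P)"
      if "continuous_on UNIV u" "continuous_on UNIV v" "\<And>x. \<bar>u x\<bar> \<le> 1" "\<And>x. \<bar>v x\<bar> \<le> 1" for u v :: "real \<Rightarrow> real"
    proof (rule id[of "\<lambda>R. u (S R)" "\<lambda>x. v (a e * x)"])
      show "continuous_on UNIV (\<lambda>R. u (S R))" by (rule continuous_on_compose2[OF that(1) cS]) auto
      show "continuous_on UNIV (\<lambda>x. v (a e * x))" by (rule continuous_on_compose2[OF that(2)]) (auto intro!: continuous_intros)
    qed (simp_all add: that Sr)
    have cc: "continuous_on UNIV (cos :: real \<Rightarrow> real)" "continuous_on UNIV (sin :: real \<Rightarrow> real)" by (intro continuous_intros)+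
    have mb: "(cos :: real \<Rightarrow> real) \<in> borel_measurable borel" "(sin :: real \<Rightarrow> real) \<in> borel_measurable borel"
      by (intro borel_measurable_continuous_onI cc)+
    note [simp] = iN[OF mb(1,1) abs_cos_le_one abs_cos_le_one] iN[OF mb(2,2) abs_sin_le_one abs_sin_le_one]
      iN[OF mb(2,1) abs_sin_le_one abs_cos_le_one] iN[OF mb(1,2) abs_cos_le_one abs_sin_le_one]
      iP[OF mb(1,1) abs_cos_le_one abs_cos_le_one] iP[OF mb(2,2) abs_sin_le_one abs_sin_le_one]
      iP[OF mb(2,1) abs_sin_le_one abs_cos_le_one] iP[OF mb(1,2) abs_cos_le_one abs_sin_le_one]
    show "(\<integral>R. cos (\<Sum>i\<in>I. a i * R i) \<partial>N) = (\<integral>w. cos (\<Sum>i\<in>I. a i * Y i w) \<partial>P)"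
      unfolding s2 unfolding s1 cos_add
      by (simp add: idt[OF cc(1) cc(1) abs_cos_le_one abs_cos_le_one] idt[OF cc(2) cc(2) abs_sin_le_one abs_sin_le_one])
    show "(\<integral>R. sin (\<Sum>i\<in>I. a i * R i) \<partial>N) = (\<integral>w. sin (\<Sum>i\<in>I. a i * Y i w) \<partial>P)"
      unfolding s2 unfolding s1 sin_add
      by (simp add: idt[OF cc(2) cc(1) abs_sin_le_one abs_cos_le_one] idt[OF cc(1) cc(2) abs_cos_le_one abs_sin_le_one])
  qed (use meI mY in auto)
  define h where "h r = f (restrict r D) * \<psi> (r e)" for r
  have mh: "h \<in> borel_measurable (PiM I (\<lambda>_. borel))"
  proof -
    have "(\<lambda>r. restrict r D) \<in> measurable (PiM I (\<lambda>_. borel)) (PiM D (\<lambda>_. borel))"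
      by (rule measurable_restrict_subset) (auto simp: I_def)
    from measurable_compose[OF this f(1)[folded D_def]]
    have "(\<lambda>r. f (restrict r D)) \<in> borel_measurable (PiM I (\<lambda>_. borel))" .
    moreover have "e \<in> I" by (simp add: I_def)
    from measurable_compose[OF measurable_component_singleton[OF this, of "\<lambda>_. borel"] \<psi>(1)]
    have "(\<lambda>r. \<psi> (r e)) \<in> borel_measurable (PiM I (\<lambda>_. borel))" .
    ultimately show ?thesis unfolding h_def by (rule borel_measurable_times)
  qed
  have mf: "(\<lambda>R. f (restrict R D)) \<in> borel_measurable N"
  proof (rule measurable_compose[OF _ f(1)[folded D_def]])
    show "(\<lambda>R. restrict R D) \<in> measurable N (PiM D (\<lambda>_. borel))"
      by (rule measurable_restrict) (rule me, use D in auto)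
  qed
  obtain A where A: "\<And>R. \<bar>f (restrict R D)\<bar> \<le> A"
  proof -
    from f(2) obtain A where A: "\<forall>x\<in>f ` space (PiM D (\<lambda>_. borel)). norm x \<le> A" unfolding bounded_iff D_def by blast
    have "restrict R D \<in> space (PiM D (\<lambda>_. borel :: real measure))" for R by (simp add: space_PiM)
    then have "\<bar>f (restrict R D)\<bar> \<le> A" for R using A by auto
    then show ?thesis by (rule that)
  qed
  obtain B where B: "\<And>x. \<bar>\<psi> x\<bar> \<le> B" using \<psi>(2) by (auto simp: bounded_iff)
  have mr: "(\<lambda>R. \<lambda>i\<in>I. R i) \<in> measurable N (PiM I (\<lambda>_. borel))" by (rule measurable_restrict) (rule meI)
  have mr': "(\<lambda>w. \<lambda>i\<in>I. Y i w) \<in> measurable P (PiM I (\<lambda>_. borel))" by (rule measurable_restrict) (rule mY)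
  have h1: "h (\<lambda>i\<in>I. R i) = f (restrict R D) * \<psi> (R e)" for R
  proof -
    have "restrict (\<lambda>i\<in>I. R i) D = restrict R D" by (auto simp: fun_eq_iff I_def)
    then show ?thesis by (simp add: h_def I_def)
  qed
  have h2: "h (\<lambda>i\<in>I. Y i w) = f (restrict (fst (snd w)) D) * \<psi> (Y e w)" for w
  proof -
    have "restrict (\<lambda>i\<in>I. Y i w) D = restrict (fst (snd w)) D" using eD by (auto simp: fun_eq_iff I_def Y_def)
    then show ?thesis by (simp add: h_def I_def)
  qed
  have "(\<integral>R. f (restrict R D) * \<psi> (R e) \<partial>N) = (\<integral>w. f (restrict (fst (snd w)) D) * \<psi> (Y e w) \<partial>P)"
    by (rule trans[OF integral_distr[OF mr mh, unfolded law_eq h1, symmetric] integral_distr[OF mr' mh, unfolded h2]])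
  also have "\<dots> = (1 / real n) * (\<integral>R. f (restrict R D) \<partial>N) * (\<integral>R. \<psi> (R (1, 2)) \<partial>N)
      + (1 / real n) * (\<Sum>l\<in>{2..n}. \<integral>R. f (restrict R D) * \<psi> (R (1, l)) \<partial>N)"
    by (rule mix[OF mf A \<psi>(1) B])
  finally show "(\<integral>R. f (restrict R ({1..n} \<times> {1..n})) * \<psi> (R (1, n + 1)) \<partial>N) =
          (1 / real n) * (\<integral>R. f (restrict R ({1..n} \<times> {1..n})) \<partial>N) * (\<integral>R. \<psi> (R (1, 2)) \<partial>N)
          + (1 / real n) * (\<Sum>l=2..n. \<integral>R. f (restrict R ({1..n} \<times> {1..n})) * \<psi> (R (1, l)) \<partial>N)"
    unfolding D_def e_def .
qed

lemma limit_ultrametric: "ultrametric_law N"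
proof -
  interpret N: prob_space N by (rule limit_prob_space[OF W law])
  interpret gg_array N c
    by unfold_locales (fact limit_sets[OF W law] limit_exchangeable[OF W law] limit_symmetric[OF W law]
      limit_bounded[OF W law] limit_positive[OF W law] limit_ghirlanda_guerra)+
  show ?thesis by (rule ultrametric)
qed

end

end

section \<open>Convexity in the parameters and generic parameters\<close>

subsection \<open>Differentiability of convex functions on the half-line\<close>

lemma convex_right_slope_mono:
  fixes f :: "real \<Rightarrow> real"
  assumes f: "convex_on {0<..} f" and x: "0 < x" and h: "0 < h" "h \<le> k"
  shows "(f (x + h) - f x) / h \<le> (f (x + k) - f x) / k"
proof (cases "h = k")
  case False
  have "(f x - f (x + h)) / (x - (x + h)) \<le> (f x - f (x + k)) / (x - (x + k))"
    by (rule convex_on_slope_le(1)[OF f]) (use x h False in auto)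
  then show ?thesis using h by (simp add: field_simps)
qed simp

lemma convex_left_slope_antimono:
  fixes f :: "real \<Rightarrow> real"
  assumes f: "convex_on {0<..} f" and h: "0 < h" "h \<le> k" "k < x"
  shows "(f x - f (x - k)) / k \<le> (f x - f (x - h)) / h"
proof (cases "h = k")
  case False
  have "(f (x - k) - f x) / (x - k - x) \<le> (f (x - h) - f x) / (x - h - x)"
    by (rule convex_on_slope_le(2)[OF f]) (use h False in auto)
  then show ?thesis using h by (simp add: field_simps)
qed simp

lemma convex_left_slope_le_right_slope:
  fixes f :: "real \<Rightarrow> real"
  assumes f: "convex_on {0<..} f" and h: "0 < h" "0 < k" "k < x"
  shows "(f x - f (x - k)) / k \<le> (f (x + h) - f x) / h"
proof -
  have "(f (x - k) - f x) / (x - k - x) \<le> (f (x - k) - f (x + h)) / (x - k - (x + h))"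
    by (rule convex_on_slope_le(1)[OF f]) (use h in auto)
  also have "\<dots> \<le> (f x - f (x + h)) / (x - (x + h))"
    by (rule convex_on_slope_le(2)[OF f]) (use h in auto)
  finally show ?thesis using h by (simp add: field_simps)
qed

text \<open>The symmetric second difference divided by its step s is the right slope minus the left
  slope at s. Slopes are monotone in the step, so a small value at a single step bounds the gap for
  all smaller ones; the supremum m of the left slopes is then the derivative. Steps 1 / (n + 1)
  suffice, which keeps the condition countable.\<close>

lemma convex_differentiable:
  fixes f :: "real \<Rightarrow> real"
  assumes f: "convex_on {0<..} f" and x: "0 < x"
    and flat: "\<And>i. \<exists>n. inverse (Suc n) < x \<and> f (x + inverse (Suc n)) + f (x - inverse (Suc n)) - 2 * f x < inverse (Suc i) * inverse (Suc n)"
  shows "f differentiable (at x)"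
proof -
  define R where "R h = (f (x + h) - f x) / h" for h
  define L where "L h = (f x - f (x - h)) / h" for h
  define m where "m = (SUP h\<in>{0<..<x}. L h)"
  have LR: "L k \<le> R h" if "0 < h" "0 < k" "k < x" for h k
    unfolding L_def R_def by (rule convex_left_slope_le_right_slope[OF f that])
  have bdd: "bdd_above (L ` {0<..<x})" by (rule bdd_aboveI[of _ "R 1"]) (auto intro: LR)
  have Lm: "L k \<le> m" if "0 < k" "k < x" for k unfolding m_def by (rule cSUP_upper[OF _ bdd]) (use that in auto)
  have mR: "m \<le> R h" if "0 < h" for h unfolding m_def
    by (rule cSUP_least) (use x that dense in \<open>auto intro: LR\<close>)
  have "((\<lambda>h. (f (x + h) - f x) / h) \<longlongrightarrow> m) (at 0)"
  proof (rule LIM_I)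
    fix r :: real assume r: "0 < r"
    obtain i where i: "inverse (real (Suc i)) < r" using reals_Archimedean[OF r] by blast
    obtain n where n: "inverse (real (Suc n)) < x"
      "f (x + inverse (Suc n)) + f (x - inverse (Suc n)) - 2 * f x < inverse (Suc i) * inverse (Suc n)"
      using flat[of i] by blast
    define s where "s = inverse (real (Suc n))"
    have s: "0 < s" "s < x" using n by (auto simp: s_def)
    have "R s - L s = (f (x + s) + f (x - s) - 2 * f x) / s" by (simp add: R_def L_def diff_divide_distrib add_divide_distrib)
    also have "\<dots> < r" using n(2) i s unfolding s_def[symmetric]
      by (subst pos_divide_less_eq) (auto elim!: order.strict_trans)
    finally have RL: "R s - L s < r" .
    have "norm ((f (x + h) - f x) / h - m) < r" if h: "h \<noteq> 0" "norm (h - 0) < s" for h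
    proof (cases "0 < h")
      case True
      have "R h \<le> R s" unfolding R_def by (rule convex_right_slope_mono[OF f x]) (use True h in auto)
      then show ?thesis using mR[OF True] Lm[OF s] RL unfolding R_def[of h] real_norm_def by linarith
    next
      case False
      define k where "k = - h"
      have k: "0 < k" "k < s" using False h by (auto simp: k_def)
      have "L s \<le> L k" unfolding L_def by (rule convex_left_slope_antimono[OF f]) (use k s in auto)
      moreover have "(f (x + h) - f x) / h = L k" 
        unfolding L_def k_def diff_minus_eq_add
        using minus_divide_divide[of "f (x + h) - f x" h] unfolding minus_diff_eq by (rule sym)
      ultimately show ?thesis using Lm[of k] mR[OF s(1)] RL k s unfolding real_norm_def by linarith
    qed
    then show "\<exists>s>0. \<forall>h. h \<noteq> 0 \<and> norm (h - 0) < s \<longrightarrow> norm ((f (x + h) - f x) / h - m) < r" using s(1) by blast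
  qed
  then have "(f has_real_derivative m) (at x)" unfolding DERIV_def .
  then show ?thesis by (auto simp: real_differentiable_def)
qed

text \<open>At such a point the right slopes exceed the left slopes by a fixed amount, so a line of
  rational slope touches the graph at this point only. Strictly supporting lines at two different
  points have strictly increasing slopes, so the points inject into the rationals.\<close>

lemma countable_convex_kinks:
  fixes f :: "real \<Rightarrow> real"
  assumes f: "convex_on {0<..} f"
  shows "countable {x. 0 < x \<and> \<not> (\<forall>i. \<exists>n. inverse (Suc n) < x \<and>
    f (x + inverse (Suc n)) + f (x - inverse (Suc n)) - 2 * f x < inverse (Suc i) * inverse (Suc n))}" (is "countable ?B")
proof -
  have "\<exists>r\<in>\<rat>. \<forall>y>0. y \<noteq> x \<longrightarrow> f x + r * (y - x) < f y" if xB: "x \<in> ?B" for x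
  proof -
    define R where "R h = (f (x + h) - f x) / h" for h
    define L where "L h = (f x - f (x - h)) / h" for h
    have x: "0 < x" using xB by simp
    obtain i where i: "\<And>n. inverse (real (Suc n)) < x \<Longrightarrow>
       inverse (Suc i) * inverse (Suc n) \<le> f (x + inverse (Suc n)) + f (x - inverse (Suc n)) - 2 * f x"
      using xB by (auto simp: not_less) (metis not_less)
    define e where "e = inverse (real (Suc i))"
    have e: "0 < e" by (simp add: e_def)
    have gap: "L k + e \<le> R h" if hk: "0 < h" "0 < k" "k < x" for h k
    proof -
      obtain n where n: "inverse (real (Suc n)) < min h k" using reals_Archimedean[of "min h k"] hk by auto
      define s where "s = inverse (real (Suc n))"
      have s: "0 < s" "s < h" "s < k" using n by (auto simp: s_def)
      \<comment> \<open>The failing condition is known only for steps 1 / (n + 1); monotonicity of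
        the slopes extends it to all h and k.\<close>
      have "e * s \<le> f (x + s) + f (x - s) - 2 * f x"
        using i[of n] s hk unfolding e_def s_def[symmetric] by linarith
      then have "e \<le> (f (x + s) + f (x - s) - 2 * f x) / s" using s by (simp add: pos_le_divide_eq)
      also have "\<dots> = R s - L s" by (simp add: R_def L_def diff_divide_distrib add_divide_distrib)
      finally have "L s + e \<le> R s" by simp
      moreover have "R s \<le> R h" unfolding R_def by (rule convex_right_slope_mono[OF f x]) (use s in auto)
      moreover have "L k \<le> L s" unfolding L_def by (rule convex_left_slope_antimono[OF f]) (use s hk in auto)
      ultimately show ?thesis by linarith
    qed
    define m where "m = (SUP h\<in>{0<..<x}. L h)"
    have ne: "{0<..<x} \<noteq> {}" using x dense by auto
    have bdd: "bdd_above (L ` {0<..<x})" by (rule bdd_aboveI[of _ "R 1"]) (use gap[of 1] e in force)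
    have Lm: "L k \<le> m" if "0 < k" "k < x" for k unfolding m_def by (rule cSUP_upper[OF _ bdd]) (use that in auto)
    have mR: "m + e \<le> R h" if "0 < h" for h
    proof -
      have "m \<le> R h - e" unfolding m_def
      proof (rule cSUP_least[OF ne])
        fix k assume "k \<in> {0<..<x}" then show "L k \<le> R h - e" using gap[OF that, of k] by auto
      qed
      then show ?thesis by simp
    qed
    obtain r where r: "r \<in> \<rat>" "m < r" "r < m + e" using Rats_dense_in_real[of m "m + e"] e by auto
    have "f x + r * (y - x) < f y" if y: "0 < y" "y \<noteq> x" for y
    proof (cases "x < y")
      case True
      then have "r < R (y - x)" using mR[of "y - x"] r by simp
      then show ?thesis using True by (simp add: R_def field_simps)
    next
      case False
      then have h: "0 < x - y" "x - y < x" using y by auto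
      have "L (x - y) < r" using Lm[OF h] r by simp
      then show ?thesis using h by (simp add: L_def pos_divide_less_eq) (simp add: algebra_simps)
    qed
    then show ?thesis using r(1) by blast
  qed
  then have "\<forall>x\<in>?B. \<exists>r. r \<in> \<rat> \<and> (\<forall>y>0. y \<noteq> x \<longrightarrow> f x + r * (y - x) < f y)" unfolding Bex_def by (rule ballI)
  from bchoice[OF this] obtain g where
    "\<forall>x\<in>?B. g x \<in> \<rat> \<and> (\<forall>y>0. y \<noteq> x \<longrightarrow> f x + g x * (y - x) < f y)" by (rule exE)
  then have g: "x \<in> ?B \<Longrightarrow> g x \<in> \<rat> \<and> (\<forall>y>0. y \<noteq> x \<longrightarrow> f x + g x * (y - x) < f y)" for x by (rule bspec)
  have lt: "g x < g y" if xy: "x \<in> ?B" "y \<in> ?B" "x < y" for x y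
  proof -
    have "f x + g x * (y - x) < f y" "f y + g y * (x - y) < f x" using g[OF xy(1)] g[OF xy(2)] xy by auto
    then have "g x * (y - x) < g y * (y - x)" by (simp add: algebra_simps)
    then show ?thesis using xy(3) by (simp add: mult_less_cancel_right)
  qed
  have "inj_on g ?B"
  proof (rule inj_onI)
    fix x y assume "x \<in> ?B" "y \<in> ?B" "g x = g y"
    then show "x = y" using lt[of x y] lt[of y x] by (cases x y rule: linorder_cases) auto
  qed
  moreover have "countable (g ` ?B)"
    by (rule countable_subset[OF _ countable_rat]) (use g in blast)
  ultimately show ?thesis by (rule countable_image_inj_on[rotated])
qed

subsection \<open>Convexity and measurability of the pressure\<close>

context gaussian_levels begin

lemma F_integrable: assumes b: "summable (\<lambda>p. (b p)\<^sup>2)" shows "integrable M (F b)"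
  by (rule square_integrable_imp_integrable[OF F_measurable F_square_integrable[OF b]])

text \<open>The Hamiltonian is almost surely linear in the coefficients. The bound
  \<open>ln_sum_exp_diff_ge\<close> from z towards a and towards b is combined with weights 1 - t
  and t, and the linear terms cancel.\<close>

lemma expectation_F_convex:
  assumes a: "summable (\<lambda>p. (a p)\<^sup>2)" and b: "summable (\<lambda>p. (b p)\<^sup>2)" and z: "summable (\<lambda>p. (z p)\<^sup>2)"
    and comb: "\<And>p. z p = (1 - t) * a p + t * b p" and t: "0 \<le> t" "t \<le> 1"
  shows "expectation (F z) \<le> (1 - t) * expectation (F a) + t * expectation (F b)"
proof -
  have "AE x in M. F z x \<le> (1 - t) * F a x + t * F b x"
    using AE_summable_T[OF a] AE_summable_T[OF b]
  proof eventually_elim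
    case (elim x)
    have T: "T z s x = (1 - t) * T a s x + t * T b s x" if "s \<in> S" for s
    proof -
      have "(\<lambda>p. (1 - t) * (a p * G p s x) + t * (b p * G p s x)) sums ((1 - t) * T a s x + t * T b s x)"
        unfolding T_def using elim that by (intro sums_add sums_mult summable_sums) auto
      also have "(\<lambda>p. (1 - t) * (a p * G p s x) + t * (b p * G p s x)) = (\<lambda>p. z p * G p s x)"
        by (auto simp: comb algebra_simps)
      finally show ?thesis unfolding T_def by (rule sums_unique[symmetric])
    qed
    have ge: "(\<Sum>s\<in>S. wt z s x * (T z s x - T y s x)) \<le> F y x - F z x" for y
      unfolding wt_def F_def by (rule ln_sum_exp_diff_ge[OF finite_S S_ne])
    have "0 = (\<Sum>s\<in>S. wt z s x * ((1 - t) * (T z s x - T a s x) + t * (T z s x - T b s x)))"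
      by (rule sum.neutral[symmetric]) (simp add: T algebra_simps)
    also have "\<dots> = (1 - t) * (\<Sum>s\<in>S. wt z s x * (T z s x - T a s x)) + t * (\<Sum>s\<in>S. wt z s x * (T z s x - T b s x))"
      unfolding sum_distrib_left sum.distrib[symmetric] by (intro sum.cong refl) (simp add: algebra_simps)
    also have "\<dots> \<le> (1 - t) * (F a x - F z x) + t * (F b x - F z x)"
      using t by (intro add_mono mult_left_mono ge) auto
    finally show ?case by (simp add: algebra_simps)
  qed
  then have "expectation (F z) \<le> expectation (\<lambda>x. (1 - t) * F a x + t * F b x)"
    by (intro integral_mono_AE F_integrable z) (auto intro!: F_integrable a b)
  also have "\<dots> = (1 - t) * expectation (F a) + t * expectation (F b)"
    using F_integrable[OF a] F_integrable[OF b] by simp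
  finally show ?thesis .
qed

end

lemma summable_square_shift_update:
  fixes \<beta> :: "nat \<Rightarrow> real"
  shows "summable (\<lambda>q. ((\<beta>(p := x)) (Suc q))\<^sup>2) \<longleftrightarrow> summable (\<lambda>q. (\<beta> (Suc q))\<^sup>2)"
proof (rule summable_cong)
  show "eventually (\<lambda>q. ((\<beta>(p := x)) (Suc q))\<^sup>2 = (\<beta> (Suc q))\<^sup>2) sequentially"
    using eventually_ge_at_top[of p] by eventually_elim auto
qed

context spin_glass begin

lemma pressure_convex:
  assumes L: "finite \<Lambda>" "\<Lambda> \<noteq> {}" and b: "summable (\<lambda>q. (\<beta> (Suc q))\<^sup>2)"
  shows "convex_on {0<..} (\<lambda>x. pressure M c H \<Lambda> (\<beta>(p := x)))"
proof (rule convex_onI)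
  fix t x y :: real assume t: "0 < t" "t < 1"
  interpret G: gaussian_levels M "configs \<Lambda>" "real (card \<Lambda>)" "\<lambda>s t. overlap M J \<Lambda> s t / c" "level \<Lambda>"
    by (rule gaussian_levels[OF L])
  have N: "0 < real (card \<Lambda>)" using L by (simp add: card_gt_0_iff)
  have s: "summable (\<lambda>q. ((\<beta>(p := x)) (Suc q))\<^sup>2)" for x using b unfolding summable_square_shift_update .
  have "expectation (Fr \<Lambda> (\<beta>(p := (1 - t) *\<^sub>R x + t *\<^sub>R y))) \<le> (1 - t) * expectation (Fr \<Lambda> (\<beta>(p := x))) + t * expectation (Fr \<Lambda> (\<beta>(p := y)))"
    by (rule G.expectation_F_convex[OF s s s]) (use t in \<open>auto simp: algebra_simps\<close>)
  then show "pressure M c H \<Lambda> (\<beta>(p := (1 - t) *\<^sub>R x + t *\<^sub>R y)) \<le>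
      (1 - t) * pressure M c H \<Lambda> (\<beta>(p := x)) + t * pressure M c H \<Lambda> (\<beta>(p := y))"
    unfolding pressure_eq[OF L] using N by (simp add: divide_right_mono add_divide_distrib[symmetric])
qed simp

lemma H_measurable:
  assumes p: "1 \<le> p" and L: "finite \<Lambda>" "\<Lambda> \<noteq> {}" and s: "\<sigma> \<in> configs \<Lambda>"
  shows "H p \<Lambda> \<sigma> \<in> borel_measurable M"
proof -
  have "finite {\<sigma>} \<and> {\<sigma>} \<subseteq> configs \<Lambda>" using s by simp
  from H_gaussian[OF p L, unfolded centered_gaussian_family_def, rule_format, OF this, of "\<lambda>_. 1"]
  obtain v where "centered_gaussian M (\<lambda>\<omega>. \<Sum>i\<in>{\<sigma>}. 1 * H p \<Lambda> i \<omega>) v" by (rule exE)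
  then show ?thesis by (simp add: centered_gaussian_def)
qed

lemma pressure_measurable:
  assumes L: "finite \<Lambda>" "\<Lambda> \<noteq> {}"
  shows "(\<lambda>\<beta>. pressure M c H \<Lambda> \<beta>) \<in> borel_measurable (PiM {1..} (\<lambda>_. borel))"
proof -
  let ?Q = "PiM {1::nat..} (\<lambda>_. borel :: real measure) \<Otimes>\<^sub>M M"
  have "(\<lambda>z. complete_hamiltonian c H \<Lambda> (fst z) \<sigma> (snd z)) \<in> borel_measurable ?Q" if s: "\<sigma> \<in> configs \<Lambda>" for \<sigma>
    unfolding complete_hamiltonian_def
  proof (intro borel_measurable_suminf borel_measurable_times borel_measurable_const)
    fix p
    show "(\<lambda>z. fst z (Suc p)) \<in> borel_measurable ?Q"
      by (rule measurable_compose[OF measurable_fst measurable_component_singleton]) simp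
    show "(\<lambda>z. H (Suc p) \<Lambda> \<sigma> (snd z)) \<in> borel_measurable ?Q"
      by (rule measurable_compose[OF measurable_snd H_measurable[OF _ L s]]) simp
  qed
  then have "(\<lambda>z. ln (partition_function c H \<Lambda> (fst z) (snd z))) \<in> borel_measurable ?Q"
    unfolding partition_function_def by measurable
  then show ?thesis unfolding pressure_def
    by (intro borel_measurable_times borel_measurable_const borel_measurable_lebesgue_integral) (simp add: case_prod_beta')
qed

end

subsection \<open>Differentiable and generic parameters\<close>

context spin_glass begin

context
  fixes V :: "nat \<Rightarrow> 'a set"
  assumes V: "\<And>k. finite (V k)" "\<And>k. V k \<noteq> {}" and V_mono: "incseq V" and V_UNIV: "(\<Union>k. V k) = UNIV"
    and inf: "infinite (UNIV :: 'a set)"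
    and pressure_limit: "\<And>\<beta>. admissible \<beta> \<Longrightarrow> convergent (\<lambda>k. pressure M c H (V k) \<beta>)"
begin

lemma card_volume_at_top: "filterlim (\<lambda>k. real (card (V k))) at_top sequentially"
  unfolding filterlim_at_top
proof
  fix Z :: real
  obtain F :: "'a set" where F: "finite F" "card F = nat \<lceil>Z\<rceil>" using infinite_arbitrarily_large[OF inf] by blast
  have "\<exists>K. F \<subseteq> V K" using F(1)
  proof (induction F)
    case (insert x F)
    then obtain K where K: "F \<subseteq> V K" by blast
    obtain k where k: "x \<in> V k" using V_UNIV by blast
    have "V K \<subseteq> V (max K k)" "V k \<subseteq> V (max K k)" using V_mono by (auto simp: incseq_def)
    then show ?case using K k by (intro exI[of _ "max K k"]) auto
  qed simp
  then obtain K where K: "F \<subseteq> V K" ..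
  show "eventually (\<lambda>k. Z \<le> real (card (V k))) sequentially"
    using eventually_ge_at_top[of K]
  proof eventually_elim
    case (elim k)
    have "card F \<le> card (V k)" by (rule card_mono[OF V(1)]) (use K incseqD[OF V_mono elim] in auto)
    then show ?case using F(2) by linarith
  qed
qed

lemma limiting_pressure_tendsto: "admissible \<beta> \<Longrightarrow> (\<lambda>k. pressure M c H (V k) \<beta>) \<longlonglongrightarrow> limiting_pressure M c H V \<beta>"
  unfolding limiting_pressure_def using pressure_limit by (simp add: convergent_LIMSEQ_iff)

lemma differentiable_pressure_limit_law:
  assumes adm: "admissible \<beta>"
    and diff: "\<And>p. 1 \<le> p \<Longrightarrow> (\<lambda>t. limiting_pressure M c H V (\<beta>(p := t))) differentiable (at (\<beta> p))"
    and r: "strict_mono r" and law: "overlap_limit_law M J c H \<beta> (\<lambda>k. V (r k)) N"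
  shows "ghirlanda_guerra N \<and> ultrametric_law N"
proof -
  have sub: "filterlim r at_top sequentially" by (rule filterlim_subseq[OF r])
  have cW: "filterlim (\<lambda>k. real (card (V (r k)))) at_top sequentially"
    by (rule filterlim_compose[OF card_volume_at_top sub])
  have conc: "\<exists>m. (\<lambda>k. energy_deviation (V (r k)) \<beta> p m) \<longlonglongrightarrow> 0" for p
  proof -
    from diff[of "Suc p"] obtain m where "((\<lambda>t. limiting_pressure M c H V (\<beta>(Suc p := t))) has_real_derivative m) (at (\<beta> (Suc p)))"
      by (auto simp: real_differentiable_def)
    from energy_concentration_limit[OF V cW adm filterlim_compose[OF limiting_pressure_tendsto sub] this]
    show ?thesis by blast
  qed
  from limit_ghirlanda_guerra[OF V law adm conc] limit_ultrametric[OF V law adm conc] show ?thesis by blast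
qed

text \<open>Differentiability in \<open>\<beta>\<^sub>p\<close>, expressed for a convex function by countably many conditions so that
  it is visibly measurable in \<open>\<beta>\<close>.\<close>

definition flat_pressure :: "nat \<Rightarrow> (nat \<Rightarrow> real) \<Rightarrow> bool" where
  "flat_pressure p \<beta> \<longleftrightarrow> (\<forall>i. \<exists>n. inverse (real (Suc n)) < \<beta> p \<and>
     limiting_pressure M c H V (\<beta>(p := \<beta> p + inverse (real (Suc n)))) + limiting_pressure M c H V (\<beta>(p := \<beta> p - inverse (real (Suc n))))
       - 2 * limiting_pressure M c H V (\<beta>(p := \<beta> p)) < inverse (real (Suc i)) * inverse (real (Suc n)))"

lemma limiting_pressure_convex:
  assumes b: "summable (\<lambda>q. (\<beta> (Suc q))\<^sup>2)" and pos: "\<And>q. 1 \<le> q \<Longrightarrow> q \<noteq> p \<Longrightarrow> 0 < \<beta> q"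
  shows "convex_on {0<..} (\<lambda>x. limiting_pressure M c H V (\<beta>(p := x)))"
proof (rule convex_onI)
  fix t x y :: real assume t: "0 < t" "t < 1" and x: "x \<in> {0<..}" and y: "y \<in> {0<..}"
  have "admissible (\<beta>(p := z))" if "0 < z" for z
    unfolding admissible_def summable_square_shift_update using that b pos by auto
  note lim = limiting_pressure_tendsto[OF this]
  have z: "0 < (1 - t) *\<^sub>R x + t *\<^sub>R y" using t x y by (auto intro!: add_pos_pos)
  have "\<And>k. pressure M c H (V k) (\<beta>(p := (1 - t) *\<^sub>R x + t *\<^sub>R y)) \<le>
      (1 - t) * pressure M c H (V k) (\<beta>(p := x)) + t * pressure M c H (V k) (\<beta>(p := y))"
    by (rule convex_onD[OF pressure_convex[OF V b]]) (use t x y in auto)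
  then show "limiting_pressure M c H V (\<beta>(p := (1 - t) *\<^sub>R x + t *\<^sub>R y)) \<le>
      (1 - t) * limiting_pressure M c H V (\<beta>(p := x)) + t * limiting_pressure M c H V (\<beta>(p := y))"
    by (intro LIMSEQ_le[OF lim[OF z] tendsto_add[OF tendsto_mult[OF tendsto_const lim] tendsto_mult[OF tendsto_const lim]]])
       (use x y in auto)
qed simp

lemma flat_pressure_differentiable:
  assumes adm: "admissible \<beta>" and p: "1 \<le> p" and flat: "flat_pressure p \<beta>"
  shows "(\<lambda>t. limiting_pressure M c H V (\<beta>(p := t))) differentiable (at (\<beta> p))"
proof (rule convex_differentiable)
  show "convex_on {0<..} (\<lambda>x. limiting_pressure M c H V (\<beta>(p := x)))"
    by (rule limiting_pressure_convex) (use adm in \<open>auto simp: admissible_def\<close>)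
  show "0 < \<beta> p" using adm p by (simp add: admissible_def)
qed (use flat in \<open>auto simp: flat_pressure_def\<close>)

lemma flat_pressure_measurable:
  assumes p: "1 \<le> p"
  shows "Measurable.pred (PiM {1..} (\<lambda>_. borel)) (flat_pressure p)"
proof -
  let ?Q = "PiM {1::nat..} (\<lambda>_. borel :: real measure)"
  have q: "limiting_pressure M c H V \<in> borel_measurable ?Q"
    unfolding limiting_pressure_def[abs_def] by (intro borel_measurable_lim_metric pressure_measurable V)
  have e [measurable]: "(\<lambda>\<beta>. \<beta> p) \<in> borel_measurable ?Q" by (rule measurable_component_singleton) (use p in simp)
  have [measurable]: "(\<lambda>\<beta>. limiting_pressure M c H V (\<beta>(p := h \<beta>))) \<in> borel_measurable ?Q"
    if h: "h \<in> borel_measurable ?Q" for h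
  proof (rule measurable_compose[OF _ q])
    show "(\<lambda>\<beta>. \<beta>(p := h \<beta>)) \<in> measurable ?Q ?Q"
      by (rule measurable_fun_upd[where J="{1..}"]) (use p h in auto)
  qed
  show ?thesis unfolding flat_pressure_def[abs_def] by measurable
qed

text \<open>Fubini over the coordinate p and the remaining ones: on each line in direction p the
  exceptional set is countable, hence null for the absolutely continuous \<mu> p. The exchange of
  the quantifiers relies on measurability of the event, which is why \<open>flat_pressure\<close>
  replaces differentiability.\<close>

lemma AE_flat_pressure:
  assumes \<mu>: "\<And>p. 1 \<le> p \<Longrightarrow> prob_space (\<mu> p)" "\<And>p. 1 \<le> p \<Longrightarrow> sets (\<mu> p) = sets borel"
    "\<And>p. 1 \<le> p \<Longrightarrow> absolutely_continuous lborel (\<mu> p)" and p: "1 \<le> p"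
  shows "AE \<beta> in PiM {1..} \<mu>. admissible \<beta> \<longrightarrow> flat_pressure p \<beta>"
proof -
  define I where "I = {1..} - {p}"
  have I: "insert p I = {1..}" "p \<notin> I" using p by (auto simp: I_def)
  interpret I: prob_space "PiM I \<mu>" by (rule prob_space_PiM) (auto simp: I_def \<mu>)
  interpret p: prob_space "\<mu> p" by (rule \<mu>(1)[OF p])
  interpret P: pair_sigma_finite "\<mu> p" "PiM I \<mu>" ..
  interpret P': pair_sigma_finite "PiM I \<mu>" "\<mu> p" ..
  have sP: "sets (PiM {1..} \<mu>) = sets (PiM {1..} (\<lambda>_. borel))" by (rule sets_PiM_cong) (auto simp: \<mu>)
  have mG: "Measurable.pred (PiM {1..} \<mu>) (\<lambda>\<beta>. admissible \<beta> \<longrightarrow> flat_pressure p \<beta>)"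
  proof -
    have e [measurable]: "(\<lambda>\<beta>. \<beta> q) \<in> borel_measurable (PiM {1..} (\<lambda>_. borel))" if "1 \<le> q" for q :: nat
      by (rule measurable_component_singleton) (use that in simp)
    have "Measurable.pred (PiM {1..} (\<lambda>_. borel)) (\<lambda>\<beta>::nat \<Rightarrow> real. \<forall>q. 0 < \<beta> (Suc q))" by measurable
    moreover have "Measurable.pred (PiM {1..} (\<lambda>_. borel)) (\<lambda>\<beta>::nat \<Rightarrow> real. summable (\<lambda>q. (\<beta> (Suc q))\<^sup>2))"
      unfolding summable_iff_convergent Cauchy_convergent_iff[symmetric] pred_def by (rule sets_Collect_Cauchy) measurable
    moreover have "admissible \<beta> \<longleftrightarrow> (\<forall>q. 0 < \<beta> (Suc q)) \<and> summable (\<lambda>q. (\<beta> (Suc q))\<^sup>2)" for \<beta>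
      unfolding admissible_def by (auto simp: Suc_le_eq gr0_conv_Suc)
    ultimately have "Measurable.pred (PiM {1..} (\<lambda>_. borel)) (\<lambda>\<beta>. admissible \<beta> \<longrightarrow> flat_pressure p \<beta>)"
      using flat_pressure_measurable[OF p] by simp
    then show ?thesis using measurable_cong_sets[OF sP refl] by blast
  qed
  have mu: "(\<lambda>(x, X). X(p := x)) \<in> measurable (\<mu> p \<Otimes>\<^sub>M PiM I \<mu>) (PiM {1..} \<mu>)"
    unfolding I(1)[symmetric] by measurable
  have d: "distr (\<mu> p \<Otimes>\<^sub>M PiM I \<mu>) (PiM {1..} \<mu>) (\<lambda>(x, X). X(p := x)) = PiM {1..} \<mu>"
    unfolding I(1)[symmetric] by (rule distr_pair_PiM_eq_PiM) (use p in \<open>auto simp: I_def \<mu>\<close>)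
  \<comment> \<open>A line without admissible points satisfies the claim trivially. Otherwise the
    other coordinates are positive and square summable, and the limiting pressure is convex along
    the line.\<close>
  have sec: "AE x in \<mu> p. admissible (X(p := x)) \<longrightarrow> flat_pressure p (X(p := x))" for X
  proof (cases "\<exists>x. admissible (X(p := x))")
    case True
    then obtain x where x: "\<And>q. 1 \<le> q \<Longrightarrow> 0 < (X(p := x)) q" and b: "summable (\<lambda>q. (X (Suc q))\<^sup>2)"
      unfolding admissible_def summable_square_shift_update by blast
    have pos: "0 < X q" if "1 \<le> q" "q \<noteq> p" for q using x[OF that(1)] that(2) by simp
    let ?f = "\<lambda>x. limiting_pressure M c H V (X(p := x))"
    have "countable {x. 0 < x \<and> \<not> (\<forall>i. \<exists>n. inverse (real (Suc n)) < x \<and>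
      ?f (x + inverse (Suc n)) + ?f (x - inverse (Suc n)) - 2 * ?f x < inverse (real (Suc i)) * inverse (real (Suc n)))}" (is "countable ?B")
      by (rule countable_convex_kinks[OF limiting_pressure_convex[OF b pos]])
    then have "?B \<in> null_sets lborel" by (rule countable_imp_null_set_lborel)
    then have "?B \<in> null_sets (\<mu> p)" using \<mu>(3)[OF p] unfolding absolutely_continuous_def by blast
    from AE_not_in[OF this] show ?thesis
    proof eventually_elim
      case (elim x)
      show ?case
      proof
        assume "admissible (X(p := x))"
        then have "0 < (X(p := x)) p" using p unfolding admissible_def by blast
        then have "0 < x" by simp
        with elim show "flat_pressure p (X(p := x))" unfolding flat_pressure_def by simp
      qed
    qed
  qed simp
  have "AE z in \<mu> p \<Otimes>\<^sub>M PiM I \<mu>. admissible ((\<lambda>(x, X). X(p := x)) z) \<longrightarrow> flat_pressure p ((\<lambda>(x, X). X(p := x)) z)"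
  proof (rule P.AE_pair_measure)
    have m: "Measurable.pred (\<mu> p \<Otimes>\<^sub>M PiM I \<mu>) (\<lambda>z. admissible ((\<lambda>(x, X). X(p := x)) z) \<longrightarrow> flat_pressure p ((\<lambda>(x, X). X(p := x)) z))"
      by (rule measurable_compose[OF mu mG])
    then show "{z \<in> space (\<mu> p \<Otimes>\<^sub>M PiM I \<mu>). admissible ((\<lambda>(x, X). X(p := x)) z) \<longrightarrow> flat_pressure p ((\<lambda>(x, X). X(p := x)) z)}
      \<in> sets (\<mu> p \<Otimes>\<^sub>M PiM I \<mu>)" by (simp add: pred_def)
    \<comment> \<open>In \<open>sec\<close> the remaining coordinates X are fixed and x varies, the
      reverse of the order in the product.\<close>
    have "AE x in \<mu> p. AE X in PiM I \<mu>. admissible (X(p := x)) \<longrightarrow> flat_pressure p (X(p := x))"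
    proof (subst P.AE_commute)
      show "{z \<in> space (\<mu> p \<Otimes>\<^sub>M PiM I \<mu>). admissible ((snd z)(p := fst z)) \<longrightarrow> flat_pressure p ((snd z)(p := fst z))} \<in> sets (\<mu> p \<Otimes>\<^sub>M PiM I \<mu>)"
        using m by (simp add: pred_def case_prod_beta')
    qed (simp add: sec)
    then show "AE x in \<mu> p. AE X in PiM I \<mu>. admissible ((\<lambda>(x, X). X(p := x)) (x, X)) \<longrightarrow> flat_pressure p ((\<lambda>(x, X). X(p := x)) (x, X))"
      by simp
  qed
  then have "AE \<beta> in distr (\<mu> p \<Otimes>\<^sub>M PiM I \<mu>) (PiM {1..} \<mu>) (\<lambda>(x, X). X(p := x)). admissible \<beta> \<longrightarrow> flat_pressure p \<beta>"
    by (subst AE_distr_iff[OF mu]) (use mG in \<open>simp_all add: pred_def\<close>)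
  then show ?thesis unfolding d .
qed

lemma generic_limit_law:
  assumes \<mu>: "\<And>p. 1 \<le> p \<Longrightarrow> prob_space (\<mu> p)" "\<And>p. 1 \<le> p \<Longrightarrow> sets (\<mu> p) = sets borel"
    "\<And>p. 1 \<le> p \<Longrightarrow> absolutely_continuous lborel (\<mu> p)" "\<And>p. 1 \<le> p \<Longrightarrow> AE x in \<mu> p. 0 < x"
    and summ: "AE \<beta> in PiM {1..} \<mu>. summable (\<lambda>p. (\<beta> (Suc p))\<^sup>2)"
  shows "AE \<beta> in PiM {1..} \<mu>. \<forall>r N. strict_mono r \<and> overlap_limit_law M J c H \<beta> (\<lambda>k. V (r k)) N \<longrightarrow>
    ghirlanda_guerra N \<and> ultrametric_law N"
proof -
  have "AE \<beta> in PiM {1..} \<mu>. 0 < \<beta> (Suc p)" for p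
    by (rule AE_PiM_component) (auto simp: \<mu>)
  then have "AE \<beta> in PiM {1..} \<mu>. \<forall>p. 0 < \<beta> (Suc p)" by (simp add: AE_all_countable)
  moreover have "AE \<beta> in PiM {1..} \<mu>. \<forall>p. admissible \<beta> \<longrightarrow> flat_pressure (Suc p) \<beta>"
    unfolding AE_all_countable by (intro allI AE_flat_pressure \<mu>) auto
  ultimately show ?thesis using summ
  proof eventually_elim
    case (elim \<beta>)
    have pos: "0 < \<beta> p" if "1 \<le> p" for p using elim(1)[rule_format, of "p - 1"] that by simp
    have adm: "admissible \<beta>" unfolding admissible_def using pos elim(3) by blast
    have flat: "flat_pressure p \<beta>" if "1 \<le> p" for p
      using elim(2)[rule_format, of "p - 1", OF adm] that by simp
    show ?case
      by (intro allI impI, elim conjE)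
        (rule differentiable_pressure_limit_law[OF adm flat_pressure_differentiable[OF adm _ flat]])
  qed
qed

end

end

lemma infinite_lattice: "infinite (UNIV :: (int ^ 'd) set)"
proof
  assume "finite (UNIV :: (int ^ 'd) set)"
  then have "finite (range (vec :: int \<Rightarrow> int ^ 'd))" by (rule finite_subset[rotated]) simp
  moreover have "inj (vec :: int \<Rightarrow> int ^ 'd)" by (auto simp: inj_on_def vec_eq_iff)
  ultimately have "finite (UNIV :: int set)" by (rule finite_imageD)
  then show False by simp
qed

theorem mainTheorem2:
  fixes M :: "'w measure"
    and \<Delta> :: "(int ^ 'd) set \<Rightarrow> (int ^ 'd) set \<Rightarrow> real"
    and J :: "(int ^ 'd) set \<Rightarrow> (int ^ 'd) set \<Rightarrow> 'w \<Rightarrow> real"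
    and H :: "nat \<Rightarrow> (int ^ 'd) set \<Rightarrow> (int ^ 'd \<Rightarrow> real) \<Rightarrow> 'w \<Rightarrow> real"
    and c :: real
    and V :: "nat \<Rightarrow> (int ^ 'd) set"
  assumes "prob_space M"
    and Delta_nonneg: "\<And>\<Lambda> X. finite \<Lambda> \<Longrightarrow> \<Lambda> \<noteq> {} \<Longrightarrow> X \<subseteq> \<Lambda> \<Longrightarrow> 0 \<le> \<Delta> \<Lambda> X"
    and J_indep: "\<And>\<Lambda>. finite \<Lambda> \<Longrightarrow> \<Lambda> \<noteq> {} \<Longrightarrow>
          prob_space.indep_vars M (\<lambda>_. borel) (J \<Lambda>) (Pow \<Lambda>)"
    and J_gaussian: "\<And>\<Lambda> X. finite \<Lambda> \<Longrightarrow> \<Lambda> \<noteq> {} \<Longrightarrow> X \<subseteq> \<Lambda> \<Longrightarrow>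
          centered_gaussian M (J \<Lambda> X) ((\<Delta> \<Lambda> X)\<^sup>2)"
    and c_pos: "0 < c"
    and stability: "\<And>\<Lambda>. finite \<Lambda> \<Longrightarrow> \<Lambda> \<noteq> {} \<Longrightarrow>
          (1 / real (card \<Lambda>)) * (\<Sum>X\<in>Pow \<Lambda>. (\<Delta> \<Lambda> X)\<^sup>2) \<le> c"
    and H_one: "\<And>\<Lambda> \<sigma> \<omega>. finite \<Lambda> \<Longrightarrow> \<Lambda> \<noteq> {} \<Longrightarrow> \<sigma> \<in> configs \<Lambda> \<Longrightarrow> \<omega> \<in> space M \<Longrightarrow>
          H 1 \<Lambda> \<sigma> \<omega> = hamiltonian J \<Lambda> \<sigma> \<omega>"
    and H_gaussian: "\<And>p \<Lambda>. 1 \<le> p \<Longrightarrow> finite \<Lambda> \<Longrightarrow> \<Lambda> \<noteq> {} \<Longrightarrow>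
          centered_gaussian_family M (configs \<Lambda>) (H p \<Lambda>)"
    and H_covariance: "\<And>p \<Lambda> \<sigma> \<tau>. 1 \<le> p \<Longrightarrow> finite \<Lambda> \<Longrightarrow> \<Lambda> \<noteq> {} \<Longrightarrow>
          \<sigma> \<in> configs \<Lambda> \<Longrightarrow> \<tau> \<in> configs \<Lambda> \<Longrightarrow>
          (1 / real (card \<Lambda>)) * (\<integral>\<omega>. H p \<Lambda> \<sigma> \<omega> * H p \<Lambda> \<tau> \<omega> \<partial>M) = (overlap M J \<Lambda> \<sigma> \<tau>) ^ p"
    and H_indep: "\<And>\<Lambda>. finite \<Lambda> \<Longrightarrow> \<Lambda> \<noteq> {} \<Longrightarrow>
          prob_space.indep_vars M (\<lambda>_. PiM (configs \<Lambda>) (\<lambda>_. borel))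
            (\<lambda>p \<omega>. \<lambda>\<sigma>\<in>configs \<Lambda>. H p \<Lambda> \<sigma> \<omega>) {1..}"
    and V_finite: "\<And>k. finite (V k)" "\<And>k. V k \<noteq> {}"
    and V_exhausts: "incseq V" "(\<Union>k. V k) = UNIV"
    and pressure_limit: "\<And>\<beta>. admissible \<beta> \<Longrightarrow> convergent (\<lambda>k. pressure M c H (V k) \<beta>)"
  shows "(\<forall>\<beta> r N.
            admissible \<beta> \<and>
            (\<forall>p\<ge>1. (\<lambda>t. limiting_pressure M c H V (\<beta>(p := t))) differentiable (at (\<beta> p))) \<and>
            strict_mono r \<and> overlap_limit_law M J c H \<beta> (\<lambda>k. V (r k)) N \<longrightarrow>
            ghirlanda_guerra N \<and> ultrametric_law N) \<and>
         (\<forall>\<mu>.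
            (\<forall>p\<ge>1. prob_space (\<mu> p) \<and> sets (\<mu> p) = sets borel \<and>
                    absolutely_continuous lborel (\<mu> p) \<and> (AE x in \<mu> p. 0 < x)) \<and>
            (AE \<beta> in PiM {1..} \<mu>. summable (\<lambda>p. (\<beta> (Suc p))\<^sup>2)) \<longrightarrow>
            (AE \<beta> in PiM {1..} \<mu>. \<forall>r N.
               strict_mono r \<and> overlap_limit_law M J c H \<beta> (\<lambda>k. V (r k)) N \<longrightarrow>
               ghirlanda_guerra N \<and> ultrametric_law N))"
proof -
  interpret spin_glass M \<Delta> J H c
    by (rule spin_glass.intro[OF \<open>prob_space M\<close>], unfold_locales)
      (fact J_indep J_gaussian c_pos stability H_gaussian H_covariance H_indep)+
  note volumes = V_finite V_exhausts infinite_lattice pressure_limit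
  show ?thesis
  proof (rule conjI; intro allI impI; elim conjE)
    fix \<beta> r N
    assume adm: "admissible \<beta>"
      and diff: "\<forall>p\<ge>1. (\<lambda>t. limiting_pressure M c H V (\<beta>(p := t))) differentiable (at (\<beta> p))"
      and rN: "strict_mono r" "overlap_limit_law M J c H \<beta> (\<lambda>k. V (r k)) N"
    show "ghirlanda_guerra N \<and> ultrametric_law N"
      by (rule differentiable_pressure_limit_law[OF volumes adm diff[rule_format] rN])
  next
    fix \<mu> :: "nat \<Rightarrow> real measure"
    assume \<mu>: "\<forall>p\<ge>1. prob_space (\<mu> p) \<and> sets (\<mu> p) = sets borel \<and>
                    absolutely_continuous lborel (\<mu> p) \<and> (AE x in \<mu> p. 0 < x)"
      and s: "AE \<beta> in PiM {1..} \<mu>. summable (\<lambda>p. (\<beta> (Suc p))\<^sup>2)"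
    show "AE \<beta> in PiM {1..} \<mu>. \<forall>r N.
               strict_mono r \<and> overlap_limit_law M J c H \<beta> (\<lambda>k. V (r k)) N \<longrightarrow>
               ghirlanda_guerra N \<and> ultrametric_law N"
      by (rule generic_limit_law[OF volumes _ _ _ _ s]) (use \<mu> in auto)
  qed
qed


end
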